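(* Suppose that $-2<s<d-3$ and $V(x)=\frac{\gamma}{\alpha}\|x\|^{\alpha}$, where $\gamma>0$ and $\alpha>\max\{-s,0\}$. Define $$\alpha_{s,d}:=\begin{cases}\max\left\{\dfrac{s\,c_{s,d}}{2-2c_{s,d}},\ 2-\dfrac{(s+2)(d-s-4)}{2(d-s-3)}\right\} & s\neq 0,\\[1em] \max\left\{-\dfrac{1}{2b_d},\ 2-\dfrac{d-4}{d-3}\right\} & s=0.\end{cases}$$ If $\alpha\ge\alpha_{s,d}$, then $\mu_{\mathrm{eq}}=\sigma_{R_*}$, where $$R_*=\left(\frac{c_{s,d}}{2\gamma}\right)^{\frac{1}{\alpha+s}}=\left(\frac{\Gamma(\frac d2)\Gamma(d-s-1)}{2\gamma\,\Gamma(\frac{d-s}{2})\Gamma(d-\frac s2-1)}\right)^{\frac{1}{\alpha+s}},$$ and the energy is then $$I_{s,V}(\sigma_{R_*})=\begin{cases}\dfrac{(\alpha+s)(2\gamma)^{\frac{s}{\alpha+s}}}{\alpha s}\left(\dfrac{\Gamma(\frac d2)\Gamma(d-s-1)}{\Gamma(\frac{d-s}{2})\Gamma(d-\frac s2-1)}\right)^{\frac{\alpha}{\alpha+s}} & s\neq0,\\[1.2em] \dfrac{1+\log(2\gamma)}{\alpha}-\log(2)+\frac12\Big(\psi_0(d-1)-\psi_0\big(\tfrac{d-1}{2}\big)\Big) & s=0.\end{cases}$$ Furthermore, the threshold $\alpha_{s,d}$ is sharp: if $\max\{-s,0\}<\alpha<\alpha_{s,d}$, then for all $R>0$, $\sigma_R$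 is not a minimizer of $I_{s,V}$.
   Context: $d\ge2$ is an integer. $\|\cdot\|$ is the Euclidean norm on $\mathbb{R}^d$, and $\mathcal{P}(\mathbb{R}^d)$ is the set of Borel probability measures on $\mathbb{R}^d$. The Riesz kernel is $K_s(x)=\frac{1}{s\|x\|^s}$ if $s\ne0$ and $K_0(x)=-\log\|x\|$. For $V:\mathbb{R}^d\to(-\infty,\infty]$ the energy of $\mu\in\mathcal{P}(\mathbb{R}^d)$ is $$I_{s,V}(\mu)=\iint\big(K_s(x-y)+V(x)+V(y)\big)\,\mathrm{d}\mu(x)\,\mathrm{d}\mu(y)\in(-\infty,+\infty].$$ The equilibrium measure $\mu_{\mathrm{eq}}$ is the (here unique) minimizer of $I_{s,V}$ over $\mathcal{P}(\mathbb{R}^d)$. For $R>0$, $\sigma_R$ is the uniform probability measure on the sphere $\{x\in\mathbb{R}^d:\|x\|=R\}$. The constants are, with ${}_2\mathrm{F}_1$, ${}_3\mathrm{F}_2$ the hypergeometric functions and $\psi_0$ the digamma function, $$c_{s,d}={}_2\mathrm{F}_1\Big(\tfrac s2,\tfrac{2+s-d}{2};\tfrac d2;1\Big)=\frac{\Gamma(\frac d2)\Gamma(d-s-1)}{\Gamma(\frac{d-s}{2})\Gamma(d-\frac s2-1)}\qquad(-2<s<d-1),$$ $$b_d=-\log 2+\tfrac14\,{}_3\mathrm{F}_2\Big(1,1,\tfrac{d+1}{2};2,d;1\Big)=-\log 2+\tfrac12\psi_0(d-1)-\tfrac12\psi_0\big(\tfrac{d-1}{2}\big).$$ *)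

theory Defs
  imports "HOL-Probability.Probability"
begin

section \<open>Riesz energy with an external field\<close>

definition borel_probs :: "'a::topological_space measure set" where
  "borel_probs = {\<mu>. prob_space \<mu> \<and> sets \<mu> = sets borel}"

text \<open>At the origin, the kernel takes its limit value: \<open>0\<close> for \<open>s < 0\<close>, and \<open>\<infinity>\<close> for \<open>s \<ge> 0\<close>.\<close>

definition riesz_kernel :: "real \<Rightarrow> 'a::euclidean_space \<Rightarrow> ereal" where
  "riesz_kernel s x =
    (if x = 0 then (if s < 0 then 0 else \<infinity>)
     else if s = 0 then ereal (- ln (norm x))
     else ereal (1 / (s * norm x powr s)))"

text \<open>
  The Lebesgue integral of an extended real function, as the integral of the positive part minus
  the integral of the negative part (\<^const>\<open>e2ennreal\<close> sends negative numbers to \<open>0\<close>). It is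
  meaningful when the negative part has a finite integral, for instance when the function is
  bounded below and the measure is finite; its value is then in \<open>(-\<infinity>, \<infinity>]\<close>.
\<close>

definition ereal_integral :: "'b measure \<Rightarrow> ('b \<Rightarrow> ereal) \<Rightarrow> ereal" where
  "ereal_integral M f =
    enn2ereal (\<integral>\<^sup>+ z. e2ennreal (f z) \<partial>M) - enn2ereal (\<integral>\<^sup>+ z. e2ennreal (- f z) \<partial>M)"

definition riesz_energy ::
    "real \<Rightarrow> ('a::euclidean_space \<Rightarrow> ereal) \<Rightarrow> 'a measure \<Rightarrow> ereal" where
  "riesz_energy s V \<mu> =
    ereal_integral (\<mu> \<Otimes>\<^sub>M \<mu>) (\<lambda>(x, y). riesz_kernel s (x - y) + V x + V y)"

definition energy_minimizer ::
    "real \<Rightarrow> ('a::euclidean_space \<Rightarrow> ereal) \<Rightarrow> 'a measure \<Rightarrow> bool" where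
  "energy_minimizer s V \<mu> \<longleftrightarrow>
    \<mu> \<in> borel_probs \<and> (\<forall>\<nu> \<in> borel_probs. riesz_energy s V \<mu> \<le> riesz_energy s V \<nu>)"

definition equilibrium_measure ::
    "real \<Rightarrow> ('a::euclidean_space \<Rightarrow> ereal) \<Rightarrow> 'a measure \<Rightarrow> bool" where
  "equilibrium_measure s V \<mu> \<longleftrightarrow>
    energy_minimizer s V \<mu> \<and> (\<forall>\<nu>. energy_minimizer s V \<nu> \<longrightarrow> \<nu> = \<mu>)"


section \<open>The uniform distribution on a sphere\<close>

text \<open>
  The normalized surface measure, obtained by projecting the uniform distribution on the unit ball
  radially to the sphere: the measure of a set is the normalized volume of the cone over it.
  The lemmas below confirm that, for \<open>R > 0\<close>, this is a rotation-invariant Borel probability measure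
  carried by the sphere of radius \<open>R\<close>, properties that determine it uniquely. (The sort
  \<open>wellorder\<close> is inherited from the library's change of variables for linear maps.)
\<close>

definition uniform_sphere :: "real \<Rightarrow> 'a::euclidean_space measure" where
  "uniform_sphere R = distr (uniform_measure lborel (ball 0 1)) borel (\<lambda>x. (R / norm x) *\<^sub>R x)"

lemma uniform_sphere_borel_probs: "uniform_sphere R \<in> borel_probs"
proof -
  have "prob_space (uniform_measure lborel (ball (0::'a) 1))"
    using unit_ball_vol_pos[of "real DIM('a)"]
    by (intro prob_space_uniform_measure) (auto simp: emeasure_ball simp del: unit_ball_vol_pos)
  then show ?thesis
    unfolding borel_probs_def uniform_sphere_def
    by (auto intro!: prob_space.prob_space_distr)
qed

lemma AE_uniform_sphere:
  assumes "R > 0"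
  shows "AE x in uniform_sphere R. x \<in> sphere (0::'a::euclidean_space) R"
proof -
  have "AE x in lborel. x \<noteq> (0::'a)"
    by (rule AE_lborel_singleton)
  then have "AE x in uniform_measure lborel (ball (0::'a) 1). (R / norm x) *\<^sub>R x \<in> sphere 0 R"
    using assms by (intro AE_uniform_measureI) auto
  then show ?thesis
    unfolding uniform_sphere_def by (subst AE_distr_iff) auto
qed

lemma uniform_sphere_rotation_invariant:
  fixes f :: "real^'n::{finite,wellorder} \<Rightarrow> real^'n::_"
  assumes f: "orthogonal_transformation f"
  shows "distr (uniform_sphere R) borel f = uniform_sphere R"
proof -
  let ?B = "ball (0 :: real^'n::{finite,wellorder}) 1"
  let ?U = "uniform_measure lborel ?B"
  have lin: "linear f" and nf: "\<And>x. norm (f x) = norm x"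
    using f by (auto simp: orthogonal_transformation)
  have [measurable]: "f \<in> borel_measurable borel"
    by (intro borel_measurable_continuous_onI linear_continuous_on linear_conv_bounded_linear[THEN iffD1] lin)
  have inv: "distr ?U borel f = ?U"
  proof (rule measure_eqI)
    fix A assume "A \<in> sets (distr ?U borel f)"
    then have A [measurable]: "A \<in> sets borel" by simp
    have bf: "bij f" using f by (rule orthogonal_transformation_bij)
    have img: "f ` (?B \<inter> f -` A) = ?B \<inter> A"
    proof (intro equalityI subsetI)
      fix y assume y: "y \<in> ?B \<inter> A"
      obtain x where "y = f x" using bij_is_surj[OF bf] by (rule surjE)
      then show "y \<in> f ` (?B \<inter> f -` A)" using y nf by auto
    qed (use nf in auto)
    have fin: "?B \<inter> X \<in> lmeasurable" if "X \<in> sets borel" for X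
      using that by (intro bounded_set_imp_lmeasurable) (auto intro: bounded_subset)
    have pre: "f -` A \<in> sets borel"
      using measurable_sets[OF \<open>f \<in> borel_measurable borel\<close> A] by simp
    have "measure lebesgue (?B \<inter> A) = measure lebesgue (?B \<inter> f -` A)"
      using measure_linear_image[OF lin fin[OF pre]] orthogonal_transformation_det[OF f]
      by (simp add: img)
    moreover have "emeasure lebesgue (?B \<inter> X) = ennreal (measure lebesgue (?B \<inter> X))"
      if "X \<in> sets borel" for X
      using fin[OF that] by (intro emeasure_eq_measure2) (auto simp: fmeasurable_def)
    ultimately have "emeasure lebesgue (?B \<inter> A) = emeasure lebesgue (?B \<inter> f -` A)"
      using A pre by simp
    then have "emeasure lborel (?B \<inter> A) = emeasure lborel (?B \<inter> f -` A)"
      using A pre by (simp add: emeasure_completion main_part_sets)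
    then show "emeasure (distr ?U borel f) A = emeasure ?U A"
      using A pre by (simp add: emeasure_distr)
  qed simp
  have sc: "f ((R / norm x) *\<^sub>R x) = (R / norm (f x)) *\<^sub>R f x" for x
    by (simp add: nf linear_cmul[OF lin])
  have "distr (uniform_sphere R) borel f = distr (distr ?U borel f) borel (\<lambda>x. (R / norm x) *\<^sub>R x)"
    unfolding uniform_sphere_def
    by (subst (1 2) distr_distr) (auto simp: comp_def sc)
  then show ?thesis
    unfolding inv by (simp add: uniform_sphere_def)
qed


section \<open>The constants\<close>

text \<open>
  Generalized hypergeometric functions; at \<open>z = 1\<close> this is the (convergent) series on the boundary
  of the disc of convergence.
\<close>

definition hypergeometric :: "real list \<Rightarrow> real list \<Rightarrow> real \<Rightarrow> real" where
  "hypergeometric as bs z = eval_fps (fps_hypergeo as bs 1) z"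

definition c_const :: "real \<Rightarrow> nat \<Rightarrow> real" where
  "c_const s d = hypergeometric [s / 2, (2 + s - real d) / 2] [real d / 2] 1"

definition b_const :: "nat \<Rightarrow> real" where
  "b_const d = - ln 2 + 1 / 4 * hypergeometric [1, 1, (real d + 1) / 2] [2, real d] 1"

definition alpha_threshold :: "real \<Rightarrow> nat \<Rightarrow> real" where
  "alpha_threshold s d =
    (if s \<noteq> 0
     then max (s * c_const s d / (2 - 2 * c_const s d))
              (2 - (s + 2) * (real d - s - 4) / (2 * (real d - s - 3)))
     else max (- 1 / (2 * b_const d))
              (2 - (real d - 4) / (real d - 3)))"

end

theory Submission
  imports Defs "HOL-Real_Asymp.Real_Asymp"
begin

text \<open>
  Write the energy in terms of the squared distance \<open>t\<close> and the kernel \<open>kk a t\<close>, \<open>a = s / 2\<close>, which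
  is the Riesz kernel shifted by a constant so as to vanish at \<open>t = 1\<close>; the logarithmic kernel is
  then simply the case \<open>a = 0\<close>. The kernel is an integral of Gaussians \<open>exp (- l t)\<close> with the positive
  weight \<open>l powr (a - 1)\<close> up to an additive constant, hence strictly positive definite on differences
  of probability measures. So \<open>\<sigma>\<^sub>R\<close> is the unique minimizer as soon as its potential plus \<open>V\<close> is
  smallest on the sphere; mixing \<open>\<sigma>\<^sub>R\<close> with \<open>\<sigma>\<^sub>r\<close> shows that this condition is also necessary.

  The potential of the unit sphere at distance \<open>sqrt \<rho>\<close> is found by integrating the power series of
  the kernel against the even moments of \<open>\<sigma>\<close>; quadratic transformations give its derivative in
  terms of \<open>F2\<close> at \<open>\<rho>\<close> (inside) and \<open>1 / \<rho>\<close> (outside). If the second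
  derivative of the total potential at the sphere has the right sign, which is the second entry of
  the threshold, then the total potential increases outside, and inside its derivative changes sign
  at most once, from positive to negative: the logarithmic derivative of \<open>F2\<close> is controlled by its
  value at \<open>1\<close>, a ratio of Gamma functions. Thus it remains to compare the sphere with the origin,
  which is the first entry.
\<close>

section \<open>The hypergeometric function on the unit interval\<close>

text \<open>Two obstacles shape the proof. Up to elementary factors, the derivatives of the
  potential are \<open>F2\<close> with second parameter \<open>a + 2 - c\<close> inside and
  \<open>a + 1 - c\<close> outside. Both may lie far below 0, so the power series have no fixed sign
  and termwise comparison fails; even positivity has to be proved. The bounds come from the exponent
  \<open>l = A * B / (C - A - B - 1)\<close>, the logarithmic derivative at 1: it solves
  \<open>l * (l + C - 1) = (l + A) * (l + B)\<close>, so the linear factor in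
  \<open>SL_DERIV\<close> vanishes at 1 and keeps its sign before. The assumption
  \<open>s < d - 3\<close> says that \<open>C - A - B - 1 > 0\<close> for both functions. The
  one-sided derivatives of \<open>u0\<close> at 1 are both \<open>- cst / 4\<close>; hence
  stationarity reads \<open>\<gamma> * R powr (\<alpha> + s) = cst / 2\<close>, the formula for the
  radius. The inner and outer exponents add up to \<open>- (a + 1)\<close>, so
  \<open>\<alpha> \<ge> 2 + 2 * ell\<close> serves both sides. The second obstacle is the
  denominator \<open>a\<close>, zero in the logarithmic case: the series of the potential and the
  relation used to differentiate it are written with \<open>a\<close> already cancelled.\<close>

definition hyp_coeff :: "real \<Rightarrow> real \<Rightarrow> real \<Rightarrow> nat \<Rightarrow> real" where
  "hyp_coeff A B C n = pochhammer A n * pochhammer B n / (pochhammer C n * fact n)"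

definition F2 :: "real \<Rightarrow> real \<Rightarrow> real \<Rightarrow> real \<Rightarrow> real" where
  "F2 A B C x = (\<Sum>n. hyp_coeff A B C n * x ^ n)"

lemma hyp_coeff_0 [simp]: "hyp_coeff A B C 0 = 1"
  by (simp add: hyp_coeff_def)

lemma hyp_coeff_Suc:
  "hyp_coeff A B C (Suc n) =
    hyp_coeff A B C n * ((A + real n) * (B + real n)) / ((C + real n) * real (Suc n))"
  by (simp add: hyp_coeff_def pochhammer_Suc field_simps)

lemma hyp_coeff_Suc':
  assumes "C > 0"
  shows "(C + real n) * real (Suc n) * hyp_coeff A B C (Suc n) =
    (A + real n) * (B + real n) * hyp_coeff A B C n"
proof -
  have "C + real n \<noteq> 0" using assms by linarith
  then show ?thesis
    unfolding hyp_coeff_Suc by (simp del: of_nat_Suc)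
qed

text \<open>The right-hand side is \<open>diffs\<close> of the coefficients, so this is term-by-term
  differentiation: a derivative raises all three parameters by 1.\<close>

lemma hyp_coeff_shift:
  assumes "C > 0"
  shows "hyp_coeff (A + 1) (B + 1) (C + 1) n * (A * B / C) = real (Suc n) * hyp_coeff A B C (Suc n)"
proof -
  have "pochhammer C (Suc n) \<noteq> 0" "pochhammer (C+1) n \<noteq> 0"
    using pochhammer_pos[of C "Suc n"] pochhammer_pos[of "C+1" n] assms by auto
  then show ?thesis
    using assms
    by (simp add: hyp_coeff_def pochhammer_rec fact_Suc[where 'a=real] mult_ac del: of_nat_Suc)
qed

text \<open>The four \<open>rGamma_series\<close> converge, so their quotient is bounded, also when
  A or B is a nonpositive integer and the limit is 0. What is left over is a power of n, whose
  exponent -1 comes from the factorial, read as \<open>pochhammer 1 (Suc n)\<close>. The shifted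
  index is that of \<open>rGamma_series\<close>.\<close>

lemma hyp_coeff_bound:
  assumes C: "C > 0"
  obtains K where "\<And>n. n \<ge> 1 \<Longrightarrow> \<bar>hyp_coeff A B C (Suc n)\<bar> \<le> K * real n powr (A + B - C - 1)"
proof -
  define q where "q n = rGamma_series A n * rGamma_series B n / (rGamma_series C n * rGamma_series 1 n)" for n
  have "rGamma C \<noteq> 0" using C by (simp add: rGamma_eq_zero_iff nonpos_Ints_def) 
  then have "q \<longlonglongrightarrow> rGamma A * rGamma B / (rGamma C * rGamma 1)"
    unfolding q_def by (intro tendsto_intros) auto
  then have "Bseq q" by (intro convergent_imp_Bseq convergentI)
  then obtain K where K: "\<And>n. norm (q n) \<le> K" by (auto simp: Bseq_def)
  have "\<bar>hyp_coeff A B C (Suc n)\<bar> \<le> K * real n powr (A + B - C - 1)" if n: "n \<ge> 1" for n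
  proof -
    have p: "pochhammer C (Suc n) \<noteq> 0" using pochhammer_pos[of C "Suc n"] C by auto
    have "hyp_coeff A B C (Suc n) = q n * real n powr (A + B - C - 1)"
    proof -
      have alg: "a * b / (c * F) = (a / (f * x)) * (b / (f * y)) / ((c / (f * z)) * (F / (f * w))) * (x * y / (z * w))"
        if "c \<noteq> 0" "F \<noteq> 0" "f \<noteq> 0" "x \<noteq> 0" "y \<noteq> 0" "z \<noteq> 0" "w \<noteq> 0" for a b c F f x y z w :: real
        using that by (simp add: field_simps)
      have rG: "rGamma_series z n = pochhammer z (Suc n) / (fact n * real n powr z)" for z :: real
        using n by (simp add: rGamma_series_def powr_def)
      have "real n powr (A + B - C - 1) = real n powr A * real n powr B / (real n powr C * real n powr 1)"
        using n by (simp add: powr_diff powr_add)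
      moreover have "hyp_coeff A B C (Suc n) =
          pochhammer A (Suc n) * pochhammer B (Suc n) / (pochhammer C (Suc n) * pochhammer 1 (Suc n))"
        unfolding hyp_coeff_def pochhammer_fact[symmetric] ..
      moreover have "pochhammer (1::real) (Suc n) \<noteq> 0" unfolding pochhammer_fact[symmetric] by simp
      ultimately show ?thesis
        unfolding q_def rG using n p by (simp only:) (rule alg, auto)
    qed
    then show ?thesis
      using K[of n] by (auto simp: abs_mult intro!: mult_right_mono)
  qed
  then show ?thesis using that by blast
qed

lemma summable_hyp_coeff_power:
  assumes C: "C > 0" and k: "A + B - C + real k < 0"
  shows "summable (\<lambda>n. \<bar>real n ^ k * hyp_coeff A B C n\<bar>)"
proof -
  obtain K where K: "\<And>n. n \<ge> 1 \<Longrightarrow> \<bar>hyp_coeff A B C (Suc n)\<bar> \<le> K * real n powr (A + B - C - 1)"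
    using hyp_coeff_bound[OF C] by blast
  have "summable (\<lambda>n. \<bar>real (Suc n) ^ k * hyp_coeff A B C (Suc n)\<bar>)"
  proof (rule summable_comparison_test_ev)
    have "real (Suc n) ^ k * \<bar>hyp_coeff A B C (Suc n)\<bar> \<le> (2 ^ k * K) * real n powr (A + B - C + real k - 1)"
      if n: "n \<ge> 1" for n
    proof -
      have "real (Suc n) ^ k \<le> (2 * real n) ^ k" using n by (intro power_mono) auto
      also have "\<dots> = 2 ^ k * real n powr real k" using n by (simp add: powr_realpow power_mult_distrib)
      finally have "real (Suc n) ^ k * \<bar>hyp_coeff A B C (Suc n)\<bar> \<le>
        (2 ^ k * real n powr real k) * (K * real n powr (A + B - C - 1))"
        using K[OF n] by (intro mult_mono) auto
      also have "\<dots> = (2 ^ k * K) * real n powr (A + B - C + real k - 1)"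
        using n by (simp add: powr_add[symmetric] algebra_simps)
      finally show ?thesis .
    qed
    then show "\<forall>\<^sub>F n in sequentially. norm \<bar>real (Suc n) ^ k * hyp_coeff A B C (Suc n)\<bar>
        \<le> (2 ^ k * K) * real n powr (A + B - C + real k - 1)"
      by (auto simp: eventually_at_top_linorder abs_mult)
    show "summable (\<lambda>n. (2 ^ k * K) * real n powr (A + B - C + real k - 1))"
      using k by (intro summable_mult) (simp add: summable_real_powr_iff)
  qed
  then show ?thesis by (subst (asm) summable_Suc_iff)
qed

lemma summable_hyp_coeff:
  assumes "C > 0" "C - A - B > 0"
  shows "summable (\<lambda>n. \<bar>hyp_coeff A B C n\<bar>)"
  using summable_hyp_coeff_power[of C A B 0] assms by simp

text \<open>The bound on the coefficients leaves one unit more room here than for summability. These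
  are the boundary terms of the telescoping sums at \<open>x = 1\<close>.\<close>

lemma hyp_coeff_tendsto_0:
  assumes C: "C > 0" and k: "A + B - C + real k < 1"
  shows "(\<lambda>n. real n ^ k * hyp_coeff A B C n) \<longlonglongrightarrow> 0"
proof -
  obtain K where K: "\<And>n. n \<ge> 1 \<Longrightarrow> \<bar>hyp_coeff A B C (Suc n)\<bar> \<le> K * real n powr (A + B - C - 1)"
    using hyp_coeff_bound[OF C] by blast
  have "(\<lambda>n. real (Suc n) ^ k * hyp_coeff A B C (Suc n)) \<longlonglongrightarrow> 0"
  proof (rule Lim_null_comparison)
    show "\<forall>\<^sub>F n in sequentially. norm (real (Suc n) ^ k * hyp_coeff A B C (Suc n))
        \<le> (2 ^ k * K) * real n powr (A + B - C + real k - 1)"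
      unfolding eventually_at_top_linorder
    proof (intro exI[of _ 1] allI impI)
      fix n :: nat assume n: "1 \<le> n"
      have "real (Suc n) ^ k \<le> (2 * real n) ^ k" using n by (intro power_mono) auto
      also have "\<dots> = 2 ^ k * real n powr real k" using n by (simp add: powr_realpow power_mult_distrib)
      finally have "real (Suc n) ^ k * \<bar>hyp_coeff A B C (Suc n)\<bar> \<le>
        (2 ^ k * real n powr real k) * (K * real n powr (A + B - C - 1))"
        using K[OF n] by (intro mult_mono) auto
      also have "\<dots> = (2 ^ k * K) * real n powr (A + B - C + real k - 1)"
        using n by (simp add: powr_add[symmetric] algebra_simps)
      finally show "norm (real (Suc n) ^ k * hyp_coeff A B C (Suc n))
        \<le> (2 ^ k * K) * real n powr (A + B - C + real k - 1)"
        by (simp add: abs_mult)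
    qed
    have "(\<lambda>n. real n powr (A + B - C + real k - 1)) \<longlonglongrightarrow> 0"
      using k by (intro tendsto_neg_powr filterlim_real_sequentially) auto
    from tendsto_mult_left[OF this, of "2^k*K"]
    show "(\<lambda>n. (2 ^ k * K) * real n powr (A + B - C + real k - 1)) \<longlonglongrightarrow> 0" by simp
  qed
  then show ?thesis by (rule LIMSEQ_imp_Suc)
qed

lemma summable_hyp_powser:
  assumes C: "C > 0" and x: "\<bar>x\<bar> < 1"
  shows "summable (\<lambda>n. \<bar>hyp_coeff A B C n * x ^ n\<bar>)"
proof -
  obtain K where K: "\<And>n. n \<ge> 1 \<Longrightarrow> \<bar>hyp_coeff A B C (Suc n)\<bar> \<le> K * real n powr (A + B - C - 1)"
    using hyp_coeff_bound[OF C] by blast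
  \<comment> \<open>Any y strictly between \<open>\<bar>x\<bar>\<close> and 1 will do:
    \<open>y ^ n\<close> absorbs the power of n, and \<open>\<bar>x\<bar> / y\<close> is still a
    geometric ratio below 1.\<close>
  define y where "y = (\<bar>x\<bar> + 1) / 2"
  have y: "\<bar>x\<bar> < y" "0 < y" "y < 1" using x by (auto simp: y_def)
  have "(\<lambda>n. real n powr (A + B - C - 1) * y ^ n) \<longlonglongrightarrow> 0"
    using y by real_asymp
  then have "Bseq (\<lambda>n. real n powr (A + B - C - 1) * y ^ n)"
    by (intro convergent_imp_Bseq convergentI)
  then obtain L where L: "\<And>n. norm (real n powr (A + B - C - 1) * y ^ n) \<le> L" by (auto simp: Bseq_def)
  have K0: "K \<ge> 0" using K[of 1] by auto
  have "summable (\<lambda>n. \<bar>hyp_coeff A B C (Suc n) * x ^ Suc n\<bar>)"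
  proof (rule summable_comparison_test_ev)
    show "\<forall>\<^sub>F n in sequentially. norm \<bar>hyp_coeff A B C (Suc n) * x ^ Suc n\<bar> \<le> K * L * \<bar>x\<bar> * (\<bar>x\<bar> / y) ^ n"
      unfolding eventually_at_top_linorder
    proof (intro exI[of _ 1] allI impI)
      fix n :: nat assume n: "1 \<le> n"
      have "\<bar>hyp_coeff A B C (Suc n)\<bar> * \<bar>x\<bar> ^ Suc n \<le> K * real n powr (A + B - C - 1) * \<bar>x\<bar> ^ Suc n"
        using K[OF n] by (intro mult_right_mono) auto
      also have "\<dots> = K * (real n powr (A + B - C - 1) * y ^ n) * \<bar>x\<bar> * (\<bar>x\<bar> / y) ^ n"
        using y by (simp add: power_divide)
      also have "\<dots> \<le> K * L * \<bar>x\<bar> * (\<bar>x\<bar> / y) ^ n"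
        using L[of n] K0 y by (intro mult_right_mono mult_left_mono) auto
      finally show "norm \<bar>hyp_coeff A B C (Suc n) * x ^ Suc n\<bar> \<le> K * L * \<bar>x\<bar> * (\<bar>x\<bar> / y) ^ n"
        by (simp add: abs_mult power_abs)
    qed
    show "summable (\<lambda>n. K * L * \<bar>x\<bar> * (\<bar>x\<bar> / y) ^ n)"
      using y by (intro summable_mult summable_geometric) auto
  qed
  then show ?thesis by (subst (asm) summable_Suc_iff)
qed

section \<open>Derivatives and the hypergeometric equation\<close>

lemma F2_0 [simp]: "F2 A B C 0 = 1"
  unfolding F2_def using powser_zero[of "hyp_coeff A B C"] by simp

lemma F2_has_derivative:
  assumes C: "C > 0" and x: "\<bar>x\<bar> < 1"
  shows "(F2 A B C has_real_derivative A * B / C * F2 (A + 1) (B + 1) (C + 1) x) (at x)"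
proof -
  have s: "summable (\<lambda>n. hyp_coeff A B C n * z ^ n)" if "norm z < 1" for z :: real
    using summable_hyp_powser[OF C] that summable_rabs_cancel by auto
  have "((\<lambda>z. \<Sum>n. hyp_coeff A B C n * z ^ n) has_real_derivative
      (\<Sum>n. diffs (hyp_coeff A B C) n * x ^ n)) (at x)"
    using x by (intro termdiffs_strong'[of 1] s) auto
  also have "(\<Sum>n. diffs (hyp_coeff A B C) n * x ^ n) = A * B / C * F2 (A + 1) (B + 1) (C + 1) x"
  proof -
    have "summable (\<lambda>n. hyp_coeff (A+1) (B+1) (C+1) n * x ^ n)"
      using summable_hyp_powser[of "C+1" x] C x summable_rabs_cancel by auto
    from suminf_mult[OF this, of "A * B / C"] show ?thesis
      unfolding F2_def diffs_def hyp_coeff_shift[OF C, symmetric]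
      by (simp add: mult_ac)
  qed
  finally show ?thesis by (simp add: F2_def[abs_def])
qed

lemma F2_continuous_on:
  assumes C: "C > 0" and d: "C - A - B > 0"
  shows "continuous_on {-1..1} (F2 A B C)"
proof -
  have "uniform_limit {-1..1} (\<lambda>n x. \<Sum>i<n. hyp_coeff A B C i * x ^ i) (F2 A B C) sequentially"
    unfolding F2_def
  proof (rule Weierstrass_m_test)
    fix n and x :: real assume "x \<in> {-1..1}"
    then have "\<bar>x\<bar> ^ n \<le> 1" by (intro power_le_one) auto
    then show "norm (hyp_coeff A B C n * x ^ n) \<le> \<bar>hyp_coeff A B C n\<bar>"
      by (simp add: abs_mult power_abs mult_left_le)
  qed (rule summable_hyp_coeff[OF C d])
  then show ?thesis
    by (rule uniform_limit_theorem[rotated]) (auto intro!: continuous_intros always_eventually)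
qed

lemma F2_sums:
  assumes "C > 0" "\<bar>x\<bar> < 1"
  shows "(\<lambda>n. hyp_coeff A B C n * x ^ n) sums F2 A B C x"
  using summable_hyp_powser[OF assms] unfolding F2_def by (simp add: summable_rabs_cancel summable_sums)

lemma F2_sums_deriv:
  assumes "C > 0" "\<bar>x\<bar> < 1"
  shows "(\<lambda>n. real (Suc n) * hyp_coeff A B C (Suc n) * x ^ n) sums (A * B / C * F2 (A+1) (B+1) (C+1) x)"
proof -
  have "(\<lambda>n. A * B / C * (hyp_coeff (A+1) (B+1) (C+1) n * x ^ n)) sums (A * B / C * F2 (A+1) (B+1) (C+1) x)"
    using assms by (intro sums_mult F2_sums) auto
  moreover have "A * B / C * (hyp_coeff (A+1) (B+1) (C+1) n * x ^ n) =
      real (Suc n) * hyp_coeff A B C (Suc n) * x ^ n" for n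
    unfolding hyp_coeff_shift[OF assms(1), symmetric] by simp
  ultimately show ?thesis by simp
qed

lemma sums_index_shift:
  fixes t :: "nat \<Rightarrow> real"
  assumes "(\<lambda>n. real (Suc n) * t (Suc n) * x ^ n) sums S"
  shows "(\<lambda>n. real n * t n * x ^ n) sums (x * S)"
proof -
  have "(\<lambda>n. x * (real (Suc n) * t (Suc n) * x ^ n)) sums (x * S)"
    by (rule sums_mult[OF assms])
  then have "(\<lambda>n. real (Suc n) * t (Suc n) * x ^ Suc n) sums (x * S)"
    by (simp add: mult_ac)
  then show ?thesis by (subst (asm) sums_Suc_iff) simp
qed

text \<open>This is the recurrence \<open>hyp_coeff_Suc'\<close> in disguise: the coefficient of
  \<open>x ^ n\<close> in the difference of the two sides is \<open>(C + n) * (n + 1)\<close> times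
  the next coefficient minus \<open>(A + n) * (B + n)\<close> times the n-th. The derivatives are
  written as \<open>F2\<close> with raised parameters.\<close>

lemma F2_ode:
  assumes C: "C > 0" and x: "\<bar>x\<bar> < 1"
  shows "x * (1 - x) * (A * B / C * ((A + 1) * (B + 1) / (C + 1) * F2 (A + 1 + 1) (B + 1 + 1) (C + 1 + 1) x))
      + (C - (A + B + 1) * x) * (A * B / C * F2 (A + 1) (B + 1) (C + 1) x) = A * B * F2 A B C x"
proof -
  let ?t = "hyp_coeff A B C"
  let ?u = "\<lambda>n. real (Suc n) * ?t (Suc n)"
  let ?f1 = "A * B / C * F2 (A + 1) (B + 1) (C + 1) x"
  let ?f2 = "A * B / C * ((A + 1) * (B + 1) / (C + 1) * F2 (A + 1 + 1) (B + 1 + 1) (C + 1 + 1) x)"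
  note s0 = F2_sums[OF C x, of A B]
  note s1 = F2_sums_deriv[OF C x, of A B]
  have s2: "(\<lambda>n. real (Suc n) * ?u (Suc n) * x ^ n) sums ?f2"
  proof -
    have "(\<lambda>n. A * B / C * (real (Suc n) * hyp_coeff (A+1) (B+1) (C+1) (Suc n) * x ^ n)) sums ?f2"
      using C by (intro sums_mult F2_sums_deriv x) auto
    moreover have "A * B / C * (real (Suc n) * hyp_coeff (A+1) (B+1) (C+1) (Suc n) * x ^ n)
        = real (Suc n) * ?u (Suc n) * x ^ n" for n
      unfolding hyp_coeff_shift[OF C, of A B "Suc n", symmetric] by simp
    ultimately show ?thesis by simp
  qed
  note s3 = sums_index_shift[OF s2]
  have "(\<lambda>n. real (Suc n) * (real n * ?t (Suc n)) * x ^ n) sums (x * ?f2)"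
    using s3 by (simp add: mult_ac)
  \<comment> \<open>Writing n as \<open>Suc n - 1\<close> exhibits the series as one in
    \<open>t (Suc n)\<close>, the shape that \<open>sums_index_shift\<close> expects.\<close>
  then have "(\<lambda>n. real (Suc n) * (real (Suc n - 1) * ?t (Suc n)) * x ^ n) sums (x * ?f2)"
    by (simp only: diff_Suc_1)
  then have s4: "(\<lambda>n. real n * (real (n - 1) * ?t n) * x ^ n) sums (x * (x * ?f2))"
    by (rule sums_index_shift[where t = "\<lambda>n. real (n - 1) * ?t n"])
  note s5 = sums_index_shift[OF s1]
  have "(\<lambda>n. real n * ?u n * x ^ n - real n * (real (n - 1) * ?t n) * x ^ n + C * (?u n * x ^ n)
      - (A + B + 1) * (real n * ?t n * x ^ n) - A * B * (?t n * x ^ n)) sums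
      (x * ?f2 - x * (x * ?f2) + C * ?f1 - (A + B + 1) * (x * ?f1) - A * B * F2 A B C x)"
    by (intro sums_add sums_diff sums_mult s0 s1 s3 s4 s5)
  moreover have "real n * ?u n * x ^ n - real n * (real (n - 1) * ?t n) * x ^ n + C * (?u n * x ^ n)
      - (A + B + 1) * (real n * ?t n * x ^ n) - A * B * (?t n * x ^ n) = 0" for n
  proof -
    have e: "real n * (real (n - 1) * ?t n) = real n * (real n - 1) * ?t n" by (cases n) auto
    have "real n * ?u n * x ^ n - real n * (real (n - 1) * ?t n) * x ^ n + C * (?u n * x ^ n)
      - (A + B + 1) * (real n * ?t n * x ^ n) - A * B * (?t n * x ^ n)
      = ((C + real n) * real (Suc n) * ?t (Suc n) - (A + real n) * (B + real n) * ?t n) * x ^ n"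
      unfolding e by (simp add: algebra_simps)
    then show ?thesis using hyp_coeff_Suc'[OF C] by simp
  qed
  ultimately have "(\<lambda>n. 0) sums (x * ?f2 - x * (x * ?f2) + C * ?f1 - (A + B + 1) * (x * ?f1) - A * B * F2 A B C x)"
    by simp
  then have "x * ?f2 - x * (x * ?f2) + C * ?f1 - (A + B + 1) * (x * ?f1) - A * B * F2 A B C x = 0"
    using sums_unique2 sums_zero by blast
  moreover have "x * (1 - x) * f2 + (C - (A + B + 1) * x) * f1 = g"
    if "x * f2 - x * (x * f2) + C * f1 - (A + B + 1) * (x * f1) - g = 0" for f1 f2 g
    using that by (simp add: algebra_simps)
  ultimately show ?thesis by blast
qed

text \<open>The logarithmic derivative at the end point is rational in the parameters, since the
  relevant combination of the series for the function and its derivative telescopes. This is where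
  the exponent \<open>ell\<close> of the threshold comes from.\<close>

lemma F2_1_deriv_ratio:
  assumes C: "C > 0" and d: "C - A - B - 1 > 0"
  shows "A * B / C * F2 (A + 1) (B + 1) (C + 1) 1 = A * B / (C - A - B - 1) * F2 A B C 1"
proof -
  let ?t = "hyp_coeff A B C"
  let ?d = "C - A - B - 1"
  have s0: "?t sums F2 A B C 1"
    using summable_hyp_coeff[OF C, of A B] d unfolding F2_def by (simp add: summable_rabs_cancel summable_sums)
  have "(\<lambda>n. A * B / C * hyp_coeff (A+1) (B+1) (C+1) n) sums (A * B / C * F2 (A+1) (B+1) (C+1) 1)"
    using summable_hyp_coeff[of "C+1" "A+1" "B+1"] C d unfolding F2_def
    by (intro sums_mult) (simp add: summable_rabs_cancel summable_sums)
  then have "(\<lambda>n. real (Suc n) * ?t (Suc n)) sums (A * B / C * F2 (A+1) (B+1) (C+1) 1)"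
    unfolding hyp_coeff_shift[OF C, symmetric] by (simp add: mult.commute)
  then have s1: "(\<lambda>n. real n * ?t n) sums (A * B / C * F2 (A+1) (B+1) (C+1) 1)"
    by (subst (asm) sums_Suc_iff) simp
  \<comment> \<open>By the recurrence, \<open>T (Suc n)\<close> is \<open>(A + n) * (B + n)\<close>
    times the n-th coefficient, so the terms quadratic in n cancel in
    \<open>T (Suc n) - T n\<close>.\<close>
  define T where "T n = real n * (C + real n - 1) * ?t n" for n
  have T: "A * B * ?t n - ?d * (real n * ?t n) = T (Suc n) - T n" for n
    using hyp_coeff_Suc'[OF C, of n A B] by (simp add: T_def algebra_simps)
  have "T \<longlonglongrightarrow> 0"
  proof -
    have "(\<lambda>n. (C - 1) * (real n ^ 1 * ?t n) + real n ^ 2 * ?t n) \<longlonglongrightarrow> (C - 1) * 0 + 0"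
      using d by (intro tendsto_intros hyp_coeff_tendsto_0 C) auto
    then show ?thesis by (simp add: T_def[abs_def] algebra_simps power2_eq_square)
  qed
  from telescope_sums[OF this] have "(\<lambda>n. A * B * ?t n - ?d * (real n * ?t n)) sums 0"
    unfolding T by (simp add: T_def)
  moreover have "(\<lambda>n. A * B * ?t n - ?d * (real n * ?t n)) sums
      (A * B * F2 A B C 1 - ?d * (A * B / C * F2 (A+1) (B+1) (C+1) 1))"
    by (intro sums_diff sums_mult s0 s1)
  ultimately have "A * B * F2 A B C 1 - ?d * (A * B / C * F2 (A+1) (B+1) (C+1) 1) = 0"
    using sums_unique2 by blast
  then have "A * B / C * F2 (A+1) (B+1) (C+1) 1 * ?d = A * B * F2 A B C 1" by (simp only: mult.commute)
  then have "A * B / C * F2 (A+1) (B+1) (C+1) 1 = A * B * F2 A B C 1 / ?d"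
    using d by (subst eq_divide_eq) auto
  then show ?thesis by simp
qed

text \<open>Again a telescoping sum, with boundary term n times the n-th coefficient, which tends to
  0 because \<open>C - A - B > 0\<close>. Raising C by 1 is the step that \<open>gauss_sum\<close>
  iterates.\<close>

lemma F2_1_contiguous:
  assumes C: "C > 0" and d: "C - A - B > 0"
  shows "F2 A B C 1 * (C * (C - A - B)) = (C - A) * (C - B) * F2 A B (C + 1) 1"
proof -
  let ?t = "hyp_coeff A B C"
  have s0: "?t sums F2 A B C 1"
    using summable_hyp_coeff[OF C, of A B] d unfolding F2_def by (simp add: summable_rabs_cancel summable_sums)
  have s1: "hyp_coeff A B (C+1) sums F2 A B (C+1) 1"
    using summable_hyp_coeff[of "C+1" A B] C d unfolding F2_def by (simp add: summable_rabs_cancel summable_sums)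
  have r: "(C + real n) * hyp_coeff A B (C+1) n = C * ?t n" for n
  proof -
    have "pochhammer C n \<noteq> 0" "pochhammer (C+1) n \<noteq> 0"
      using pochhammer_pos[of C n] pochhammer_pos[of "C+1" n] C by auto
    moreover have "(C + real n) * pochhammer C n = C * pochhammer (C+1) n"
      using pochhammer_rec[of C n] pochhammer_Suc[of C n] by (simp add: algebra_simps)
    moreover have "C + real n \<noteq> 0" using C by linarith
    ultimately have "(C + real n) / pochhammer (C+1) n = C / pochhammer C n"
      by (simp add: frac_eq_eq)
    then have "pochhammer A n * pochhammer B n / fact n * ((C + real n) / pochhammer (C+1) n)
        = pochhammer A n * pochhammer B n / fact n * (C / pochhammer C n)" by simp
    then show ?thesis by (simp add: hyp_coeff_def mult_ac)
  qed
  define T where "T n = C * (real n * ?t n)" for n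
  have T: "(C - A) * (C - B) * hyp_coeff A B (C+1) n - C * (C - A - B) * ?t n = T (Suc n) - T n" for n
  proof -
    have nz: "C + real n \<noteq> 0" using C by linarith
    have "(C + real n) * ((C - A) * (C - B) * hyp_coeff A B (C+1) n - C * (C - A - B) * ?t n - (T (Suc n) - T n))
      = (C - A) * (C - B) * ((C + real n) * hyp_coeff A B (C+1) n) - C * (C - A - B) * (C + real n) * ?t n
        - C * ((C + real n) * real (Suc n) * ?t (Suc n)) + C * (C + real n) * real n * ?t n"
      by (simp add: T_def algebra_simps)
    also have "\<dots> = 0"
      unfolding r hyp_coeff_Suc'[OF C] by (simp add: algebra_simps)
    finally show ?thesis using nz by simp
  qed
  have "T \<longlonglongrightarrow> 0"
  proof -
    have "(\<lambda>n. C * (real n ^ 1 * ?t n)) \<longlonglongrightarrow> C * 0"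
      using d by (intro tendsto_intros hyp_coeff_tendsto_0 C) auto
    then show ?thesis by (simp add: T_def[abs_def])
  qed
  from telescope_sums[OF this]
  have "(\<lambda>n. (C - A) * (C - B) * hyp_coeff A B (C+1) n - C * (C - A - B) * ?t n) sums 0"
    unfolding T by (simp add: T_def)
  moreover have "(\<lambda>n. (C - A) * (C - B) * hyp_coeff A B (C+1) n - C * (C - A - B) * ?t n) sums
      ((C - A) * (C - B) * F2 A B (C+1) 1 - C * (C - A - B) * F2 A B C 1)"
    by (intro sums_diff sums_mult s0 s1)
  ultimately have "(C - A) * (C - B) * F2 A B (C+1) 1 - C * (C - A - B) * F2 A B C 1 = 0"
    using sums_unique2 by blast
  then show ?thesis by (simp add: algebra_simps)
qed

text \<open>The condition \<open>x + y = z + w\<close> makes the powers of n in the four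
  \<open>rGamma_series\<close> cancel, so that only Pochhammer symbols remain.\<close>

lemma pochhammer_ratio_tendsto:
  fixes x y z w :: real
  assumes "x + y = z + w" "z > 0" "w > 0"
  shows "(\<lambda>n. pochhammer x n * pochhammer y n / (pochhammer z n * pochhammer w n))
    \<longlonglongrightarrow> rGamma x * rGamma y / (rGamma z * rGamma w)"
proof -
  have "rGamma z \<noteq> 0" "rGamma w \<noteq> 0" using assms by (simp_all add: rGamma_eq_zero_iff nonpos_Ints_def)
  then have "(\<lambda>n. rGamma_series x n * rGamma_series y n / (rGamma_series z n * rGamma_series w n))
      \<longlonglongrightarrow> rGamma x * rGamma y / (rGamma z * rGamma w)"
    by (intro tendsto_intros) auto
  moreover have "rGamma_series x n * rGamma_series y n / (rGamma_series z n * rGamma_series w n) =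
      pochhammer x (Suc n) * pochhammer y (Suc n) / (pochhammer z (Suc n) * pochhammer w (Suc n))" for n
  proof -
    have "exp (x * ln (real n)) * exp (y * ln (real n)) = exp (z * ln (real n)) * exp (w * ln (real n))"
      unfolding exp_add[symmetric] distrib_right[symmetric] assms(1) ..
    moreover have "pochhammer z (Suc n) \<noteq> 0" "pochhammer w (Suc n) \<noteq> 0"
      using pochhammer_pos[of z "Suc n"] pochhammer_pos[of w "Suc n"] assms by auto
    ultimately show ?thesis
      unfolding rGamma_series_def by (simp add: divide_simps)
  qed
  ultimately show ?thesis
    by (intro LIMSEQ_imp_Suc[where f = "\<lambda>n. pochhammer x n * pochhammer y n / (pochhammer z n * pochhammer w n)"]) simp
qed

text \<open>Gauss's summation theorem by his own device: raise C by N steps with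
  \<open>F2_1_contiguous\<close>, then let N tend to infinity. The series tends to its constant term
  1 and the accumulated rational factor to the quotient of Gamma functions.\<close>

theorem gauss_sum:
  assumes C: "C > 0" and d: "C - A - B > 0"
  shows "F2 A B C 1 = rGamma (C - A) * rGamma (C - B) / (rGamma C * rGamma (C - A - B))"
proof -
  let ?p = "\<lambda>N. pochhammer (C - A) N * pochhammer (C - B) N / (pochhammer C N * pochhammer (C - A - B) N)"
  have it: "F2 A B C 1 = ?p N * F2 A B (C + real N) 1" for N
  proof (induction N)
    case (Suc N)
    have *: "C + real N > 0" "C + real N - A - B > 0" using C d by auto
    have "F2 A B (C + real N) 1 * ((C + real N) * (C + real N - A - B))
        = (C + real N - A) * (C + real N - B) * F2 A B (C + real N + 1) 1"
      by (rule F2_1_contiguous[OF *])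
    then have "F2 A B (C + real N) 1 =
        (C + real N - A) * (C + real N - B) * F2 A B (C + real N + 1) 1 / ((C + real N) * (C + real N - A - B))"
      using * by (subst eq_divide_eq) auto
    then show ?case unfolding Suc
      by (simp add: pochhammer_Suc add_ac diff_add_eq diff_diff_eq) (simp add: algebra_simps)
  qed simp
  have "(\<lambda>N. F2 A B (C + real N) 1 - 1) \<longlonglongrightarrow> 0"
  proof (rule Lim_null_comparison)
    let ?S = "\<Sum>n. \<bar>hyp_coeff A B C n\<bar>"
    show "\<forall>\<^sub>F N in sequentially. norm (F2 A B (C + real N) 1 - 1) \<le> ?S * (C / (C + real N))"
    proof (rule always_eventually, rule allI)
      fix N
      let ?u = "hyp_coeff A B (C + real N)"
      have su: "summable (\<lambda>n. \<bar>?u n\<bar>)" using C d by (intro summable_hyp_coeff) auto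
      have st: "summable (\<lambda>n. \<bar>hyp_coeff A B C n\<bar>)" using C d by (intro summable_hyp_coeff) auto
      have su': "summable (\<lambda>n. \<bar>?u (Suc n)\<bar>)" and st': "summable (\<lambda>n. \<bar>hyp_coeff A B C (Suc n)\<bar>)"
        using su st summable_Suc_iff[of "\<lambda>n. \<bar>?u n\<bar>"] summable_Suc_iff[of "\<lambda>n. \<bar>hyp_coeff A B C n\<bar>"] by auto
      \<comment> \<open>Only the first factor of the Pochhammer symbol in the denominator supplies
        the gain \<open>C / (C + N)\<close>; the remaining factors merely grow with N.\<close>
      have le: "\<bar>?u (Suc n)\<bar> \<le> \<bar>hyp_coeff A B C (Suc n)\<bar> * (C / (C + real N))" for n
      proof -
        have pos: "pochhammer C (Suc n) > 0" "pochhammer (C + real N) (Suc n) > 0"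
            "pochhammer (C+1) n > 0" "pochhammer (C + real N + 1) n > 0"
          using C by (auto intro!: pochhammer_pos)
        have "pochhammer (C+1) n \<le> pochhammer (C + real N + 1) n"
          using C unfolding pochhammer_prod by (intro prod_mono) auto
        then have "(C + real N) * pochhammer C (Suc n) \<le> C * pochhammer (C + real N) (Suc n)"
          using C unfolding pochhammer_rec by (simp add: mult_left_mono)
        then have "1 / pochhammer (C + real N) (Suc n) \<le> (C / (C + real N)) / pochhammer C (Suc n)"
          using pos C frac_le[of C C "(C + real N) * pochhammer C (Suc n)" "C * pochhammer (C + real N) (Suc n)"]
          by (simp del: pochhammer_Suc)
        then have "\<bar>pochhammer A (Suc n) * pochhammer B (Suc n) / fact (Suc n)\<bar> * (1 / pochhammer (C + real N) (Suc n))
          \<le> \<bar>pochhammer A (Suc n) * pochhammer B (Suc n) / fact (Suc n)\<bar> * ((C / (C + real N)) / pochhammer C (Suc n))"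
          by (rule mult_left_mono) simp
        then show ?thesis using pos unfolding hyp_coeff_def abs_mult abs_divide
          by (simp only: abs_of_pos fact_gt_zero mult_ac times_divide_eq_left times_divide_eq_right divide_divide_eq_left mult_1_left mult_1_right)
      qed
      have "F2 A B (C + real N) 1 - 1 = (\<Sum>n. ?u (Suc n))"
        unfolding F2_def using suminf_split_head[of ?u] su by (simp add: summable_rabs_cancel)
      also have "norm \<dots> \<le> (\<Sum>n. \<bar>?u (Suc n)\<bar>)"
        unfolding real_norm_def by (rule summable_rabs[OF su'])
      also have "\<dots> \<le> (\<Sum>n. \<bar>hyp_coeff A B C (Suc n)\<bar> * (C / (C + real N)))"
        by (intro suminf_le le summable_mult2 su' st')
      also have "\<dots> = (\<Sum>n. \<bar>hyp_coeff A B C (Suc n)\<bar>) * (C / (C + real N))"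
        by (intro suminf_mult2[symmetric] st')
      also have "\<dots> \<le> ?S * (C / (C + real N))"
        using C suminf_split_head[OF st] by (intro mult_right_mono) auto
      finally show "norm (F2 A B (C + real N) 1 - 1) \<le> ?S * (C / (C + real N))" .
    qed
    have "(\<lambda>N. C / (C + real N)) \<longlonglongrightarrow> 0" by real_asymp
    from tendsto_mult_left[OF this, of ?S] show "(\<lambda>N. ?S * (C / (C + real N))) \<longlonglongrightarrow> 0" by simp
  qed
  then have "(\<lambda>N. F2 A B (C + real N) 1) \<longlonglongrightarrow> 1" by (simp add: LIM_zero_iff)
  moreover have "?p \<longlonglongrightarrow> rGamma (C - A) * rGamma (C - B) / (rGamma C * rGamma (C - A - B))"
    using C d by (intro pochhammer_ratio_tendsto) auto
  ultimately have "(\<lambda>N. ?p N * F2 A B (C + real N) 1) \<longlonglongrightarrow>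
      rGamma (C - A) * rGamma (C - B) / (rGamma C * rGamma (C - A - B)) * 1"
    by (intro tendsto_mult)
  then show ?thesis unfolding it[symmetric] by (simp add: LIMSEQ_const_iff)
qed

section \<open>Sign changes and logarithmic derivatives\<close>

text \<open>Phrased through order alone, so that zeros need neither be located nor counted:
  functions of one sign and functions with whole intervals of zeros are included, and the property
  survives integration and multiplication by positive factors.\<close>

definition pos_then_neg :: "(real \<Rightarrow> real) \<Rightarrow> bool" where
  "pos_then_neg f \<longleftrightarrow> (\<forall>x y. 0 < x \<and> x < y \<and> y < 1 \<and> f x < 0 \<longrightarrow> f y \<le> 0)"

lemma pos_then_negI:
  assumes "\<And>x y. 0 < x \<Longrightarrow> x < y \<Longrightarrow> y < 1 \<Longrightarrow> f x < 0 \<Longrightarrow> f y \<le> 0"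
  shows "pos_then_neg f"
  using assms unfolding pos_then_neg_def by blast

lemma pos_then_neg_cong_sgn:
  assumes "pos_then_neg f" "\<And>x. 0 < x \<Longrightarrow> x < 1 \<Longrightarrow> sgn (g x) = sgn (f x)"
  shows "pos_then_neg g"
proof (rule pos_then_negI)
  fix x y :: real assume *: "0 < x" "x < y" "y < 1" "g x < 0"
  then have "f x < 0" using assms(2)[of x] by (auto simp: sgn_if split: if_splits)
  then have "f y \<le> 0" using assms(1) * unfolding pos_then_neg_def by blast
  then show "g y \<le> 0" using assms(2)[of y] * by (auto simp: sgn_if split: if_splits)
qed

text \<open>A negative value of F must have been reached by falling; this is what
  \<open>start\<close> guarantees at the left end, where F itself may be undefined. Then the
  derivative was negative earlier, and F cannot rise again.\<close>

lemma pos_then_neg_antideriv: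
  assumes F: "\<And>x. 0 < x \<Longrightarrow> x < 1 \<Longrightarrow> (F has_real_derivative F' x) (at x)"
    and F': "pos_then_neg F'"
    and start: "\<And>x. 0 < x \<Longrightarrow> x < 1 \<Longrightarrow> F x < 0 \<Longrightarrow> \<exists>t. 0 < t \<and> t < x \<and> F t > F x"
  shows "pos_then_neg F"
proof (rule pos_then_negI)
  fix x y :: real assume *: "0 < x" "x < y" "y < 1" "F x < 0"
  then obtain t where t: "0 < t" "t < x" "F t > F x" using start[of x] by auto
  then obtain z where z: "t < z" "z < x" "F x - F t = (x - t) * F' z"
    using MVT2[of t x F F'] F * by auto
  then have "F' z < 0" using t by (metis diff_gt_0_iff_gt diff_less_0_iff_less mult_less_0_iff not_less_iff_gr_or_eq)
  then have "F' w \<le> 0" if "z < w" "w < 1" for w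
    using F' that z t \<open>F' z < 0\<close> unfolding pos_then_neg_def by (meson less_trans)
  then have "F y \<le> F x"
    using F * z t by (intro DERIV_nonpos_imp_nonincreasing[of x y F]) (auto intro!: exI F)
  then show "F y \<le> 0" using * by linarith
qed

text \<open>If D were above \<open>D 1\<close> at x and below it at a later y, it would fall in
  between and would have to rise again to reach \<open>D 1\<close>.\<close>

lemma pos_then_neg_minus_end:
  assumes D: "\<And>x. 0 < x \<Longrightarrow> x < 1 \<Longrightarrow> (D has_real_derivative D' x) (at x)"
    and cont: "continuous_on {0<..1} D"
    and D': "pos_then_neg D'"
  shows "pos_then_neg (\<lambda>x. D 1 - D x)"
proof (rule pos_then_negI)
  fix x y :: real assume *: "0 < x" "x < y" "y < 1" "D 1 - D x < 0"
  show "D 1 - D y \<le> 0"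
  proof (rule ccontr)
    assume "\<not> D 1 - D y \<le> 0"
    then have lt: "D y < D 1" by simp
    obtain z where z: "x < z" "z < y" "D y - D x = (y - x) * D' z"
      using MVT2[of x y D D'] D * by auto
    have "(y - x) * D' z < 0" using z lt * by linarith
    then have "D' z < 0" using * by (simp add: mult_less_0_iff)
    then have neg: "D' w \<le> 0" if "z < w" "w < 1" for w
      using D' that z * \<open>D' z < 0\<close> unfolding pos_then_neg_def by (meson less_trans)
    have "D 1 \<le> D y"
    proof (rule DERIV_nonpos_imp_decreasing_open[of y 1 D])
      show "continuous_on {y..1} D" using * by (intro continuous_on_subset[OF cont]) auto
        fix w assume "y < w" "w < 1"
      then show "\<exists>l. (D has_real_derivative l) (at w) \<and> l \<le> 0"
        using * z by (intro exI[of _ "D' w"] conjI D neg) auto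
    qed (use * in auto)
    then show False using lt by simp
  qed
qed

text \<open>A function that rises first and falls afterwards attains its minimum at an end point.
  For the total potential inside the sphere the two end points are the origin and the sphere
  itself.\<close>

lemma pos_then_neg_ge_min:
  assumes h: "\<And>x. 0 < x \<Longrightarrow> x < 1 \<Longrightarrow> (h has_real_derivative h' x) (at x)"
    and cont: "continuous_on {0..1} h"
    and h': "pos_then_neg h'"
    and x: "0 \<le> x" "x \<le> 1"
  shows "min (h 0) (h 1) \<le> h x"
proof (cases "h x < h 0")
  case True
  then have x0: "0 < x" using x by (cases "x = 0") auto
  have cx: "continuous_on {0..x} h" using x by (intro continuous_on_subset[OF cont]) auto
  obtain z where z: "0 < z" "z < x" "h x - h 0 = x * h' z"
  proof -
    have "\<exists>l z. 0 < z \<and> z < x \<and> (h has_real_derivative l) (at z) \<and> h x - h 0 = (x - 0) * l"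
      using x0 x by (intro MVT cx) (auto simp: real_differentiable_def intro!: exI h)
    then obtain l z where lz: "0 < z" "z < x" "(h has_real_derivative l) (at z)" "h x - h 0 = (x - 0) * l" by blast
    moreover have "l = h' z" using lz x by (intro DERIV_unique[OF lz(3)] h) auto
    ultimately show ?thesis using that by auto
  qed
  have "x * h' z < 0" using z True by linarith
  then have "h' z < 0" using x0 by (simp add: mult_less_0_iff)
  then have neg: "h' w \<le> 0" if "z < w" "w < 1" for w
    using h' that z x \<open>h' z < 0\<close> unfolding pos_then_neg_def by (meson less_trans)
  have "h 1 \<le> h x"
  proof (rule DERIV_nonpos_imp_decreasing_open[of x 1 h])
    show "continuous_on {x..1} h" using x by (intro continuous_on_subset[OF cont]) auto
    fix w assume "x < w" "w < 1"
    then show "\<exists>y. (h has_real_derivative y) (at w) \<and> y \<le> 0"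
      using x0 z by (intro exI[of _ "h' w"] conjI h neg) auto
  qed (use x in auto)
  then show ?thesis by simp
qed auto

section \<open>Positivity and logarithmic derivatives of \<open>F2\<close>\<close>

definition F2' :: "real \<Rightarrow> real \<Rightarrow> real \<Rightarrow> real \<Rightarrow> real" where
  "F2' A B C x = A * B / C * F2 (A + 1) (B + 1) (C + 1) x"

lemma F2_DERIV:
  assumes "C > 0" "\<bar>x\<bar> < 1"
  shows "(F2 A B C has_real_derivative F2' A B C x) (at x)"
  using F2_has_derivative[OF assms] unfolding F2'_def .

lemma F2_symmetric: "F2 A B C = F2 B A C"
  unfolding F2_def[abs_def] hyp_coeff_def by (simp add: mult.commute)

lemma F2'_DERIV:
  assumes "C > 0" "0 < x" "x < 1"
  shows "(F2' A B C has_real_derivative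
    (A * B * F2 A B C x - (C - (A + B + 1) * x) * F2' A B C x) / (x * (1 - x))) (at x)"
proof -
  have "((\<lambda>x. A * B / C * F2 (A+1) (B+1) (C+1) x) has_real_derivative A * B / C * F2' (A+1) (B+1) (C+1) x) (at x)"
    using assms by (intro DERIV_cmult F2_DERIV) auto
  then have "(F2' A B C has_real_derivative A * B / C * F2' (A+1) (B+1) (C+1) x) (at x)"
    by (simp only: F2'_def[symmetric])
  moreover have "A * B / C * F2' (A+1) (B+1) (C+1) x =
      (A * B * F2 A B C x - (C - (A + B + 1) * x) * F2' A B C x) / (x * (1 - x))"
    using F2_ode[of C x A B] assms unfolding F2'_def
    by (subst eq_divide_eq) (auto simp: algebra_simps)
  ultimately show ?thesis by simp
qed

lemma F2_isCont_0: "C > 0 \<Longrightarrow> isCont (F2 A B C) 0"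
  by (rule DERIV_isCont[OF F2_DERIV]) auto

lemma F2'_isCont_0: "C > 0 \<Longrightarrow> isCont (F2' A B C) 0"
  unfolding F2'_def[abs_def] by (intro continuous_intros F2_isCont_0) auto

lemma F2_coeffs_nonneg:
  assumes "A \<ge> 0" "B \<ge> 0" "C > 0"
  shows "hyp_coeff A B C n \<ge> 0"
proof -
  have "pochhammer A n \<ge> 0" "pochhammer B n \<ge> 0" "pochhammer C n > 0"
    using assms by (auto intro!: pochhammer_pos) (auto simp: pochhammer_prod intro!: prod_nonneg)
  then show ?thesis by (simp add: hyp_coeff_def)
qed

text \<open>For \<open>- 1 \<le> B \<le> 0\<close> only the first factor of
  \<open>pochhammer B (Suc n)\<close> is nonpositive, so every coefficient after the constant one
  has the same sign.\<close>

lemma F2_coeffs_nonpos: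
  assumes "A \<ge> 0" "-1 \<le> B" "B \<le> 0" "C > 0"
  shows "hyp_coeff A B C (Suc n) \<le> 0"
proof -
  have "hyp_coeff A B C (Suc n) = hyp_coeff (A+1) (B+1) (C+1) n * (A * B / C) / real (Suc n)"
    by (subst hyp_coeff_shift) (use assms in auto)
  moreover have "hyp_coeff (A+1) (B+1) (C+1) n \<ge> 0" using assms by (intro F2_coeffs_nonneg) auto
  moreover have "A * B / C \<le> 0" using assms by (simp add: divide_nonpos_pos mult_nonneg_nonpos)
  ultimately show ?thesis
    by (simp only:) (rule divide_nonpos_pos[OF mult_nonneg_nonpos], auto)
qed

lemma F2_ge_1:
  assumes "A \<ge> 0" "B \<ge> 0" "C > 0" "0 \<le> x" "x < 1"
  shows "F2 A B C x \<ge> 1"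
proof -
  have "(\<Sum>n\<in>{0}. hyp_coeff A B C n * x ^ n) \<le> F2 A B C x"
    unfolding F2_def using assms F2_sums[of C x A B]
    by (intro sum_le_suminf) (auto intro!: mult_nonneg_nonneg F2_coeffs_nonneg dest: sums_summable)
  then show ?thesis by simp
qed

lemma F2_le_1_value:
  assumes "A \<ge> 0" "B \<ge> 0" "C > 0" "C - A - B > 0" "0 \<le> x" "x < 1"
  shows "F2 A B C x \<le> F2 A B C 1"
  unfolding F2_def
proof (rule suminf_le)
  fix n
  have "x ^ n \<le> 1" using assms by (intro power_le_one) auto
  then show "hyp_coeff A B C n * x ^ n \<le> hyp_coeff A B C n * 1 ^ n"
    using F2_coeffs_nonneg[of A B C n] assms by (simp add: mult_left_le)
  show "summable (\<lambda>n. hyp_coeff A B C n * x ^ n)" using F2_sums[of C x A B] assms by (auto dest: sums_summable)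
  show "summable (\<lambda>n. hyp_coeff A B C n * 1 ^ n)"
    using summable_hyp_coeff[of C A B] assms by (simp add: summable_rabs_cancel)
qed

lemma F2_ge_1_value:
  assumes "A \<ge> 0" "-1 \<le> B" "B \<le> 0" "C > 0" "C - A - B > 0" "0 \<le> x" "x < 1"
  shows "F2 A B C x \<ge> F2 A B C 1"
  unfolding F2_def
proof (rule suminf_le)
  fix n
  have "x ^ n \<le> 1" using assms by (intro power_le_one) auto
  then show "hyp_coeff A B C n * 1 ^ n \<le> hyp_coeff A B C n * x ^ n"
    using F2_coeffs_nonpos[of A B C "n - 1"] assms by (cases n) (auto simp: mult_le_cancel_left1)
  show "summable (\<lambda>n. hyp_coeff A B C n * x ^ n)" using F2_sums[of C x A B] assms by (auto dest: sums_summable)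
  show "summable (\<lambda>n. hyp_coeff A B C n * 1 ^ n)"
    using summable_hyp_coeff[of C A B] assms by (simp add: summable_rabs_cancel)
qed

text \<open>
  The quotient \<open>x powr (-\<beta>) * F2 A B C x\<close> has the derivative
  \<open>x powr (-\<beta>-1) * (x * F2' A B C x - \<beta> * F2 A B C x)\<close>. Multiplied by the integrating factor of
  the hypergeometric equation in Sturm--Liouville form, this derivative becomes the following
  function, whose own derivative has an elementary sign as long as \<open>F2 A B C\<close> is positive.
\<close>

definition SL :: "real \<Rightarrow> real \<Rightarrow> real \<Rightarrow> real \<Rightarrow> real \<Rightarrow> real" where
  "SL A B C \<beta> x = x powr (\<beta> + C - 1) * (1 - x) powr (A + B + 1 - C) * (x * F2' A B C x - \<beta> * F2 A B C x)"

text \<open>With \<open>h x = x powr (- \<beta>) * F2 A B C x\<close>, the function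
  \<open>SL\<close> is \<open>x powr (2 * \<beta> + C) * (1 - x) powr (A + B + 1 - C)\<close> times
  the derivative of h. In this self-adjoint form all first-order terms disappear, and the
  zeroth-order coefficient is linear in x up to positive powers.\<close>

lemma SL_DERIV:
  assumes C: "C > 0" and x: "0 < x" "x < 1"
  shows "(SL A B C \<beta> has_real_derivative
    x powr (\<beta> + C - 2) * (1 - x) powr (A + B - C) *
      ((x * ((\<beta> + A) * (\<beta> + B)) - \<beta> * (\<beta> + C - 1)) * F2 A B C x)) (at x)"
proof -
  let ?f = "F2 A B C x" and ?g = "F2' A B C x"
  let ?h = "(A * B * ?f - (C - (A + B + 1) * x) * ?g) / (x * (1 - x))"
  let ?e = "\<beta> + C - 1" and ?d = "A + B + 1 - C"
  let ?u = "x powr (\<beta> + C - 2)" and ?v = "(1 - x) powr (A + B - C)"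
  have pu: "x powr ?e = x * ?u" "x powr (?e - 1) = ?u"
    using x powr_add[of x 1 "\<beta> + C - 2"] by (simp_all add: algebra_simps)
  have pv: "(1 - x) powr ?d = (1 - x) * ?v" "(1 - x) powr (?d - 1) = ?v"
    using x powr_add[of "1 - x" 1 "A + B - C"] by (simp_all add: algebra_simps)
  have d1: "((\<lambda>x. x powr ?e) has_real_derivative ?e * x powr (?e - 1)) (at x)"
    using x by (intro has_real_derivative_powr) auto
  have d2: "((\<lambda>x. (1 - x) powr ?d) has_real_derivative - ?d * (1 - x) powr (?d - 1)) (at x)"
  proof -
    have "((\<lambda>x. (1 - x) powr ?d) has_real_derivative ?d * (1 - x) powr (?d - 1) * (0 - 1)) (at x)"
      using x by (intro DERIV_chain2[OF has_real_derivative_powr] DERIV_diff DERIV_const DERIV_ident) auto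
    then show ?thesis by (rule DERIV_cong) (simp only: minus_mult_left[symmetric] mult_minus_right[symmetric], simp)
  qed
  have "((\<lambda>x. x * F2' A B C x) has_real_derivative ?g + x * ?h) (at x)"
    using DERIV_mult[OF DERIV_ident F2'_DERIV[OF C x]] by simp
  then have d3: "((\<lambda>x. x * F2' A B C x - \<beta> * F2 A B C x) has_real_derivative ?g + x * ?h - \<beta> * ?g) (at x)"
    using x by (intro DERIV_diff DERIV_cmult F2_DERIV C) auto
  have "(SL A B C \<beta> has_real_derivative
     ((?e * x powr (?e - 1)) * (1 - x) powr ?d + x powr ?e * (- ?d * (1 - x) powr (?d - 1))) * (x * ?g - \<beta> * ?f)
      + x powr ?e * (1 - x) powr ?d * (?g + x * ?h - \<beta> * ?g)) (at x)"
    unfolding SL_def[abs_def] by (rule DERIV_cong[OF DERIV_mult[OF DERIV_mult[OF d1 d2] d3]]) simp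
  moreover have hh: "x * (1 - x) * ?h = A * B * ?f - (C - (A + B + 1) * x) * ?g" using x by simp
  have "((?e * x powr (?e - 1)) * (1 - x) powr ?d + x powr ?e * (- ?d * (1 - x) powr (?d - 1))) * (x * ?g - \<beta> * ?f)
      + x powr ?e * (1 - x) powr ?d * (?g + x * ?h - \<beta> * ?g) =
     ?u * ?v * ((x * ((\<beta> + A) * (\<beta> + B)) - \<beta> * (\<beta> + C - 1)) * ?f)"
  proof -
    have "((?e * x powr (?e - 1)) * (1 - x) powr ?d + x powr ?e * (- ?d * (1 - x) powr (?d - 1))) * (x * ?g - \<beta> * ?f)
        + x powr ?e * (1 - x) powr ?d * (?g + x * ?h - \<beta> * ?g) =
       ?u * ?v * ((?e * (1 - x) - ?d * x) * (x * ?g - \<beta> * ?f) + x * (1 - x) * (1 - \<beta>) * ?g + x * (x * (1 - x) * ?h))"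
    proof -
      have "((e * u) * ((1 - x) * v) + (x * u) * (- d * v)) * (x * g - \<beta> * f)
          + (x * u) * ((1 - x) * v) * (g + x * h - \<beta> * g) =
        u * v * ((e * (1 - x) - d * x) * (x * g - \<beta> * f) + x * (1 - x) * (1 - \<beta>) * g + x * (x * (1 - x) * h))"
        for e d u v f g h by (simp add: algebra_simps)
      then show ?thesis unfolding pu pv .
    qed
    also have "(?e * (1 - x) - ?d * x) * (x * ?g - \<beta> * ?f) + x * (1 - x) * (1 - \<beta>) * ?g + x * (x * (1 - x) * ?h)
        = (x * ((\<beta> + A) * (\<beta> + B)) - \<beta> * (\<beta> + C - 1)) * ?f"
      unfolding hh by (simp add: algebra_simps)
    finally show ?thesis .
  qed
  ultimately show ?thesis by simp
qed

lemma SL_sgn: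
  assumes "0 < x" "x < 1"
  shows "sgn (SL A B C \<beta> x) = sgn (x * F2' A B C x - \<beta> * F2 A B C x)"
  using assms by (simp add: SL_def sgn_mult)

lemma powr_F2_DERIV:
  assumes C: "C > 0" and x: "0 < x" "x < 1"
  shows "((\<lambda>x. x powr (- \<beta>) * F2 A B C x) has_real_derivative
    x powr (- \<beta> - 1) * (x * F2' A B C x - \<beta> * F2 A B C x)) (at x)"
proof -
  have "x powr (- \<beta>) = x * x powr (- \<beta> - 1)" using x powr_add[of x 1 "-\<beta> - 1"] by simp
  then show ?thesis using x
    by (auto intro!: derivative_eq_intros F2_DERIV[OF C] simp: algebra_simps)
qed

lemma SL_tendsto_start:
  assumes C: "C > 0"
  shows "((\<lambda>x. x * F2' A B C x - \<beta> * F2 A B C x) \<longlongrightarrow> - \<beta>) (at_right 0)"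
proof -
  have "((\<lambda>x. x * F2' A B C x - \<beta> * F2 A B C x) \<longlongrightarrow> 0 * F2' A B C 0 - \<beta> * F2 A B C 0) (at 0)"
    using F2_isCont_0[OF C, of A B] F2'_isCont_0[OF C, of A B] unfolding isCont_def
    by (intro tendsto_intros)
  then show ?thesis by (auto intro: tendsto_mono[OF at_le])
qed

text \<open>Positivity is assumed only up to \<open>x0\<close>, because this lemma is a step in the
  proof of positivity itself. The function \<open>SL\<close> starts positive, since
  \<open>- l > 0\<close>, and is nondecreasing as long as \<open>F2\<close> stays positive.\<close>

lemma F2_pos_aux:
  assumes A: "0 < A" "A \<le> C - 1" and B: "B < 0"
  defines "l \<equiv> A * B / (C - A - B - 1)"
  assumes x0: "0 < x0" "x0 \<le> 1" and pos: "\<And>t. 0 < t \<Longrightarrow> t < x0 \<Longrightarrow> F2 A B C t > 0"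
    and x: "0 < x" "x < x0"
  shows "l * F2 A B C x \<le> x * F2' A B C x"
proof -
  have C: "C > 0" and d: "C - A - B - 1 > 0" using A B by auto
  have l: "l < 0" unfolding l_def using A B d by (simp add: divide_neg_pos mult_pos_neg)
  \<comment> \<open>This equation singles out l: it turns the linear factor in
    \<open>SL_DERIV\<close> into \<open>- (1 - y) * ((l + A) * (l + B))\<close>, which vanishes at
    1.\<close>
  have PQ: "l * (l + C - 1) = (l + A) * (l + B)"
    using d unfolding l_def by (simp add: field_simps)
  \<comment> \<open>The condition \<open>A \<le> C - 1\<close> enters exactly here.\<close>
  have "l + A = A * (C - 1 - A) / (C - A - B - 1)" using d unfolding l_def by (simp add: field_simps)
  then have lA: "l + A \<ge> 0" using A d by simp
  have K: "(l + A) * (l + B) \<le> 0" using lA l B by (intro mult_nonneg_nonpos) auto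
  have "eventually (\<lambda>t. t * F2' A B C t - l * F2 A B C t > 0) (at_right 0)"
    using order_tendstoD(1)[OF SL_tendsto_start[OF C, of A B l], of 0] l by simp
  then obtain e where e: "e > 0" "\<And>t. 0 < t \<Longrightarrow> t < e \<Longrightarrow> t * F2' A B C t - l * F2 A B C t > 0"
    unfolding eventually_at_right_field by auto
  define t where "t = min (e / 2) (x / 2)"
  have t: "0 < t" "t < e" "t < x" using e x by (auto simp: t_def min_def)
  have "SL A B C l t > 0" using e(2)[of t] t x x0 by (simp add: SL_def)
  also have "SL A B C l t \<le> SL A B C l x"
  proof (rule DERIV_nonneg_imp_nondecreasing[OF less_imp_le[OF t(3)]])
    fix y assume y: "t \<le> y" "y \<le> x"
    have "(y * ((l + A) * (l + B)) - l * (l + C - 1)) * F2 A B C y = - (1 - y) * ((l + A) * (l + B)) * F2 A B C y"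
      unfolding PQ by (simp add: algebra_simps)
    also have "\<dots> \<ge> 0"
      using K y t x x0 pos[of y] by (intro mult_nonneg_nonneg mult_nonpos_nonpos) auto
    finally show "\<exists>z. (SL A B C l has_real_derivative z) (at y) \<and> 0 \<le> z"
      using y t x x0 by - (intro exI conjI, rule SL_DERIV[OF C], auto)
  qed
  finally have "SL A B C l x > 0" .
  then have "sgn (x * F2' A B C x - l * F2 A B C x) = 1"
    using SL_sgn[of x A B C l] x x0 by simp
  then show ?thesis by (auto simp: sgn_if split: if_splits)
qed

text \<open>Consider the first zero \<open>x0\<close>. Before it \<open>F2\<close> is positive, so
  \<open>F2_pos_aux\<close> makes \<open>x powr (- l) * F2 A B C x\<close> nondecreasing, and a
  positive nondecreasing function cannot reach 0 at \<open>x0\<close>.\<close>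

lemma F2_pos_neg_param:
  assumes A: "0 < A" "A \<le> C - 1" and B: "B < 0" and x: "0 \<le> x" "x < 1"
  shows "F2 A B C x > 0"
proof (rule ccontr)
  assume "\<not> F2 A B C x > 0"
  have C: "C > 0" using A B by auto
  have cont: "continuous_on {0..x} (F2 A B C)"
    using x by (intro DERIV_continuous_on) (auto intro!: DERIV_subset[OF F2_DERIV[OF C]])
  let ?S = "{t \<in> {0..x}. F2 A B C t \<le> 0}"
  have "compact ?S"
  proof -
    have "closed ?S" using continuous_closed_preimage[OF cont closed_atLeastAtMost closed_atMost[of 0]]
      by (simp add: vimage_def Collect_conj_eq[symmetric] Int_def)
    moreover have "bounded ?S" by (rule bounded_subset[of "{0..x}"]) auto
    ultimately show ?thesis by (simp add: compact_eq_bounded_closed)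
  qed
  moreover have "?S \<noteq> {}" using \<open>\<not> F2 A B C x > 0\<close> x by auto
  ultimately have "\<exists>x0 \<in> ?S. \<forall>t \<in> ?S. x0 \<le> t" by (rule compact_attains_inf)
  then obtain x0 where x0: "x0 \<in> ?S" "\<forall>t \<in> ?S. x0 \<le> t" ..
  have "x0 \<noteq> 0" using x0(1) by auto
  then have x0': "0 < x0" "x0 \<le> x" "F2 A B C x0 \<le> 0" using x0(1) by auto
  have pos: "F2 A B C t > 0" if "0 < t" "t < x0" for t
    proof (rule ccontr)
    assume "\<not> F2 A B C t > 0"
    then have "t \<in> ?S" using that x0' by auto
    then show False using x0(2) that by (meson not_le)
  qed
  define l where "l = A * B / (C - A - B - 1)"
  \<comment> \<open>Starting at \<open>x0 / 2\<close> is arbitrary; it only keeps away from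
    0.\<close>
  have "(x0/2) powr (-l) * F2 A B C (x0/2) \<le> x0 powr (-l) * F2 A B C x0"
  proof (rule DERIV_nonneg_imp_increasing_open[of "x0/2" x0 "\<lambda>x. x powr (-l) * F2 A B C x"])
    fix y assume y: "x0 / 2 < y" "y < x0"
    have "l * F2 A B C y \<le> y * F2' A B C y"
      unfolding l_def using x0' x y pos by (intro F2_pos_aux[OF A B, of x0]) auto
    then show "\<exists>z. ((\<lambda>x. x powr (-l) * F2 A B C x) has_real_derivative z) (at y) \<and> 0 \<le> z"
      using y x0' x by - (intro exI conjI, rule powr_F2_DERIV[OF C], auto)
  next
    show "continuous_on {x0/2..x0} (\<lambda>x. x powr (-l) * F2 A B C x)"
      using x0' x by (intro continuous_intros continuous_on_subset[OF cont]) auto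
  qed (use x0' in auto)
  moreover have "(x0/2) powr (-l) * F2 A B C (x0/2) > 0" using pos[of "x0/2"] x0' by auto
  ultimately have "x0 powr (-l) * F2 A B C x0 > 0" by linarith
  then show False using x0' by (simp add: zero_less_mult_iff)
qed

lemma F2_pos:
  assumes "0 < A" "A \<le> C - 1" "0 \<le> x" "x < 1"
  shows "F2 A B C x > 0"
  using F2_pos_neg_param[of A C B x] F2_ge_1[of A B C x] assms by (cases "B < 0") force+

lemma F2_log_deriv_ge:
  assumes A: "0 < A" "A \<le> C - 1" and B: "B < 0" and x: "0 < x" "x < 1"
  shows "A * B / (C - A - B - 1) * F2 A B C x \<le> x * F2' A B C x"
  using F2_pos[OF A] x by (intro F2_pos_aux[OF A B, of 1]) auto

text \<open>A substitute for \<open>F2_log_deriv_ge\<close> when \<open>A > C - 1\<close>. With B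
  between -1 and 0 all higher coefficients have one sign, so both \<open>F2\<close> and
  \<open>x * F2'\<close> are bounded below by their values at 1, and there
  \<open>F2_1_deriv_ratio\<close> gives equality.\<close>

lemma F2_log_deriv_ge':
  assumes A: "0 < A" and B: "-1 < B" "B < 0" and C: "C > 0" and d: "C - A - B - 1 > 0"
    and pos: "F2 A B C 1 > 0" and x: "0 < x" "x < 1"
  shows "A * B / (C - A - B - 1) * F2 A B C x \<le> x * F2' A B C x"
proof -
  have l: "A * B / (C - A - B - 1) \<le> 0" using A B d by (simp add: divide_nonpos_pos mult_nonneg_nonpos)
  have "F2 A B C 1 \<le> F2 A B C x" using assms by (intro F2_ge_1_value) auto
  then have "A * B / (C - A - B - 1) * F2 A B C x \<le> A * B / (C - A - B - 1) * F2 A B C 1"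
    using l by (rule mult_left_mono_neg)
  also have "\<dots> = A * B / C * F2 (A+1) (B+1) (C+1) 1"
    using F2_1_deriv_ratio[OF C, of A B] d by simp
  also have "\<dots> \<le> A * B / C * (x * F2 (A+1) (B+1) (C+1) x)"
  proof (rule mult_left_mono_neg)
    have "F2 (A+1) (B+1) (C+1) x \<le> F2 (A+1) (B+1) (C+1) 1"
      using assms by (intro F2_le_1_value) auto
    moreover have "F2 (A+1) (B+1) (C+1) x \<ge> 1" using assms by (intro F2_ge_1) auto
    then have "x * F2 (A+1) (B+1) (C+1) x \<le> F2 (A+1) (B+1) (C+1) x" using x by simp
    ultimately show "x * F2 (A+1) (B+1) (C+1) x \<le> F2 (A+1) (B+1) (C+1) 1" by linarith
    show "A * B / C \<le> 0" using A B C by (simp add: divide_nonpos_pos mult_nonneg_nonpos)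
  qed
  finally show ?thesis by (simp add: F2'_def mult_ac)
qed

text \<open>The argument of \<open>F2_pos_aux\<close> with signs reversed: for B positive also l is
  positive, so \<open>SL\<close> starts negative and decreases. Positivity of \<open>F2\<close> is
  immediate from its coefficients.\<close>

lemma F2_log_deriv_le:
  assumes A: "0 < A" and B: "B \<ge> 0" and C: "C > 0" and d: "C - A - B - 1 > 0" and x: "0 < x" "x < 1"
  shows "x * F2' A B C x \<le> A * B / (C - A - B - 1) * F2 A B C x"
proof (cases "B = 0")
  case True
  then show ?thesis by (simp add: F2'_def)
next
  case False
  define l where "l = A * B / (C - A - B - 1)"
  have l: "l > 0" unfolding l_def using A B False d by simp
  have PQ: "l * (l + C - 1) = (l + A) * (l + B)"
    using d unfolding l_def by (simp add: field_simps)
  have K: "(l + A) * (l + B) \<ge> 0" using l A B by simp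
  have "eventually (\<lambda>t. t * F2' A B C t - l * F2 A B C t < 0) (at_right 0)"
    using order_tendstoD(2)[OF SL_tendsto_start[OF C, of A B l], of 0] l by simp
  then obtain e where e: "e > 0" "\<And>t. 0 < t \<Longrightarrow> t < e \<Longrightarrow> t * F2' A B C t - l * F2 A B C t < 0"
    unfolding eventually_at_right_field by auto
  define t where "t = min (e / 2) (x / 2)"
  have t: "0 < t" "t < e" "t < x" using e x by (auto simp: t_def min_def)
  have "SL A B C l x \<le> SL A B C l t"
  proof (rule DERIV_nonpos_imp_nonincreasing[OF less_imp_le[OF t(3)]])
    fix y assume y: "t \<le> y" "y \<le> x"
    have "(y * ((l + A) * (l + B)) - l * (l + C - 1)) * F2 A B C y = - ((1 - y) * ((l + A) * (l + B)) * F2 A B C y)"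
      unfolding PQ by (simp add: algebra_simps)
    also have "\<dots> \<le> 0"
      using K y t x F2_ge_1[of A B C y] A B C by (auto intro!: mult_nonneg_nonneg)
    finally show "\<exists>z. (SL A B C l has_real_derivative z) (at y) \<and> z \<le> 0"
      using y t x by - (intro exI conjI, rule SL_DERIV[OF C], auto intro!: mult_nonneg_nonpos)
  qed
  also have "SL A B C l t < 0" using e(2)[of t] t x by (auto simp: SL_def intro!: mult_pos_neg)
  finally have "sgn (x * F2' A B C x - l * F2 A B C x) = -1"
    using SL_sgn[of x A B C l] x by simp
  then show ?thesis unfolding l_def by (auto simp: sgn_if split: if_splits)
qed

text \<open>Integrate the bound on the logarithmic derivative from x to 1. It will be applied at
  \<open>x = 1 / \<rho>\<close>, outside the sphere.\<close>

lemma F2_le_powr: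
  assumes C: "C > 0" and d: "C - A - B > 0"
    and ge: "\<And>t. 0 < t \<Longrightarrow> t < 1 \<Longrightarrow> l * F2 A B C t \<le> t * F2' A B C t"
    and pos: "F2 A B C 1 \<ge> 0" and y: "y \<le> l" and x: "0 < x" "x \<le> 1"
  shows "F2 A B C x \<le> F2 A B C 1 * x powr y"
proof -
  have "x powr (-l) * F2 A B C x \<le> 1 powr (-l) * F2 A B C 1"
  proof (rule DERIV_nonneg_imp_increasing_open[of x 1 "\<lambda>x. x powr (-l) * F2 A B C x"])
    fix t assume t: "x < t" "t < 1"
    then show "\<exists>z. ((\<lambda>x. x powr (-l) * F2 A B C x) has_real_derivative z) (at t) \<and> 0 \<le> z"
      using x ge[of t] by - (intro exI conjI, rule powr_F2_DERIV[OF C], auto)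
  next
    show "continuous_on {x..1} (\<lambda>x. x powr (-l) * F2 A B C x)"
      using x by (intro continuous_intros continuous_on_subset[OF F2_continuous_on[OF C d]]) auto
  qed (use x in auto)
  then have "x powr l * (x powr (-l) * F2 A B C x) \<le> x powr l * F2 A B C 1"
    by (intro mult_left_mono) auto
  then have "F2 A B C x \<le> F2 A B C 1 * x powr l" using x
    by (simp add: powr_minus mult_ac) (simp add: field_simps)
  also have "\<dots> \<le> F2 A B C 1 * x powr y"
    using pos x y by (intro mult_left_mono powr_mono') auto
  finally show ?thesis .
qed

lemma F2_pos_1:
  assumes "C > 0" "C - A > 0" "C - B > 0" "C - A - B > 0"
  shows "F2 A B C 1 > 0"
proof -
  have "rGamma (z::real) > 0" if "z > 0" for z
    using Gamma_real_pos[OF that] by (simp add: rGamma_inverse_Gamma)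
  then show ?thesis using assms by (simp add: gauss_sum)
qed

text \<open>For \<open>\<beta> = \<alpha> / 2 - 1\<close> and the inner parameters, this difference
  is a positive multiple of the derivative of the total potential inside the sphere. For
  \<open>B \<ge> 0\<close> or \<open>\<beta> \<ge> 0\<close> it is nonpositive throughout. In the
  remaining case one sign change is possible and is traced back through two antiderivatives to a
  linear function.\<close>

lemma F2_pattern:
  assumes A: "0 < A" "A \<le> C - 1" and d: "C - A - B - 1 > 0"
    and b: "A * B / (C - A - B - 1) \<le> \<beta>"
  shows "pos_then_neg (\<lambda>x. F2 A B C 1 * x powr \<beta> - F2 A B C x)"
proof -
  have C: "C > 0" and d': "C - A - B > 0" using A d by auto
  have p1: "F2 A B C 1 > 0" using A d by (intro F2_pos_1) auto
  let ?l = "A * B / (C - A - B - 1)"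
  consider (i) "B \<ge> 0" | (ii) "B < 0" "\<beta> \<ge> 0" | (iii) "B < 0" "\<beta> < 0" by linarith
  then show ?thesis
  proof cases
    case i
    have "F2 A B C 1 * x powr \<beta> - F2 A B C x \<le> 0" if x: "0 < x" "x < 1" for x
    proof -
      have "1 powr (-?l) * F2 A B C 1 \<le> x powr (-?l) * F2 A B C x"
      proof (rule DERIV_nonpos_imp_decreasing_open[of x 1 "\<lambda>x. x powr (-?l) * F2 A B C x"])
        fix t assume t: "x < t" "t < 1"
        then show "\<exists>z. ((\<lambda>x. x powr (-?l) * F2 A B C x) has_real_derivative z) (at t) \<and> z \<le> 0"
          using x F2_log_deriv_le[OF A(1) i C d, of t]
          by - (intro exI conjI, rule powr_F2_DERIV[OF C], auto intro!: mult_nonneg_nonpos)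
      next
        show "continuous_on {x..1} (\<lambda>x. x powr (-?l) * F2 A B C x)"
          using x by (intro continuous_intros continuous_on_subset[OF F2_continuous_on[OF C d']]) auto
      qed (use x in auto)
      then have "x powr ?l * F2 A B C 1 \<le> x powr ?l * (x powr (-?l) * F2 A B C x)"
        by (intro mult_left_mono) auto
      also have "\<dots> = F2 A B C x" using x by (simp add: powr_minus)
      finally have "F2 A B C 1 * x powr ?l \<le> F2 A B C x" by (simp add: mult.commute)
      moreover have "F2 A B C 1 * x powr \<beta> \<le> F2 A B C 1 * x powr ?l"
        using p1 x b by (intro mult_left_mono powr_mono') auto
      ultimately show ?thesis by linarith
    qed
    then show ?thesis by (intro pos_then_negI) auto
  next
    case ii
    have "F2 A B C 1 * x powr \<beta> - F2 A B C x \<le> 0" if x: "0 < x" "x < 1" for x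
    proof -
      have "F2 A B C 1 \<le> F2 A B C x"
      proof (rule DERIV_nonpos_imp_decreasing_open[of x 1 "F2 A B C"])
        fix t assume t: "x < t" "t < 1"
        have "F2 (A+1) (B+1) (C+1) t > 0" using A t x by (intro F2_pos) auto
        then have "F2' A B C t \<le> 0" unfolding F2'_def using A C ii
          by (intro mult_nonpos_nonneg) (auto simp: divide_nonpos_pos mult_nonneg_nonpos)
        then show "\<exists>z. (F2 A B C has_real_derivative z) (at t) \<and> z \<le> 0"
          using x t by - (intro exI conjI, rule F2_DERIV[OF C], auto)
      next
        show "continuous_on {x..1} (F2 A B C)"
          using x by (intro continuous_on_subset[OF F2_continuous_on[OF C d']]) auto
      qed (use x in auto)
      moreover have "x powr \<beta> \<le> 1" using x ii by (intro powr_le1) auto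
      then have "F2 A B C 1 * x powr \<beta> \<le> F2 A B C 1" using p1 by (simp add: mult_left_le)
      ultimately show ?thesis by linarith
    qed
    then show ?thesis by (intro pos_then_negI) auto
  next
    case iii
    have "?l + A = A * (C - 1 - A) / (C - A - B - 1)" using d by (simp add: field_simps)
    then have "?l + A \<ge> 0" using A d by simp
    \<comment> \<open>From \<open>\<beta> \<ge> l\<close> and \<open>l + A \<ge> 0\<close> the first
      factor is nonnegative; the second is a sum of two negative numbers. Hence the linear factor of
      the derivative of \<open>SL\<close> has nonpositive slope.\<close>
    then have Q: "(\<beta> + A) * (\<beta> + B) \<le> 0" using b iii by (intro mult_nonneg_nonpos) auto
    have "pos_then_neg (\<lambda>x. x * ((\<beta> + A) * (\<beta> + B)) - \<beta> * (\<beta> + C - 1))"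
    proof (rule pos_then_negI)
      fix x y :: real assume *: "0 < x" "x < y" "x * ((\<beta> + A) * (\<beta> + B)) - \<beta> * (\<beta> + C - 1) < 0"
      have "y * ((\<beta> + A) * (\<beta> + B)) \<le> x * ((\<beta> + A) * (\<beta> + B))"
        using Q * by (intro mult_right_mono_neg) auto
      then show "y * ((\<beta> + A) * (\<beta> + B)) - \<beta> * (\<beta> + C - 1) \<le> 0" using * by linarith
    qed
    then have "pos_then_neg (\<lambda>x. x powr (\<beta> + C - 2) * (1 - x) powr (A + B - C) *
      ((x * ((\<beta> + A) * (\<beta> + B)) - \<beta> * (\<beta> + C - 1)) * F2 A B C x))"
      by (rule pos_then_neg_cong_sgn) (use F2_pos[OF A] in \<open>simp add: sgn_mult\<close>)
    note SL' = this
    have "pos_then_neg (SL A B C \<beta>)"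
    proof (rule pos_then_neg_antideriv[OF SL_DERIV[OF C] SL'])
      fix x :: real assume x: "0 < x" "x < 1" and neg: "SL A B C \<beta> x < 0"
      \<comment> \<open>The limit at 0 is \<open>- \<beta> > 0\<close>, so \<open>SL\<close> is
        positive near 0 and any negative value of it has been reached by falling.\<close>
      have "eventually (\<lambda>t. t * F2' A B C t - \<beta> * F2 A B C t > 0) (at_right 0)"
        using order_tendstoD(1)[OF SL_tendsto_start[OF C, of A B \<beta>], of 0] iii by simp
      then obtain e where e: "e > 0" "\<And>t. 0 < t \<Longrightarrow> t < e \<Longrightarrow> t * F2' A B C t - \<beta> * F2 A B C t > 0"
        unfolding eventually_at_right_field by auto
      define t where "t = min (e / 2) (x / 2)"
      have t: "0 < t" "t < e" "t < x" using e x by (auto simp: t_def min_def)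
      have "SL A B C \<beta> t > 0" using e(2)[of t] t x by (simp add: SL_def)
      then show "\<exists>t. 0 < t \<and> t < x \<and> SL A B C \<beta> x < SL A B C \<beta> t" using neg t by (intro exI[of _ t]) auto
    qed
    then have "pos_then_neg (\<lambda>x. x powr (- \<beta> - 1) * (x * F2' A B C x - \<beta> * F2 A B C x))"
      by (rule pos_then_neg_cong_sgn) (simp add: SL_sgn sgn_mult)
    then have "pos_then_neg (\<lambda>x. 1 powr (-\<beta>) * F2 A B C 1 - x powr (-\<beta>) * F2 A B C x)"
      by (rule pos_then_neg_minus_end[OF powr_F2_DERIV[OF C], rotated 3])
        (auto intro!: continuous_intros continuous_on_subset[OF F2_continuous_on[OF C d']])
    then show ?thesis
    proof (rule pos_then_neg_cong_sgn)
      fix x :: real assume x: "0 < x" "x < 1"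
      have "F2 A B C 1 * x powr \<beta> - F2 A B C x = x powr \<beta> * (1 powr (-\<beta>) * F2 A B C 1 - x powr (-\<beta>) * F2 A B C x)"
        using x by (simp add: powr_minus field_simps)
      then show "sgn (F2 A B C 1 * x powr \<beta> - F2 A B C x) = sgn (1 powr (-\<beta>) * F2 A B C 1 - x powr (-\<beta>) * F2 A B C x)"
        using x by (simp add: sgn_mult)
    qed
  qed
qed

section \<open>A quadratic transformation\<close>

lemma sums_shift:
  fixes t :: "nat \<Rightarrow> real"
  assumes "(\<lambda>n. t n * x ^ n) sums S"
  shows "(\<lambda>n. (case n of 0 \<Rightarrow> 0 | Suc m \<Rightarrow> t m) * x ^ n) sums (x * S)"
proof -
  have "(\<lambda>n. x * (t n * x ^ n)) sums (x * S)" by (rule sums_mult[OF assms])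
  then have "(\<lambda>n. (case Suc n of 0 \<Rightarrow> 0 | Suc m \<Rightarrow> t m) * x ^ Suc n) sums (x * S)" by (simp add: mult_ac)
  then show ?thesis by (subst (asm) sums_Suc_iff) simp
qed

text \<open>Dividing out the common part P turns each contiguous relation below into a polynomial
  identity in n, with the term of index 0 checked separately.\<close>

lemma hyp_coeff_common_factor:
  fixes A B C :: real
  assumes C: "C > 0"
  obtains P where "\<And>n. hyp_coeff A B C (Suc n) = A * B * P n"
    and "\<And>n. hyp_coeff (A+1) B C (Suc n) = (A + 1 + real n) * B * P n"
    and "\<And>n. hyp_coeff (A+1) (B+1) C (Suc n) = (A + 1 + real n) * (B + 1 + real n) * P n"
    and "\<And>n. hyp_coeff (A+1) (B+1) C n = (C + real n) * (real n + 1) * P n"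
    and "\<And>n. hyp_coeff (A+1) (B+1) (C+1) n = C * (real n + 1) * P n"
proof (rule that)
  let ?P = "\<lambda>n. pochhammer (A+1) n * pochhammer (B+1) n / (pochhammer C (Suc n) * fact (Suc n))"
  fix n
  have nz: "pochhammer C n \<noteq> 0" "C + real n \<noteq> 0" "pochhammer (C+1) n \<noteq> 0"
    using C pochhammer_pos[of C n] pochhammer_pos[of "C+1" n] by auto
  have n1: "real n + 1 = real (Suc n)" by simp
  show "hyp_coeff A B C (Suc n) = A * B * ?P n"
    by (simp add: hyp_coeff_def pochhammer_rec[of A n] pochhammer_rec[of B n] mult_ac)
  show "hyp_coeff (A+1) B C (Suc n) = (A + 1 + real n) * B * ?P n"
    by (simp add: hyp_coeff_def pochhammer_Suc[of "A+1" n] pochhammer_rec[of B n] mult_ac)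
  show "hyp_coeff (A+1) (B+1) C (Suc n) = (A + 1 + real n) * (B + 1 + real n) * ?P n"
    by (simp add: hyp_coeff_def pochhammer_Suc[of "A+1" n] pochhammer_Suc[of "B+1" n] mult_ac)
  show "hyp_coeff (A+1) (B+1) C n = (C + real n) * (real n + 1) * ?P n"
    using nz unfolding n1
    by (simp add: hyp_coeff_def pochhammer_Suc[of C n] fact_Suc[where 'a=real] mult_ac del: of_nat_Suc)
  show "hyp_coeff (A+1) (B+1) (C+1) n = C * (real n + 1) * ?P n"
    using nz C unfolding n1
    by (simp add: hyp_coeff_def pochhammer_rec[of C n] fact_Suc[where 'a=real] mult_ac del: of_nat_Suc)
qed

text \<open>Classically, \<open>x d/dx + A\<close> raises A. Here A is divided out, so the relation
  keeps its content for \<open>A = a / 2 = 0\<close>, the logarithmic case.\<close>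

lemma F2_contiguous_up:
  assumes C: "C > 0" and x: "\<bar>x\<bar> < 1"
  shows "F2 (A+1) B C x - F2 A B C x = x * (B / C * F2 (A+1) (B+1) (C+1) x)"
proof -
  obtain P where P: "\<And>n. hyp_coeff A B C (Suc n) = A * B * P n"
    "\<And>n. hyp_coeff (A+1) B C (Suc n) = (A + 1 + real n) * B * P n"
    "\<And>n. hyp_coeff (A+1) (B+1) C (Suc n) = (A + 1 + real n) * (B + 1 + real n) * P n"
    "\<And>n. hyp_coeff (A+1) (B+1) C n = (C + real n) * (real n + 1) * P n"
    "\<And>n. hyp_coeff (A+1) (B+1) (C+1) n = C * (real n + 1) * P n"
    using hyp_coeff_common_factor[OF C] by metis
  have "(\<lambda>n. hyp_coeff (A+1) B C n * x ^ n - hyp_coeff A B C n * x ^ n) sums (F2 (A+1) B C x - F2 A B C x)"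
    by (intro sums_diff F2_sums C x)
  moreover have "(\<lambda>n. (B / C * hyp_coeff (A+1) (B+1) (C+1) n) * x ^ n) sums (B / C * F2 (A+1) (B+1) (C+1) x)"
    using sums_mult[OF F2_sums[of "C+1" x "A+1" "B+1"], of "B/C"] C x by (simp add: mult_ac)
  note sums_shift[OF this]
  moreover have "hyp_coeff (A+1) B C n * x ^ n - hyp_coeff A B C n * x ^ n =
      (case n of 0 \<Rightarrow> 0 | Suc m \<Rightarrow> B / C * hyp_coeff (A+1) (B+1) (C+1) m) * x ^ n" for n
  proof (cases n)
    case (Suc m)
    have e: "B / C * (C * (real m + 1) * P m) = B * (real m + 1) * P m" using C by simp
    show ?thesis unfolding Suc nat.case P(1)[of m] P(2)[of m] P(3)[of m] P(4)[of m] P(5)[of m] e by (simp add: algebra_simps)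
  qed simp
  ultimately show ?thesis using sums_unique2 by fastforce
qed

text \<open>Inside the sphere this merges the two terms of \<open>u0_DERIV\<close> into a single
  hypergeometric function, with a factor x that cancels the denominator.\<close>

lemma F2_contiguous_diff:
  assumes C: "C > 0" and x: "\<bar>x\<bar> < 1"
  shows "F2 A B C x - (1 - x) * F2 (A+1) (B+1) C x = x * ((C - A - B - 1) / C * F2 (A+1) (B+1) (C+1) x)"
proof -
  obtain P where P: "\<And>n. hyp_coeff A B C (Suc n) = A * B * P n"
    "\<And>n. hyp_coeff (A+1) B C (Suc n) = (A + 1 + real n) * B * P n"
    "\<And>n. hyp_coeff (A+1) (B+1) C (Suc n) = (A + 1 + real n) * (B + 1 + real n) * P n"
    "\<And>n. hyp_coeff (A+1) (B+1) C n = (C + real n) * (real n + 1) * P n"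
    "\<And>n. hyp_coeff (A+1) (B+1) (C+1) n = C * (real n + 1) * P n"
    using hyp_coeff_common_factor[OF C] by metis
  have "(\<lambda>n. hyp_coeff A B C n * x ^ n - hyp_coeff (A+1) (B+1) C n * x ^ n
      + (case n of 0 \<Rightarrow> 0 | Suc m \<Rightarrow> hyp_coeff (A+1) (B+1) C m) * x ^ n)
      sums (F2 A B C x - F2 (A+1) (B+1) C x + x * F2 (A+1) (B+1) C x)"
    by (intro sums_diff sums_add sums_shift F2_sums C x)
  moreover have "(\<lambda>n. ((C - A - B - 1) / C * hyp_coeff (A+1) (B+1) (C+1) n) * x ^ n)
      sums ((C - A - B - 1) / C * F2 (A+1) (B+1) (C+1) x)"
    using sums_mult[OF F2_sums[of "C+1" x "A+1" "B+1"], of "(C - A - B - 1) / C"] C x by (simp add: mult_ac)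
  note sums_shift[OF this]
  moreover have "hyp_coeff A B C n * x ^ n - hyp_coeff (A+1) (B+1) C n * x ^ n
      + (case n of 0 \<Rightarrow> 0 | Suc m \<Rightarrow> hyp_coeff (A+1) (B+1) C m) * x ^ n =
      (case n of 0 \<Rightarrow> 0 | Suc m \<Rightarrow> (C - A - B - 1) / C * hyp_coeff (A+1) (B+1) (C+1) m) * x ^ n" for n
  proof (cases n)
    case (Suc m)
    have e: "(C - A - B - 1) / C * (C * (real m + 1) * P m) = (C - A - B - 1) * (real m + 1) * P m"
      using C by simp
    show ?thesis unfolding Suc nat.case P(1)[of m] P(2)[of m] P(3)[of m] P(4)[of m] P(5)[of m] e by (simp add: algebra_simps)
  qed simp
  ultimately have "F2 A B C x - F2 (A+1) (B+1) C x + x * F2 (A+1) (B+1) C x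
    = x * ((C - A - B - 1) / C * F2 (A+1) (B+1) (C+1) x)"
    using sums_unique2 by fastforce
  then show ?thesis by (simp add: algebra_simps)
qed

text \<open>The counterpart outside the sphere. The constraint on B is the one produced by the
  quadratic transformation, and only under it does the sum collapse to one function.\<close>

lemma F2_contiguous_sum:
  assumes C: "C > 0" and x: "\<bar>x\<bar> < 1" and B: "B = A + 1 - C"
  shows "F2 A B C x + (1 - x) * F2 (A+1) (B+1) C x = 2 * F2 (A+1) B C x"
proof -
  obtain P where P: "\<And>n. hyp_coeff A B C (Suc n) = A * B * P n"
    "\<And>n. hyp_coeff (A+1) B C (Suc n) = (A + 1 + real n) * B * P n"
    "\<And>n. hyp_coeff (A+1) (B+1) C (Suc n) = (A + 1 + real n) * (B + 1 + real n) * P n"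
    "\<And>n. hyp_coeff (A+1) (B+1) C n = (C + real n) * (real n + 1) * P n"
    "\<And>n. hyp_coeff (A+1) (B+1) (C+1) n = C * (real n + 1) * P n"
    using hyp_coeff_common_factor[OF C] by metis
  have "(\<lambda>n. hyp_coeff A B C n * x ^ n + (hyp_coeff (A+1) (B+1) C n * x ^ n
      - (case n of 0 \<Rightarrow> 0 | Suc m \<Rightarrow> hyp_coeff (A+1) (B+1) C m) * x ^ n))
      sums (F2 A B C x + (F2 (A+1) (B+1) C x - x * F2 (A+1) (B+1) C x))"
    by (intro sums_diff sums_add sums_shift F2_sums C x)
  moreover have "(\<lambda>n. 2 * (hyp_coeff (A+1) B C n * x ^ n)) sums (2 * F2 (A+1) B C x)"
    by (intro sums_mult F2_sums C x)
  moreover have "hyp_coeff A B C n * x ^ n + (hyp_coeff (A+1) (B+1) C n * x ^ n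
      - (case n of 0 \<Rightarrow> 0 | Suc m \<Rightarrow> hyp_coeff (A+1) (B+1) C m) * x ^ n) = 2 * (hyp_coeff (A+1) B C n * x ^ n)" for n
  proof (cases n)
    case (Suc m)
    have e: "A * B * p + ((A + 1 + k) * (B + 1 + k) * p - (C + k) * (k + 1) * p) = 2 * ((A + 1 + k) * B * p)" for k p
      unfolding B by (simp add: algebra_simps)
    from arg_cong[OF e[of "P m" "real m"], of "\<lambda>t. t * x ^ Suc m"]
    show ?thesis unfolding Suc nat.case P(1)[of m] P(2)[of m] P(3)[of m] P(4)[of m] P(5)[of m] by (simp only: algebra_simps)
  qed simp
  ultimately have "F2 A B C x + (F2 (A+1) (B+1) C x - x * F2 (A+1) (B+1) C x) = 2 * F2 (A+1) B C x"
    using sums_unique2 by fastforce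
  then show ?thesis by (simp add: algebra_simps)
qed

text \<open>
  The expectation of \<open>(1 + \<rho> - 2 * sqrt \<rho> * \<xi>) powr (-p)\<close>, where \<open>\<xi>\<close> is a coordinate of a uniform
  point of the unit sphere in dimension \<open>2 * c\<close>; see \<open>sphere_potential\<close> below.
\<close>

definition Wf :: "real \<Rightarrow> real \<Rightarrow> real \<Rightarrow> real" where
  "Wf p c \<rho> = (1 + \<rho>) powr (- p) * F2 (p / 2) ((p + 1) / 2) c (4 * \<rho> / (1 + \<rho>)\<^sup>2)"

lemma mobius_lt_1:
  assumes "0 \<le> \<rho>" "\<rho> \<noteq> (1::real)"
  shows "\<bar>4 * \<rho> / (1 + \<rho>)\<^sup>2\<bar> < 1"
proof -
  have "(1 - \<rho>)\<^sup>2 > 0" using assms by simp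
  then have "4 * \<rho> < (1 + \<rho>)\<^sup>2" by (simp add: power2_eq_square algebra_simps)
  then show ?thesis using assms by (auto simp: abs_div_pos)
qed

lemma mobius_le_1:
  assumes "0 \<le> (\<rho>::real)"
  shows "4 * \<rho> / (1 + \<rho>)\<^sup>2 \<in> {0..1}"
  using mobius_lt_1[of \<rho>] assms by (cases "\<rho> = 1") (auto simp: power2_eq_square)

lemma mobius_DERIV:
  assumes "0 \<le> \<rho>"
  shows "((\<lambda>\<rho>. 4 * \<rho> / (1 + \<rho>)\<^sup>2) has_real_derivative 4 * (1 - \<rho>) / (1 + \<rho>) ^ 3) (at \<rho>)"
proof -
  have "(1 + \<rho>) ^ 4 \<noteq> 0" "1 + \<rho> \<noteq> 0" using assms by auto
  then show ?thesis
    by (auto intro!: derivative_eq_intros simp: divide_simps) (simp add: algebra_simps eval_nat_numeral)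
qed

text \<open>The argument \<open>4 * \<rho> / (1 + \<rho>)\<^sup>2\<close> is invariant under
  inversion. This carries formulas from inside the sphere to the outside.\<close>

lemma Wf_inverse:
  assumes "\<rho> > 0"
  shows "Wf p c \<rho> = \<rho> powr (- p) * Wf p c (1 / \<rho>)"
proof -
  have "4 * (1 / \<rho>) / (1 + 1 / \<rho>)\<^sup>2 = 4 * \<rho> / (1 + \<rho>)\<^sup>2"
    using assms by (simp add: field_simps power2_eq_square)
  moreover have "\<rho> powr (- p) * (1 + 1 / \<rho>) powr (- p) = (1 + \<rho>) powr (- p)"
  proof -
    have "\<rho> * (1 + 1 / \<rho>) = 1 + \<rho>" using assms by (simp add: field_simps)
    then show ?thesis using assms powr_mult[of \<rho> "1 + 1 / \<rho>" "-p"] by simp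
  qed
  ultimately show ?thesis unfolding Wf_def by (simp add: mult.assoc[symmetric])
qed

text \<open>Allows division by \<open>Wf\<close> in the uniqueness argument of
  \<open>Wf_eq_F2\<close>. For negative p the series decreases to its value at 1, which is positive
  by Gauss's theorem.\<close>

lemma Wf_pos:
  assumes p: "-1 < p" and c: "c - p - 1/2 > 0" "c > 1/2" and r: "0 \<le> \<rho>" "\<rho> \<noteq> 1"
  shows "Wf p c \<rho> > 0"
proof -
  let ?z = "4 * \<rho> / (1 + \<rho>)\<^sup>2"
  have z: "0 \<le> ?z" "?z < 1" using mobius_lt_1[OF r] r by auto
  have "F2 (p / 2) ((p + 1) / 2) c ?z > 0"
  proof (cases "p \<ge> 0")
    case True
    then show ?thesis using F2_ge_1[of "p/2" "(p+1)/2" c ?z] z c by simp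
  next
    case False
    have "0 < F2 ((p + 1) / 2) (p / 2) c 1"
      using p c False by (intro F2_pos_1) (auto simp: field_simps)
    also have "\<dots> \<le> F2 ((p + 1) / 2) (p / 2) c ?z"
      using p c False z by (intro F2_ge_1_value) (auto simp: field_simps)
    finally show ?thesis by (simp add: F2_symmetric)
  qed
  then show ?thesis using r unfolding Wf_def by simp
qed

definition Wf' :: "real \<Rightarrow> real \<Rightarrow> real \<Rightarrow> real" where
  "Wf' p c \<rho> = (1 + \<rho>) powr (- p) * (- p * F2 (p / 2) ((p + 1) / 2) c (4 * \<rho> / (1 + \<rho>)\<^sup>2) / (1 + \<rho>)
     + 4 * (1 - \<rho>) / (1 + \<rho>) ^ 3 * F2' (p / 2) ((p + 1) / 2) c (4 * \<rho> / (1 + \<rho>)\<^sup>2))"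

lemma powr_one_plus_DERIV:
  assumes "0 \<le> \<rho>"
  shows "((\<lambda>\<rho>. (1 + \<rho>) powr (- p)) has_real_derivative - p * ((1 + \<rho>) powr (- p) / (1 + \<rho>))) (at \<rho>)"
proof -
  have "(1 + \<rho>) powr (- p - 1) = (1 + \<rho>) powr (- p) / (1 + \<rho>)"
    using assms powr_diff[of "1 + \<rho>" "-p" 1] by simp
  then show ?thesis using assms by (auto intro!: derivative_eq_intros)
qed

lemma Wf_DERIV:
  assumes c: "c > 0" and r: "0 \<le> \<rho>" "\<rho> \<noteq> 1"
  shows "(Wf p c has_real_derivative Wf' p c \<rho>) (at \<rho>)"
proof -
  have "((\<lambda>\<rho>. F2 (p / 2) ((p + 1) / 2) c (4 * \<rho> / (1 + \<rho>)\<^sup>2)) has_real_derivative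
      F2' (p / 2) ((p + 1) / 2) c (4 * \<rho> / (1 + \<rho>)\<^sup>2) * (4 * (1 - \<rho>) / (1 + \<rho>) ^ 3)) (at \<rho>)"
    by (rule DERIV_chain2[OF F2_DERIV[OF c mobius_lt_1[OF r]] mobius_DERIV[OF r(1)]])
  from DERIV_mult[OF powr_one_plus_DERIV[OF r(1), of p] this]
  show ?thesis unfolding Wf_def[abs_def] Wf'_def
    by (rule DERIV_cong) (simp add: algebra_simps)
qed

text \<open>The rational identity behind \<open>Wf'_DERIV\<close>, with X and Y in place of the
  value and derivative of \<open>F2\<close>: pulling back the equation with parameters
  \<open>p / 2\<close>, \<open>(p + 1) / 2\<close>, c along the quadratic map gives the one with
  parameters p, \<open>p + 1 - c\<close>, c.\<close>

lemma Wf_ode_algebra: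
  fixes r p c X Y :: real
  assumes "0 < r" "r < 1"
  shows "p * X / (1 + r)\<^sup>2 - p * (4 * (1 - r) / (1 + r) ^ 3) * Y / (1 + r) + (8 * r - 16) / (1 + r) ^ 4 * Y
      + 4 / (r * (1 + r)\<^sup>2) * (p / 2 * ((p + 1) / 2) * X - (c - (p + 3 / 2) * (4 * r / (1 + r)\<^sup>2)) * Y)
      - p * (- p * X / (1 + r) + 4 * (1 - r) / (1 + r) ^ 3 * Y) / (1 + r) =
    (p * (p + 1 - c) * X - (c - (p + (p + 1 - c) + 1) * r) * (- p * X / (1 + r) + 4 * (1 - r) / (1 + r) ^ 3 * Y))
      / (r * (1 - r))"
proof -
  have nz: "1 + r \<noteq> 0" "r \<noteq> 0" "1 - r \<noteq> 0" using assms by auto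
  show ?thesis using nz
    apply (simp add: divide_simps)
    apply algebra
    done
qed

lemma Wf'_DERIV:
  assumes c: "c > 0" and r: "0 < \<rho>" "\<rho> < 1"
  shows "(Wf' p c has_real_derivative
    (p * (p + 1 - c) * Wf p c \<rho> - (c - (p + (p + 1 - c) + 1) * \<rho>) * Wf' p c \<rho>) / (\<rho> * (1 - \<rho>))) (at \<rho>)"
proof -
  define z where "z = 4 * \<rho> / (1 + \<rho>)\<^sup>2"
  define X where "X = F2 (p / 2) ((p + 1) / 2) c z"
  define Y where "Y = F2' (p / 2) ((p + 1) / 2) c z"
  define E where "E = (1 + \<rho>) powr (- p)"
  define S where "S = - p * X / (1 + \<rho>) + 4 * (1 - \<rho>) / (1 + \<rho>) ^ 3 * Y"
  let ?zd = "4 * (1 - \<rho>) / (1 + \<rho>) ^ 3"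
  let ?Yd = "(p / 2 * ((p + 1) / 2) * X - (c - (p / 2 + (p + 1) / 2 + 1) * z) * Y) / (z * (1 - z))"
  have nz: "1 + \<rho> \<noteq> 0" using r by auto
  have z: "0 < z" "z < 1" using mobius_lt_1[of \<rho>] r by (auto simp: z_def)
  have zd: "((\<lambda>\<rho>. 4 * \<rho> / (1 + \<rho>)\<^sup>2) has_real_derivative ?zd) (at \<rho>)"
    using r by (intro mobius_DERIV) auto
  have Xd: "((\<lambda>\<rho>. F2 (p / 2) ((p + 1) / 2) c (4 * \<rho> / (1 + \<rho>)\<^sup>2)) has_real_derivative Y * ?zd) (at \<rho>)"
    unfolding Y_def z_def using z by (intro DERIV_chain2[OF F2_DERIV[OF c] zd]) (auto simp: z_def)
  have Yd: "((\<lambda>\<rho>. F2' (p / 2) ((p + 1) / 2) c (4 * \<rho> / (1 + \<rho>)\<^sup>2)) has_real_derivative ?Yd * ?zd) (at \<rho>)"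
    unfolding X_def Y_def z_def using z by (intro DERIV_chain2[OF F2'_DERIV[OF c] zd]) (auto simp: z_def)
  have Kd: "((\<lambda>\<rho>. 4 * (1 - \<rho>) / (1 + \<rho>) ^ 3) has_real_derivative (8 * \<rho> - 16) / (1 + \<rho>) ^ 4) (at \<rho>)"
    using nz by (auto intro!: derivative_eq_intros simp: divide_simps) (simp add: algebra_simps eval_nat_numeral)
  have Id: "((\<lambda>\<rho>. - p * F2 (p / 2) ((p + 1) / 2) c (4 * \<rho> / (1 + \<rho>)\<^sup>2) / (1 + \<rho>)) has_real_derivative
     p * X / (1 + \<rho>)\<^sup>2 - p * ?zd * Y / (1 + \<rho>)) (at \<rho>)"
  proof -
    have "((\<lambda>\<rho>. 1 + \<rho>) has_real_derivative 1) (at \<rho>)" by (auto intro!: derivative_eq_intros)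
    from DERIV_divide[OF DERIV_cmult[OF Xd, of "- p"] this nz] show ?thesis
      by (rule DERIV_cong) (use nz in \<open>simp add: X_def z_def power2_eq_square diff_divide_distrib mult_ac\<close>)
  qed
  have D: "(Wf' p c has_real_derivative
     (- p * (E / (1 + \<rho>))) * S + (p * X / (1 + \<rho>)\<^sup>2 - p * ?zd * Y / (1 + \<rho>)
       + ((8 * \<rho> - 16) / (1 + \<rho>) ^ 4 * Y + ?Yd * ?zd * ?zd)) * E) (at \<rho>)"
    unfolding Wf'_def[abs_def] E_def S_def X_def Y_def z_def
    by (intro DERIV_mult DERIV_add powr_one_plus_DERIV Id[unfolded X_def Y_def z_def]
        Yd[unfolded X_def Y_def z_def] Kd) (use r in auto)
  \<comment> \<open>The factor \<open>z * (1 - z)\<close> in the denominator divides the square of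
    the derivative of the map up to \<open>4 / (\<rho> * (1 + \<rho>)\<^sup>2)\<close>, so no power
    of \<open>1 - \<rho>\<close> survives in this term.\<close>
  have Yeq: "?Yd * ?zd * ?zd = 4 / (\<rho> * (1 + \<rho>)\<^sup>2) * (p / 2 * ((p + 1) / 2) * X - (c - (p + 3 / 2) * z) * Y)"
  proof -
    have "z * (1 - z) * (4 / (\<rho> * (1 + \<rho>)\<^sup>2)) = ?zd * ?zd"
      using r nz unfolding z_def by (simp add: divide_simps eval_nat_numeral) (simp add: algebra_simps)
    moreover have zz: "z * (1 - z) \<noteq> 0" using z by simp
    ultimately have "?zd * ?zd / (z * (1 - z)) = 4 / (\<rho> * (1 + \<rho>)\<^sup>2)"
      unfolding nonzero_divide_eq_eq[OF zz] by (simp only: mult.commute)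
    moreover have "p / 2 + (p + 1) / 2 + 1 = p + 3 / 2" by (simp add: field_simps)
    moreover have "L / D * u * u = (u * u / D) * L" for L D u :: real by simp
    ultimately show ?thesis by (simp only:)
  qed
  have key: "p * X / (1 + \<rho>)\<^sup>2 - p * ?zd * Y / (1 + \<rho>) + ((8 * \<rho> - 16) / (1 + \<rho>) ^ 4 * Y
      + 4 / (\<rho> * (1 + \<rho>)\<^sup>2) * (p / 2 * ((p + 1) / 2) * X - (c - (p + 3 / 2) * z) * Y)) - p * S / (1 + \<rho>)
    = (p * (p + 1 - c) * X - (c - (p + (p + 1 - c) + 1) * \<rho>) * S) / (\<rho> * (1 - \<rho>))"
    using Wf_ode_algebra[OF r, of p X Y c] unfolding S_def z_def by (simp only: add.assoc diff_add_eq)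
  have "(- p * (E / q)) * S + U * E = E * (U - p * S / q)" for U q by (simp add: algebra_simps)
  note this[of "1 + \<rho>"]
  from D[unfolded Yeq this key] have "(Wf' p c has_real_derivative
     E * ((p * (p + 1 - c) * X - (c - (p + (p + 1 - c) + 1) * \<rho>) * S) / (\<rho> * (1 - \<rho>)))) (at \<rho>)" .
  moreover have "Wf p c \<rho> = E * X" "Wf' p c \<rho> = E * S"
    by (simp_all add: Wf_def Wf'_def E_def X_def Y_def S_def z_def)
  ultimately show ?thesis by (simp add: algebra_simps)
qed

lemma F2_mobius_tendsto_0:
  assumes c: "c > 0"
  shows "((\<lambda>\<rho>. F2 A B c (4 * \<rho> / (1 + \<rho>)\<^sup>2)) \<longlongrightarrow> 1) (at_right 0)"
    and "((\<lambda>\<rho>. F2' A B c (4 * \<rho> / (1 + \<rho>)\<^sup>2)) \<longlongrightarrow> F2' A B c 0) (at_right 0)"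
proof -
  have m: "((\<lambda>\<rho>::real. 4 * \<rho> / (1 + \<rho>)\<^sup>2) \<longlongrightarrow> 4 * 0 / (1 + 0)\<^sup>2) (at_right 0)"
    by (intro tendsto_intros) auto
  show "((\<lambda>\<rho>. F2 A B c (4 * \<rho> / (1 + \<rho>)\<^sup>2)) \<longlongrightarrow> 1) (at_right 0)"
    using isCont_tendsto_compose[OF F2_isCont_0[OF c] m[simplified], of A B] by simp
  show "((\<lambda>\<rho>. F2' A B c (4 * \<rho> / (1 + \<rho>)\<^sup>2)) \<longlongrightarrow> F2' A B c 0) (at_right 0)"
    using isCont_tendsto_compose[OF F2'_isCont_0[OF c] m[simplified], of A B] by simp
qed

text \<open>
  Both sides solve the same hypergeometric equation on \<open>(0,1)\<close> and are bounded at \<open>0\<close>, so their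
  Wronskian, which is a multiple of \<open>\<rho> powr (-c) * (1 - \<rho>) powr (2 * c - 2 * p - 2)\<close>, vanishes.
\<close>

theorem Wf_eq_F2:
  assumes p: "-1 < p" and c: "c - p - 1/2 > 0" "c > 1/2" and r: "0 \<le> \<rho>" "\<rho> < 1"
  shows "Wf p c \<rho> = F2 p (p + 1 - c) c \<rho>"
proof -
  have c0: "c > 0" using c by simp
  let ?b = "p + 1 - c"
  let ?s = "p + ?b + 1"
  let ?F = "F2 p ?b c" and ?F' = "F2' p ?b c" and ?W = "Wf p c" and ?W' = "Wf' p c"
  define N where "N x = ?F' x * ?W x - ?F x * ?W' x" for x
  \<comment> \<open>Abel's identity: the added factors compensate the decay and growth of the
    Wronskian N, so T is constant; since c is positive, T tends to 0 at 0.\<close>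
  define T where "T x = x powr c * (1 - x) powr (?s - c) * N x" for x
  have dN: "(N has_real_derivative - (c - ?s * x) / (x * (1 - x)) * N x) (at x)" if x: "0 < x" "x < 1" for x
  proof -
    have D: "(N has_real_derivative
       ((p * ?b * ?F x - (c - ?s * x) * ?F' x) / (x * (1 - x))) * ?W x + ?W' x * ?F' x
        - (?F' x * ?W' x + ((p * ?b * ?W x - (c - ?s * x) * ?W' x) / (x * (1 - x))) * ?F x)) (at x)"
      unfolding N_def[abs_def] using x
      by (intro DERIV_diff DERIV_mult F2'_DERIV F2_DERIV Wf_DERIV Wf'_DERIV c0) auto
    have "(A - k * f') / d * w + w' * f' - (f' * w' + (B - k * w') / d * f) = - k / d * (f' * w - f * w')"
      if "A * w = B * f" for A B k d f f' w w' :: real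
    proof -
      have "(A - k * f') / d * w + w' * f' - (f' * w' + (B - k * w') / d * f)
        = (A * w - B * f - k * (f' * w - f * w')) / d"
        by (simp add: algebra_simps diff_divide_distrib add_divide_distrib)
      then show ?thesis using that by simp
    qed
    from DERIV_cong[OF D this] show ?thesis unfolding N_def by (simp add: mult_ac)
  qed
  have dT: "(T has_real_derivative 0) (at x)" if x: "0 < x" "x < 1" for x
  proof -
    have "((\<lambda>x. (1 - x) powr (?s - c)) has_real_derivative (?s - c) * (1 - x) powr (?s - c - 1) * (0 - 1)) (at x)"
      using x by (intro DERIV_chain2[OF has_real_derivative_powr] DERIV_diff DERIV_const DERIV_ident) auto
    from DERIV_mult[OF DERIV_mult[OF has_real_derivative_powr[OF x(1), of c] this] dN[OF x]]
    have "(T has_real_derivative (c * x powr (c - 1) * (1 - x) powr (?s - c) +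
        (?s - c) * (1 - x) powr (?s - c - 1) * (0 - 1) * x powr c) * N x +
        - (c - ?s * x) / (x * (1 - x)) * N x * (x powr c * (1 - x) powr (?s - c))) (at x)"
      unfolding T_def[abs_def] .
    moreover have "x powr (c - 1) = x powr c / x" "(1 - x) powr (?s - c - 1) = (1 - x) powr (?s - c) / (1 - x)"
      using x powr_diff[of x c 1] powr_diff[of "1 - x" "?s - c" 1] by simp_all
    moreover have "(c * (u / x) * v + (?s - c) * (v / (1 - x)) * (0 - 1) * u) * n
        + - (c - ?s * x) / (x * (1 - x)) * n * (u * v) = 0" for u v n
    proof -
      have "c / x - (?s - c) / (1 - x) = (c - ?s * x) / (x * (1 - x))"
        using x by (simp add: divide_simps) (simp add: algebra_simps)
      moreover have "(c * (u / x) * v + S * (v / (1 - x)) * (0 - 1) * u) * n + - k / d * n * (u * v)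
          = u * v * n * (c / x - S / (1 - x) - k / d)" for S k d
        by (simp add: algebra_simps)
      ultimately show ?thesis by (simp only: diff_self mult_zero_right)
    qed
    ultimately show ?thesis by metis
  qed
  have T0: "(T \<longlongrightarrow> 0) (at_right 0)"
  proof -
    have F: "(?F \<longlongrightarrow> 1) (at_right 0)" "(?F' \<longlongrightarrow> ?F' 0) (at_right 0)"
      using F2_isCont_0[OF c0, of p ?b] F2'_isCont_0[OF c0, of p ?b]
      by (auto simp: isCont_def intro: tendsto_mono[OF at_le])
    note m = F2_mobius_tendsto_0[OF c0, of "p/2" "(p+1)/2"]
    have W: "(?W \<longlongrightarrow> (1 + 0) powr (-p) * 1) (at_right 0)"
      unfolding Wf_def[abs_def] by (intro tendsto_intros m) auto
    have W': "(?W' \<longlongrightarrow> (1 + 0) powr (-p) * (- p * 1 / (1 + 0) + 4 * (1 - 0) / (1 + 0) ^ 3 * F2' (p/2) ((p+1)/2) c 0)) (at_right 0)"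
      unfolding Wf'_def[abs_def] by (intro tendsto_intros m) auto
    have x: "((\<lambda>x::real. x powr c) \<longlongrightarrow> 0) (at_right 0)" using c0 by real_asymp
    have x1: "((\<lambda>x::real. (1 - x) powr (?s - c)) \<longlongrightarrow> (1 - 0) powr (?s - c)) (at_right 0)"
      by (intro tendsto_intros) auto
    from tendsto_mult[OF tendsto_mult[OF x x1] tendsto_diff[OF tendsto_mult[OF F(2) W] tendsto_mult[OF F(1) W']]]
    show ?thesis unfolding T_def[abs_def] N_def by simp
  qed
  have T: "T x = 0" if x: "0 < x" "x < 1" for x
  proof -
    have "T y = T x" if y: "0 < y" "y < x" for y
      using DERIV_isconst2[of y x T x] y x by (metis DERIV_isCont continuous_at_imp_continuous_on atLeastAtMost_iff dT less_le_trans less_trans le_less_trans order_refl less_imp_le)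
    then have "eventually (\<lambda>y. T y = T x) (at_right 0)"
      unfolding eventually_at_right_field using x by (intro exI[of _ x]) auto
    then have "(T \<longlongrightarrow> T x) (at_right 0)" by (rule tendsto_eventually)
    then show ?thesis using T0 tendsto_unique trivial_limit_at_right_real by blast
  qed
  have N: "N x = 0" if x: "0 < x" "x < 1" for x
    using T[OF x] x by (simp add: T_def)
  have Wp: "?W x > 0" if "0 \<le> x" "x < 1" for x
    using that p c by (intro Wf_pos) auto
  show ?thesis
  proof (cases "\<rho> = 0")
    case True
    then show ?thesis by (simp add: Wf_def)
  next
    case False
    then have r0: "0 < \<rho>" using r by simp
    let ?Q = "\<lambda>x. ?F x / ?W x"
    have "?Q \<rho> = ?Q 0"
    proof (rule DERIV_isconst_end[OF r0])
      show "continuous_on {0..\<rho>} ?Q"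
      proof (intro continuous_on_divide)
        show "continuous_on {0..\<rho>} ?F"
          using r by (intro DERIV_continuous_on) (auto intro!: DERIV_subset[OF F2_DERIV[OF c0]])
        show "continuous_on {0..\<rho>} ?W"
          using r by (intro DERIV_continuous_on) (auto intro!: DERIV_subset[OF Wf_DERIV[OF c0]])
      qed (use Wp r in force)
      fix x assume x: "0 < x" "x < \<rho>"
      have "(?Q has_real_derivative (?F' x * ?W x - ?F x * ?W' x) / (?W x * ?W x)) (at x)"
        using x r Wp[of x] by (intro DERIV_divide F2_DERIV Wf_DERIV c0) auto
      then show "(?Q has_real_derivative 0) (at x)" using N[of x] x r by (simp add: N_def)
    qed
    moreover have "?W 0 = 1" by (simp add: Wf_def)
    ultimately have "?F \<rho> / ?W \<rho> = 1" by simp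
    moreover have "?W \<rho> \<noteq> 0" using Wp[of \<rho>] r by simp
    ultimately show ?thesis by (simp add: divide_eq_1_iff)
  qed
qed

section \<open>The potential of the unit sphere as a function of the radius\<close>

text \<open>Up to an additive constant, \<open>riesz_kernel s x\<close> is \<open>kk (s / 2) ((norm x)\<^sup>2)\<close>.\<close>

definition kk :: "real \<Rightarrow> real \<Rightarrow> real" where
  "kk a t = (if a = 0 then - ln t / 2 else (t powr (- a) - 1) / (2 * a))"

lemma kk_1 [simp]: "kk a 1 = 0"
  by (simp add: kk_def)

lemma kk_DERIV:
  assumes "t > 0"
  shows "(kk a has_real_derivative - (1 / 2) * t powr (- a - 1)) (at t)"
proof (cases "a = 0")
  case True
  have "((\<lambda>t. - ln t / 2) has_real_derivative - (1 / 2) * t powr (- 0 - 1)) (at t)"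
    using assms by (auto intro!: derivative_eq_intros simp: powr_minus inverse_eq_divide)
  then show ?thesis unfolding kk_def[abs_def] using True by simp
next
  case False
  have "((\<lambda>t. (t powr (- a) - 1) / (2 * a)) has_real_derivative - (1 / 2) * t powr (- a - 1)) (at t)"
    using assms False by (auto intro!: derivative_eq_intros)
  then show ?thesis unfolding kk_def[abs_def] using False by simp
qed

text \<open>For a nonzero this is the coefficient of \<open>F2 (a / 2) ((a + 1) / 2) c\<close>
  divided by \<open>2 * a\<close>, see \<open>phi0_mult\<close>; cancelling the factor a first lets
  the same formula cover \<open>a = 0\<close>. Its meaning as Taylor coefficient times moment is
  \<open>phi0_eq_kap\<close>.\<close>

definition phi0 :: "real \<Rightarrow> real \<Rightarrow> nat \<Rightarrow> real" where
  "phi0 a c j = (case j of 0 \<Rightarrow> 0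
    | Suc i \<Rightarrow> (a + 1) / (8 * c) * hyp_coeff (a / 2 + 1) ((a + 1) / 2 + 1) (c + 1) i / real (Suc i))"

definition Phi0 :: "real \<Rightarrow> real \<Rightarrow> real \<Rightarrow> real" where
  "Phi0 a c z = (\<Sum>j. phi0 a c j * z ^ j)"

text \<open>
  The potential of the uniform probability measure on the unit sphere in dimension \<open>2 * c\<close>, as a
  function of the squared distance to the origin, see \<open>sphere_potential\<close> below.
\<close>

definition u0 :: "real \<Rightarrow> real \<Rightarrow> real \<Rightarrow> real" where
  "u0 a c \<rho> = kk a (1 + \<rho>) + (1 + \<rho>) powr (- a) * Phi0 a c (4 * \<rho> / (1 + \<rho>)\<^sup>2)"

lemma phi0_0 [simp]: "phi0 a c 0 = 0"
  by (simp add: phi0_def)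

lemma Phi0_0 [simp]: "Phi0 a c 0 = 0"
  unfolding Phi0_def using powser_zero[of "phi0 a c"] by simp

lemma u0_0 [simp]: "u0 a c 0 = 0"
  by (simp add: u0_def)

lemma phi0_mult:
  assumes "c > 0"
  shows "a * phi0 a c (Suc i) = 1 / 2 * hyp_coeff (a / 2) ((a + 1) / 2) c (Suc i)"
proof -
  have "real (Suc i) * hyp_coeff (a / 2) ((a + 1) / 2) c (Suc i) =
      hyp_coeff (a / 2 + 1) ((a + 1) / 2 + 1) (c + 1) i * (a / 2 * ((a + 1) / 2) / c)"
    using hyp_coeff_shift[OF assms, of "a/2" "(a+1)/2" i] by simp
  then have "hyp_coeff (a / 2) ((a + 1) / 2) c (Suc i) =
      hyp_coeff (a / 2 + 1) ((a + 1) / 2 + 1) (c + 1) i * (a / 2 * ((a + 1) / 2) / c) / real (Suc i)"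
    by (subst nonzero_eq_divide_eq) (simp, simp only: mult.commute)
  then show ?thesis by (simp add: phi0_def mult_ac)
qed

locale riesz_sphere =
  fixes a c :: real
  assumes a_gt: "-1 < a" and a_lt: "a < c - 3 / 2"
begin

lemma c_gt: "c > 1 / 2"
  using a_gt a_lt by simp

lemma c_pos: "c > 0"
  using c_gt by simp

lemma phi0_nonneg: "phi0 a c j \<ge> 0"
  using F2_coeffs_nonneg[of "a/2+1" "(a+1)/2+1" "c+1"] a_gt c_pos
  by (auto simp: phi0_def split: nat.split)

lemma phi0_le: "phi0 a c (Suc i) \<le> (a + 1) / (8 * c) * \<bar>hyp_coeff (a / 2 + 1) ((a + 1) / 2 + 1) (c + 1) i\<bar>"
proof -
  have h: "hyp_coeff (a / 2 + 1) ((a + 1) / 2 + 1) (c + 1) i \<ge> 0" (is "?h \<ge> 0")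
    using F2_coeffs_nonneg[of "a/2+1" "(a+1)/2+1" "c+1"] a_gt c_pos by auto
  have "(a + 1) / (8 * c) * ?h / real (Suc i) \<le> (a + 1) / (8 * c) * ?h / 1"
    using h a_gt c_pos by (intro divide_left_mono mult_nonneg_nonneg) auto
  then show ?thesis using h by (simp add: phi0_def)
qed

lemma summable_phi0: "summable (phi0 a c)"
proof -
  have "summable (\<lambda>i. (a + 1) / (8 * c) * \<bar>hyp_coeff (a / 2 + 1) ((a + 1) / 2 + 1) (c + 1) i\<bar>)"
    using a_lt c_pos by (intro summable_mult summable_hyp_coeff) (auto simp: field_simps)
  then have "summable (\<lambda>i. phi0 a c (Suc i))"
    by (rule summable_comparison_test[rotated]) (use phi0_le phi0_nonneg in \<open>auto intro!: exI[of _ 0]\<close>)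
  then show ?thesis by (subst (asm) summable_Suc_iff)
qed

lemma phi0_powser_sums:
  assumes "0 \<le> z" "z \<le> 1"
  shows "(\<lambda>j. phi0 a c j * z ^ j) sums Phi0 a c z"
  unfolding Phi0_def
proof (rule summable_sums, rule summable_comparison_test[OF _ summable_phi0])
  show "\<exists>N. \<forall>n\<ge>N. norm (phi0 a c n * z ^ n) \<le> phi0 a c n"
    using assms phi0_nonneg by (auto intro!: exI[of _ 0] mult_left_le power_le_one simp: abs_mult)
qed

lemma Phi0_continuous: "continuous_on {0..1} (Phi0 a c)"
proof -
  have "uniform_limit {0..1} (\<lambda>n x. \<Sum>i<n. phi0 a c i * x ^ i) (Phi0 a c) sequentially"
    unfolding Phi0_def[abs_def]
  proof (rule Weierstrass_m_test[OF _ summable_phi0])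
    fix n and x :: real assume "x \<in> {0..1}"
    then show "norm (phi0 a c n * x ^ n) \<le> phi0 a c n"
      using phi0_nonneg by (auto intro!: mult_left_le power_le_one simp: abs_mult)
  qed
  then show ?thesis
    by (rule uniform_limit_theorem[rotated]) (auto intro!: continuous_intros always_eventually)
qed

lemma Phi0_DERIV:
  assumes z: "\<bar>z\<bar> < 1"
  shows "(Phi0 a c has_real_derivative
    (a + 1) / (8 * c) * F2 (a / 2 + 1) ((a + 1) / 2 + 1) (c + 1) z) (at z)"
proof -
  have D: "(Phi0 a c has_real_derivative (\<Sum>n. diffs (phi0 a c) n * z ^ n)) (at z)"
    unfolding Phi0_def[abs_def]
    by (rule termdiffs_strong[of _ 1]) (use summable_phi0 z in auto)
  have S: "(\<lambda>n. diffs (phi0 a c) n * z ^ n) sums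
      ((a + 1) / (8 * c) * F2 (a / 2 + 1) ((a + 1) / 2 + 1) (c + 1) z)"
  proof -
    have "diffs (phi0 a c) n * z ^ n =
      (a + 1) / (8 * c) * (hyp_coeff (a / 2 + 1) ((a + 1) / 2 + 1) (c + 1) n * z ^ n)" for n
      by (simp add: diffs_def phi0_def del: of_nat_Suc)
    then show ?thesis using c_pos z by (simp only:) (intro sums_mult F2_sums, auto)
  qed
  show ?thesis using D unfolding sums_unique[OF S, symmetric] .
qed

lemma Phi0_mult:
  assumes z: "0 \<le> z" "z \<le> 1"
  shows "a * Phi0 a c z = 1 / 2 * (F2 (a / 2) ((a + 1) / 2) c z - 1)"
proof -
  let ?t = "hyp_coeff (a / 2) ((a + 1) / 2) c"
  have s: "summable (\<lambda>n. ?t n * z ^ n)"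
  proof (rule summable_comparison_test)
    show "summable (\<lambda>n. \<bar>?t n\<bar>)" using a_lt c_pos by (intro summable_hyp_coeff) auto
    show "\<exists>N. \<forall>n\<ge>N. norm (?t n * z ^ n) \<le> \<bar>?t n\<bar>"
      using z by (auto intro!: exI[of _ 0] mult_left_le power_le_one simp: abs_mult)
  qed
  have S1: "(\<lambda>n. 1 / 2 * (?t (Suc n) * z ^ Suc n)) sums (1 / 2 * (F2 (a / 2) ((a + 1) / 2) c z - ?t 0 * z ^ 0))"
    unfolding F2_def by (intro sums_mult, subst sums_Suc_iff) (use s in \<open>simp add: summable_sums\<close>)
  have S2: "(\<lambda>n. a * (phi0 a c (Suc n) * z ^ Suc n)) sums (a * (Phi0 a c z - phi0 a c 0 * z ^ 0))"
    by (intro sums_mult, subst sums_Suc_iff) (use phi0_powser_sums[OF z] in simp)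
  have e: "a * (phi0 a c (Suc n) * z ^ Suc n) = 1 / 2 * (?t (Suc n) * z ^ Suc n)" for n
    using phi0_mult[OF c_pos, of a n] by (simp add: mult.assoc[symmetric])
  show ?thesis using sums_unique2[OF S2[unfolded e] S1] by simp
qed

lemma u0_continuous: "continuous_on {0..} (u0 a c)"
proof -
  have "continuous_on {0..} (\<lambda>\<rho>. kk a (1 + \<rho>))"
  proof (rule continuous_on_compose2[where g = "kk a" and f = "\<lambda>\<rho>. 1 + \<rho>"])
    show "continuous_on {0<..} (kk a)"
      by (intro DERIV_continuous_on) (auto intro!: DERIV_subset[OF kk_DERIV])
  qed (auto intro!: continuous_intros)
  moreover have "continuous_on {0..} (\<lambda>\<rho>. Phi0 a c (4 * \<rho> / (1 + \<rho>)\<^sup>2))"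
    by (rule continuous_on_compose2[OF Phi0_continuous]) (use mobius_le_1 in \<open>auto intro!: continuous_intros\<close>)
  ultimately show ?thesis unfolding u0_def[abs_def]
    by (intro continuous_intros) auto
qed

text \<open>After differentiation \<open>Phi0\<close> occurs only multiplied by a, so
  \<open>Phi0_mult\<close> eliminates it even for \<open>a = 0\<close>. The derivative of
  \<open>Phi0\<close> is expressed by \<open>F2_contiguous_up\<close>, which accounts for the
  exponent \<open>a + 1\<close>.\<close>

lemma u0_DERIV:
  assumes r: "0 < \<rho>" "\<rho> \<noteq> 1"
  shows "(u0 a c has_real_derivative - (Wf a c \<rho> - (1 - \<rho>) * Wf (a + 1) c \<rho>) / (4 * \<rho>)) (at \<rho>)"
proof -
  define z where "z = 4 * \<rho> / (1 + \<rho>)\<^sup>2"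
  define E where "E = (1 + \<rho>) powr (- a)"
  define X where "X = F2 (a / 2) ((a + 1) / 2) c z"
  define Y where "Y = F2 (a / 2 + 1) ((a + 1) / 2) c z"
  define D where "D = (a + 1) / (8 * c) * F2 (a / 2 + 1) ((a + 1) / 2 + 1) (c + 1) z"
  have z: "\<bar>z\<bar> < 1" "0 \<le> z" using mobius_lt_1[of \<rho>] r by (auto simp: z_def)
  have zD: "z * D = 1 / 4 * (Y - X)"
    using F2_contiguous_up[OF c_pos z(1), of "a/2" "(a+1)/2"] unfolding D_def X_def Y_def
    by (simp add: field_simps)
  have aP: "a * Phi0 a c z = 1 / 2 * (X - 1)" unfolding X_def using z by (intro Phi0_mult) auto
  have "((\<lambda>\<rho>. 1 + \<rho>) has_real_derivative 1) (at \<rho>)" by (auto intro!: derivative_eq_intros)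
  from DERIV_chain2[OF kk_DERIV this, of a] r
  have k: "((\<lambda>\<rho>. kk a (1 + \<rho>)) has_real_derivative - (1 / 2) * (1 + \<rho>) powr (- a - 1) * 1) (at \<rho>)" by simp
  have zd: "((\<lambda>\<rho>. 4 * \<rho> / (1 + \<rho>)\<^sup>2) has_real_derivative 4 * (1 - \<rho>) / (1 + \<rho>) ^ 3) (at \<rho>)"
    using r by (intro mobius_DERIV) auto
  have P: "((\<lambda>\<rho>. Phi0 a c (4 * \<rho> / (1 + \<rho>)\<^sup>2)) has_real_derivative D * (4 * (1 - \<rho>) / (1 + \<rho>) ^ 3)) (at \<rho>)"
    unfolding D_def z_def using z by (intro DERIV_chain2[OF Phi0_DERIV zd]) (auto simp: z_def)
  have "0 \<le> \<rho>" using r by simp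
  from DERIV_add[OF k DERIV_mult[OF powr_one_plus_DERIV[OF this, of a] P]]
  have d: "(u0 a c has_real_derivative - (1 / 2) * (1 + \<rho>) powr (- a - 1) * 1 +
     (- a * ((1 + \<rho>) powr (- a) / (1 + \<rho>)) * Phi0 a c (4 * \<rho> / (1 + \<rho>)\<^sup>2) +
      D * (4 * (1 - \<rho>) / (1 + \<rho>) ^ 3) * (1 + \<rho>) powr (- a))) (at \<rho>)"
    unfolding u0_def[abs_def] .
  have E1: "(1 + \<rho>) powr (- a - 1) = E / (1 + \<rho>)" unfolding E_def using r powr_diff[of "1 + \<rho>" "-a" 1] by simp
  have zd': "4 * (1 - \<rho>) / (1 + \<rho>) ^ 3 = z * ((1 - \<rho>) / (\<rho> * (1 + \<rho>)))"
    unfolding z_def using r by (simp add: divide_simps eval_nat_numeral)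
  have "- (1 / 2) * (1 + \<rho>) powr (- a - 1) * 1 +
     (- a * ((1 + \<rho>) powr (- a) / (1 + \<rho>)) * Phi0 a c (4 * \<rho> / (1 + \<rho>)\<^sup>2) +
      D * (4 * (1 - \<rho>) / (1 + \<rho>) ^ 3) * (1 + \<rho>) powr (- a)) =
     - (1 / 2) * (E / (1 + \<rho>)) - (E / (1 + \<rho>)) * (a * Phi0 a c z) + (z * D) * ((1 - \<rho>) / (\<rho> * (1 + \<rho>))) * E"
    unfolding E1 zd' z_def[symmetric] E_def[symmetric] by (simp add: algebra_simps)
  also have "\<dots> = - (E * X - (1 - \<rho>) * (E / (1 + \<rho>) * Y)) / (4 * \<rho>)"
    unfolding aP zD using r by (simp add: divide_simps) (simp add: algebra_simps)
  also have "E * X = Wf a c \<rho>" by (simp add: Wf_def E_def X_def z_def)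
  also have "E / (1 + \<rho>) * Y = Wf (a + 1) c \<rho>"
  proof -
    have "- (a + 1) = - a - 1" "(a + 1 + 1) / 2 = a / 2 + 1" by (simp_all add: field_simps)
    then show ?thesis unfolding Wf_def Y_def z_def by (simp only: E1 F2_symmetric[of "a/2+1" "(a+1)/2"])
  qed
  finally show ?thesis using d by simp
qed

lemma u0_DERIV_inside:
  assumes r: "0 < \<rho>" "\<rho> < 1"
  shows "(u0 a c has_real_derivative
    - (1 / 2) * ((c - 1 - a) / c * F2 (a + 1) (a + 2 - c) (c + 1) \<rho>)) (at \<rho>)"
proof -
  have W: "Wf a c \<rho> = F2 a (a + 1 - c) c \<rho>" "Wf (a + 1) c \<rho> = F2 (a + 1) (a + 1 - c + 1) c \<rho>"
    using Wf_eq_F2[of a c \<rho>] Wf_eq_F2[of "a+1" c \<rho>] a_gt a_lt c_gt r by (auto simp: algebra_simps)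
  have "Wf a c \<rho> - (1 - \<rho>) * Wf (a + 1) c \<rho> =
      \<rho> * ((c - a - (a + 1 - c) - 1) / c * F2 (a + 1) (a + 1 - c + 1) (c + 1) \<rho>)"
    unfolding W using r by (intro F2_contiguous_diff c_pos) auto
  also have "c - a - (a + 1 - c) - 1 = 2 * (c - 1 - a)" by simp
  also have "a + 1 - c + 1 = a + 2 - c" by simp
  finally have W: "Wf a c \<rho> - (1 - \<rho>) * Wf (a + 1) c \<rho> =
      \<rho> * (2 * (c - 1 - a) / c * F2 (a + 1) (a + 2 - c) (c + 1) \<rho>)" .
  have e: "- (\<rho> * (2 * k / c * F)) / (4 * \<rho>) = - (1 / 2) * (k / c * F)" for k F
    using r by simp
  show ?thesis by (rule u0_DERIV[of \<rho>, unfolded W e]) (use r in auto)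
qed

text \<open>Inversion reduces to the point \<open>1 / \<rho>\<close> in the unit interval, where the
  quadratic transformation applies. The powers of \<rho> then turn the difference of the two terms
  into a sum, which \<open>F2_contiguous_sum\<close> evaluates.\<close>

lemma u0_DERIV_outside:
  assumes r: "1 < \<rho>"
  shows "(u0 a c has_real_derivative
    - (1 / 2) * (\<rho> powr (- a - 1) * F2 (a + 1) (a + 1 - c) c (1 / \<rho>))) (at \<rho>)"
proof -
  let ?q = "1 / \<rho>"
  have q: "0 < ?q" "?q < 1" using r by auto
  have W: "Wf a c ?q = F2 a (a + 1 - c) c ?q" "Wf (a + 1) c ?q = F2 (a + 1) (a + 1 - c + 1) c ?q"
    using Wf_eq_F2[of a c ?q] Wf_eq_F2[of "a+1" c ?q] a_gt a_lt c_gt q by (auto simp: algebra_simps)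
  have W': "Wf a c \<rho> = \<rho> powr (- a) * F2 a (a + 1 - c) c ?q"
     "Wf (a + 1) c \<rho> = \<rho> powr (- (a + 1)) * F2 (a + 1) (a + 1 - c + 1) c ?q"
    unfolding W[symmetric] using r by (intro Wf_inverse, simp)+
  have p: "\<rho> powr (- a) = \<rho> * \<rho> powr (- a - 1)" "- (a + 1) = - a - 1"
    using r powr_add[of \<rho> 1 "-a - 1"] by auto
  have "Wf a c \<rho> - (1 - \<rho>) * Wf (a + 1) c \<rho> =
      \<rho> * \<rho> powr (- a - 1) * (F2 a (a + 1 - c) c ?q + (1 - ?q) * F2 (a + 1) (a + 1 - c + 1) c ?q)"
    unfolding W' p using r by (simp add: algebra_simps)
  also have "F2 a (a + 1 - c) c ?q + (1 - ?q) * F2 (a + 1) (a + 1 - c + 1) c ?q = 2 * F2 (a + 1) (a + 1 - c) c ?q"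
    using q by (intro F2_contiguous_sum c_pos) auto
  finally have "- (Wf a c \<rho> - (1 - \<rho>) * Wf (a + 1) c \<rho>) / (4 * \<rho>) =
    - (1 / 2) * (\<rho> powr (- a - 1) * F2 (a + 1) (a + 1 - c) c ?q)"
    using r by simp
  then show ?thesis using u0_DERIV[of \<rho>] r by simp
qed

text \<open>With \<open>a = s / 2\<close> and \<open>c = d / 2\<close> this is the constant of the
  theorem, see \<open>cst_c_const\<close>.\<close>

definition cst :: real where
  "cst = F2 a (a + 1 - c) c 1"

lemma cst_eq: "cst = rGamma (c - a) * rGamma (2 * c - a - 1) / (rGamma c * rGamma (2 * c - 2 * a - 1))"
  using gauss_sum[OF c_pos, of a "a + 1 - c"] a_lt by (simp add: cst_def algebra_simps)

lemma cst_pos: "cst > 0"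
  unfolding cst_def using a_lt a_gt by (intro F2_pos_1 c_pos) auto

text \<open>Together with \<open>outside_value\<close> this shows that the derivative of the
  potential has the same limit \<open>- cst / 4\<close> from both sides of the sphere. Both follow
  from Gauss's theorem and the functional equation of the Gamma function.\<close>

lemma inside_value: "(c - 1 - a) / c * F2 (a + 1) (a + 2 - c) (c + 1) 1 = cst / 2"
proof -
  define k where "k = c - 1 - a"
  have k: "k \<noteq> 0" "2 * c - 2 * a - 2 = 2 * k" "2 * c - 2 * a - 1 = 2 * k + 1" using a_lt by (auto simp: k_def)
  have "F2 (a + 1) (a + 2 - c) (c + 1) 1 =
      rGamma (c - a) * rGamma (2 * c - a - 1) / (rGamma (c + 1) * rGamma (2 * c - 2 * a - 2))"
    using gauss_sum[of "c + 1" "a + 1" "a + 2 - c"] c_pos a_lt by (simp add: algebra_simps)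
  moreover have "rGamma c = c * rGamma (c + 1)" "rGamma (2 * k) = (2 * k) * rGamma (2 * k + 1)"
    using rGamma_plus1[of c] rGamma_plus1[of "2 * k"] by simp_all
  ultimately show ?thesis using c_pos k(1) unfolding cst_eq k k_def[symmetric] by simp
qed

lemma outside_value: "F2 (a + 1) (a + 1 - c) c 1 = cst / 2"
proof -
  define k where "k = c - 1 - a"
  have k: "k \<noteq> 0" "2 * c - 2 * a - 2 = 2 * k" "2 * c - 2 * a - 1 = 2 * k + 1" "c - a - 1 = k" "c - a = k + 1"
    using a_lt by (auto simp: k_def)
  have "F2 (a + 1) (a + 1 - c) c 1 =
      rGamma (c - a - 1) * rGamma (2 * c - a - 1) / (rGamma c * rGamma (2 * c - 2 * a - 2))"
    using gauss_sum[OF c_pos, of "a + 1" "a + 1 - c"] a_lt by (simp add: algebra_simps)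
  moreover have "rGamma k = k * rGamma (k + 1)" "rGamma (2 * k) = (2 * k) * rGamma (2 * k + 1)"
    using rGamma_plus1[of k] rGamma_plus1[of "2 * k"] by simp_all
  ultimately show ?thesis using k(1) unfolding cst_eq k by simp
qed

lemma F2_inside_pos:
  assumes "0 \<le> \<rho>" "\<rho> < 1"
  shows "F2 (a + 1) (a + 2 - c) (c + 1) \<rho> > 0"
  using assms a_gt a_lt by (intro F2_pos) auto

text \<open>The potential decreases strictly from its value 0 at the centre. The sign permits
  division by \<open>u0 a c 1\<close> in the first entry of the threshold.\<close>

lemma u0_1_neg: "u0 a c 1 < 0"
proof -
  have "u0 a c 1 < u0 a c 0"
  proof (rule DERIV_neg_imp_decreasing_open[of 0 1 "u0 a c"])
    fix x :: real assume x: "0 < x" "x < 1"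
    have "(c - 1 - a) / c * F2 (a + 1) (a + 2 - c) (c + 1) x > 0"
      using F2_inside_pos[of x] x c_pos a_lt by simp
    then have "- (1 / 2) * ((c - 1 - a) / c * F2 (a + 1) (a + 2 - c) (c + 1) x) < 0" by linarith
    then show "\<exists>y. (u0 a c has_real_derivative y) (at x) \<and> y < 0"
      using u0_DERIV_inside[OF x] by blast
  next
    show "continuous_on {0..1} (u0 a c)" by (rule continuous_on_subset[OF u0_continuous]) auto
  qed simp
  then show ?thesis by simp
qed

text \<open>The closed form comes from \<open>Wf_eq_F2\<close>, which holds only for \<rho> below 1;
  continuity of both sides carries it to 1.\<close>

lemma u0_1: "a \<noteq> 0 \<Longrightarrow> u0 a c 1 = (cst - 1) / (2 * a)"
proof -
  assume a: "a \<noteq> 0"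
  have u: "u0 a c \<rho> = (F2 a (a + 1 - c) c \<rho> - 1) / (2 * a)" if "0 \<le> \<rho>" "\<rho> < 1" for \<rho>
  proof -
    have "a * Phi0 a c (4 * \<rho> / (1 + \<rho>)\<^sup>2) = 1 / 2 * (F2 (a / 2) ((a + 1) / 2) c (4 * \<rho> / (1 + \<rho>)\<^sup>2) - 1)"
      using mobius_le_1[of \<rho>] that by (intro Phi0_mult) auto
    then have X: "F2 (a / 2) ((a + 1) / 2) c (4 * \<rho> / (1 + \<rho>)\<^sup>2) = 1 + 2 * a * Phi0 a c (4 * \<rho> / (1 + \<rho>)\<^sup>2)"
      by simp
    have "(E - 1) / (2 * a) + E * P = (E * (1 + 2 * a * P) - 1) / (2 * a)" for E P
      using a by (simp add: field_simps)
    then have "u0 a c \<rho> = (Wf a c \<rho> - 1) / (2 * a)"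
      using a unfolding u0_def Wf_def kk_def X by simp
    then show ?thesis using Wf_eq_F2[of a c \<rho>] a_gt a_lt c_gt that by simp
  qed
  have "continuous_on {0..1} (\<lambda>\<rho>. u0 a c \<rho> - (F2 a (a + 1 - c) c \<rho> - 1) / (2 * a))"
    using a a_lt by (intro continuous_intros continuous_on_subset[OF u0_continuous]
      continuous_on_subset[OF F2_continuous_on] c_pos) auto
  then have "((\<lambda>\<rho>. u0 a c \<rho> - (F2 a (a + 1 - c) c \<rho> - 1) / (2 * a)) \<longlongrightarrow>
      u0 a c 1 - (F2 a (a + 1 - c) c 1 - 1) / (2 * a)) (at 1 within {0..1})"
    by (simp add: continuous_on)
  then have "((\<lambda>\<rho>. u0 a c \<rho> - (F2 a (a + 1 - c) c \<rho> - 1) / (2 * a)) \<longlongrightarrow>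
      u0 a c 1 - (F2 a (a + 1 - c) c 1 - 1) / (2 * a)) (at_left 1)"
    by (simp add: at_within_Icc_at_left)
  moreover have "eventually (\<lambda>\<rho>. u0 a c \<rho> - (F2 a (a + 1 - c) c \<rho> - 1) / (2 * a) = 0) (at_left 1)"
    unfolding eventually_at_left_field using u by (intro exI[of _ 0]) auto
  then have "((\<lambda>\<rho>. u0 a c \<rho> - (F2 a (a + 1 - c) c \<rho> - 1) / (2 * a)) \<longlongrightarrow> 0) (at_left 1)"
    by (rule tendsto_eventually)
  ultimately have "u0 a c 1 - (F2 a (a + 1 - c) c 1 - 1) / (2 * a) = 0"
    using tendsto_unique trivial_limit_at_left_real by blast
  then show ?thesis by (simp add: cst_def)
qed

end

section \<open>Minimality of the total potential\<close>

lemma increasing_near_left_end: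
  fixes f f' :: "real \<Rightarrow> real"
  assumes f: "\<And>x. 0 < x \<Longrightarrow> x < 1 \<Longrightarrow> (f has_real_derivative f' x) (at x)"
    and cont: "continuous_on {0<..1} f" and pos: "eventually (\<lambda>x. f' x > 0) (at_left 1)"
  shows "eventually (\<lambda>x. f x < f 1) (at_left 1)"
proof -
  obtain e where e: "e < 1" "\<And>x. e < x \<Longrightarrow> x < 1 \<Longrightarrow> f' x > 0"
    using pos unfolding eventually_at_left_field by auto
  have "f x < f 1" if x: "max e 0 < x" "x < 1" for x
  proof (rule DERIV_pos_imp_increasing_open[of x 1 f])
    fix y assume "x < y" "y < 1"
    then show "\<exists>l. (f has_real_derivative l) (at y) \<and> l > 0"
      using x by (intro exI[of _ "f' y"] conjI f e) auto
  next
    show "continuous_on {x..1} f" using x by (intro continuous_on_subset[OF cont]) auto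
  qed (use x in auto)
  then show ?thesis unfolding eventually_at_left_field using e(1) by (intro exI[of _ "max e 0"]) auto
qed

lemma decreasing_near_right_end:
  fixes f f' :: "real \<Rightarrow> real"
  assumes f: "\<And>x. 1 < x \<Longrightarrow> (f has_real_derivative f' x) (at x)"
    and cont: "continuous_on {1..} f" and neg: "eventually (\<lambda>x. f' x < 0) (at_right 1)"
  shows "\<exists>x>1. f x < f 1"
proof -
  obtain e where e: "e > 1" "\<And>x. 1 < x \<Longrightarrow> x < e \<Longrightarrow> f' x < 0"
    using neg unfolding eventually_at_right_field by auto
  have "f ((1 + e) / 2) < f 1"
  proof (rule DERIV_neg_imp_decreasing_open[of 1 "(1 + e) / 2" f])
    fix y assume "1 < y" "y < (1 + e) / 2"
    then show "\<exists>l. (f has_real_derivative l) (at y) \<and> l < 0"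
      using e(1) by (intro exI[of _ "f' y"] conjI f e(2)) auto
  next
    show "continuous_on {1..(1 + e) / 2} f" by (intro continuous_on_subset[OF cont]) auto
  qed (use e(1) in auto)
  then show ?thesis using e(1) by (intro exI[of _ "(1 + e) / 2"]) auto
qed

lemma continuous_on_at_left_1:
  fixes f :: "real \<Rightarrow> real"
  assumes "continuous_on {0<..1} f"
  shows "(f \<longlongrightarrow> f 1) (at_left 1)"
proof -
  have "continuous_on {1/2..1} f" by (rule continuous_on_subset[OF assms]) auto
  then have "(f \<longlongrightarrow> f 1) (at 1 within {1/2..1})" by (auto simp: continuous_on)
  then show ?thesis by (simp add: at_within_Icc_at_left)
qed

lemma continuous_on_at_right_1:
  fixes f :: "real \<Rightarrow> real"
  assumes "continuous_on {1..} f"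
  shows "(f \<longlongrightarrow> f 1) (at_right 1)"
proof -
  have "continuous_on {1..2} f" by (rule continuous_on_subset[OF assms]) auto
  then have "(f \<longlongrightarrow> f 1) (at 1 within {1..2})" by (auto simp: continuous_on)
  then show ?thesis by (simp add: at_within_Icc_at_right)
qed

text \<open>
  With \<open>g = \<gamma> * R powr (\<alpha> + s)\<close>, this is, up to scaling and an additive constant, the sum of the
  potential of the uniform measure on the sphere of radius \<open>R\<close> and of the external field, at
  distance \<open>R * sqrt \<rho>\<close> from the origin.
\<close>

definition eff_pot :: "real \<Rightarrow> real \<Rightarrow> real \<Rightarrow> real \<Rightarrow> real \<Rightarrow> real" where
  "eff_pot a c g \<alpha> \<rho> = u0 a c \<rho> + g / \<alpha> * \<rho> powr (\<alpha> / 2)"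

context riesz_sphere
begin

text \<open>The logarithmic derivative at 1 of \<open>F2 (a + 1) (a + 2 - c) (c + 1)\<close>, by
  \<open>F2_1_deriv_ratio\<close>. The field contributes the exponent
  \<open>\<alpha> / 2 - 1\<close> to the inner derivative, so
  \<open>\<alpha> \<ge> 2 + 2 * ell\<close> compares the two at the sphere.\<close>

definition ell :: real where
  "ell = (a + 1) * (a + 2 - c) / (2 * c - 2 * a - 3)"

lemma ell_eq: "ell = (a + 1) * (a + 2 - c) / ((c + 1) - (a + 1) - (a + 2 - c) - 1)"
  unfolding ell_def by (simp add: algebra_simps)

lemma eff_pot_continuous:
  assumes "\<alpha> > 0"
  shows "continuous_on {0..} (eff_pot a c g \<alpha>)"
  unfolding eff_pot_def[abs_def] using assms
  by (intro continuous_intros u0_continuous continuous_on_powr') auto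

definition eff_pot_in' :: "real \<Rightarrow> real \<Rightarrow> real \<Rightarrow> real" where
  "eff_pot_in' g \<alpha> \<rho> = 1 / 2 * (g * \<rho> powr (\<alpha> / 2 - 1) - (c - 1 - a) / c * F2 (a + 1) (a + 2 - c) (c + 1) \<rho>)"

definition eff_pot_out' :: "real \<Rightarrow> real \<Rightarrow> real \<Rightarrow> real" where
  "eff_pot_out' g \<alpha> \<rho> = 1 / 2 * (g * \<rho> powr (\<alpha> / 2 - 1) - \<rho> powr (- a - 1) * F2 (a + 1) (a + 1 - c) c (1 / \<rho>))"

lemma eff_pot_DERIV_inside:
  assumes "\<alpha> > 0" "0 < \<rho>" "\<rho> < 1"
  shows "(eff_pot a c g \<alpha> has_real_derivative eff_pot_in' g \<alpha> \<rho>) (at \<rho>)"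
proof -
  have "(eff_pot a c g \<alpha> has_real_derivative
    - (1 / 2) * ((c - 1 - a) / c * F2 (a + 1) (a + 2 - c) (c + 1) \<rho>) + g / \<alpha> * (\<alpha> / 2 * \<rho> powr (\<alpha> / 2 - 1))) (at \<rho>)"
    unfolding eff_pot_def[abs_def] using assms
    by (intro DERIV_add DERIV_cmult u0_DERIV_inside has_real_derivative_powr) auto
  moreover have "- (1 / 2) * X + g / \<alpha> * (\<alpha> / 2 * Y) = 1 / 2 * (g * Y - X)" for X Y
    using assms by simp
  ultimately show ?thesis unfolding eff_pot_in'_def by (simp only:)
qed

lemma eff_pot_DERIV_outside:
  assumes "\<alpha> > 0" "1 < \<rho>"
  shows "(eff_pot a c g \<alpha> has_real_derivative eff_pot_out' g \<alpha> \<rho>) (at \<rho>)"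
proof -
  have "(eff_pot a c g \<alpha> has_real_derivative
    - (1 / 2) * (\<rho> powr (- a - 1) * F2 (a + 1) (a + 1 - c) c (1 / \<rho>)) + g / \<alpha> * (\<alpha> / 2 * \<rho> powr (\<alpha> / 2 - 1))) (at \<rho>)"
    unfolding eff_pot_def[abs_def] using assms
    by (intro DERIV_add DERIV_cmult u0_DERIV_outside has_real_derivative_powr) auto
  moreover have "- (1 / 2) * X + g / \<alpha> * (\<alpha> / 2 * Y) = 1 / 2 * (g * Y - X)" for X Y
    using assms by simp
  ultimately show ?thesis unfolding eff_pot_out'_def by (simp only:)
qed

text \<open>For \<open>a + 1 > c - 1\<close> the Sturm--Liouville argument is out of reach, but then
  \<open>a + 1 - c\<close> lies between -1 and 0 and \<open>F2_log_deriv_ge'\<close> takes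
  over.\<close>

lemma F2_outside_log_deriv_ge:
  assumes q: "0 < q" "q < 1"
  shows "(a + 1) * (a + 1 - c) / (2 * c - 2 * a - 3) * F2 (a + 1) (a + 1 - c) c q \<le> q * F2' (a + 1) (a + 1 - c) c q"
proof -
  have e: "2 * c - 2 * a - 3 = c - (a + 1) - (a + 1 - c) - 1" by simp
  show ?thesis unfolding e
  proof (cases "a + 1 \<le> c - 1")
    case True
    then show "(a + 1) * (a + 1 - c) / (c - (a + 1) - (a + 1 - c) - 1) * F2 (a + 1) (a + 1 - c) c q \<le> q * F2' (a + 1) (a + 1 - c) c q"
      using q a_gt a_lt by (intro F2_log_deriv_ge) auto
  next
    case False
    then show "(a + 1) * (a + 1 - c) / (c - (a + 1) - (a + 1 - c) - 1) * F2 (a + 1) (a + 1 - c) c q \<le> q * F2' (a + 1) (a + 1 - c) c q"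
      using q a_gt a_lt c_pos outside_value cst_pos by (intro F2_log_deriv_ge') auto
  qed
qed

theorem eff_pot_minimal:
  assumes \<alpha>: "\<alpha> > 0" and t1: "\<alpha> \<ge> - cst / (2 * u0 a c 1)" and t2: "\<alpha> \<ge> 2 + 2 * ell" and r: "\<rho> \<ge> 0"
  shows "eff_pot a c (cst / 2) \<alpha> 1 \<le> eff_pot a c (cst / 2) \<alpha> \<rho>"
proof (cases "\<rho> \<le> 1")
  case True
  \<comment> \<open>With \<open>g = cst / 2\<close> the inner derivative vanishes at 1, so it is a
    positive multiple of the difference treated by \<open>F2_pattern\<close>.\<close>
  have "pos_then_neg (eff_pot_in' (cst / 2) \<alpha>)"
  proof (rule pos_then_neg_cong_sgn)
    show "pos_then_neg (\<lambda>x. F2 (a + 1) (a + 2 - c) (c + 1) 1 * x powr (\<alpha> / 2 - 1) - F2 (a + 1) (a + 2 - c) (c + 1) x)"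
    proof (rule F2_pattern)
      show "(a + 1) * (a + 2 - c) / ((c + 1) - (a + 1) - (a + 2 - c) - 1) \<le> \<alpha> / 2 - 1"
        unfolding ell_eq[symmetric] using t2 by simp
    qed (use a_gt a_lt in auto)
    fix x :: real
    have "eff_pot_in' (cst / 2) \<alpha> x = 1 / 2 * ((c - 1 - a) / c) *
       (F2 (a + 1) (a + 2 - c) (c + 1) 1 * x powr (\<alpha> / 2 - 1) - F2 (a + 1) (a + 2 - c) (c + 1) x)"
      unfolding eff_pot_in'_def inside_value[symmetric] by (simp only: algebra_simps)
    moreover have "1 / 2 * ((c - 1 - a) / c) > 0" using a_lt c_pos by simp
    ultimately show "sgn (eff_pot_in' (cst / 2) \<alpha> x) =
       sgn (F2 (a + 1) (a + 2 - c) (c + 1) 1 * x powr (\<alpha> / 2 - 1) - F2 (a + 1) (a + 2 - c) (c + 1) x)"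
      by (simp only: sgn_mult sgn_pos mult_1_left)
  qed
  then have "min (eff_pot a c (cst / 2) \<alpha> 0) (eff_pot a c (cst / 2) \<alpha> 1) \<le> eff_pot a c (cst / 2) \<alpha> \<rho>"
    using r True \<alpha> by (intro pos_then_neg_ge_min[OF eff_pot_DERIV_inside])
      (auto intro!: continuous_on_subset[OF eff_pot_continuous])
  \<comment> \<open>At the origin the total potential is 0, on the sphere it is
    \<open>u0 a c 1 + cst / (2 * \<alpha>)\<close>; comparing them is the first entry of the
    threshold.\<close>
  moreover have "eff_pot a c (cst / 2) \<alpha> 1 \<le> eff_pot a c (cst / 2) \<alpha> 0"
  proof -
    have "cst / (2 * (- u0 a c 1)) \<le> \<alpha>" using t1 by simp
    then have "cst \<le> \<alpha> * (2 * (- u0 a c 1))" using u0_1_neg by (subst (asm) pos_divide_le_eq) auto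
    then have "cst / 2 / \<alpha> \<le> - u0 a c 1" using \<alpha> by (simp add: field_simps)
    then show ?thesis by (simp add: eff_pot_def)
  qed
  ultimately show ?thesis by simp
next
  case False
  show ?thesis
  proof (rule DERIV_nonneg_imp_increasing_open[of 1 \<rho> "eff_pot a c (cst / 2) \<alpha>"])
    fix x assume x: "1 < x" "x < \<rho>"
    let ?y = "- (\<alpha> / 2 + a)" and ?D = "2 * c - 2 * a - 3"
    have D: "?D > 0" using a_lt by simp
    \<comment> \<open>The outer logarithmic derivative and \<open>ell\<close> add up to
      \<open>- (a + 1)\<close>, so the inner condition on \<alpha> is also the outer one.\<close>
    have "?y \<le> (a + 1) * (a + 1 - c) / ?D"
    proof -
      have "(a + 1) * (a + 1 - c) / ?D + ell = - (a + 1)"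
        unfolding ell_def using D by (simp add: add_divide_distrib[symmetric] divide_eq_eq) (simp add: algebra_simps)
      then show ?thesis using t2 by linarith
    qed
    then have "F2 (a + 1) (a + 1 - c) c (1 / x) \<le> F2 (a + 1) (a + 1 - c) c 1 * (1 / x) powr ?y"
      using x a_lt outside_value cst_pos
      by (intro F2_le_powr[OF c_pos _ F2_outside_log_deriv_ge]) auto
    then have "x powr (- a - 1) * F2 (a + 1) (a + 1 - c) c (1 / x) \<le> x powr (- a - 1) * (cst / 2 * (1 / x) powr ?y)"
      unfolding outside_value by (intro mult_left_mono) auto
    also have "(1 / x) powr ?y = x powr (\<alpha> / 2 + a)"
    proof -
      have "1 / x = x powr (- 1)" using x by (simp add: powr_minus_divide)
      then show ?thesis by (simp only: powr_powr) (simp add: add.commute)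
    qed
    also have "x powr (- a - 1) * (cst / 2 * x powr (\<alpha> / 2 + a)) = cst / 2 * x powr (\<alpha> / 2 - 1)"
      by (simp add: powr_add[symmetric] mult_ac)
    finally have "eff_pot_out' (cst / 2) \<alpha> x \<ge> 0" by (simp add: eff_pot_out'_def)
    then show "\<exists>y. (eff_pot a c (cst / 2) \<alpha> has_real_derivative y) (at x) \<and> 0 \<le> y"
      using eff_pot_DERIV_outside[OF \<alpha> x(1)] by blast
  next
    show "continuous_on {1..\<rho>} (eff_pot a c (cst / 2) \<alpha>)"
      by (rule continuous_on_subset[OF eff_pot_continuous[OF \<alpha>]]) auto
  qed (use False in auto)
qed

text \<open>Each conclusion tests minimality in one place: the first derivative on the two sides of
  the sphere bounds g from above and from below, the limit at the origin gives the first entry, and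
  the second derivative just inside the sphere gives the second.\<close>

theorem eff_pot_minimal_imp:
  assumes \<alpha>: "\<alpha> > 0" and min: "\<And>\<rho>. \<rho> > 0 \<Longrightarrow> eff_pot a c g \<alpha> 1 \<le> eff_pot a c g \<alpha> \<rho>"
  shows "g = cst / 2" "\<alpha> \<ge> - cst / (2 * u0 a c 1)" "\<alpha> \<ge> 2 + 2 * ell"
proof -
  let ?G = "F2 (a + 1) (a + 2 - c) (c + 1)"
  let ?k = "(c - 1 - a) / c"
  have contG: "continuous_on {0<..1} ?G"
    using a_lt c_pos by (intro continuous_on_subset[OF F2_continuous_on]) auto
  have contin: "continuous_on {0<..1} (eff_pot_in' g \<alpha>)"
    unfolding eff_pot_in'_def[abs_def] by (intro continuous_intros contG) auto
  have conth: "continuous_on {0<..1} (eff_pot a c g \<alpha>)"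
    by (rule continuous_on_subset[OF eff_pot_continuous[OF \<alpha>]]) auto
  have notpos: "\<not> eventually (\<lambda>x. eff_pot_in' g \<alpha> x > 0) (at_left 1)"
  proof
    assume "eventually (\<lambda>x. eff_pot_in' g \<alpha> x > 0) (at_left 1)"
    from increasing_near_left_end[OF eff_pot_DERIV_inside[OF \<alpha>] conth this]
    obtain e where e: "e < 1" "\<And>x. e < x \<Longrightarrow> x < 1 \<Longrightarrow> eff_pot a c g \<alpha> x < eff_pot a c g \<alpha> 1"
      unfolding eventually_at_left_field by auto
    define x where "x = (max e 0 + 1) / 2"
    have "e < x" "x < 1" "0 < x" using e(1) by (auto simp: x_def)
    then show False using e(2)[of x] min[of x] by auto
  qed
  have "\<not> eff_pot_in' g \<alpha> 1 > 0"
    using order_tendstoD(1)[OF continuous_on_at_left_1[OF contin], of 0] notpos by blast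
  moreover have in1: "eff_pot_in' g \<alpha> 1 = 1 / 2 * (g - cst / 2)"
    unfolding eff_pot_in'_def inside_value by simp
  ultimately have le: "g \<le> cst / 2" by simp
  have contout: "continuous_on {1..} (eff_pot_out' g \<alpha>)"
  proof -
    have "continuous_on {1..} (\<lambda>x. F2 (a + 1) (a + 1 - c) c (1 / x))"
      by (rule continuous_on_compose2[OF F2_continuous_on[OF c_pos, of "a + 1" "a + 1 - c"], of _ "\<lambda>x. 1 / x"])
        (use a_lt in \<open>auto intro!: continuous_intros simp: field_simps\<close>)
    then show ?thesis unfolding eff_pot_out'_def[abs_def] by (intro continuous_intros) auto
  qed
  have "\<not> eff_pot_out' g \<alpha> 1 < 0"
  proof
    assume "eff_pot_out' g \<alpha> 1 < 0"
    then have "eventually (\<lambda>x. eff_pot_out' g \<alpha> x < 0) (at_right 1)"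
      using order_tendstoD(2)[OF continuous_on_at_right_1[OF contout], of 0] by blast
    moreover have "continuous_on {1..} (eff_pot a c g \<alpha>)"
      by (rule continuous_on_subset[OF eff_pot_continuous[OF \<alpha>]]) auto
    ultimately obtain x where "x > 1" "eff_pot a c g \<alpha> x < eff_pot a c g \<alpha> 1"
      using decreasing_near_right_end[OF eff_pot_DERIV_outside[OF \<alpha>]] by blast
    then show False using min[of x] by auto
  qed
  then have "g \<ge> cst / 2" using outside_value by (simp add: eff_pot_out'_def)
  with le show g: "g = cst / 2" by simp
  show "\<alpha> \<ge> - cst / (2 * u0 a c 1)"
  proof -
    \<comment> \<open>Minimality is only assumed against positive \<rho>, that is, against spheres
      of positive radius; the origin is reached by continuity.\<close>
    have "continuous_on {0..1} (eff_pot a c g \<alpha>)"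
      by (rule continuous_on_subset[OF eff_pot_continuous[OF \<alpha>]]) auto
    then have "(eff_pot a c g \<alpha> \<longlongrightarrow> eff_pot a c g \<alpha> 0) (at 0 within {0..1})" by (auto simp: continuous_on)
    then have "(eff_pot a c g \<alpha> \<longlongrightarrow> eff_pot a c g \<alpha> 0) (at_right 0)" by (simp add: at_within_Icc_at_right)
    moreover have "eventually (\<lambda>x. eff_pot a c g \<alpha> 1 \<le> eff_pot a c g \<alpha> x) (at_right 0)"
      unfolding eventually_at_right_field using min by (intro exI[of _ 1]) auto
    ultimately have "eff_pot a c g \<alpha> 1 \<le> eff_pot a c g \<alpha> 0"
      by (intro tendsto_lowerbound) auto
    then have "cst / 2 / \<alpha> \<le> - u0 a c 1" using \<alpha> g by (simp add: eff_pot_def)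
    then have "cst \<le> \<alpha> * (2 * (- u0 a c 1))" using \<alpha> by (simp add: field_simps)
    then have "cst / (2 * (- u0 a c 1)) \<le> \<alpha>" using u0_1_neg by (subst pos_divide_le_eq) auto
    then show ?thesis by simp
  qed
  show "\<alpha> \<ge> 2 + 2 * ell"
  proof (rule ccontr)
    assume "\<not> \<alpha> \<ge> 2 + 2 * ell"
    \<comment> \<open>The inner derivative vanishes at 1 and its own derivative there is
      \<open>cst / 4 * ((\<alpha> / 2 - 1) - ell) < 0\<close>. So it is positive just inside, and
      the total potential would be smaller there than on the sphere.\<close>
    then have b: "\<alpha> / 2 - 1 < ell" by simp
    let ?L' = "\<lambda>x. - (1 / 2 * (g * ((\<alpha> / 2 - 1) * x powr (\<alpha> / 2 - 1 - 1)) - ?k * F2' (a + 1) (a + 2 - c) (c + 1) x))"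
    have "((\<lambda>x. - eff_pot_in' g \<alpha> x) has_real_derivative ?L' x) (at x)" if "0 < x" "x < 1" for x
      unfolding eff_pot_in'_def[abs_def] using that c_pos
      by (intro DERIV_minus DERIV_cmult DERIV_diff F2_DERIV has_real_derivative_powr) auto
    moreover have "continuous_on {0<..1} (\<lambda>x. - eff_pot_in' g \<alpha> x)"
      by (intro continuous_intros contin)
    moreover have "eventually (\<lambda>x. ?L' x > 0) (at_left 1)"
    proof -
      have "continuous_on {0<..1} (F2' (a + 1) (a + 2 - c) (c + 1))"
        unfolding F2'_def[abs_def] using a_lt c_pos
        by (intro continuous_intros continuous_on_subset[OF F2_continuous_on]) auto
      then have "continuous_on {0<..1} ?L'" by (intro continuous_intros) auto
      from continuous_on_at_left_1[OF this] have lim: "(?L' \<longlongrightarrow> ?L' 1) (at_left 1)" .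
      have "F2' (a + 1) (a + 2 - c) (c + 1) 1 = ell * ?G 1"
        unfolding F2'_def ell_eq using a_lt c_pos by (intro F2_1_deriv_ratio) auto
      then have "?k * F2' (a + 1) (a + 2 - c) (c + 1) 1 = ell * (?k * ?G 1)"
        by (simp only: mult_ac)
      then have e: "?k * F2' (a + 1) (a + 2 - c) (c + 1) 1 = ell * (cst / 2)"
        unfolding inside_value .
      have "?L' 1 = cst / 4 * (ell - (\<alpha> / 2 - 1))"
      proof -
        have "- (1 / 2 * (cst / 2 * (B * 1 powr p) - l * (cst / 2))) = cst / 4 * (l - B)" for B l p
          by (simp add: algebra_simps)
        then show ?thesis unfolding e g .
      qed
      moreover have "cst / 4 * (ell - (\<alpha> / 2 - 1)) > 0" using b cst_pos by simp
      ultimately have "?L' 1 > 0" by (simp only:)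
      then show ?thesis using order_tendstoD(1)[OF lim, of 0] by blast
    qed
    ultimately have "eventually (\<lambda>x. - eff_pot_in' g \<alpha> x < - eff_pot_in' g \<alpha> 1) (at_left 1)"
      by (rule increasing_near_left_end)
    moreover have "eff_pot_in' g \<alpha> 1 = 0" using in1 g by (simp only:) simp
    ultimately have "eventually (\<lambda>x. eff_pot_in' g \<alpha> x > 0) (at_left 1)" by simp
    then show False using notpos by blast
  qed
qed

end

section \<open>Gaussian integrals\<close>

text \<open>By induction the lower coefficients vanish, so one can divide by \<open>t ^ n\<close>
  and let t decrease to 0. Positive t suffice, and in the application t is the square of the
  parameter l.\<close>

lemma powser_zero_coeffs:
  fixes c :: "nat \<Rightarrow> real"
  assumes s: "\<And>t. 0 < t \<Longrightarrow> t < 1 \<Longrightarrow> (\<lambda>n. c n * t ^ n) sums 0"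
  shows "c n = 0"
proof (induction n rule: less_induct)
  case (less n)
  have s': "(\<lambda>k. c (k + n) * t ^ k) sums 0" if t: "0 < t" "t < 1" for t
  proof -
    have "(\<lambda>k. c (k + n) * t ^ (k + n)) sums (0 - (\<Sum>i<n. c i * t ^ i))"
      using s[OF t] by (subst sums_iff_shift) simp
    then have "(\<lambda>k. t ^ n * (c (k + n) * t ^ k)) sums 0"
      using less by (simp add: power_add mult_ac)
    then have "(\<lambda>k. inverse (t ^ n) * (t ^ n * (c (k + n) * t ^ k))) sums (inverse (t ^ n) * 0)"
      by (rule sums_mult)
    then show ?thesis using t by (simp add: mult.assoc[symmetric])
  qed
  have "isCont (\<lambda>t. \<Sum>k. c (k + n) * t ^ k) 0"
    by (rule isCont_powser[of _ "1/2"]) (use s'[of "1/2"] in \<open>auto simp: sums_iff\<close>)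
  then have "((\<lambda>t. \<Sum>k. c (k + n) * t ^ k) \<longlongrightarrow> (\<Sum>k. c (k + n) * 0 ^ k)) (at_right 0)"
    by (auto simp: isCont_def intro: tendsto_mono[OF at_le])
  moreover have "eventually (\<lambda>t. (\<Sum>k. c (k + n) * t ^ k) = 0) (at_right 0)"
    unfolding eventually_at_right_field using s' by (intro exI[of _ 1]) (auto simp: sums_iff)
  then have "((\<lambda>t. \<Sum>k. c (k + n) * t ^ k) \<longlongrightarrow> 0) (at_right 0)" by (rule tendsto_eventually)
  ultimately have "(\<Sum>k. c (k + n) * 0 ^ k) = 0"
    using tendsto_unique trivial_limit_at_right_real by blast
  then show ?case using powser_zero[of "\<lambda>k. c (k + n)"] by simp
qed

section \<open>Scaling, translation and polar coordinates for Lebesgue measure\<close>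

lemma nn_integral_lborel_scale:
  fixes f :: "'a::euclidean_space \<Rightarrow> ennreal"
  assumes [measurable]: "f \<in> borel_measurable borel" and c: "c > 0"
  shows "(\<integral>\<^sup>+ y. f y \<partial>lborel) = ennreal (c ^ DIM('a)) * (\<integral>\<^sup>+ y. f (c *\<^sub>R y) \<partial>lborel)"
proof -
  have "(\<integral>\<^sup>+ y. f y \<partial>lborel) = (\<integral>\<^sup>+ y. f y \<partial>density (distr lborel borel (\<lambda>x. 0 + c *\<^sub>R x)) (\<lambda>_. \<bar>c\<bar>^DIM('a)))"
    using lborel_affine[of c "0::'a"] c by simp
  also have "\<dots> = ennreal (c ^ DIM('a)) * (\<integral>\<^sup>+ y. f (c *\<^sub>R y) \<partial>lborel)"
    using c by (subst nn_integral_density) (auto simp: nn_integral_distr nn_integral_cmult)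
  finally show ?thesis .
qed

lemma nn_integral_lborel_translate:
  fixes f :: "'a::euclidean_space \<Rightarrow> ennreal"
  assumes [measurable]: "f \<in> borel_measurable borel"
  shows "(\<integral>\<^sup>+ y. f (y + c) \<partial>lborel) = (\<integral>\<^sup>+ y. f y \<partial>lborel)"
proof -
  have "(\<integral>\<^sup>+ y. f y \<partial>lborel) = (\<integral>\<^sup>+ y. f y \<partial>distr lborel borel ((+) c))"
    by (simp add: lborel_distr_plus)
  also have "\<dots> = (\<integral>\<^sup>+ y. f (y + c) \<partial>lborel)" by (simp add: nn_integral_distr add.commute)
  finally show ?thesis ..
qed

text \<open>Polar coordinates without surface measure: by homogeneity and scaling, the image under
  \<open>norm\<close> of the measure with density f gives \<open>{..<x}\<close> the mass of the unit
  ball times \<open>x ^ d\<close>. This identifies it with a measure of explicit density, since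
  half-lines generate the Borel sets and have finite mass.\<close>

lemma nn_integral_polar:
  fixes f :: "'a::euclidean_space \<Rightarrow> ennreal" and \<psi> :: "real \<Rightarrow> ennreal"
  assumes [measurable]: "f \<in> borel_measurable borel" "\<psi> \<in> borel_measurable borel"
    and hom: "\<And>t y. t > 0 \<Longrightarrow> f (t *\<^sub>R y) = f y"
    and fin: "(\<integral>\<^sup>+ y. f y * indicator (ball 0 1) y \<partial>lborel) < \<infinity>"
  shows "(\<integral>\<^sup>+ y. f y * \<psi> (norm y) \<partial>lborel) = (\<integral>\<^sup>+ y. f y * indicator (ball 0 1) y \<partial>lborel) *
    (\<integral>\<^sup>+ r. ennreal (DIM('a) * r ^ (DIM('a) - 1)) * indicator {0..} r * \<psi> r \<partial>lborel)"
proof -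
  let ?d = "DIM('a)"
  let ?C = "\<integral>\<^sup>+ y. f y * indicator (ball 0 1) y \<partial>lborel"
  let ?w = "\<lambda>r::real. ennreal (?d * r ^ (?d - 1)) * indicator {0..} r"
  let ?M = "distr (density lborel f) borel norm"
  let ?N = "density lborel (\<lambda>r. ?C * ?w r)"
  have M: "emeasure ?M {..<x} = (if x \<le> 0 then 0 else ?C * ennreal (x ^ ?d))" for x
  proof -
    have "emeasure ?M {..<x} = (\<integral>\<^sup>+ y. f y * indicator (ball 0 x) y \<partial>lborel)"
      by (subst emeasure_distr) (auto simp: emeasure_density vimage_def ball_def dist_norm intro!: nn_integral_cong split: split_indicator)
    also have "\<dots> = (if x \<le> 0 then 0 else ?C * ennreal (x ^ ?d))"
    proof (cases "x \<le> 0")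
      case False
      have [measurable]: "ball (0::'a) x \<in> sets borel" by simp
      have "(\<integral>\<^sup>+ y. f y * indicator (ball 0 x) y \<partial>lborel) =
          ennreal (x ^ ?d) * (\<integral>\<^sup>+ y. f (x *\<^sub>R y) * indicator (ball 0 x) (x *\<^sub>R y) \<partial>lborel)"
        using False by (intro nn_integral_lborel_scale) (measurable, use False in \<open>auto intro!: open_Collect_less continuous_intros\<close>)
      also have "(\<integral>\<^sup>+ y. f (x *\<^sub>R y) * indicator (ball 0 x) (x *\<^sub>R y) \<partial>lborel) = ?C"
        using False by (intro nn_integral_cong) (auto simp: hom split: split_indicator)
      finally show ?thesis using False by (simp add: mult.commute)
    qed (simp add: ball_empty)
    finally show ?thesis .
  qed
  have N: "emeasure ?N {..<x} = (if x \<le> 0 then 0 else ?C * ennreal (x ^ ?d))" for x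
  proof -
    have "emeasure ?N {..<x} = (\<integral>\<^sup>+ r. ?C * (?w r * indicator {..<x} r) \<partial>lborel)"
      by (subst emeasure_density) (auto simp: mult.assoc)
    also have "\<dots> = ?C * (\<integral>\<^sup>+ r. ?w r * indicator {..<x} r \<partial>lborel)"
      by (rule nn_integral_cmult) auto
    also have "(\<integral>\<^sup>+ r. ?w r * indicator {..<x} r \<partial>lborel) = (if x \<le> 0 then 0 else ennreal (x ^ ?d))"
    proof (cases "x \<le> 0")
      case True
      then have "(\<integral>\<^sup>+ r. ?w r * indicator {..<x} r \<partial>lborel) = (\<integral>\<^sup>+ (r::real). 0 \<partial>lborel)"
        by (intro nn_integral_cong) (auto split: split_indicator)
      then show ?thesis using True by simp
    next
      case False
      have "(\<integral>\<^sup>+ r. ?w r * indicator {..<x} r \<partial>lborel) = (\<integral>\<^sup>+ r. ennreal (?d * r ^ (?d - 1)) * indicator {0..x} r \<partial>lborel)"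
      proof (rule nn_integral_cong_AE)
        show "AE r in lborel. ?w r * indicator {..<x} r = ennreal (?d * r ^ (?d - 1)) * indicator {0..x} r"
          using AE_lborel_singleton[of x] by eventually_elim (auto split: split_indicator)
      qed
      also have "\<dots> = ennreal (x ^ ?d - 0 ^ ?d)"
        using False by (intro nn_integral_FTC_Icc) (auto intro!: derivative_eq_intros)
      finally show ?thesis using False by simp
    qed
    finally show ?thesis by simp
  qed
  have "?M = ?N"
  proof (rule measure_eqI_generator_eq[where E = "range lessThan" and \<Omega> = UNIV and A = "\<lambda>i. {..<real i}"])
    show "Int_stable (range (lessThan :: real \<Rightarrow> _))"
    proof (rule Int_stableI)
      fix S T :: "real set" assume "S \<in> range lessThan" "T \<in> range lessThan"
      then obtain x y where "S = {..<x}" "T = {..<y}" by blast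
      then have "S \<inter> T = {..<min x y}" by auto
      then show "S \<inter> T \<in> range lessThan" by blast
    qed
    show "sets ?M = sigma_sets UNIV (range lessThan)" "sets ?N = sigma_sets UNIV (range lessThan)"
      by (simp_all add: borel_Iio)
    show "(\<Union>i. {..<real i}) = UNIV" using reals_Archimedean2 by auto
    fix i show "emeasure ?M {..<real i} \<noteq> \<infinity>"
      unfolding M using fin by (auto simp: ennreal_mult_eq_top_iff)
  next
    fix X :: "real set" assume "X \<in> range lessThan"
    then obtain x where "X = {..<x}" by blast
    then show "emeasure ?M X = emeasure ?N X" by (simp only: M N)
  qed auto
  then have "(\<integral>\<^sup>+ r. \<psi> r \<partial>?M) = (\<integral>\<^sup>+ r. \<psi> r \<partial>?N)" by simp
  moreover have "(\<integral>\<^sup>+ r. \<psi> r \<partial>?M) = (\<integral>\<^sup>+ y. f y * \<psi> (norm y) \<partial>lborel)"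
    by (simp add: nn_integral_distr nn_integral_density)
  moreover have "(\<integral>\<^sup>+ r. \<psi> r \<partial>?N) = ?C * (\<integral>\<^sup>+ r. ?w r * \<psi> r \<partial>lborel)"
    by (simp add: nn_integral_density nn_integral_cmult[symmetric] mult.assoc)
  ultimately show ?thesis by simp
qed

text \<open>This is \<open>Gamma ((k + 1) / 2) / 2\<close>, in the parity-dependent form of
  \<open>gaussian_moment_even_pos\<close> and \<open>gaussian_moment_odd_pos\<close>.\<close>

definition gauss_mom :: "nat \<Rightarrow> real" where
  "gauss_mom k = (if even k then sqrt pi / 2 * (fact k / (2 ^ k * fact (k div 2))) else fact (k div 2) / 2)"

lemma gauss_mom_pos: "gauss_mom k > 0"
  by (simp add: gauss_mom_def)

lemma nn_integral_gauss_mom: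
  "(\<integral>\<^sup>+ r. ennreal (exp (- r\<^sup>2) * r ^ k) * indicator {0..} r \<partial>lborel) = ennreal (gauss_mom k)"
proof -
  have b: "has_bochner_integral lborel (\<lambda>r. indicator {0..} r *\<^sub>R (exp (- r\<^sup>2) * r ^ k)) (gauss_mom k)"
  proof (cases "even k")
    case True
    then show ?thesis using gaussian_moment_even_pos[of "k div 2"] by (simp add: gauss_mom_def)
  next
    case False
    then show ?thesis using gaussian_moment_odd_pos[of "k div 2"] by (simp add: gauss_mom_def)
  qed
  have "(\<integral>\<^sup>+ r. ennreal (exp (- r\<^sup>2) * r ^ k) * indicator {0..} r \<partial>lborel) =
      (\<integral>\<^sup>+ r. ennreal (indicator {0..} r *\<^sub>R (exp (- r\<^sup>2) * r ^ k)) \<partial>lborel)"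
    by (intro nn_integral_cong) (auto split: split_indicator)
  also have "\<dots> = ennreal (gauss_mom k)"
    using b by (subst nn_integral_eq_integral) (auto simp: has_bochner_integral_iff split: split_indicator)
  finally show ?thesis .
qed

lemma gauss_mom_Suc_Suc: "gauss_mom (Suc (Suc k)) = (real k + 1) / 2 * gauss_mom k"
proof (cases "even k")
  case True
  then obtain m where k: "k = 2 * m" by (elim evenE)
  have "Suc (Suc k) div 2 = Suc m" "k div 2 = m" by (simp_all add: k)
  moreover have "fact (Suc (Suc k)) = (real k + 2) * ((real k + 1) * fact k)"
    by (simp add: algebra_simps)
  moreover have "fact (Suc m) = (real k + 2) / 2 * fact m" by (simp add: k field_simps)
  ultimately show ?thesis using True
    unfolding gauss_mom_def by (simp del: fact_Suc) (simp add: divide_simps)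
next
  case False
  then obtain m where k: "k = 2 * m + 1" by (elim oddE)
  then show ?thesis by (simp add: gauss_mom_def field_simps)
qed

text \<open>For \<open>k = d - 1\<close> the Pochhammer symbol has base \<open>d / 2\<close>; it
  becomes the denominator of the moments of the sphere.\<close>

lemma gauss_mom_shift: "gauss_mom (k + 2 * j) = pochhammer ((real k + 1) / 2) j * gauss_mom k"
proof (induction j)
  case (Suc j)
  have "gauss_mom (k + 2 * Suc j) = gauss_mom (Suc (Suc (k + 2 * j)))" by simp
  also have "\<dots> = (real (k + 2 * j) + 1) / 2 * gauss_mom (k + 2 * j)" by (rule gauss_mom_Suc_Suc)
  also have "\<dots> = ((real k + 1) / 2 + real j) * (pochhammer ((real k + 1) / 2) j * gauss_mom k)"
    unfolding Suc by (simp add: field_simps)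
  finally show ?case by (simp add: pochhammer_Suc)
qed simp

definition gauss_mass :: "'a::euclidean_space itself \<Rightarrow> real" where
  "gauss_mass _ = enn2real (\<integral>\<^sup>+ (y::'a). ennreal (exp (- (norm y)\<^sup>2)) \<partial>lborel)"

lemma nn_integral_gauss:
  "(\<integral>\<^sup>+ (y::'a::euclidean_space). ennreal (exp (- (norm y)\<^sup>2)) \<partial>lborel) = ennreal (gauss_mass TYPE('a))"
  and gauss_mass_pos: "gauss_mass TYPE('a) > 0"
proof -
  let ?I = "\<integral>\<^sup>+ (y::'a). ennreal (exp (- (norm y)\<^sup>2)) \<partial>lborel"
  have vol: "(\<integral>\<^sup>+ (y::'a). 1 * indicator (ball 0 1) y \<partial>lborel) = ennreal (unit_ball_vol (real DIM('a)))"
    by (simp add: emeasure_ball)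
  have "?I = (\<integral>\<^sup>+ (y::'a). 1 * ennreal (exp (- (norm y)\<^sup>2)) \<partial>lborel)" by simp
  also have "\<dots> = (\<integral>\<^sup>+ (y::'a). 1 * indicator (ball 0 1) y \<partial>lborel) *
    (\<integral>\<^sup>+ r. ennreal (DIM('a) * r ^ (DIM('a) - 1)) * indicator {0..} r * ennreal (exp (- r\<^sup>2)) \<partial>lborel)"
    by (intro nn_integral_polar) (auto simp: emeasure_ball)
  also have "(\<integral>\<^sup>+ r. ennreal (DIM('a) * r ^ (DIM('a) - 1)) * indicator {0..} r * ennreal (exp (- r\<^sup>2)) \<partial>lborel)
     = (\<integral>\<^sup>+ r. ennreal DIM('a) * (ennreal (exp (- r\<^sup>2) * r ^ (DIM('a) - 1)) * indicator {0..} r) \<partial>lborel)"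
    by (intro nn_integral_cong) (auto simp: ennreal_mult[symmetric] mult_ac split: split_indicator)
  also have "\<dots> = ennreal DIM('a) * ennreal (gauss_mom (DIM('a) - 1))"
    by (subst nn_integral_cmult) (auto simp: nn_integral_gauss_mom)
  finally have I: "?I = ennreal (unit_ball_vol (real DIM('a)) * (DIM('a) * gauss_mom (DIM('a) - 1)))"
    unfolding vol by (simp add: ennreal_mult'' gauss_mom_pos less_imp_le)
  moreover have pos: "unit_ball_vol (real DIM('a)) * (DIM('a) * gauss_mom (DIM('a) - 1)) > 0"
    by (intro mult_pos_pos gauss_mom_pos) auto
  ultimately show "gauss_mass TYPE('a) > 0" "?I = ennreal (gauss_mass TYPE('a))"
    unfolding gauss_mass_def by auto
qed

lemma cosh_sums_even: "(\<lambda>j. (x::real) ^ (2 * j) / fact (2 * j)) sums cosh x"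
proof -
  have "(\<lambda>n. if even n then x ^ n /\<^sub>R fact n else 0) sums cosh x" by (rule cosh_converges)
  then have "(\<lambda>n. (if even (2 * n) then x ^ (2 * n) /\<^sub>R fact (2 * n) else 0)) sums cosh x"
    by (subst sums_mono_reindex[of "\<lambda>n. 2 * n"]) (auto simp: strict_mono_def elim!: evenE)
  then show ?thesis by (simp add: divide_inverse mult.commute)
qed

text \<open>
  The moments of the Gaussian in the direction \<open>x\<close> depend on \<open>norm x\<close> only, because completing the
  square evaluates their generating function by translation invariance alone.
\<close>

lemma gauss_cosh:
  fixes x :: "'a::euclidean_space"
  shows "(\<integral>\<^sup>+ y. ennreal (cosh (l * (x \<bullet> y)) * exp (- (norm y)\<^sup>2)) \<partial>lborel) =
    ennreal (exp (l\<^sup>2 * (norm x)\<^sup>2 / 4) * gauss_mass TYPE('a))"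
proof -
  have e: "(\<integral>\<^sup>+ y. ennreal (exp (m * (x \<bullet> y)) * exp (- (norm y)\<^sup>2)) \<partial>lborel) =
      ennreal (exp (m\<^sup>2 * (norm x)\<^sup>2 / 4) * gauss_mass TYPE('a))" for m
  proof -
    have n: "(norm (y + c *\<^sub>R x))\<^sup>2 = (norm y)\<^sup>2 + 2 * c * (x \<bullet> y) + c\<^sup>2 * (norm x)\<^sup>2" for y c
      unfolding power2_norm_eq_inner
      by (simp add: inner_add_left inner_add_right inner_commute[of y x] power2_eq_square algebra_simps)
    have sq: "m * (x \<bullet> y) + - (norm y)\<^sup>2 = m\<^sup>2 * (norm x)\<^sup>2 / 4 + - (norm (y + (- (m / 2)) *\<^sub>R x))\<^sup>2" for y
      unfolding n by (simp add: power2_eq_square)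
    have "(\<integral>\<^sup>+ y. ennreal (exp (m * (x \<bullet> y)) * exp (- (norm y)\<^sup>2)) \<partial>lborel) =
      (\<integral>\<^sup>+ y. ennreal (exp (m\<^sup>2 * (norm x)\<^sup>2 / 4)) * ennreal (exp (- (norm (y + (- (m / 2)) *\<^sub>R x))\<^sup>2)) \<partial>lborel)"
      unfolding exp_add[symmetric] sq by (simp only: exp_add ennreal_mult''[OF exp_ge_zero])
    also have "\<dots> = ennreal (exp (m\<^sup>2 * (norm x)\<^sup>2 / 4)) * (\<integral>\<^sup>+ y. ennreal (exp (- (norm (y + (- (m / 2)) *\<^sub>R x))\<^sup>2)) \<partial>lborel)"
      by (rule nn_integral_cmult) auto
    also have "(\<integral>\<^sup>+ y. ennreal (exp (- (norm (y + (- (m / 2)) *\<^sub>R x))\<^sup>2)) \<partial>lborel) = ennreal (gauss_mass TYPE('a))"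
      by (subst nn_integral_lborel_translate[where f = "\<lambda>y. ennreal (exp (- (norm y)\<^sup>2))"]) (auto simp: nn_integral_gauss)
    finally show ?thesis by (simp only: ennreal_mult''[OF less_imp_le[OF gauss_mass_pos]])
  qed
  have "ennreal (cosh (l * (x \<bullet> y)) * exp (- (norm y)\<^sup>2)) =
    ennreal (1 / 2) * (ennreal (exp (l * (x \<bullet> y)) * exp (- (norm y)\<^sup>2)) + ennreal (exp ((- l) * (x \<bullet> y)) * exp (- (norm y)\<^sup>2)))" for y
    by (subst ennreal_plus[symmetric], simp, simp, subst ennreal_mult''[symmetric])
      (auto simp: cosh_def algebra_simps)
  then have "(\<integral>\<^sup>+ y. ennreal (cosh (l * (x \<bullet> y)) * exp (- (norm y)\<^sup>2)) \<partial>lborel) =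
     ennreal (1 / 2) * ((\<integral>\<^sup>+ y. ennreal (exp (l * (x \<bullet> y)) * exp (- (norm y)\<^sup>2)) \<partial>lborel)
       + (\<integral>\<^sup>+ y. ennreal (exp ((- l) * (x \<bullet> y)) * exp (- (norm y)\<^sup>2)) \<partial>lborel))"
    by (simp only:) (subst nn_integral_cmult, auto simp: nn_integral_add)
  also have "\<dots> = ennreal (exp (l\<^sup>2 * (norm x)\<^sup>2 / 4) * gauss_mass TYPE('a))"
  proof -
    have half: "ennreal (1 / 2) * (ennreal B + ennreal B) = ennreal B" if "B \<ge> 0" for B
    proof -
      have "ennreal B + ennreal B = ennreal (B + B)" using that that by (rule ennreal_plus[symmetric])
      moreover have "ennreal (1 / 2) * ennreal (B + B) = ennreal (1 / 2 * (B + B))"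
        using that by (intro ennreal_mult[symmetric]) auto
      moreover have "1 / 2 * (B + B) = B" by simp
      ultimately show ?thesis by (simp only:)
    qed
    have "(- l)\<^sup>2 = l\<^sup>2" by simp
    then show ?thesis
      unfolding e by (simp only:) (rule half, use gauss_mass_pos[where 'a='a] in \<open>simp add: less_imp_le\<close>)
  qed
  finally show ?thesis .
qed

text \<open>Both sides of \<open>gauss_cosh\<close> are power series in
  \<open>t = l\<^sup>2\<close>. The left one has the moments divided by \<open>fact (2 * j)\<close>
  as coefficients, so comparing coefficients gives each moment.\<close>

lemma nn_integral_gauss_inner_power:
  fixes x :: "'a::euclidean_space"
  shows "(\<integral>\<^sup>+ y. ennreal ((x \<bullet> y) ^ (2 * j) * exp (- (norm y)\<^sup>2)) \<partial>lborel) =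
    ennreal ((norm x) ^ (2 * j) * pochhammer (1 / 2) j * gauss_mass TYPE('a))"
proof -
  let ?J = "gauss_mass TYPE('a)"
  define M where "M j = (\<integral>\<^sup>+ y. ennreal ((x \<bullet> y) ^ (2 * j) * exp (- (norm y)\<^sup>2)) \<partial>lborel)" for j
  have ser: "(\<Sum>j. ennreal (l ^ (2 * j) / fact (2 * j)) * M j) = ennreal (exp (l\<^sup>2 * (norm x)\<^sup>2 / 4) * ?J)" for l
  proof -
    have "ennreal (exp (l\<^sup>2 * (norm x)\<^sup>2 / 4) * ?J) =
      (\<integral>\<^sup>+ y. (\<Sum>j. ennreal (l ^ (2 * j) / fact (2 * j) * ((x \<bullet> y) ^ (2 * j) * exp (- (norm y)\<^sup>2)))) \<partial>lborel)"
      unfolding gauss_cosh[symmetric]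
    proof (intro nn_integral_cong)
      fix y
      have "(\<lambda>j. (l * (x \<bullet> y)) ^ (2 * j) / fact (2 * j) * exp (- (norm y)\<^sup>2)) sums (cosh (l * (x \<bullet> y)) * exp (- (norm y)\<^sup>2))"
        by (intro sums_mult2 cosh_sums_even)
      then have "(\<lambda>j. l ^ (2 * j) / fact (2 * j) * ((x \<bullet> y) ^ (2 * j) * exp (- (norm y)\<^sup>2))) sums (cosh (l * (x \<bullet> y)) * exp (- (norm y)\<^sup>2))"
        by (simp add: power_mult_distrib mult_ac)
      then show "ennreal (cosh (l * (x \<bullet> y)) * exp (- (norm y)\<^sup>2)) =
         (\<Sum>j. ennreal (l ^ (2 * j) / fact (2 * j) * ((x \<bullet> y) ^ (2 * j) * exp (- (norm y)\<^sup>2))))"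
        by (subst suminf_ennreal_eq[symmetric]) (auto simp: power_mult)
    qed
    also have "\<dots> = (\<Sum>j. \<integral>\<^sup>+ y. ennreal (l ^ (2 * j) / fact (2 * j) * ((x \<bullet> y) ^ (2 * j) * exp (- (norm y)\<^sup>2))) \<partial>lborel)"
      by (rule nn_integral_suminf) auto
    also have "\<dots> = (\<Sum>j. ennreal (l ^ (2 * j) / fact (2 * j)) * M j)"
    proof (intro arg_cong[where f = suminf] ext)
      fix j
      have "(\<integral>\<^sup>+ y. ennreal (l ^ (2 * j) / fact (2 * j) * ((x \<bullet> y) ^ (2 * j) * exp (- (norm y)\<^sup>2))) \<partial>lborel) =
        (\<integral>\<^sup>+ y. ennreal (l ^ (2 * j) / fact (2 * j)) * ennreal ((x \<bullet> y) ^ (2 * j) * exp (- (norm y)\<^sup>2)) \<partial>lborel)"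
        by (intro nn_integral_cong ennreal_mult) (auto simp: power_mult)
      also have "\<dots> = ennreal (l ^ (2 * j) / fact (2 * j)) * M j"
        unfolding M_def by (rule nn_integral_cmult) auto
      finally show "(\<integral>\<^sup>+ y. ennreal (l ^ (2 * j) / fact (2 * j) * ((x \<bullet> y) ^ (2 * j) * exp (- (norm y)\<^sup>2))) \<partial>lborel) =
         ennreal (l ^ (2 * j) / fact (2 * j)) * M j" .
    qed
    finally show ?thesis ..
  qed
  \<comment> \<open>The terms are nonnegative, so the finite total at \<open>l = 1\<close> bounds
    every single moment; only then can real power series be compared.\<close>
  have M_fin: "M j < top" for j
  proof -
    have "ennreal (1 ^ (2 * j) / fact (2 * j)) * M j \<le> (\<Sum>j. ennreal (1 ^ (2 * j) / fact (2 * j)) * M j)"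
      using sum_le_suminf[of "\<lambda>j. ennreal (1 ^ (2 * j) / fact (2 * j)) * M j" "{j}"] by simp
    also have "\<dots> < top" unfolding ser by simp
    finally show ?thesis by (auto simp: ennreal_mult_less_top)
  qed
  define m where "m j = enn2real (M j)" for j
  have Mm: "M j = ennreal (m j)" and m0: "m j \<ge> 0" for j
    using M_fin[of j] by (auto simp: m_def)
  have "(\<lambda>j. (m j / fact (2 * j) - (norm x ^ 2 / 4) ^ j / fact j * ?J) * t ^ j) sums 0" if t: "0 < t" for t
  proof -
    have S1: "(\<lambda>j. m j / fact (2 * j) * t ^ j) sums (exp (t * (norm x)\<^sup>2 / 4) * ?J)"
    proof -
      have "(\<Sum>j. ennreal (m j / fact (2 * j) * t ^ j)) = ennreal (exp (t * (norm x)\<^sup>2 / 4) * ?J)"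
      proof -
        have "(sqrt t ^ j)\<^sup>2 = t ^ j" for j
          using t by (simp add: power2_eq_square power_mult_distrib[symmetric])
        then have e: "sqrt t ^ (2 * j) = t ^ j" for j
          by (metis mult.commute power_mult)
        show ?thesis
          using ser[of "sqrt t"] t m0 unfolding Mm e
          by (simp add: ennreal_mult''[symmetric] mult_ac)
      qed
      then show ?thesis
        using t m0 gauss_mass_pos[where 'a='a]
        by (intro sums_ennreal[THEN iffD1] ) (auto simp: sums_iff less_imp_le)
    qed
    have S2: "(\<lambda>j. (t * (norm x)\<^sup>2 / 4) ^ j /\<^sub>R fact j * ?J) sums (exp (t * (norm x)\<^sup>2 / 4) * ?J)"
      by (intro sums_mult2 exp_converges)
    from sums_diff[OF S1 S2]
    have "(\<lambda>j. m j / fact (2 * j) * t ^ j - (t * (norm x)\<^sup>2 / 4) ^ j /\<^sub>R fact j * ?J) sums 0" by simp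
    moreover have "m j / fact (2 * j) * t ^ j - (t * (norm x)\<^sup>2 / 4) ^ j /\<^sub>R fact j * ?J =
        (m j / fact (2 * j) - ((norm x)\<^sup>2 / 4) ^ j / fact j * ?J) * t ^ j" for j
    proof -
      have "(t * (norm x)\<^sup>2 / 4) ^ j = t ^ j * ((norm x)\<^sup>2 / 4) ^ j"
        using power_mult_distrib[of t "(norm x)\<^sup>2 / 4" j] by simp
      moreover have "A - T * Q /\<^sub>R f * J = A - Q / f * J * T" for A T Q f J :: real
        by (simp add: divide_inverse)
      ultimately show ?thesis by (simp only: left_diff_distrib)
    qed
    ultimately show ?thesis by simp
  qed
  from powser_zero_coeffs[OF this, of j] have "m j / fact (2 * j) = (norm x ^ 2 / 4) ^ j / fact j * ?J"
    by simp
  then have "m j = fact (2 * j) * ((norm x ^ 2 / 4) ^ j / fact j * ?J)"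
    by (simp add: divide_eq_eq mult.commute)
  also have "fact (2 * j) = 4 ^ j * pochhammer (1 / 2) j * (fact j :: real)"
    using fact_double[of j, where 'a=real] by (simp add: power_mult)
  finally have "m j = norm x ^ (2 * j) * pochhammer (1 / 2) j * ?J"
    by (simp add: power_divide power_mult)
  then show ?thesis using Mm[of j] unfolding M_def by simp
qed

section \<open>Uniform measure on the sphere\<close>

lemma uniform_sphere_prob: "prob_space (uniform_sphere R :: 'a::euclidean_space measure)"
  and sets_uniform_sphere [measurable_cong, simp]: "sets (uniform_sphere R :: 'a measure) = sets borel"
  and space_uniform_sphere [simp]: "space (uniform_sphere R :: 'a measure) = UNIV"
  using uniform_sphere_borel_probs[of R, where 'a='a]
  by (auto simp: borel_probs_def dest: sets_eq_imp_space_eq)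

lemma uniform_sphere_scale:
  "uniform_sphere R = distr (uniform_sphere 1) borel (\<lambda>x::'a::euclidean_space. R *\<^sub>R x)"
  unfolding uniform_sphere_def by (subst distr_distr) (auto simp: comp_def)

lemma nn_integral_uniform_sphere:
  fixes f :: "'a::euclidean_space \<Rightarrow> ennreal"
  assumes [measurable]: "f \<in> borel_measurable borel"
  shows "(\<integral>\<^sup>+ y. f y \<partial>uniform_sphere 1) =
    (\<integral>\<^sup>+ y. f ((1 / norm y) *\<^sub>R y) * indicator (ball 0 1) y \<partial>lborel) / ennreal (unit_ball_vol (real DIM('a)))"
  unfolding uniform_sphere_def
  by (subst nn_integral_distr, measurable)
    (subst nn_integral_uniform_measure, auto simp: emeasure_ball)

text \<open>A Gaussian moment in the direction x splits by polar coordinates into the spherical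
  moment and a radial one. The case \<open>j = 0\<close> supplies the normalization, and the
  Gaussian mass cancels.\<close>

lemma sphere_moment_even:
  fixes x :: "'a::euclidean_space"
  shows "(\<integral>\<^sup>+ y. ennreal ((x \<bullet> y) ^ (2 * j)) \<partial>uniform_sphere 1) =
    ennreal ((norm x) ^ (2 * j) * (pochhammer (1 / 2) j / pochhammer (real DIM('a) / 2) j))"
proof -
  let ?d = "DIM('a)"
  let ?v = "unit_ball_vol (real ?d)"
  let ?J = "gauss_mass TYPE('a)"
  have v: "?v > 0" by simp
  have polar: "(\<integral>\<^sup>+ y. ennreal ((x \<bullet> ((1 / norm y) *\<^sub>R y)) ^ (2 * j)) * indicator (ball 0 1) y \<partial>lborel) *
      ennreal (?d * gauss_mom (?d - 1 + 2 * j)) = ennreal ((norm x) ^ (2 * j) * pochhammer (1 / 2) j * ?J)" for j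
  proof -
    let ?f = "\<lambda>y. ennreal ((x \<bullet> ((1 / norm y) *\<^sub>R y)) ^ (2 * j))"
    have [measurable]: "?f \<in> borel_measurable borel" by measurable
    have fin: "(\<integral>\<^sup>+ y. ?f y * indicator (ball 0 1) y \<partial>lborel) < \<infinity>"
    proof -
      have "?f y \<le> ennreal ((norm x) ^ (2 * j))" for y
      proof -
        have "\<bar>x \<bullet> ((1 / norm y) *\<^sub>R y)\<bar> \<le> norm x * norm ((1 / norm y) *\<^sub>R y)" by (rule Cauchy_Schwarz_ineq2)
        also have "\<dots> \<le> norm x" by (simp add: mult_left_le)
        finally have "\<bar>x \<bullet> ((1 / norm y) *\<^sub>R y)\<bar> ^ (2 * j) \<le> norm x ^ (2 * j)" by (intro power_mono) auto
        moreover have "\<bar>x \<bullet> ((1 / norm y) *\<^sub>R y)\<bar> ^ (2 * j) = (x \<bullet> ((1 / norm y) *\<^sub>R y)) ^ (2 * j)"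
          by (rule power_even_abs) simp
        ultimately show ?thesis by (intro ennreal_leI) (simp only:)
      qed
      then have "(\<integral>\<^sup>+ y. ?f y * indicator (ball 0 1) y \<partial>lborel) \<le> (\<integral>\<^sup>+ y. ennreal ((norm x) ^ (2 * j)) * indicator (ball (0::'a) 1) y \<partial>lborel)"
        by (intro nn_integral_mono mult_right_mono) auto
      also have "\<dots> < \<infinity>" by (simp add: nn_integral_cmult_indicator emeasure_ball ennreal_mult_less_top)
      finally show ?thesis .
    qed
    have "ennreal ((norm x) ^ (2 * j) * pochhammer (1 / 2) j * ?J) =
        (\<integral>\<^sup>+ y. ?f y * ennreal (norm y ^ (2 * j) * exp (- (norm y)\<^sup>2)) \<partial>lborel)"
      unfolding nn_integral_gauss_inner_power[symmetric]
    proof (intro nn_integral_cong)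
      fix y :: 'a
      have "(x \<bullet> ((1 / norm y) *\<^sub>R y)) ^ (2 * j) * norm y ^ (2 * j) = (x \<bullet> y) ^ (2 * j)"
        by (cases "y = 0") (auto simp: power_mult_distrib[symmetric])
      then show "ennreal ((x \<bullet> y) ^ (2 * j) * exp (- (norm y)\<^sup>2)) = ?f y * ennreal (norm y ^ (2 * j) * exp (- (norm y)\<^sup>2))"
        by (subst ennreal_mult[symmetric]) (auto simp: mult.assoc[symmetric] power_mult)
    qed
    also have "\<dots> = (\<integral>\<^sup>+ y. ?f y * indicator (ball 0 1) y \<partial>lborel) *
        (\<integral>\<^sup>+ r. ennreal (?d * r ^ (?d - 1)) * indicator {0..} r * ennreal (r ^ (2 * j) * exp (- r\<^sup>2)) \<partial>lborel)"
      by (intro nn_integral_polar[where \<psi> = "\<lambda>r. ennreal (r ^ (2 * j) * exp (- r\<^sup>2))"] fin) auto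
    also have "(\<integral>\<^sup>+ r. ennreal (?d * r ^ (?d - 1)) * indicator {0..} r * ennreal (r ^ (2 * j) * exp (- r\<^sup>2)) \<partial>lborel)
       = (\<integral>\<^sup>+ r. ennreal ?d * (ennreal (exp (- r\<^sup>2) * r ^ (?d - 1 + 2 * j)) * indicator {0..} r) \<partial>lborel)"
      unfolding power_add by (intro nn_integral_cong) (auto simp: ennreal_mult[symmetric] mult_ac split: split_indicator)
    also have "\<dots> = ennreal ?d * ennreal (gauss_mom (?d - 1 + 2 * j))"
      by (subst nn_integral_cmult) (auto simp: nn_integral_gauss_mom)
    also have "\<dots> = ennreal (?d * gauss_mom (?d - 1 + 2 * j))"
      using gauss_mom_pos[of "?d - 1 + 2 * j"] by (subst ennreal_mult) auto
    finally show ?thesis ..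
  qed
  have d1: "real (?d - 1) + 1 = real ?d" by (simp add: of_nat_diff)
  have J: "?v * (?d * gauss_mom (?d - 1)) = ?J"
  proof -
    have "(\<integral>\<^sup>+ y. ennreal ((x \<bullet> ((1 / norm y) *\<^sub>R y)) ^ (2 * 0)) * indicator (ball 0 1) y \<partial>lborel) = ennreal ?v"
      by (simp add: emeasure_ball)
    then have "ennreal ?v * ennreal (?d * gauss_mom (?d - 1)) = ennreal ?J"
      using polar[of 0] by simp
    then show ?thesis
      using gauss_mom_pos[of "?d - 1"] gauss_mass_pos[where 'a='a]
      by (subst (asm) ennreal_mult[symmetric]) (auto simp: less_imp_le)
  qed
  let ?C = "\<integral>\<^sup>+ y. ennreal ((x \<bullet> ((1 / norm y) *\<^sub>R y)) ^ (2 * j)) * indicator (ball 0 1) y \<partial>lborel"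
  define P where "P = pochhammer (real ?d / 2) j"
  have P: "P > 0" unfolding P_def by (intro pochhammer_pos) auto
  define I where "I = ?d * gauss_mom (?d - 1)"
  have I: "I > 0" unfolding I_def using gauss_mom_pos[of "?d - 1"] by simp
  have e0: "?d * gauss_mom (?d - 1 + 2 * j) = P * I"
    unfolding gauss_mom_shift d1 P_def I_def by simp
  have J': "?J = ?v * I" using J unfolding I_def ..
  have e: "?C * ennreal (P * I) = ennreal ((norm x) ^ (2 * j) * pochhammer (1 / 2) j * (?v * I))"
    using polar[of j] unfolding e0 J' .
  have "?C = ?C * ennreal (P * I) / ennreal (P * I)"
    using P I by (simp add: ennreal_mult_divide_eq)
  also have "\<dots> = ennreal ((norm x) ^ (2 * j) * pochhammer (1 / 2) j * (?v * I) / (P * I))"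
    unfolding e using P I v by (intro divide_ennreal) (auto intro!: mult_nonneg_nonneg pochhammer_nonneg)
  finally have C: "?C = ennreal ((norm x) ^ (2 * j) * pochhammer (1 / 2) j * ?v / P)"
    using I by (simp add: mult_ac)
  have "(\<integral>\<^sup>+ y. ennreal ((x \<bullet> y) ^ (2 * j)) \<partial>uniform_sphere 1) = ?C / ennreal ?v"
    by (rule nn_integral_uniform_sphere) measurable
  also have "\<dots> = ennreal ((norm x) ^ (2 * j) * pochhammer (1 / 2) j * ?v / P / ?v)"
    unfolding C using P v by (intro divide_ennreal) (auto intro!: divide_nonneg_nonneg mult_nonneg_nonneg pochhammer_nonneg)
  finally show ?thesis using v unfolding P_def by simp
qed

lemma AE_sphere_norm: "AE y in uniform_sphere 1. norm (y::'a::euclidean_space) = 1"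
  using AE_uniform_sphere[of 1, where 'a='a] by simp

lemma integrable_bounded_sphere:
  fixes f :: "'a::euclidean_space \<Rightarrow> real"
  assumes [measurable]: "f \<in> borel_measurable borel" and b: "\<And>y. norm y = 1 \<Longrightarrow> \<bar>f y\<bar> \<le> B"
  shows "integrable (uniform_sphere 1) f"
proof -
  interpret prob_space "uniform_sphere 1 :: 'a measure" by (rule uniform_sphere_prob)
  show ?thesis
    by (rule integrable_const_bound[where B = B]) (use AE_sphere_norm b in \<open>auto elim!: eventually_mono\<close>)
qed

lemma integrable_sphere_inner_power:
  fixes x :: "'a::euclidean_space"
  shows "integrable (uniform_sphere 1) (\<lambda>y. (x \<bullet> y) ^ n)"
proof (rule integrable_bounded_sphere)
  fix y :: 'a assume "norm y = 1"
  then have "\<bar>x \<bullet> y\<bar> \<le> norm x" using Cauchy_Schwarz_ineq2[of x y] by simp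
  then have "\<bar>x \<bullet> y\<bar> ^ n \<le> norm x ^ n" by (intro power_mono) auto
  then show "\<bar>(x \<bullet> y) ^ n\<bar> \<le> norm x ^ n" by (simp add: power_abs)
qed measurable

lemma integral_sphere_inner_even:
  fixes x :: "'a::euclidean_space"
  shows "(\<integral> y. (x \<bullet> y) ^ (2 * j) \<partial>uniform_sphere 1) =
    (norm x) ^ (2 * j) * (pochhammer (1 / 2) j / pochhammer (real DIM('a) / 2) j)"
  using sphere_moment_even[of x j] pochhammer_pos[of "1/2::real" j] pochhammer_pos[of "real DIM('a) / 2" j]
  by (subst integral_eq_nn_integral) (auto simp: power_mult)

text \<open>Symmetry of Lebesgue measure on the cone over A; it makes all odd moments
  vanish.\<close>

lemma uniform_sphere_uminus:
  "distr (uniform_sphere 1) borel uminus = (uniform_sphere 1 :: 'a::euclidean_space measure)"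
proof (rule measure_eqI)
  fix A assume "A \<in> sets (distr (uniform_sphere 1) borel uminus :: 'a measure)"
  then have A [measurable]: "A \<in> sets borel" by simp
  let ?f = "\<lambda>y::'a. indicator A ((1 / norm y) *\<^sub>R y) * indicator (ball 0 1) y :: ennreal"
  have [measurable]: "ball (0::'a) 1 \<in> sets borel" by simp
  have fm [measurable]: "?f \<in> borel_measurable borel" by measurable
  have "emeasure (distr (uniform_sphere 1) borel uminus) A = (\<integral>\<^sup>+ (y::'a). indicator A y \<partial>distr (uniform_sphere 1) borel uminus)"
    by simp
  also have "\<dots> = (\<integral>\<^sup>+ (y::'a). indicator A (- y) \<partial>uniform_sphere 1)" by (subst nn_integral_distr) auto
  also have "\<dots> = (\<integral>\<^sup>+ y. ?f (- y) \<partial>lborel) / ennreal (unit_ball_vol (real DIM('a)))"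
    by (subst nn_integral_uniform_sphere) (auto intro!: nn_integral_cong arg_cong2[where f = "(/)"] split: split_indicator)
  also have "(\<integral>\<^sup>+ y. ?f (- y) \<partial>lborel) = (\<integral>\<^sup>+ y. ?f y \<partial>lborel)"
  proof -
    have "(\<integral>\<^sup>+ y. ?f y \<partial>lborel) = (\<integral>\<^sup>+ y. ?f y \<partial>density (distr lborel borel uminus) (\<lambda>_. 1))"
      using lborel_affine[of "-1" "0::'a"] by simp
    also have "\<dots> = (\<integral>\<^sup>+ y. ?f (- y) \<partial>lborel)"
      by (subst nn_integral_density) (auto simp: nn_integral_distr)
    finally show ?thesis ..
  qed
  also have "(\<integral>\<^sup>+ y. ?f y \<partial>lborel) / ennreal (unit_ball_vol (real DIM('a))) = (\<integral>\<^sup>+ (y::'a). indicator A y \<partial>uniform_sphere 1)"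
    by (subst nn_integral_uniform_sphere) auto
  finally show "emeasure (distr (uniform_sphere 1) borel uminus) A = emeasure (uniform_sphere 1 :: 'a measure) A" by simp
qed simp

lemma integral_sphere_inner_odd:
  fixes x :: "'a::euclidean_space"
  assumes "odd n"
  shows "(\<integral> y. (x \<bullet> y) ^ n \<partial>uniform_sphere 1) = 0"
proof -
  have "(\<integral> y. (x \<bullet> y) ^ n \<partial>uniform_sphere 1) = (\<integral> y. (x \<bullet> y) ^ n \<partial>distr (uniform_sphere 1) borel uminus)"
    by (simp add: uniform_sphere_uminus)
  also have "\<dots> = (\<integral> y. (x \<bullet> - y) ^ n \<partial>uniform_sphere 1)" by (subst integral_distr) auto
  also have "\<dots> = - (\<integral> y. (x \<bullet> y) ^ n \<partial>uniform_sphere 1)" using assms by simp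
  finally show ?thesis by simp
qed

text \<open>The gain from normalizing the kernel at 1: scaling acts in the same way for power and
  logarithmic kernels.\<close>

lemma kk_mult:
  assumes "s > 0" "t > 0"
  shows "kk a (s * t) = kk a s + s powr (- a) * kk a t"
  using assms by (auto simp: kk_def ln_mult powr_mult field_simps)

text \<open>The Taylor coefficients of \<open>kk a (1 - w)\<close> at 0, again with the factor a
  cancelled, see \<open>kk_sums\<close>. They are nonnegative for \<open>a > - 1\<close>.\<close>

definition kap :: "real \<Rightarrow> nat \<Rightarrow> real" where
  "kap a n = (case n of 0 \<Rightarrow> 0 | Suc m \<Rightarrow> 1 / 2 * pochhammer (a + 1) m / fact (Suc m))"

lemma kap_0 [simp]: "kap a 0 = 0"
  by (simp add: kap_def)

lemma kap_nonneg: "a > -1 \<Longrightarrow> kap a n \<ge> 0"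
  using pochhammer_pos[of "a + 1"]
  by (auto simp: kap_def less_imp_le intro!: divide_nonneg_nonneg mult_nonneg_nonneg split: nat.split)

lemma summable_kap:
  assumes w: "\<bar>w\<bar> < 1"
  shows "summable (\<lambda>n. kap a n * w ^ n)"
proof -
  have h: "hyp_coeff (a + 1) 1 1 n = pochhammer (a + 1) n / fact n" for n
    by (simp add: hyp_coeff_def pochhammer_fact[symmetric])
  have "summable (\<lambda>n. 1 / 2 * \<bar>w\<bar> * \<bar>hyp_coeff (a + 1) 1 1 n * w ^ n\<bar>)"
    by (intro summable_mult summable_hyp_powser w) simp
  then have "summable (\<lambda>n. kap a (Suc n) * w ^ Suc n)"
  proof (rule summable_comparison_test[rotated], intro exI allI impI)
    fix n
    have "\<bar>pochhammer (a + 1) n\<bar> / fact (Suc n) \<le> \<bar>pochhammer (a + 1) n\<bar> / fact n"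
      by (intro divide_left_mono) (auto intro!: fact_mono)
    then have "1 / 2 * (\<bar>pochhammer (a + 1) n\<bar> / fact (Suc n)) * \<bar>w\<bar> ^ Suc n \<le>
        1 / 2 * (\<bar>pochhammer (a + 1) n\<bar> / fact n) * \<bar>w\<bar> ^ Suc n"
      by (intro mult_right_mono mult_left_mono) auto
    then show "norm (kap a (Suc n) * w ^ Suc n) \<le> 1 / 2 * \<bar>w\<bar> * \<bar>hyp_coeff (a + 1) 1 1 n * w ^ n\<bar>"
      unfolding h by (simp add: kap_def abs_mult power_abs mult_ac del: fact_Suc)
  qed
  then show ?thesis by (subst (asm) summable_Suc_iff)
qed

text \<open>By the binomial series both sides have the derivative
  \<open>1 / 2 * (1 - w) powr (- a - 1)\<close>, and both vanish at 0.\<close>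

lemma kk_sums:
  assumes w: "\<bar>w\<bar> < 1"
  shows "(\<lambda>n. kap a n * w ^ n) sums kk a (1 - w)"
proof -
  let ?S = "\<lambda>w. \<Sum>n. kap a n * w ^ n"
  have dS: "(?S has_real_derivative 1 / 2 * (1 - t) powr (- a - 1)) (at t)" if t: "\<bar>t\<bar> < 1" for t
  proof -
    have D: "(?S has_real_derivative (\<Sum>n. diffs (kap a) n * t ^ n)) (at t)"
      by (rule termdiffs_strong'[of 1]) (use summable_kap t in auto)
    have S: "(\<lambda>n. diffs (kap a) n * t ^ n) sums (1 / 2 * (1 - t) powr (- a - 1))"
    proof -
      have "(\<lambda>n. ((- a - 1) gchoose n) * (- t) ^ n) sums (1 + - t) powr (- a - 1)"
        using t by (intro gen_binomial_real) auto
      then have "(\<lambda>n. 1 / 2 * (((- a - 1) gchoose n) * (- t) ^ n)) sums (1 / 2 * (1 - t) powr (- a - 1))"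
        using sums_mult by fastforce
      moreover have "1 / 2 * (((- a - 1) gchoose n) * (- t) ^ n) = diffs (kap a) n * t ^ n" for n
      proof -
        have "(-1) ^ n * (- t) ^ n = t ^ n" by (simp add: power_mult_distrib[symmetric])
        then have "((- a - 1) gchoose n) * (- t) ^ n = pochhammer (a + 1) n / fact n * t ^ n"
          unfolding gbinomial_pochhammer by (simp add: add.commute)
        moreover have "diffs (kap a) n = 1 / 2 * (pochhammer (a + 1) n / fact n)"
          by (simp add: diffs_def kap_def del: of_nat_Suc)
        ultimately show ?thesis by simp
      qed
      ultimately show ?thesis by simp
    qed
    show ?thesis using D unfolding sums_unique[OF S, symmetric] .
  qed
  have dk: "((\<lambda>t. kk a (1 - t)) has_real_derivative 1 / 2 * (1 - t) powr (- a - 1)) (at t)" if t: "\<bar>t\<bar> < 1" for t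
  proof -
    have "((\<lambda>t. 1 - t) has_real_derivative - 1) (at t)" by (auto intro!: derivative_eq_intros)
    from DERIV_chain2[OF kk_DERIV this, of a] t show ?thesis by simp
  qed
  have "?S w - kk a (1 - w) = ?S 0 - kk a (1 - 0)"
  proof (rule DERIV_isconst3[of "-1" 1 w 0 "\<lambda>t. ?S t - kk a (1 - t)"])
    fix t :: real assume "t \<in> {-1<..<1}"
    then have "\<bar>t\<bar> < 1" by (simp add: abs_less_iff)
    from DERIV_diff[OF dS[OF this] dk[OF this]]
    show "((\<lambda>t. ?S t - kk a (1 - t)) has_real_derivative 0) (at t)" by simp
  qed (use w in auto)
  moreover have "?S 0 = 0" using powser_zero[of "kap a"] by simp
  ultimately have "?S w = kk a (1 - w)" by simp
  then show ?thesis using summable_kap[OF w, of a] by (simp add: sums_iff)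
qed

text \<open>Taylor coefficient of even order times the corresponding moment of the sphere. The
  duplication formulas for Pochhammer symbol and factorial split \<open>2 * j\<close> into two
  half-steps, hence the parameters \<open>a / 2\<close> and \<open>(a + 1) / 2\<close>.\<close>

lemma phi0_eq_kap:
  assumes "c > 0"
  shows "phi0 a c j = kap a (2 * j) * (pochhammer (1 / 2) j / pochhammer c j)"
proof (cases j)
  case (Suc i)
  have "pochhammer (a + 2) (2 * i) = 4 ^ i * pochhammer (a / 2 + 1) i * pochhammer ((a + 1) / 2 + 1) i"
  proof -
    have "2 * (a / 2 + 1) = a + 2" "a / 2 + 1 + 1 / 2 = (a + 1) / 2 + 1" "real (2 ^ (2 * i)) = 4 ^ i"
      using power_mult[of "2::real" 2 i] by (simp_all add: field_simps)
    then show ?thesis using pochhammer_double[of "a / 2 + 1" i] by (simp only:)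
  qed
  then have 1: "pochhammer (a + 1) (Suc (2 * i)) = (a + 1) * (4 ^ i * (pochhammer (a / 2 + 1) i * pochhammer ((a + 1) / 2 + 1) i))"
    by (simp add: pochhammer_rec add.commute mult.assoc)
  have 2: "(fact (2 * Suc i) :: real) = 4 * 4 ^ i * pochhammer (1 / 2) (Suc i) * (real (Suc i) * fact i)"
    using fact_double[of "Suc i", where 'a=real] by (simp add: power_mult)
  have nz: "pochhammer (1 / 2 :: real) (Suc i) \<noteq> 0" "pochhammer (c + 1) i \<noteq> 0" "c \<noteq> 0" "(4::real) ^ i \<noteq> 0"
    using pochhammer_pos[of "1/2::real" "Suc i"] pochhammer_pos[of "c+1" i] assms by auto
  have "kap a (2 * j) * (pochhammer (1 / 2) j / pochhammer c j) =
     1 / 2 * ((a + 1) * (4 ^ i * (pochhammer (a / 2 + 1) i * pochhammer ((a + 1) / 2 + 1) i)))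
       / (4 * 4 ^ i * pochhammer (1 / 2) (Suc i) * (real (Suc i) * fact i)) * (pochhammer (1 / 2) (Suc i) / (c * pochhammer (c + 1) i))"
    unfolding 1[symmetric] 2[symmetric] by (simp add: kap_def Suc pochhammer_rec[of c i])
  also have "\<dots> = phi0 a c j"
    using nz unfolding phi0_def Suc hyp_coeff_def
    by (simp add: divide_simps del: of_nat_Suc pochhammer_Suc)
  finally show ?thesis ..
qed simp

lemma sum_lessThan_even_odd:
  fixes g :: "nat \<Rightarrow> real"
  shows "(\<Sum>n<2*N. g n) = (\<Sum>j<N. g (2 * j) + g (2 * j + 1))"
  by (induction N) (auto simp: algebra_simps)

lemma summable_even_odd:
  fixes g :: "nat \<Rightarrow> real"
  assumes g: "\<And>n. g n \<ge> 0" and s: "summable (\<lambda>j. g (2 * j) + g (2 * j + 1))"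
  shows "summable g"
proof (rule summableI_nonneg_bounded[OF g])
  fix n
  have "(\<Sum>n<n. g n) \<le> (\<Sum>n<2*n. g n)" using g by (intro sum_mono2) auto
  also have "\<dots> = (\<Sum>j<n. g (2 * j) + g (2 * j + 1))" by (rule sum_lessThan_even_odd)
  also have "\<dots> \<le> (\<Sum>j. g (2 * j) + g (2 * j + 1))"
    using g by (intro sum_le_suminf s) (auto intro: add_nonneg_nonneg)
  finally show "(\<Sum>n<n. g n) \<le> (\<Sum>j. g (2 * j) + g (2 * j + 1))" .
qed

text \<open>Odd terms integrate to 0, but the exchange of sum and integral needs their absolute
  values. These are dominated by the preceding even terms; \<open>j \<ge> 1\<close> because
  \<open>kap a 0 = 0\<close>.\<close>

lemma kap_odd_le:
  assumes a: "a > -1" and j: "j \<ge> 1"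
  shows "kap a (2 * j + 1) \<le> (\<bar>a\<bar> + 1) * kap a (2 * j)"
proof -
  obtain i where i: "j = Suc i" using j by (cases j) auto
  have "kap a (2 * j + 1) = kap a (2 * j) * ((a + 1 + real (2 * i + 1)) / real (2 * i + 3))"
    by (simp add: kap_def i pochhammer_Suc)
  moreover have "(a + 1 + real (2 * i + 1)) / real (2 * i + 3) \<le> \<bar>a\<bar> + 1"
  proof -
    have "\<bar>a\<bar> * 1 \<le> \<bar>a\<bar> * real (2 * i + 3)" by (intro mult_left_mono) auto
    then have "a + 1 + real (2 * i + 1) \<le> (\<bar>a\<bar> + 1) * real (2 * i + 3)"
      by (simp only: distrib_right) simp
    then show ?thesis by (simp add: divide_le_eq del: of_nat_add of_nat_mult)
  qed
  ultimately have "kap a (2 * j + 1) \<le> kap a (2 * j) * (\<bar>a\<bar> + 1)"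
    using mult_left_mono[OF _ kap_nonneg[OF a, of "2 * j"]] by (simp only:)
  then show ?thesis by (simp only: mult.commute)
qed

text \<open>Markov's inequality with moments of arbitrarily high even order, which tend to 0 as soon
  as the dimension exceeds 1. The moments are read as \<open>hyp_coeff (1 / 2) 1 (d / 2)\<close>,
  where the 1 cancels the factorial.\<close>

lemma AE_sphere_inner_lt:
  fixes x :: "'a::euclidean_space"
  assumes x: "norm x \<le> 1" and d: "DIM('a) \<ge> 2"
  shows "AE y in uniform_sphere 1. \<bar>x \<bullet> y\<bar> < 1"
proof -
  let ?M = "uniform_sphere 1 :: 'a measure"
  let ?S = "{y. \<bar>x \<bullet> y\<bar> \<ge> 1}"
  have [measurable]: "?S \<in> sets borel" by measurable
  have "emeasure ?M ?S \<le> ennreal (hyp_coeff (1 / 2) 1 (DIM('a) / 2) j)" for j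
  proof -
    have "emeasure ?M ?S = (\<integral>\<^sup>+ y. indicator ?S y \<partial>?M)" by simp
    also have "\<dots> \<le> (\<integral>\<^sup>+ y. ennreal ((x \<bullet> y) ^ (2 * j)) \<partial>?M)"
    proof (intro nn_integral_mono)
      fix y
      show "indicator ?S y \<le> ennreal ((x \<bullet> y) ^ (2 * j))"
      proof (cases "y \<in> ?S")
        case True
        then have "1 \<le> \<bar>x \<bullet> y\<bar> ^ (2 * j)" by (intro one_le_power) auto
        also have "\<bar>x \<bullet> y\<bar> ^ (2 * j) = (x \<bullet> y) ^ (2 * j)" by (rule power_even_abs) simp
        finally show ?thesis using True by (simp add: ennreal_ge_1)
      qed simp
    qed
    also have "\<dots> = ennreal ((norm x) ^ (2 * j) * (pochhammer (1 / 2) j / pochhammer (real DIM('a) / 2) j))"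
      by (rule sphere_moment_even)
    also have "\<dots> \<le> ennreal (hyp_coeff (1 / 2) 1 (DIM('a) / 2) j)"
    proof (rule ennreal_leI)
      have "pochhammer (1 / 2 :: real) j / pochhammer (real DIM('a) / 2) j \<ge> 0"
        using pochhammer_pos[of "real DIM('a) / 2" j] by (auto intro!: divide_nonneg_nonneg pochhammer_nonneg simp: less_imp_le)
      then have "(norm x) ^ (2 * j) * (pochhammer (1 / 2 :: real) j / pochhammer (real DIM('a) / 2) j) \<le>
          1 * (pochhammer (1 / 2 :: real) j / pochhammer (real DIM('a) / 2) j)"
        using x by (intro mult_right_mono power_le_one) auto
      then show "(norm x) ^ (2 * j) * (pochhammer (1 / 2 :: real) j / pochhammer (real DIM('a) / 2) j) \<le> hyp_coeff (1 / 2) 1 (DIM('a) / 2) j"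
        by (simp add: hyp_coeff_def pochhammer_fact[symmetric])
    qed
    finally show ?thesis .
  qed
  moreover have "(\<lambda>j. ennreal (hyp_coeff (1 / 2) 1 (DIM('a) / 2) j)) \<longlonglongrightarrow> ennreal 0"
    using hyp_coeff_tendsto_0[of "DIM('a) / 2" "1/2" 1 0] d by (intro tendsto_ennrealI) auto
  ultimately have "emeasure ?M ?S \<le> ennreal 0" by (intro LIMSEQ_le_const) auto
  then have "emeasure ?M ?S = 0" by simp
  then show ?thesis by (intro AE_I[where N = ?S]) auto
qed

text \<open>Expand the kernel in powers of \<open>x \<bullet> y\<close> and integrate term by term.\<close>

theorem sphere_potential:
  fixes x :: "'a::euclidean_space"
  assumes d: "DIM('a) \<ge> 2" and rs: "riesz_sphere a (DIM('a) / 2)"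
  shows "integrable (uniform_sphere 1) (\<lambda>y. kk a ((norm (x - y))\<^sup>2))"
    and "(\<integral> y. kk a ((norm (x - y))\<^sup>2) \<partial>uniform_sphere 1) = u0 a (DIM('a) / 2) ((norm x)\<^sup>2)"
proof -
  interpret riesz_sphere a "DIM('a) / 2" by (rule rs)
  interpret prob_space "uniform_sphere 1 :: 'a measure" by (rule uniform_sphere_prob)
  let ?M = "uniform_sphere 1 :: 'a measure"
  let ?c = "DIM('a) / 2 :: real"
  define \<rho> where "\<rho> = (norm x)\<^sup>2"
  \<comment> \<open>For y on the unit sphere the squared distance is
    \<open>(1 + \<rho>) * (1 - x' \<bullet> y)\<close>. So \<open>kk_mult\<close> separates the
    factor \<open>1 + \<rho>\<close>, and the squared norm of \<open>x'\<close> is the argument z of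
    \<open>Phi0\<close>.\<close>
  define x' where "x' = (2 / (1 + \<rho>)) *\<^sub>R x"
  define z where "z = 4 * \<rho> / (1 + \<rho>)\<^sup>2"
  have r: "\<rho> \<ge> 0" by (simp add: \<rho>_def)
  have nx': "(norm x')\<^sup>2 = z" unfolding x'_def z_def using r
    by (simp add: power_mult_distrib power_divide \<rho>_def[symmetric])
  have z: "0 \<le> z" "z \<le> 1" using mobius_le_1[OF r] by (auto simp: z_def)
  have x'1: "norm x' \<le> 1" using nx' z(2) by (metis norm_ge_zero power_le_one_iff power2_le_imp_le one_power2 zero_le_one)
  note lt = AE_sphere_inner_lt[OF x'1 d]
  define f where "f n y = kap a n * (x' \<bullet> y) ^ n" for n y
  have fint: "integrable ?M (f n)" for n
    unfolding f_def[abs_def] by (intro integrable_mult_right integrable_sphere_inner_power)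
  have ev: "(\<integral> y. f (2 * j) y \<partial>?M) = phi0 a ?c j * z ^ j" for j
  proof -
    have "norm x' ^ (2 * j) = z ^ j" unfolding power_mult nx' ..
    then show ?thesis
      unfolding f_def integral_mult_right_zero integral_sphere_inner_even phi0_eq_kap[OF c_pos] by simp
  qed
  have nev: "(\<integral> y. norm (f (2 * j) y) \<partial>?M) = phi0 a ?c j * z ^ j" for j
  proof -
    have "norm (f (2 * j) y) = f (2 * j) y" for y
      using kap_nonneg[OF a_gt, of "2*j"] by (simp add: f_def power_mult)
    then show ?thesis using ev by simp
  qed
  have nodd: "(\<integral> y. norm (f (2 * j + 1) y) \<partial>?M) \<le> (\<bar>a\<bar> + 1) * (phi0 a ?c j * z ^ j)" if j: "j \<ge> 1" for j
  proof -
    have "(\<integral> y. norm (f (2 * j + 1) y) \<partial>?M) \<le> (\<integral> y. (\<bar>a\<bar> + 1) * norm (f (2 * j) y) \<partial>?M)"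
    proof (rule integral_mono_AE)
      show "AE y in ?M. norm (f (2 * j + 1) y) \<le> (\<bar>a\<bar> + 1) * norm (f (2 * j) y)"
        using lt
      proof eventually_elim
        case (elim y)
        have "norm (f (2 * j + 1) y) = kap a (2 * j + 1) * (\<bar>x' \<bullet> y\<bar> * \<bar>x' \<bullet> y\<bar> ^ (2 * j))"
          using kap_nonneg[OF a_gt, of "2*j+1"] by (simp add: f_def abs_mult power_abs)
        also have "\<dots> \<le> ((\<bar>a\<bar> + 1) * kap a (2 * j)) * (1 * \<bar>x' \<bullet> y\<bar> ^ (2 * j))"
          using elim kap_odd_le[OF a_gt j] kap_nonneg[OF a_gt, of "2*j"] kap_nonneg[OF a_gt, of "2*j+1"]
          by (intro mult_mono) auto
        also have "\<dots> = (\<bar>a\<bar> + 1) * norm (f (2 * j) y)"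
          using kap_nonneg[OF a_gt, of "2*j"] by (simp add: f_def abs_mult power_abs)
        finally show ?case .
      qed
    qed (auto intro!: integrable_mult_right integrable_norm fint)
    also have "\<dots> = (\<bar>a\<bar> + 1) * (phi0 a ?c j * z ^ j)" by (simp only: integral_mult_right_zero nev)
    finally show ?thesis .
  qed
  have summ: "summable (\<lambda>n. \<integral> y. norm (f n y) \<partial>?M)"
  proof (rule summable_even_odd)
    have "summable (\<lambda>j. (\<bar>a\<bar> + 2) * (phi0 a ?c j * z ^ j))"
      using phi0_powser_sums[OF z] by (intro summable_mult) (auto simp: sums_iff)
    then show "summable (\<lambda>j. (\<integral> y. norm (f (2 * j) y) \<partial>?M) + (\<integral> y. norm (f (2 * j + 1) y) \<partial>?M))"
    proof (rule summable_comparison_test[rotated], intro exI[of _ 1] allI impI)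
      fix j :: nat assume j: "1 \<le> j"
      have "0 \<le> (\<integral> y. norm (f (2 * j) y) \<partial>?M) + (\<integral> y. norm (f (2 * j + 1) y) \<partial>?M)" by simp
      moreover have "(\<integral> y. norm (f (2 * j) y) \<partial>?M) + (\<integral> y. norm (f (2 * j + 1) y) \<partial>?M) \<le> (\<bar>a\<bar> + 2) * (phi0 a ?c j * z ^ j)"
        unfolding nev using nodd[OF j] by (simp only: distrib_right)
      ultimately show "norm ((\<integral> y. norm (f (2 * j) y) \<partial>?M) + (\<integral> y. norm (f (2 * j + 1) y) \<partial>?M)) \<le> (\<bar>a\<bar> + 2) * (phi0 a ?c j * z ^ j)"
        by simp
    qed
  qed simp
  have aes: "AE y in ?M. summable (\<lambda>n. norm (f n y))"
    using lt
  proof eventually_elim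
    case (elim y)
    have "summable (\<lambda>n. kap a n * \<bar>x' \<bullet> y\<bar> ^ n)" using elim by (intro summable_kap) auto
    then show ?case using kap_nonneg[OF a_gt] by (simp add: f_def abs_mult power_abs)
  qed
  note I = integrable_suminf[OF fint aes summ] integral_suminf[OF fint aes summ] summable_integral[OF fint aes summ]
  have "(\<Sum>n. \<integral> y. f n y \<partial>?M) = Phi0 a ?c z"
  proof -
    have "(\<lambda>j. \<integral> y. f (2 * j) y \<partial>?M) sums Phi0 a ?c z"
      unfolding ev by (rule phi0_powser_sums[OF z])
    then have "(\<lambda>n. \<integral> y. f n y \<partial>?M) sums Phi0 a ?c z"
    proof (subst (asm) sums_mono_reindex)
      fix n :: nat assume "n \<notin> range ((*) 2)"
      then have "odd n" by (auto elim!: evenE)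
      then show "(\<integral> y. f n y \<partial>?M) = 0" by (simp add: f_def integral_sphere_inner_odd)
    qed (auto simp: strict_mono_def)
    then show ?thesis by (simp add: sums_iff)
  qed
  with I have S: "integrable ?M (\<lambda>y. \<Sum>n. f n y)" "(\<integral> y. (\<Sum>n. f n y) \<partial>?M) = Phi0 a ?c z" by auto
  have ae: "AE y in ?M. kk a ((norm (x - y))\<^sup>2) = kk a (1 + \<rho>) + (1 + \<rho>) powr (- a) * (\<Sum>n. f n y)"
    using lt AE_sphere_norm
  proof eventually_elim
    case (elim y)
    have "(norm (x - y))\<^sup>2 = 1 + \<rho> - 2 * (x \<bullet> y)"
    proof -
      have "(norm (x - y))\<^sup>2 = (norm x)\<^sup>2 + (norm y)\<^sup>2 - 2 * (x \<bullet> y)"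
        unfolding power2_norm_eq_inner by (simp add: inner_diff_left inner_diff_right inner_commute[of y x])
      then show ?thesis using elim by (simp add: \<rho>_def)
    qed
    also have "\<dots> = (1 + \<rho>) * (1 - x' \<bullet> y)" unfolding x'_def using r by (simp add: field_simps)
    finally have e: "(norm (x - y))\<^sup>2 = (1 + \<rho>) * (1 - x' \<bullet> y)" .
    have "kk a ((norm (x - y))\<^sup>2) = kk a (1 + \<rho>) + (1 + \<rho>) powr (- a) * kk a (1 - x' \<bullet> y)"
      unfolding e using r elim by (intro kk_mult) auto
    also have "kk a (1 - x' \<bullet> y) = (\<Sum>n. f n y)"
      using kk_sums[of "x' \<bullet> y" a] elim by (simp add: f_def sums_iff)
    finally show ?case .
  qed
  have meas [measurable]: "(\<lambda>y. kk a ((norm (x - y))\<^sup>2)) \<in> borel_measurable borel"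
    unfolding kk_def by measurable
  have meas2: "(\<lambda>y. \<Sum>n. f n y) \<in> borel_measurable ?M" using S(1) by (rule borel_measurable_integrable)
  show "integrable ?M (\<lambda>y. kk a ((norm (x - y))\<^sup>2))"
    by (subst integrable_cong_AE[OF _ _ ae]) (use S(1) meas2 in auto)
  have "(\<integral> y. kk a ((norm (x - y))\<^sup>2) \<partial>?M) = (\<integral> y. kk a (1 + \<rho>) + (1 + \<rho>) powr (- a) * (\<Sum>n. f n y) \<partial>?M)"
    by (rule integral_cong_AE[OF _ _ ae]) (use meas2 in auto)
  also have "\<dots> = kk a (1 + \<rho>) + (1 + \<rho>) powr (- a) * Phi0 a ?c z"
    using S prob_space by simp
  finally show "(\<integral> y. kk a ((norm (x - y))\<^sup>2) \<partial>?M) = u0 a ?c ((norm x)\<^sup>2)"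
    by (simp add: u0_def \<rho>_def z_def)
qed

section \<open>Positive definiteness of the Riesz kernel\<close>

lemma nn_integral_Gamma_scaled:
  assumes a: "a > -1" and u: "u > 0"
  shows "(\<integral>\<^sup>+ l. ennreal (l powr a * exp (- l * u)) * indicator {0<..} l \<partial>lborel) = ennreal (Gamma (a + 1) * u powr (- a - 1))"
    (is "?X = _")
proof -
  have "ennreal (Gamma (a + 1)) = (\<integral>\<^sup>+ t. ennreal (indicator {0..} t * t powr a / exp t) \<partial>lborel)"
    using Gamma_conv_nn_integral_real[of "a + 1"] a by simp
  also have "\<dots> = ennreal (u ^ DIM(real)) * (\<integral>\<^sup>+ l. ennreal (indicator {0..} (u *\<^sub>R l) * (u *\<^sub>R l) powr a / exp (u *\<^sub>R l)) \<partial>lborel)"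
    by (rule nn_integral_lborel_scale) (use u in auto)
  also have "(\<integral>\<^sup>+ l. ennreal (indicator {0..} (u *\<^sub>R l) * (u *\<^sub>R l) powr a / exp (u *\<^sub>R l)) \<partial>lborel)
      = (\<integral>\<^sup>+ l. ennreal (u powr a) * (ennreal (l powr a * exp (- l * u)) * indicator {0<..} l) \<partial>lborel)"
  proof (intro nn_integral_cong)
    fix l :: real
    show "ennreal (indicator {0..} (u *\<^sub>R l) * (u *\<^sub>R l) powr a / exp (u *\<^sub>R l)) =
      ennreal (u powr a) * (ennreal (l powr a * exp (- l * u)) * indicator {0<..} l)"
    proof (cases "l > 0")
      case True
      then show ?thesis using u
        by (simp add: powr_mult ennreal_mult[symmetric] exp_minus divide_inverse mult_ac)
    next
      case False
      then show ?thesis using u by (cases "l = 0") (auto simp: indicator_def zero_le_mult_iff)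
    qed
  qed
  also have "\<dots> = ennreal (u powr a) * ?X" by (rule nn_integral_cmult) auto
  finally have G: "ennreal (Gamma (a + 1)) = ennreal (u powr (a + 1)) * ?X"
    using u by (simp add: powr_add mult.assoc[symmetric] ennreal_mult[symmetric] mult.commute)
  have "ennreal (u powr (- a - 1)) * ennreal (u powr (a + 1)) = 1"
    using u by (subst ennreal_mult[symmetric]) (auto simp: powr_add[symmetric])
  then have "?X = ennreal (u powr (- a - 1)) * (ennreal (u powr (a + 1)) * ?X)"
    by (simp add: mult.assoc[symmetric])
  also have "\<dots> = ennreal (u powr (- a - 1)) * ennreal (Gamma (a + 1))" unfolding G[symmetric] ..
  also have "\<dots> = ennreal (Gamma (a + 1) * u powr (- a - 1))"
    using Gamma_real_pos[of "a + 1"] a by (subst ennreal_mult[symmetric]) (auto simp: mult.commute)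
  finally show ?thesis .
qed

lemma kk_antimono:
  assumes "0 < s" "s \<le> e"
  shows "kk a e \<le> kk a s"
proof (rule DERIV_nonpos_imp_nonincreasing[OF assms(2)])
  fix x assume "s \<le> x" "x \<le> e"
  then show "\<exists>y. (kk a has_real_derivative y) (at x) \<and> y \<le> 0"
    using kk_DERIV[of x a] assms by (intro exI conjI) auto
qed

text \<open>Integrate the Gamma integral over u from s to e and exchange the integrals. Taking a
  difference of exponentials gains one power of l near 0, so the integral converges for all
  \<open>a > - 1\<close>, although \<open>l powr (a - 1)\<close> alone is not integrable at 0 when
  \<open>a \<le> 0\<close>.\<close>

lemma nn_integral_kk_diff:
  assumes a: "a > -1" and s: "0 < s" "s \<le> e"
  shows "(\<integral>\<^sup>+ l. ennreal (l powr (a - 1) * (exp (- l * s) - exp (- l * e))) * indicator {0<..} l \<partial>lborel)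
    = ennreal (2 * Gamma (a + 1) * (kk a s - kk a e))"
proof -
  have G: "Gamma (a + 1) > 0" using a by (intro Gamma_real_pos) auto
  have "(\<integral>\<^sup>+ l. ennreal (l powr (a - 1) * (exp (- l * s) - exp (- l * e))) * indicator {0<..} l \<partial>lborel)
    = (\<integral>\<^sup>+ l. \<integral>\<^sup>+ u. ennreal (l powr a * exp (- l * u)) * indicator {0<..} l * indicator {s..e} u \<partial>lborel \<partial>lborel)"
  proof (intro nn_integral_cong)
    fix l :: real
    show "ennreal (l powr (a - 1) * (exp (- l * s) - exp (- l * e))) * indicator {0<..} l =
      (\<integral>\<^sup>+ u. ennreal (l powr a * exp (- l * u)) * indicator {0<..} l * indicator {s..e} u \<partial>lborel)"
    proof (cases "l > 0")
      case True
      have "(\<integral>\<^sup>+ u. ennreal (l powr a * exp (- l * u)) * indicator {s..e} u \<partial>lborel) =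
        ennreal (- (l powr a * exp (- l * e) / l) - - (l powr a * exp (- l * s) / l))"
        using True s
        by (intro nn_integral_FTC_Icc[where F = "\<lambda>u. - (l powr a * exp (- l * u) / l)"])
          (auto intro!: derivative_eq_intros)
      also have "- (l powr a * exp (- l * e) / l) - - (l powr a * exp (- l * s) / l) = l powr (a - 1) * (exp (- l * s) - exp (- l * e))"
        using True by (simp add: powr_diff algebra_simps diff_divide_distrib)
      finally show ?thesis using True by simp
    qed simp
  qed
  also have "\<dots> = (\<integral>\<^sup>+ u. \<integral>\<^sup>+ l. ennreal (l powr a * exp (- l * u)) * indicator {0<..} l * indicator {s..e} u \<partial>lborel \<partial>lborel)"
    by (rule lborel_pair.Fubini') measurable
  also have "\<dots> = (\<integral>\<^sup>+ u. ennreal (Gamma (a + 1) * u powr (- a - 1)) * indicator {s..e} u \<partial>lborel)"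
  proof (intro nn_integral_cong)
    fix u :: real
    show "(\<integral>\<^sup>+ l. ennreal (l powr a * exp (- l * u)) * indicator {0<..} l * indicator {s..e} u \<partial>lborel) =
      ennreal (Gamma (a + 1) * u powr (- a - 1)) * indicator {s..e} u"
      using s nn_integral_Gamma_scaled[OF a, of u]
      by (cases "u \<in> {s..e}") (auto simp: nn_integral_multc)
  qed
  also have "\<dots> = ennreal (- (2 * Gamma (a + 1)) * kk a e - - (2 * Gamma (a + 1)) * kk a s)"
  proof (rule nn_integral_FTC_Icc[where F = "\<lambda>u. - (2 * Gamma (a + 1)) * kk a u"])
    fix u assume "u \<in> {s..e}"
    then have "((\<lambda>u. - (2 * Gamma (a + 1)) * kk a u) has_real_derivative - (2 * Gamma (a + 1)) * (- (1 / 2) * u powr (- a - 1))) (at u)"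
      using s by (intro DERIV_cmult kk_DERIV) auto
    then show "((\<lambda>u. - (2 * Gamma (a + 1)) * kk a u) has_real_derivative Gamma (a + 1) * u powr (- a - 1)) (at u)"
      by (rule DERIV_cong) simp
  qed (use G s in auto)
  finally show ?thesis by (simp add: algebra_simps)
qed

text \<open>Subtracting \<open>exp (- l)\<close> is the counterpart of the normalization
  \<open>kk a 1 = 0\<close>; the integral over l is then exactly \<open>kk a t\<close>, see
  \<open>lker_integral\<close>.\<close>

definition lker :: "real \<Rightarrow> real \<Rightarrow> real \<Rightarrow> real" where
  "lker a l t = indicator {0<..} l * (l powr (a - 1) * (exp (- l * t) - exp (- l))) / (2 * Gamma (a + 1))"

lemma lker_measurable [measurable]:
  assumes [measurable]: "f \<in> borel_measurable M" "g \<in> borel_measurable M"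
  shows "(\<lambda>x. lker a (f x) (g x)) \<in> borel_measurable M"
  unfolding lker_def by measurable

lemma nn_integral_lker:
  assumes a: "a > -1" and t: "t > 0 \<or> t = 0 \<and> a < 0"
  shows "(\<integral>\<^sup>+ l. ennreal \<bar>lker a l t\<bar> \<partial>lborel) = ennreal \<bar>kk a t\<bar>"
proof -
  have G: "Gamma (a + 1) > 0" using a by (intro Gamma_real_pos) auto
  have conv: "(\<integral>\<^sup>+ l. ennreal \<bar>lker a l t\<bar> \<partial>lborel) = ennreal (k / (2 * Gamma (a + 1)))"
    if "(\<integral>\<^sup>+ l. ennreal (l powr (a - 1) * \<bar>exp (- l * t) - exp (- l)\<bar>) * indicator {0<..} l \<partial>lborel) = ennreal k" "k \<ge> 0" for t k
  proof -
    have "(\<integral>\<^sup>+ l. ennreal \<bar>lker a l t\<bar> \<partial>lborel) =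
      (\<integral>\<^sup>+ l. ennreal (1 / (2 * Gamma (a + 1))) * (ennreal (l powr (a - 1) * \<bar>exp (- l * t) - exp (- l)\<bar>) * indicator {0<..} l) \<partial>lborel)"
    proof (intro nn_integral_cong)
      fix l :: real
      show "ennreal \<bar>lker a l t\<bar> = ennreal (1 / (2 * Gamma (a + 1))) * (ennreal (l powr (a - 1) * \<bar>exp (- l * t) - exp (- l)\<bar>) * indicator {0<..} l)"
        using G by (cases "l > 0") (auto simp: lker_def abs_mult ennreal_mult[symmetric] simp del: ennreal_mult'')
    qed
    also have "\<dots> = ennreal (1 / (2 * Gamma (a + 1))) * ennreal k"
      unfolding that(1)[symmetric] by (rule nn_integral_cmult) auto
    also have "\<dots> = ennreal (k / (2 * Gamma (a + 1)))"
      using G that(2) by (subst ennreal_mult[symmetric]) auto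
    finally show ?thesis .
  qed
  have le: "(\<integral>\<^sup>+ l. ennreal (l powr (a - 1) * \<bar>exp (- l * t) - exp (- l)\<bar>) * indicator {0<..} l \<partial>lborel) = ennreal (2 * Gamma (a + 1) * kk a t)"
    if "0 < t" "t \<le> 1" for t
  proof -
    have "(\<integral>\<^sup>+ l. ennreal (l powr (a - 1) * \<bar>exp (- l * t) - exp (- l)\<bar>) * indicator {0<..} l \<partial>lborel)
       = (\<integral>\<^sup>+ l. ennreal (l powr (a - 1) * (exp (- l * t) - exp (- l * 1))) * indicator {0<..} l \<partial>lborel)"
      using that by (intro nn_integral_cong) (auto split: split_indicator)
    also have "\<dots> = ennreal (2 * Gamma (a + 1) * (kk a t - kk a 1))" by (rule nn_integral_kk_diff) (use a that in auto)
    finally show ?thesis by simp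
  qed
  consider "0 < t" "t \<le> 1" | "t > 1" | "t = 0" "a < 0" using t by force
  then show ?thesis
  proof cases
    case 1
    then have "kk a t \<ge> 0" using kk_antimono[of t 1 a] by simp
    then show ?thesis using conv[OF le[OF 1]] G by simp
  next
    case 2
    have k: "kk a t \<le> 0" using kk_antimono[of 1 t a] 2 by simp
    have "(\<integral>\<^sup>+ l. ennreal (l powr (a - 1) * \<bar>exp (- l * t) - exp (- l)\<bar>) * indicator {0<..} l \<partial>lborel)
       = (\<integral>\<^sup>+ l. ennreal (l powr (a - 1) * (exp (- l * 1) - exp (- l * t))) * indicator {0<..} l \<partial>lborel)"
      using 2 by (intro nn_integral_cong) (auto split: split_indicator)
    also have "\<dots> = ennreal (2 * Gamma (a + 1) * (kk a 1 - kk a t))" by (rule nn_integral_kk_diff) (use a 2 in auto)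
    finally have e: "(\<integral>\<^sup>+ l. ennreal (l powr (a - 1) * \<bar>exp (- l * t) - exp (- l)\<bar>) * indicator {0<..} l \<partial>lborel)
       = ennreal (2 * Gamma (a + 1) * (- kk a t))" by simp
    have "0 \<le> 2 * Gamma (a + 1) * (- kk a t)" using G k by (intro mult_nonneg_nonneg) auto
    from conv[OF e this] show ?thesis using k G by simp
  next
    case 3
    \<comment> \<open>The value at 0 is a monotone limit along \<open>1 / (n + 1)\<close>. Since
      \<open>0 powr (- a)\<close> is 0, \<open>kk a 0\<close> is \<open>- 1 / (2 * a)\<close>, the
      limit of the kernel for \<open>a < 0\<close>.\<close>
    let ?s = "\<lambda>n. 1 / real (Suc n)"
    let ?f = "\<lambda>n l. ennreal (l powr (a - 1) * \<bar>exp (- l * ?s n) - exp (- l)\<bar>) * indicator {0<..} l"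
    have s0: "?s \<longlonglongrightarrow> 0" using LIMSEQ_Suc[OF lim_1_over_n] by simp
    have "(\<lambda>n. \<integral>\<^sup>+ l. ?f n l \<partial>lborel) \<longlonglongrightarrow> (\<integral>\<^sup>+ l. ennreal (l powr (a - 1) * \<bar>exp (- l * 0) - exp (- l)\<bar>) * indicator {0<..} l \<partial>lborel)"
    proof (rule nn_integral_LIMSEQ)
      show "incseq ?f"
      proof (intro incseq_SucI le_funI)
        fix n and l :: real
        show "?f n l \<le> ?f (Suc n) l"
        proof (cases "l > 0")
          case True
          have s1: "?s (Suc n) \<le> ?s n" "?s n \<le> 1" by (auto simp: divide_simps)
          have "l * ?s (Suc n) \<le> l * ?s n" "l * ?s n \<le> l * 1"
            using True s1 by (intro mult_left_mono; simp)+
          then have "exp (- l) \<le> exp (- l * ?s n)" "exp (- l * ?s n) \<le> exp (- l * ?s (Suc n))" by (auto simp: mult_minus_left)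
          then show ?thesis using True by (intro mult_right_mono ennreal_leI mult_left_mono) auto
        qed simp
      qed
      show "(\<lambda>n. ?f n l) \<longlonglongrightarrow> ennreal (l powr (a - 1) * \<bar>exp (- l * 0) - exp (- l)\<bar>) * indicator {0<..} l" for l :: real
      proof (cases "l > 0")
        case True
        have "(\<lambda>n. l powr (a - 1) * \<bar>exp (- l * ?s n) - exp (- l)\<bar>) \<longlonglongrightarrow> l powr (a - 1) * \<bar>exp (- l * 0) - exp (- l)\<bar>"
          by (intro tendsto_intros s0)
        from tendsto_ennrealI[OF this] show ?thesis using True by simp
      qed simp
    qed auto
    moreover have "(\<integral>\<^sup>+ l. ?f n l \<partial>lborel) = ennreal (2 * Gamma (a + 1) * kk a (?s n))" for n
      by (rule le) auto
    moreover have "(\<lambda>n. ennreal (2 * Gamma (a + 1) * kk a (?s n))) \<longlonglongrightarrow> ennreal (2 * Gamma (a + 1) * kk a 0)"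
    proof -
      have "(\<lambda>n. ?s n powr (- a)) \<longlonglongrightarrow> 0 powr (- a)"
        using 3 by (intro tendsto_powr' s0 tendsto_const) auto
      then have "(\<lambda>n. (?s n powr (- a) - 1) / (2 * a)) \<longlonglongrightarrow> (0 powr (- a) - 1) / (2 * a)"
        using 3 by (intro tendsto_divide tendsto_diff tendsto_const) auto
      then show ?thesis unfolding kk_def using 3 by (intro tendsto_ennrealI tendsto_mult tendsto_const) auto
    qed
    ultimately have "(\<integral>\<^sup>+ l. ennreal (l powr (a - 1) * \<bar>exp (- l * 0) - exp (- l)\<bar>) * indicator {0<..} l \<partial>lborel) = ennreal (2 * Gamma (a + 1) * kk a 0)"
      using LIMSEQ_unique by (simp only:) blast
    moreover have k: "kk a 0 \<ge> 0" using 3 by (simp add: kk_def divide_simps)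
    ultimately show ?thesis using conv[of 0 "2 * Gamma (a + 1) * kk a 0"] G 3 by simp
  qed
qed

lemma lker_integral:
  assumes a: "a > -1" and t: "t > 0 \<or> t = 0 \<and> a < 0"
  shows "integrable lborel (\<lambda>l. lker a l t)" "(\<integral> l. lker a l t \<partial>lborel) = kk a t"
proof -
  have G: "Gamma (a + 1) > 0" using a by (intro Gamma_real_pos) auto
  note nn = nn_integral_lker[OF a t]
  show int: "integrable lborel (\<lambda>l. lker a l t)"
    by (rule integrableI_bounded) (auto simp: nn)
  have abs: "(\<integral> l. \<bar>lker a l t\<bar> \<partial>lborel) = \<bar>kk a t\<bar>"
    by (subst integral_eq_nn_integral) (auto simp: nn)
  show "(\<integral> l. lker a l t \<partial>lborel) = kk a t"
  proof (cases "t \<le> 1")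
    case True
    have "0 \<le> lker a l t" for l
    proof (cases "l > 0")
      case l: True
      have "l * t \<le> l * 1" using l True by (intro mult_left_mono) auto
      then show ?thesis using G by (auto simp: lker_def)
    qed (simp add: lker_def)
    moreover have "kk a t \<ge> 0" using t True kk_antimono[of t 1 a] by (auto simp: kk_def divide_simps)
    ultimately show ?thesis using abs by simp
  next
    case False
    have "lker a l t \<le> 0" for l
    proof (cases "l > 0")
      case l: True
      have "l * 1 \<le> l * t" using l False by (intro mult_left_mono) auto
      then show ?thesis using G by (auto simp: lker_def divide_nonpos_pos mult_nonneg_nonpos)
    qed (simp add: lker_def)
    then have "\<bar>lker a l t\<bar> = - lker a l t" for l by (simp add: abs_of_nonpos)
    moreover have "kk a t \<le> 0" using False kk_antimono[of 1 t a] by auto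
    ultimately show ?thesis using abs by simp
  qed
qed

text \<open>
  Positive definiteness of the Gaussian: it is the convolution square of a narrower Gaussian. The
  smoothed densities converge to the measure as \<open>l\<close> tends to infinity, which gives strictness.
\<close>

definition gsmooth :: "real \<Rightarrow> 'a::euclidean_space measure \<Rightarrow> 'a \<Rightarrow> real" where
  "gsmooth l M z = (\<integral> x. exp (- (2 * l * (norm (x - z))\<^sup>2)) \<partial>M)"

definition gpair :: "real \<Rightarrow> 'a::euclidean_space measure \<Rightarrow> 'a measure \<Rightarrow> real" where
  "gpair l M N = (\<integral> p. exp (- (l * (norm (fst p - snd p))\<^sup>2)) \<partial>(M \<Otimes>\<^sub>M N))"

section \<open>Gaussian forms on probability measures\<close>

lemma borel_probsD:
  assumes "M \<in> borel_probs"
  shows "prob_space M" "sets M = sets borel" "space M = UNIV"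
  using assms by (auto simp: borel_probs_def dest: sets_eq_imp_space_eq)

lemma prob_space_pair:
  assumes "M \<in> borel_probs" "N \<in> borel_probs"
  shows "prob_space (M \<Otimes>\<^sub>M N)"
proof -
  interpret M: prob_space M using borel_probsD[OF assms(1)] by simp
  interpret N: prob_space N using borel_probsD[OF assms(2)] by simp
  interpret pair_prob_space M N ..
  show ?thesis by unfold_locales
qed

lemma nn_integral_gauss_scaled:
  assumes l: "l > 0"
  shows "(\<integral>\<^sup>+ z. ennreal (exp (- (l * (norm (z :: 'a::euclidean_space))\<^sup>2))) \<partial>lborel) =
    ennreal (gauss_mass TYPE('a) / sqrt l ^ DIM('a))"
proof -
  have s: "sqrt l ^ DIM('a) > 0" using l by simp
  have "ennreal (gauss_mass TYPE('a) / sqrt l ^ DIM('a)) = ennreal (1 / sqrt l ^ DIM('a)) * ennreal (gauss_mass TYPE('a))"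
    using s gauss_mass_pos[where 'a='a] by (subst ennreal_mult[symmetric]) auto
  also have "ennreal (gauss_mass TYPE('a)) = (\<integral>\<^sup>+ (z::'a). ennreal (exp (- (norm z)\<^sup>2)) \<partial>lborel)"
    by (simp add: nn_integral_gauss)
  also have "\<dots> = ennreal (sqrt l ^ DIM('a)) * (\<integral>\<^sup>+ (z::'a). ennreal (exp (- (norm (sqrt l *\<^sub>R z))\<^sup>2)) \<partial>lborel)"
    by (rule nn_integral_lborel_scale) (use l in auto)
  also have "ennreal (1 / sqrt l ^ DIM('a)) * (ennreal (sqrt l ^ DIM('a)) * (\<integral>\<^sup>+ (z::'a). ennreal (exp (- (norm (sqrt l *\<^sub>R z))\<^sup>2)) \<partial>lborel))
     = (\<integral>\<^sup>+ (z::'a). ennreal (exp (- (norm (sqrt l *\<^sub>R z))\<^sup>2)) \<partial>lborel)"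
    using s l by (simp add: mult.assoc[symmetric] ennreal_mult[symmetric] del: real_sqrt_power)
  also have "\<dots> = (\<integral>\<^sup>+ (z::'a). ennreal (exp (- (l * (norm z)\<^sup>2))) \<partial>lborel)"
    using l by (simp add: power_mult_distrib)
  finally show ?thesis ..
qed

text \<open>The mass of \<open>exp (- (4 * l * (norm z)\<^sup>2))\<close>, the factor left by the
  midpoint identity in \<open>gsmooth_product\<close>.\<close>

definition gconst :: "'a::euclidean_space itself \<Rightarrow> real \<Rightarrow> real" where
  "gconst T l = gauss_mass TYPE('a) / sqrt (4 * l) ^ DIM('a)"

lemma gconst_pos: "l > 0 \<Longrightarrow> gconst TYPE('a::euclidean_space) l > 0"
  using gauss_mass_pos[where 'a='a] by (simp add: gconst_def)

lemma integrable_gauss_kernel: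
  fixes M :: "'a::euclidean_space measure"
  assumes "M \<in> borel_probs" "l \<ge> 0"
  shows "integrable M (\<lambda>x. exp (- (2 * l * (norm (x - z))\<^sup>2)))"
proof -
  interpret prob_space M using borel_probsD[OF assms(1)] by simp
  have [measurable_cong]: "sets M = sets borel" using borel_probsD[OF assms(1)] by simp
  show ?thesis by (rule integrable_const_bound[where B = 1], use assms in simp, measurable)
qed

lemma gsmooth_nonneg: "gsmooth l M z \<ge> 0"
  by (simp add: gsmooth_def)

lemma ennreal_gsmooth:
  assumes "M \<in> borel_probs" "l \<ge> 0"
  shows "ennreal (gsmooth l M z) = (\<integral>\<^sup>+ x. ennreal (exp (- (2 * l * (norm (x - z))\<^sup>2))) \<partial>M)"
  unfolding gsmooth_def by (rule nn_integral_eq_integral[symmetric]) (use integrable_gauss_kernel[OF assms] in auto)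

lemma gsmooth_measurable [measurable]:
  assumes "M \<in> borel_probs"
  shows "gsmooth l M \<in> borel_measurable borel"
proof -
  interpret prob_space M using borel_probsD[OF assms(1)] by simp
  have [measurable_cong]: "sets M = sets borel" using borel_probsD[OF assms(1)] by simp
  show ?thesis unfolding gsmooth_def by measurable
qed

lemma integrable_gpair:
  fixes M N :: "'a::euclidean_space measure"
  assumes "M \<in> borel_probs" "N \<in> borel_probs" "l \<ge> 0"
  shows "integrable (M \<Otimes>\<^sub>M N) (\<lambda>p. exp (- (l * (norm (fst p - snd p))\<^sup>2)))"
proof -
  interpret prob_space "M \<Otimes>\<^sub>M N" using prob_space_pair[OF assms(1,2)] .
  have [measurable_cong]: "sets M = sets borel" "sets N = sets borel" using borel_probsD assms by auto
  show ?thesis by (rule integrable_const_bound[where B = 1], use assms in simp, measurable)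
qed

lemma gsmooth_product:
  fixes M N :: "'a::euclidean_space measure"
  assumes M: "M \<in> borel_probs" and N: "N \<in> borel_probs" and l: "l > 0"
  shows "(\<integral>\<^sup>+ z. ennreal (gsmooth l M z * gsmooth l N z) \<partial>lborel) = ennreal (gconst TYPE('a) l * gpair l M N)"
proof -
  interpret M: prob_space M using borel_probsD[OF M] by simp
  interpret N: prob_space N using borel_probsD[OF N] by simp
  interpret PM: pair_sigma_finite M "lborel :: 'a measure" ..
  interpret PN: pair_sigma_finite N "lborel :: 'a measure" ..
  have [measurable_cong]: "sets M = sets borel" "sets N = sets borel" using borel_probsD M N by auto
  let ?e = "\<lambda>x z::'a. exp (- (2 * l * (norm (x - z))\<^sup>2))"
  have "(\<integral>\<^sup>+ z. ennreal (gsmooth l M z * gsmooth l N z) \<partial>lborel) =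
    (\<integral>\<^sup>+ z. \<integral>\<^sup>+ x. ennreal (?e x z) * ennreal (gsmooth l N z) \<partial>M \<partial>lborel)"
    using M N l by (intro nn_integral_cong)
      (simp add: ennreal_mult' gsmooth_nonneg ennreal_gsmooth[OF M] nn_integral_multc)
  also have "\<dots> = (\<integral>\<^sup>+ x. \<integral>\<^sup>+ z. ennreal (?e x z) * ennreal (gsmooth l N z) \<partial>lborel \<partial>M)"
    using N by (intro PM.Fubini') measurable
  also have "\<dots> = (\<integral>\<^sup>+ x. \<integral>\<^sup>+ y. ennreal (gconst TYPE('a) l * exp (- (l * (norm (x - y))\<^sup>2))) \<partial>N \<partial>M)"
  proof (intro nn_integral_cong)
    fix x
    have "(\<integral>\<^sup>+ z. ennreal (?e x z) * ennreal (gsmooth l N z) \<partial>lborel) =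
      (\<integral>\<^sup>+ z. \<integral>\<^sup>+ y. ennreal (?e x z) * ennreal (?e y z) \<partial>N \<partial>lborel)"
      using N l by (intro nn_integral_cong) (simp add: ennreal_gsmooth nn_integral_cmult)
    also have "\<dots> = (\<integral>\<^sup>+ y. \<integral>\<^sup>+ z. ennreal (?e x z) * ennreal (?e y z) \<partial>lborel \<partial>N)"
      by (intro PN.Fubini') measurable
    also have "\<dots> = (\<integral>\<^sup>+ y. ennreal (gconst TYPE('a) l * exp (- (l * (norm (x - y))\<^sup>2))) \<partial>N)"
    proof (intro nn_integral_cong)
      fix y
      \<comment> \<open>The parallelogram law around the midpoint of x and y: the product of two
        Gaussians in z is a Gaussian in \<open>x - y\<close> times one centred at the midpoint, and
        the latter integrates to a constant.\<close>
      have id: "2 * (norm (x - z))\<^sup>2 + 2 * (norm (y - z))\<^sup>2 = (norm (x - y))\<^sup>2 + 4 * (norm (z + - ((1/2) *\<^sub>R (x + y))))\<^sup>2" for z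
        unfolding power2_norm_eq_inner
        by (simp add: inner_add_left inner_add_right inner_diff_left inner_diff_right inner_commute[of y x]
            inner_commute[of z x] inner_commute[of z y] algebra_simps)
      have "ennreal (?e x z) * ennreal (?e y z) =
        ennreal (exp (- (l * (norm (x - y))\<^sup>2))) * ennreal (exp (- (4 * l * (norm (z + - ((1/2) *\<^sub>R (x + y))))\<^sup>2)))" for z
      proof -
        have "- (2 * l * (norm (x - z))\<^sup>2) + - (2 * l * (norm (y - z))\<^sup>2) =
          - (l * (norm (x - y))\<^sup>2) + - (4 * l * (norm (z + - ((1/2) *\<^sub>R (x + y))))\<^sup>2)"
          using arg_cong[OF id[of z], of "\<lambda>t. - l * t"] by (simp add: algebra_simps)
        then show ?thesis by (simp only: ennreal_mult[symmetric] exp_ge_zero exp_add[symmetric])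
      qed
      then have "(\<integral>\<^sup>+ z. ennreal (?e x z) * ennreal (?e y z) \<partial>lborel) =
        ennreal (exp (- (l * (norm (x - y))\<^sup>2))) * (\<integral>\<^sup>+ z. ennreal (exp (- (4 * l * (norm (z + - ((1/2) *\<^sub>R (x + y))))\<^sup>2))) \<partial>lborel)"
        by (simp only:) (rule nn_integral_cmult, measurable)
      also have "(\<integral>\<^sup>+ z. ennreal (exp (- (4 * l * (norm (z + - ((1/2) *\<^sub>R (x + y))))\<^sup>2))) \<partial>lborel) = ennreal (gconst TYPE('a) l)"
        using nn_integral_lborel_translate[of "\<lambda>z. ennreal (exp (- (4 * l * (norm z)\<^sup>2)))" "- ((1/2) *\<^sub>R (x + y))"]
          nn_integral_gauss_scaled[of "4 * l", where 'a='a] l by (simp add: gconst_def)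
      finally show "(\<integral>\<^sup>+ z. ennreal (?e x z) * ennreal (?e y z) \<partial>lborel) =
          ennreal (gconst TYPE('a) l * exp (- (l * (norm (x - y))\<^sup>2)))"
        using gconst_pos[OF l, where 'a='a] by (simp add: ennreal_mult' less_imp_le mult.commute)
    qed
    finally show "(\<integral>\<^sup>+ z. ennreal (?e x z) * ennreal (gsmooth l N z) \<partial>lborel) =
      (\<integral>\<^sup>+ y. ennreal (gconst TYPE('a) l * exp (- (l * (norm (x - y))\<^sup>2))) \<partial>N)" .
  qed
  also have "\<dots> = (\<integral>\<^sup>+ p. ennreal (gconst TYPE('a) l * exp (- (l * (norm (fst p - snd p))\<^sup>2))) \<partial>(M \<Otimes>\<^sub>M N))"
    by (subst N.nn_integral_fst[symmetric]) auto
  also have "\<dots> = ennreal (gconst TYPE('a) l * gpair l M N)"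
    unfolding gpair_def using gconst_pos[OF l, where 'a='a] integrable_gpair[OF M N] l
    by (subst nn_integral_eq_integral) (auto simp: less_imp_le)
  finally show ?thesis .
qed

lemma gsmooth_product_integral:
  fixes M N :: "'a::euclidean_space measure"
  assumes M: "M \<in> borel_probs" and N: "N \<in> borel_probs" and l: "l > 0"
  shows "integrable lborel (\<lambda>z. gsmooth l M z * gsmooth l N z)"
    "(\<integral> z. gsmooth l M z * gsmooth l N z \<partial>lborel) = gconst TYPE('a) l * gpair l M N"
proof -
  have [measurable]: "gsmooth l M \<in> borel_measurable borel" "gsmooth l N \<in> borel_measurable borel"
    using M N by (auto intro: gsmooth_measurable)
  have nn: "0 \<le> gsmooth l M z * gsmooth l N z" for z by (simp add: gsmooth_nonneg)
  have g: "0 \<le> gconst TYPE('a) l * gpair l M N"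
    using gconst_pos[OF l, where 'a='a] by (simp add: gpair_def)
  show "integrable lborel (\<lambda>z. gsmooth l M z * gsmooth l N z)"
    using gsmooth_product[OF M N l] nn by (intro integrableI_nonneg) auto
  show "(\<integral> z. gsmooth l M z * gsmooth l N z \<partial>lborel) = gconst TYPE('a) l * gpair l M N"
    using gsmooth_product[OF M N l] nn g by (subst integral_eq_nn_integral) auto
qed

definition gdist :: "real \<Rightarrow> 'a::euclidean_space measure \<Rightarrow> 'a measure \<Rightarrow> real" where
  "gdist l M N = gpair l M M - 2 * gpair l M N + gpair l N N"

lemma gdist_eq:
  fixes M N :: "'a::euclidean_space measure"
  assumes M: "M \<in> borel_probs" and N: "N \<in> borel_probs" and l: "l > 0"
  shows "integrable lborel (\<lambda>z. (gsmooth l M z - gsmooth l N z)\<^sup>2)"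
    "gconst TYPE('a) l * gdist l M N = (\<integral> z. (gsmooth l M z - gsmooth l N z)\<^sup>2 \<partial>lborel)"
proof -
  have e: "(gsmooth l M z - gsmooth l N z)\<^sup>2 = gsmooth l M z * gsmooth l M z - 2 * (gsmooth l M z * gsmooth l N z)
      + gsmooth l N z * gsmooth l N z" for z
    by (simp add: power2_eq_square algebra_simps)
  note I = gsmooth_product_integral[OF M M l] gsmooth_product_integral[OF M N l] gsmooth_product_integral[OF N N l]
  show "integrable lborel (\<lambda>z. (gsmooth l M z - gsmooth l N z)\<^sup>2)"
    unfolding e by (intro Bochner_Integration.integrable_add Bochner_Integration.integrable_diff integrable_mult_right I)
  show "gconst TYPE('a) l * gdist l M N = (\<integral> z. (gsmooth l M z - gsmooth l N z)\<^sup>2 \<partial>lborel)"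
    unfolding e using I by (simp add: gdist_def algebra_simps)
qed

lemma gdist_nonneg:
  fixes M N :: "'a::euclidean_space measure"
  assumes "M \<in> borel_probs" "N \<in> borel_probs" "l > 0"
  shows "gdist l M N \<ge> 0"
proof -
  have "gconst TYPE('a) l * gdist l M N \<ge> 0" unfolding gdist_eq(2)[OF assms] by simp
  then show ?thesis using gconst_pos[OF assms(3), where 'a='a] by (simp add: zero_le_mult_iff)
qed

lemma gdist_0_imp:
  fixes M N :: "'a::euclidean_space measure"
  assumes "M \<in> borel_probs" "N \<in> borel_probs" "l > 0" "gdist l M N = 0"
  shows "AE z in lborel. gsmooth l M z = gsmooth l N z"
proof -
  have "(\<integral> z. (gsmooth l M z - gsmooth l N z)\<^sup>2 \<partial>lborel) = 0"
    using gdist_eq(2)[OF assms(1-3)] assms(4) by simp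
  then have "AE z in lborel. (gsmooth l M z - gsmooth l N z)\<^sup>2 = 0"
    using gdist_eq(1)[OF assms(1-3)] by (subst (asm) integral_nonneg_eq_0_iff_AE) auto
  then show ?thesis by eventually_elim simp
qed

text \<open>Continuous functions of the distance decrease to the indicator of a closed set, and
  closed sets form an intersection-stable generator of the Borel sets.\<close>

lemma prob_eqI_continuous:
  fixes M N :: "'a::euclidean_space measure"
  assumes M: "M \<in> borel_probs" and N: "N \<in> borel_probs"
    and eq: "\<And>f. continuous_on UNIV f \<Longrightarrow> (\<And>x. 0 \<le> f x) \<Longrightarrow> (\<And>x. f x \<le> (1::real)) \<Longrightarrow>
      (\<integral>\<^sup>+ x. ennreal (f x) \<partial>M) = (\<integral>\<^sup>+ x. ennreal (f x) \<partial>N)"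
  shows "M = N"
proof -
  interpret M: prob_space M using borel_probsD[OF M] by simp
  interpret N: prob_space N using borel_probsD[OF N] by simp
  have s [measurable_cong]: "sets M = sets borel" "sets N = sets borel" using borel_probsD M N by auto
  have closed_eq: "emeasure M F = emeasure N F" if F: "closed F" for F
  proof (cases "F = {}")
    case False
    define f where "f n x = max 0 (1 - real n * infdist x F)" for n x
    have cont: "continuous_on UNIV (f n)" for n
      unfolding f_def by (intro continuous_intros)
    have [measurable]: "f n \<in> borel_measurable borel" for n
      by (rule borel_measurable_continuous_onI[OF cont])
    have [measurable]: "F \<in> sets borel" using F by simp
    have b: "0 \<le> f n x" "f n x \<le> 1" for n x by (auto simp: f_def infdist_nonneg)
    have lim: "(\<lambda>n. ennreal (f n x)) \<longlonglongrightarrow> indicator F x" for x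
    proof (cases "x \<in> F")
      case True
      then show ?thesis by (simp add: f_def)
    next
      case x: False
      then have pos: "infdist x F > 0" using F False by (simp add: infdist_pos_not_in_closed)
      obtain m where m: "1 / infdist x F < real m" using reals_Archimedean2 by blast
      have "f n x = 0" if "n \<ge> m" for n
      proof -
        have "1 / infdist x F \<le> real n" using m that by linarith
        then have "1 \<le> real n * infdist x F" using pos by (simp add: divide_le_eq)
        then show ?thesis by (simp add: f_def)
      qed
      then have "eventually (\<lambda>n. ennreal (f n x) = 0) sequentially"
        unfolding eventually_at_top_linorder by (intro exI[of _ m]) simp
      then show ?thesis using x by (simp add: tendsto_eventually)
    qed
    have conv: "(\<lambda>n. \<integral>\<^sup>+ x. ennreal (f n x) \<partial>P) \<longlonglongrightarrow> emeasure P F" if P: "P \<in> borel_probs" for P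
    proof -
      interpret P: prob_space P using borel_probsD[OF P] by simp
      have [measurable_cong]: "sets P = sets borel" using borel_probsD P by auto
      have "(\<lambda>n. \<integral>\<^sup>+ x. ennreal (f n x) \<partial>P) \<longlonglongrightarrow> (\<integral>\<^sup>+ x. indicator F x \<partial>P)"
        by (rule nn_integral_dominated_convergence[where w = "\<lambda>_. 1"])
          (use b lim in \<open>auto simp: P.emeasure_space_1\<close>)
      then show ?thesis by simp
    qed
    have "(\<lambda>n. \<integral>\<^sup>+ x. ennreal (f n x) \<partial>M) = (\<lambda>n. \<integral>\<^sup>+ x. ennreal (f n x) \<partial>N)"
      using eq[OF cont b] by simp
    then show ?thesis using conv[OF M] conv[OF N] LIMSEQ_unique by metis
  qed simp
  show ?thesis
  proof (rule measure_eqI_generator_eq[where E = "Collect closed" and \<Omega> = UNIV and A = "\<lambda>_. UNIV"])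
    show "Int_stable (Collect closed :: 'a set set)" by (auto simp: Int_stable_def)
    show "sets M = sigma_sets UNIV (Collect closed)" "sets N = sigma_sets UNIV (Collect closed)"
      unfolding s by (subst borel_eq_closed, simp)+
  qed (use closed_eq in \<open>auto simp: M.emeasure_eq_measure\<close>)
qed

text \<open>Convolution with a Gaussian after rescaling: l moves from the weight into the argument
  of f, so the weight serves as a dominating function while l tends to infinity.\<close>

definition blur :: "real \<Rightarrow> ('a::euclidean_space \<Rightarrow> real) \<Rightarrow> 'a \<Rightarrow> ennreal" where
  "blur l f x = (\<integral>\<^sup>+ y. ennreal (f (x + (1 / sqrt (2 * l)) *\<^sub>R y) * exp (- (norm y)\<^sup>2)) \<partial>lborel)"

lemma nn_integral_gsmooth_mult:
  fixes M :: "'a::euclidean_space measure"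
  assumes M: "M \<in> borel_probs" and l: "l > 0" and [measurable]: "f \<in> borel_measurable borel" and f: "\<And>x. 0 \<le> f x"
  shows "(\<integral>\<^sup>+ z. ennreal (f z) * ennreal (gsmooth l M z) \<partial>lborel) =
    ennreal ((1 / sqrt (2 * l)) ^ DIM('a)) * (\<integral>\<^sup>+ x. blur l f x \<partial>M)"
proof -
  interpret M: prob_space M using borel_probsD[OF M] by simp
  interpret P: pair_sigma_finite M "lborel :: 'a measure" ..
  have [measurable_cong]: "sets M = sets borel" using borel_probsD M by auto
  let ?e = "\<lambda>x z::'a. exp (- (2 * l * (norm (x - z))\<^sup>2))"
  let ?c = "1 / sqrt (2 * l)"
  have c: "?c > 0" using l by simp
  have "(\<integral>\<^sup>+ z. ennreal (f z) * ennreal (gsmooth l M z) \<partial>lborel) = (\<integral>\<^sup>+ z. \<integral>\<^sup>+ x. ennreal (f z) * ennreal (?e x z) \<partial>M \<partial>lborel)"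
    using M l by (intro nn_integral_cong) (simp add: ennreal_gsmooth nn_integral_cmult)
  also have "\<dots> = (\<integral>\<^sup>+ x. \<integral>\<^sup>+ z. ennreal (f z) * ennreal (?e x z) \<partial>lborel \<partial>M)"
    by (intro P.Fubini') measurable
  also have "\<dots> = (\<integral>\<^sup>+ x. ennreal (?c ^ DIM('a)) * blur l f x \<partial>M)"
  proof (intro nn_integral_cong)
    fix x
    have "(\<integral>\<^sup>+ z. ennreal (f z) * ennreal (?e x z) \<partial>lborel) = (\<integral>\<^sup>+ z. ennreal (f (z + x)) * ennreal (?e x (z + x)) \<partial>lborel)"
      by (subst nn_integral_lborel_translate[where f = "\<lambda>z. ennreal (f z) * ennreal (?e x z)"]) auto
    also have "\<dots> = ennreal (?c ^ DIM('a)) * (\<integral>\<^sup>+ z. ennreal (f (?c *\<^sub>R z + x)) * ennreal (?e x (?c *\<^sub>R z + x)) \<partial>lborel)"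
      by (rule nn_integral_lborel_scale) (use c in auto)
    also have "(\<integral>\<^sup>+ z. ennreal (f (?c *\<^sub>R z + x)) * ennreal (?e x (?c *\<^sub>R z + x)) \<partial>lborel) = blur l f x"
      unfolding blur_def
    proof (intro nn_integral_cong)
      fix z
      have "2 * l * (norm (x - (?c *\<^sub>R z + x)))\<^sup>2 = (norm z)\<^sup>2"
        using l by (simp add: power_divide power_mult_distrib)
      then show "ennreal (f (?c *\<^sub>R z + x)) * ennreal (?e x (?c *\<^sub>R z + x)) = ennreal (f (x + ?c *\<^sub>R z) * exp (- (norm z)\<^sup>2))"
        using f by (simp only: ennreal_mult add.commute exp_ge_zero)
    qed
    finally show "(\<integral>\<^sup>+ z. ennreal (f z) * ennreal (?e x z) \<partial>lborel) = ennreal (?c ^ DIM('a)) * blur l f x" .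
  qed
  also have "\<dots> = ennreal (?c ^ DIM('a)) * (\<integral>\<^sup>+ x. blur l f x \<partial>M)"
    unfolding blur_def by (rule nn_integral_cmult) measurable
  finally show ?thesis .
qed

lemma nn_integral_blur_tendsto:
  fixes M :: "'a::euclidean_space measure"
  assumes M: "M \<in> borel_probs" and l: "filterlim l at_top sequentially"
    and cont: "continuous_on UNIV f" and f: "\<And>x. 0 \<le> f x" "\<And>x. f x \<le> 1"
  shows "(\<lambda>i. \<integral>\<^sup>+ x. blur (l i) f x \<partial>M) \<longlonglongrightarrow> ennreal (gauss_mass TYPE('a)) * (\<integral>\<^sup>+ x. ennreal (f x) \<partial>M)"
proof -
  interpret M: prob_space M using borel_probsD[OF M] by simp
  have [measurable_cong]: "sets M = sets borel" using borel_probsD M by auto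
  have [measurable]: "f \<in> borel_measurable borel" by (rule borel_measurable_continuous_onI[OF cont])
  let ?J = "gauss_mass TYPE('a)"
  have J: "(\<integral>\<^sup>+ (y::'a). ennreal (exp (- (norm y)\<^sup>2)) \<partial>lborel) = ennreal ?J" by (rule nn_integral_gauss)
  have le: "ennreal (f (x + c *\<^sub>R y) * exp (- (norm y)\<^sup>2)) \<le> ennreal (exp (- (norm y)\<^sup>2))" for x y and c :: real
    using f by (intro ennreal_leI) (simp add: mult_left_le_one_le)
  have c0: "(\<lambda>i. 1 / sqrt (2 * l i)) \<longlonglongrightarrow> 0"
  proof -
    have "filterlim (\<lambda>i. sqrt (2 * l i)) at_top sequentially"
      by (intro filterlim_compose[OF sqrt_at_top] filterlim_tendsto_pos_mult_at_top[OF tendsto_const _ l]) auto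
    then show ?thesis by (intro tendsto_divide_0[OF tendsto_const] filterlim_at_top_imp_at_infinity)
  qed
  have pt: "(\<lambda>i. blur (l i) f x) \<longlonglongrightarrow> ennreal (f x) * ennreal ?J" for x
  proof -
    have "(\<lambda>i. blur (l i) f x) \<longlonglongrightarrow> (\<integral>\<^sup>+ y. ennreal (f x * exp (- (norm (y::'a))\<^sup>2)) \<partial>lborel)"
      unfolding blur_def
    proof (rule nn_integral_dominated_convergence[where w = "\<lambda>y. ennreal (exp (- (norm (y::'a))\<^sup>2))"])
      show "AE y in lborel. (\<lambda>i. ennreal (f (x + (1 / sqrt (2 * l i)) *\<^sub>R y) * exp (- (norm y)\<^sup>2))) \<longlonglongrightarrow> ennreal (f x * exp (- (norm y)\<^sup>2))"
      proof (intro always_eventually allI tendsto_ennrealI tendsto_mult tendsto_const)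
        fix y :: 'a
        have "(\<lambda>i. x + (1 / sqrt (2 * l i)) *\<^sub>R y) \<longlonglongrightarrow> x + 0 *\<^sub>R y" by (intro tendsto_intros c0)
        then have "(\<lambda>i. x + (1 / sqrt (2 * l i)) *\<^sub>R y) \<longlonglongrightarrow> x" by simp
        moreover have "isCont f x" using cont by (simp add: continuous_on_eq_continuous_at)
        ultimately show "(\<lambda>i. f (x + (1 / sqrt (2 * l i)) *\<^sub>R y)) \<longlonglongrightarrow> f x"
          by (rule isCont_tendsto_compose[rotated])
      qed
    qed (use le J in auto)
    also have "(\<integral>\<^sup>+ y. ennreal (f x * exp (- (norm (y::'a))\<^sup>2)) \<partial>lborel) = ennreal (f x) * ennreal ?J"
      unfolding J[symmetric] using f(1) by (simp add: ennreal_mult nn_integral_cmult)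
    finally show ?thesis .
  qed
  have "(\<lambda>i. \<integral>\<^sup>+ x. blur (l i) f x \<partial>M) \<longlonglongrightarrow> (\<integral>\<^sup>+ x. ennreal (f x) * ennreal ?J \<partial>M)"
  proof (rule nn_integral_dominated_convergence[where w = "\<lambda>_. ennreal ?J"])
    show "AE x in M. blur (l i) f x \<le> ennreal ?J" for i
      unfolding J[symmetric] blur_def by (intro always_eventually allI nn_integral_mono le)
    show "blur (l i) f \<in> borel_measurable M" for i unfolding blur_def by measurable
  qed (use pt in \<open>auto simp: M.emeasure_space_1\<close>)
  also have "(\<integral>\<^sup>+ x. ennreal (f x) * ennreal ?J \<partial>M) = ennreal ?J * (\<integral>\<^sup>+ x. ennreal (f x) \<partial>M)"
    by (subst nn_integral_multc) (auto simp: mult.commute)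
  finally show ?thesis .
qed

text \<open>A vanishing Gaussian distance makes the smoothed densities agree almost everywhere.
  Tested against f this equates the integrals of \<open>blur\<close>, and their limit recovers the
  integral of f. A sequence of parameters is enough.\<close>

lemma gdist_0_imp_eq:
  fixes M N :: "'a::euclidean_space measure"
  assumes M: "M \<in> borel_probs" and N: "N \<in> borel_probs" and l: "filterlim l at_top sequentially"
    and pos: "\<And>i. l i > 0" and 0: "\<And>i. gdist (l i) M N = 0"
  shows "M = N"
proof (rule prob_eqI_continuous[OF M N])
  fix f :: "'a \<Rightarrow> real" assume cont: "continuous_on UNIV f" and f: "\<And>x. 0 \<le> f x" "\<And>x. f x \<le> 1"
  have [measurable]: "f \<in> borel_measurable borel" by (rule borel_measurable_continuous_onI[OF cont])
  have "(\<integral>\<^sup>+ x. blur (l i) f x \<partial>M) = (\<integral>\<^sup>+ x. blur (l i) f x \<partial>N)" for i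
  proof -
    let ?k = "ennreal ((1 / sqrt (2 * l i)) ^ DIM('a))"
    have "(\<integral>\<^sup>+ z. ennreal (f z) * ennreal (gsmooth (l i) M z) \<partial>lborel) = (\<integral>\<^sup>+ z. ennreal (f z) * ennreal (gsmooth (l i) N z) \<partial>lborel)"
    proof (rule nn_integral_cong_AE)
      show "AE z in lborel. ennreal (f z) * ennreal (gsmooth (l i) M z) = ennreal (f z) * ennreal (gsmooth (l i) N z)"
        using gdist_0_imp[OF M N pos 0, of i] by eventually_elim simp
    qed
    then have "?k * (\<integral>\<^sup>+ x. blur (l i) f x \<partial>M) = ?k * (\<integral>\<^sup>+ x. blur (l i) f x \<partial>N)"
      using nn_integral_gsmooth_mult[OF M pos _ f(1)] nn_integral_gsmooth_mult[OF N pos _ f(1)] by simp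
    moreover have "?k \<noteq> 0" "?k \<noteq> top" using pos[of i] by auto
    ultimately show ?thesis by (simp add: ennreal_mult_cancel_left)
  qed
  then have "(\<lambda>i. \<integral>\<^sup>+ x. blur (l i) f x \<partial>M) = (\<lambda>i. \<integral>\<^sup>+ x. blur (l i) f x \<partial>N)" by simp
  with nn_integral_blur_tendsto[OF M l cont f] nn_integral_blur_tendsto[OF N l cont f]
  have "ennreal (gauss_mass TYPE('a)) * (\<integral>\<^sup>+ x. ennreal (f x) \<partial>M) = ennreal (gauss_mass TYPE('a)) * (\<integral>\<^sup>+ x. ennreal (f x) \<partial>N)"
    using LIMSEQ_unique by metis
  then show "(\<integral>\<^sup>+ x. ennreal (f x) \<partial>M) = (\<integral>\<^sup>+ x. ennreal (f x) \<partial>N)"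
    using gauss_mass_pos[where 'a='a] by (simp add: ennreal_mult_cancel_left)
qed

section \<open>From the Gaussian forms to the kernel\<close>

lemma kk_measurable [measurable]: "kk a \<in> borel_measurable borel"
proof -
  have "(\<lambda>t::real. - ln t / 2) \<in> borel_measurable borel" "(\<lambda>t::real. (t powr (- a) - 1) / (2 * a)) \<in> borel_measurable borel"
    by measurable
  then show ?thesis unfolding kk_def[abs_def] by (cases "a = 0") auto
qed

definition kk_pair :: "real \<Rightarrow> 'a::euclidean_space \<times> 'a \<Rightarrow> real" where
  "kk_pair a p = kk a ((norm (fst p - snd p))\<^sup>2)"

definition kk_energy :: "real \<Rightarrow> 'a::euclidean_space measure \<Rightarrow> 'a measure \<Rightarrow> real" where
  "kk_energy a P Q = (\<integral> p. kk_pair a p \<partial>(P \<Otimes>\<^sub>M Q))"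

text \<open>For \<open>a \<ge> 0\<close> the junk value of \<^const>\<open>kk\<close> at \<open>0\<close> must not be seen by the measure.\<close>

definition kk_admissible :: "real \<Rightarrow> 'a::euclidean_space measure \<Rightarrow> 'a measure \<Rightarrow> bool" where
  "kk_admissible a P Q \<longleftrightarrow> integrable (P \<Otimes>\<^sub>M Q) (kk_pair a) \<and> (AE p in P \<Otimes>\<^sub>M Q. a < 0 \<or> fst p \<noteq> snd p)"

lemma kk_pair_measurable [measurable]:
  fixes P Q :: "'a::euclidean_space measure"
  assumes [measurable_cong]: "sets P = sets borel" "sets Q = sets borel"
  shows "kk_pair a \<in> borel_measurable (P \<Otimes>\<^sub>M Q)"
  unfolding kk_pair_def[abs_def] by measurable

text \<open>For fixed t the function \<open>lker a l t\<close> has one sign in l, so its absolute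
  integral is \<open>\<bar>kk a t\<bar>\<close>. Integrability of the kernel is therefore exactly
  what Fubini's theorem asks for.\<close>

lemma kk_energy_laplace:
  fixes P Q :: "'a::euclidean_space measure"
  assumes a: "a > -1" and P: "P \<in> borel_probs" and Q: "Q \<in> borel_probs" and adm: "kk_admissible a P Q"
  shows "integrable lborel (\<lambda>l. indicator {0<..} l * (l powr (a - 1) * (gpair l P Q - exp (- l))) / (2 * Gamma (a + 1)))"
    "(\<integral> l. indicator {0<..} l * (l powr (a - 1) * (gpair l P Q - exp (- l))) / (2 * Gamma (a + 1)) \<partial>lborel) = kk_energy a P Q"
proof -
  interpret PQ: prob_space "P \<Otimes>\<^sub>M Q" by (rule prob_space_pair[OF P Q])
  interpret X: pair_sigma_finite "P \<Otimes>\<^sub>M Q" "lborel :: real measure" ..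
  have [measurable_cong]: "sets P = sets borel" "sets Q = sets borel" using borel_probsD P Q by auto
  let ?t = "\<lambda>p::'a \<times> 'a. (norm (fst p - snd p))\<^sup>2"
  let ?f = "\<lambda>p l. lker a l (?t p)"
  have int: "integrable (P \<Otimes>\<^sub>M Q) (kk_pair a)" using adm by (simp add: kk_admissible_def)
  have ae: "AE p in P \<Otimes>\<^sub>M Q. ?t p > 0 \<or> ?t p = 0 \<and> a < 0"
  proof -
    have "AE p in P \<Otimes>\<^sub>M Q. a < 0 \<or> fst p \<noteq> snd p" using adm by (simp only: kk_admissible_def)
    then show ?thesis by eventually_elim auto
  qed
  have abs: "AE p in P \<Otimes>\<^sub>M Q. (\<integral> l. norm (?f p l) \<partial>lborel) = \<bar>kk_pair a p\<bar>"
    using ae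
  proof eventually_elim
    case (elim p)
    then show ?case
      by (subst integral_eq_nn_integral) (auto simp: nn_integral_lker[OF a] kk_pair_def)
  qed
  have meas: "case_prod ?f \<in> borel_measurable ((P \<Otimes>\<^sub>M Q) \<Otimes>\<^sub>M lborel)" by measurable
  have prod: "integrable ((P \<Otimes>\<^sub>M Q) \<Otimes>\<^sub>M lborel) (case_prod ?f)"
  proof (rule X.Fubini_integrable[OF meas])
    have "integrable (P \<Otimes>\<^sub>M Q) (\<lambda>p. \<bar>kk_pair a p\<bar>)" using int by simp
    then show "integrable (P \<Otimes>\<^sub>M Q) (\<lambda>p. \<integral> l. norm (case (p, l) of (p, l) \<Rightarrow> ?f p l) \<partial>lborel)"
      by (rule integrable_cong_AE_imp) (use abs in \<open>auto elim: eventually_mono\<close>)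
    show "AE p in P \<Otimes>\<^sub>M Q. integrable lborel (\<lambda>l. case (p, l) of (p, l) \<Rightarrow> ?f p l)"
      using ae by eventually_elim (simp add: lker_integral[OF a])
  qed
  have inner: "(\<integral> p. ?f p l \<partial>(P \<Otimes>\<^sub>M Q)) =
    indicator {0<..} l * (l powr (a - 1) * (gpair l P Q - exp (- l))) / (2 * Gamma (a + 1))" for l
  proof (cases "l > 0")
    case True
    have "(\<integral> p. exp (- l * ?t p) - exp (- l) \<partial>(P \<Otimes>\<^sub>M Q)) = gpair l P Q - exp (- l)"
      using integrable_gpair[OF P Q, of l] True
      by (subst Bochner_Integration.integral_diff) (auto simp: gpair_def PQ.prob_space)
    then show ?thesis by (simp add: lker_def)
  qed (simp add: lker_def)
  show "integrable lborel (\<lambda>l. indicator {0<..} l * (l powr (a - 1) * (gpair l P Q - exp (- l))) / (2 * Gamma (a + 1)))"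
    using X.integrable_snd[OF prod] unfolding inner .
  have "(\<integral> l. \<integral> p. ?f p l \<partial>(P \<Otimes>\<^sub>M Q) \<partial>lborel) = (\<integral> p. \<integral> l. ?f p l \<partial>lborel \<partial>(P \<Otimes>\<^sub>M Q))"
    by (rule X.Fubini_integral[OF prod])
  also have "\<dots> = kk_energy a P Q" unfolding kk_energy_def
  proof (rule integral_cong_AE)
    show "AE p in P \<Otimes>\<^sub>M Q. (\<integral> l. ?f p l \<partial>lborel) = kk_pair a p"
      using ae by eventually_elim (simp add: lker_integral[OF a] kk_pair_def)
  qed measurable
  finally show "(\<integral> l. indicator {0<..} l * (l powr (a - 1) * (gpair l P Q - exp (- l))) / (2 * Gamma (a + 1)) \<partial>lborel) = kk_energy a P Q"
    unfolding inner .
qed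

text \<open>
  Each Gaussian form is nonnegative, and the kernel is a mixture of Gaussians up to an additive
  constant, which cancels because the measures have the same mass.
\<close>

lemma kk_energy_posdef:
  fixes M N :: "'a::euclidean_space measure"
  assumes a: "a > -1" and M: "M \<in> borel_probs" and N: "N \<in> borel_probs"
    and adm: "kk_admissible a M M" "kk_admissible a M N" "kk_admissible a N N"
  shows "kk_energy a M M - 2 * kk_energy a M N + kk_energy a N N \<ge> 0"
    "kk_energy a M M - 2 * kk_energy a M N + kk_energy a N N = 0 \<Longrightarrow> M = N"
proof -
  have G: "Gamma (a + 1) > 0" using a by (intro Gamma_real_pos) auto
  let ?h = "\<lambda>P Q l. indicator {0<..} l * (l powr (a - 1) * (gpair l P Q - exp (- l))) / (2 * Gamma (a + 1))"
  let ?g = "\<lambda>l. indicator {0<..} l * (l powr (a - 1) * gdist l M N) / (2 * Gamma (a + 1))"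
  note I = kk_energy_laplace[OF a M M adm(1)] kk_energy_laplace[OF a M N adm(2)] kk_energy_laplace[OF a N N adm(3)]
  have e: "?g = (\<lambda>l. ?h M M l - 2 * ?h M N l + ?h N N l)"
    by (intro ext) (simp add: gdist_def diff_divide_distrib add_divide_distrib algebra_simps)
  have int: "integrable lborel ?g"
    unfolding e by (intro Bochner_Integration.integrable_add Bochner_Integration.integrable_diff integrable_mult_right I)
  have eq: "kk_energy a M M - 2 * kk_energy a M N + kk_energy a N N = (\<integral> l. ?g l \<partial>lborel)"
  proof -
    have "(\<integral> l. ?g l \<partial>lborel) = (\<integral> l. ?h M M l - 2 * ?h M N l \<partial>lborel) + (\<integral> l. ?h N N l \<partial>lborel)"
      unfolding e by (intro Bochner_Integration.integral_add Bochner_Integration.integrable_diff integrable_mult_right I)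
    also have "(\<integral> l. ?h M M l - 2 * ?h M N l \<partial>lborel) = (\<integral> l. ?h M M l \<partial>lborel) - (\<integral> l. 2 * ?h M N l \<partial>lborel)"
      by (intro Bochner_Integration.integral_diff integrable_mult_right I)
    finally show ?thesis by (simp only: integral_mult_right_zero I)
  qed
  have nn: "?g l \<ge> 0" for l
    using gdist_nonneg[OF M N, of l] G by (cases "l > 0") auto
  show "kk_energy a M M - 2 * kk_energy a M N + kk_energy a N N \<ge> 0"
    unfolding eq by (rule integral_nonneg_AE) (use nn in blast)
  assume "kk_energy a M M - 2 * kk_energy a M N + kk_energy a N N = 0"
  then have "AE l in lborel. ?g l = 0"
    unfolding eq using int nn by (subst (asm) integral_nonneg_eq_0_iff_AE) auto
  then have ae: "AE l in lborel. l > 0 \<longrightarrow> gdist l M N = 0"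
    by eventually_elim (use G in \<open>auto simp: indicator_def\<close>)
  \<comment> \<open>The distance vanishes only for almost every l, but every interval beyond i has
    positive length and so contains such an l.\<close>
  have "\<exists>l. l > real i \<and> gdist l M N = 0" for i
  proof (rule ccontr)
    assume none: "\<nexists>l. l > real i \<and> gdist l M N = 0"
    have "AE l in lborel. l \<notin> {real i<..<real i + 1}"
      using ae
    proof eventually_elim
      case (elim l)
      show ?case using none elim by (cases "l > real i") auto
    qed
    then have "emeasure lborel {real i<..<real i + 1} = 0"
      by (subst (asm) AE_iff_measurable[of "{real i<..<real i + 1}"]) auto
    then show False by simp
  qed
  then obtain l where l: "\<And>i. l i > real i" "\<And>i. gdist (l i) M N = 0" by metis
  show "M = N"
  proof (rule gdist_0_imp_eq[OF M N _ _ l(2)])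
    show "filterlim l at_top sequentially"
      by (rule filterlim_at_top_mono[OF filterlim_real_sequentially]) (use l(1) in \<open>auto intro: less_imp_le always_eventually\<close>)
    show "l i > 0" for i using l(1)[of i] by linarith
  qed
qed

section \<open>Energies and potentials\<close>

text \<open>The kernel falls at most logarithmically or like \<open>t powr (- a)\<close>, with
  \<open>- a < b\<close>, so it is absorbed by an arbitrarily small multiple of
  \<open>t powr b\<close>. The value at 0 goes into the constant C.\<close>

lemma kk_lower_bound:
  assumes "w > 0" "b > 0" "b > - a"
  obtains C where "C \<ge> 0" "\<And>t. t \<ge> 0 \<Longrightarrow> kk a t \<ge> - C - w * t powr b"
proof -
  have ev: "eventually (\<lambda>t. kk a t \<ge> - (w * t powr b)) at_top"
  proof -
    consider "a = 0" | "a > 0" | "a < 0" by linarith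
    then show ?thesis
    proof cases
      case 1
      have "eventually (\<lambda>t. - ln t / 2 \<ge> - (w * t powr b)) at_top" using assms by real_asymp
      then show ?thesis using 1 by (simp add: kk_def)
    next
      case 2
      have "eventually (\<lambda>t. (t powr (- a) - 1) / (2 * a) \<ge> - 1 / (2 * a)) at_top"
        using 2 by (intro always_eventually allI divide_right_mono) auto
      moreover have "eventually (\<lambda>t. - 1 / (2 * a) \<ge> - (w * t powr b)) at_top" using assms by real_asymp
      ultimately show ?thesis by eventually_elim (use 2 in \<open>simp add: kk_def\<close>)
    next
      case 3
      define e where "e = - a"
      have e: "e > 0" "e < b" using 3 assms by (auto simp: e_def)
      have "eventually (\<lambda>t. - ((t powr e - 1) / (2 * e)) \<ge> - (w * t powr b)) at_top" using e assms(1) by real_asymp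
      then show ?thesis using 3 by (simp add: kk_def e_def)
    qed
  qed
  then obtain T where T: "\<And>t. t \<ge> T \<Longrightarrow> kk a t \<ge> - (w * t powr b)"
    unfolding eventually_at_top_linorder by blast
  define T' where "T' = max T 1"
  show ?thesis
  proof (rule that[of "\<bar>kk a T'\<bar> + \<bar>kk a 0\<bar>"])
    fix t :: real assume t: "t \<ge> 0"
    have w: "w * t powr b \<ge> 0" using assms by simp
    consider "t = 0" | "0 < t" "t \<le> T'" | "t \<ge> T'" using t by linarith
    then show "kk a t \<ge> - (\<bar>kk a T'\<bar> + \<bar>kk a 0\<bar>) - w * t powr b"
    proof cases
      case 1 then show ?thesis by simp
    next
      case 2
      then show ?thesis using kk_antimono[of t T' a] w by linarith
    next
      case 3
      then show ?thesis using T[of t] by (auto simp: T'_def)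
    qed
  qed simp
qed

lemma power2_powr_half: "(x\<^sup>2) powr (b / 2) = x powr b" if "x \<ge> (0::real)"
proof (cases "x = 0")
  case False
  then have "(x\<^sup>2) powr (b / 2) = (x powr 2) powr (b / 2)" using that by (simp add: powr_numeral)
  then show ?thesis by (simp add: powr_powr)
qed auto

lemma powr_add_le:
  assumes "u \<ge> 0" "v \<ge> 0" "b > (0::real)"
  shows "(u + v) powr b \<le> 2 powr b * (u powr b + v powr b)"
proof -
  have *: "(u + v) powr b \<le> 2 powr b * (u powr b + v powr b)" if "0 \<le> u" "u \<le> v" for u v :: real
  proof -
    have "(u + v) powr b \<le> (2 * v) powr b" using that assms by (intro powr_mono2) auto
    also have "\<dots> = 2 powr b * v powr b" using that by (simp add: powr_mult)
    also have "\<dots> \<le> 2 powr b * (u powr b + v powr b)" by (intro mult_left_mono) auto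
    finally show ?thesis .
  qed
  show ?thesis using *[of u v] *[of v u] assms by (cases "u \<le> v") (auto simp: add.commute)
qed

lemma kk_pair_lower_bound:
  assumes w: "w > 0" and \<alpha>: "\<alpha> > 0" "\<alpha> > - 2 * a"
  obtains C where "C \<ge> 0"
    "\<And>p :: 'a::euclidean_space \<times> 'a. kk_pair a p \<ge> - C - w * norm (fst p) powr \<alpha> - w * norm (snd p) powr \<alpha>"
proof -
  obtain C where C: "C \<ge> 0" "\<And>t. t \<ge> 0 \<Longrightarrow> kk a t \<ge> - C - w / 2 powr \<alpha> * t powr (\<alpha> / 2)"
    by (rule kk_lower_bound[of "w / 2 powr \<alpha>" "\<alpha> / 2" a]) (use assms in auto)
  show ?thesis
  proof (rule that[OF C(1)])
    fix p :: "'a \<times> 'a"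
    have "((norm (fst p - snd p))\<^sup>2) powr (\<alpha> / 2) = norm (fst p - snd p) powr \<alpha>" by (rule power2_powr_half) simp
    also have "\<dots> \<le> (norm (fst p) + norm (snd p)) powr \<alpha>"
      using \<alpha> by (intro powr_mono2 norm_triangle_ineq4) auto
    also have "\<dots> \<le> 2 powr \<alpha> * (norm (fst p) powr \<alpha> + norm (snd p) powr \<alpha>)" using \<alpha> by (intro powr_add_le) auto
    finally have "w / 2 powr \<alpha> * ((norm (fst p - snd p))\<^sup>2) powr (\<alpha> / 2) \<le>
        w / 2 powr \<alpha> * (2 powr \<alpha> * (norm (fst p) powr \<alpha> + norm (snd p) powr \<alpha>))"
      using w by (intro mult_left_mono) auto
    also have "\<dots> = w * norm (fst p) powr \<alpha> + w * norm (snd p) powr \<alpha>" by (simp add: algebra_simps)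
    finally show "kk_pair a p \<ge> - C - w * norm (fst p) powr \<alpha> - w * norm (snd p) powr \<alpha>"
      using C(2)[of "(norm (fst p - snd p))\<^sup>2"] by (simp add: kk_pair_def)
  qed
qed

definition kk_pot :: "real \<Rightarrow> 'a::euclidean_space measure \<Rightarrow> 'a \<Rightarrow> real" where
  "kk_pot a Q x = (\<integral> y. kk_pair a (x, y) \<partial>Q)"

text \<open>What Fubini's theorem requires of one factor so that the other may be any measure with a
  finite moment of order \<alpha>. Spheres satisfy it and mixtures inherit it. The potential is
  bounded from above only, since the kernel tends to minus infinity at infinity when
  \<open>a \<le> 0\<close>.\<close>

definition bounded_potential :: "real \<Rightarrow> real \<Rightarrow> 'a::euclidean_space measure \<Rightarrow> bool" where
  "bounded_potential a \<alpha> Q \<longleftrightarrow> Q \<in> borel_probs \<and> integrable Q (\<lambda>y. norm y powr \<alpha>) \<and>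
    (\<forall>x. integrable Q (\<lambda>y. kk_pair a (x, y))) \<and> (\<exists>B. \<forall>x. kk_pot a Q x \<le> B) \<and> (\<forall>x. AE y in Q. x \<noteq> y)"

text \<open>The lower bound \<open>- C - u - v\<close> on the kernel k gives
  \<open>\<bar>k\<bar> \<le> k + 2 * (C + u + v)\<close>, so the upper bound on the potential
  controls the absolute integral as well.\<close>

lemma kk_admissible_bounded_potential:
  fixes P Q :: "'a::euclidean_space measure"
  assumes \<alpha>: "\<alpha> > 0" "\<alpha> > - 2 * a" and P: "P \<in> borel_probs" "integrable P (\<lambda>x. norm x powr \<alpha>)"
    and Q: "bounded_potential a \<alpha> Q"
  shows "kk_admissible a P Q" "integrable P (kk_pot a Q)" "kk_energy a P Q = (\<integral> x. kk_pot a Q x \<partial>P)"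
proof -
  have Qb: "Q \<in> borel_probs" and Qm: "integrable Q (\<lambda>y. norm y powr \<alpha>)"
    and Qi: "\<And>x. integrable Q (\<lambda>y. kk_pair a (x, y))" and Qae: "\<And>x. AE y in Q. x \<noteq> y"
    using Q by (auto simp: bounded_potential_def)
  obtain B where B: "\<And>x. kk_pot a Q x \<le> B" using Q by (auto simp: bounded_potential_def)
  interpret P: prob_space P using borel_probsD[OF P(1)] by simp
  interpret Q: prob_space Q using borel_probsD[OF Qb] by simp
  interpret PQ: pair_sigma_finite P Q ..
  have [measurable_cong]: "sets P = sets borel" "sets Q = sets borel" using borel_probsD P Qb by auto
  have km [measurable]: "kk_pair a \<in> borel_measurable (P \<Otimes>\<^sub>M Q)" by measurable
  obtain C where C: "C \<ge> 0"
    "\<And>p :: 'a \<times> 'a. kk_pair a p \<ge> - C - 1 * norm (fst p) powr \<alpha> - 1 * norm (snd p) powr \<alpha>"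
    using kk_pair_lower_bound[of 1 \<alpha> a, where 'a='a] \<alpha> by auto
  define K where "K = (\<integral> y. norm y powr \<alpha> \<partial>Q)"
  have int: "integrable (P \<Otimes>\<^sub>M Q) (kk_pair a)"
  proof (rule PQ.Fubini_integrable[OF km])
    show "AE x in P. integrable Q (\<lambda>y. kk_pair a (x, y))" using Qi by simp
    show "integrable P (\<lambda>x. \<integral> y. norm (kk_pair a (x, y)) \<partial>Q)"
    proof (rule Bochner_Integration.integrable_bound[where f = "\<lambda>x. \<bar>B\<bar> + 2 * (C + norm x powr \<alpha> + K)"])
      show "integrable P (\<lambda>x. \<bar>B\<bar> + 2 * (C + norm x powr \<alpha> + K))" using P(2) by auto
      show "(\<lambda>x. \<integral> y. norm (kk_pair a (x, y)) \<partial>Q) \<in> borel_measurable P" by measurable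
      show "AE x in P. norm (\<integral> y. norm (kk_pair a (x, y)) \<partial>Q) \<le> norm (\<bar>B\<bar> + 2 * (C + norm x powr \<alpha> + K))"
      proof (intro always_eventually allI)
        fix x :: 'a
        have "(\<integral> y. norm (kk_pair a (x, y)) \<partial>Q) \<le> (\<integral> y. kk_pair a (x, y) + 2 * (C + norm x powr \<alpha> + norm y powr \<alpha>) \<partial>Q)"
        proof (rule integral_mono)
          show "norm (kk_pair a (x, y)) \<le> kk_pair a (x, y) + 2 * (C + norm x powr \<alpha> + norm y powr \<alpha>)" for y
          proof -
            have *: "\<bar>k\<bar> \<le> k + 2 * (C + u + v)" if "0 \<le> u" "0 \<le> v" "- C - u - v \<le> k" for u v k :: real
            proof -
              have "- k \<le> k + 2 * (C + u + v)" using that(3) by argo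
              moreover have "k \<le> k + 2 * (C + u + v)" using that(1,2) C(1) by simp
              ultimately show ?thesis by (rule abs_leI[rotated])
            qed
            show ?thesis using C(2)[of "(x, y)"] unfolding real_norm_def by (intro *) auto
          qed
        qed (use Qi Qm in auto)
        also have "\<dots> = kk_pot a Q x + 2 * (C + norm x powr \<alpha> + K)"
          using Qi[of x] Qm by (simp add: kk_pot_def K_def Q.prob_space)
        also have "\<dots> \<le> \<bar>B\<bar> + 2 * (C + norm x powr \<alpha> + K)" using B[of x] by linarith
        finally show "norm (\<integral> y. norm (kk_pair a (x, y)) \<partial>Q) \<le> norm (\<bar>B\<bar> + 2 * (C + norm x powr \<alpha> + K))"
          using integral_nonneg_AE[of "\<lambda>y. norm (kk_pair a (x, y))" Q] by auto
      qed
    qed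
  qed
  have "AE p in P \<Otimes>\<^sub>M Q. norm (fst p - snd p) \<noteq> 0"
  proof (rule PQ.AE_pair_measure)
    show "{p \<in> space (P \<Otimes>\<^sub>M Q). norm (fst p - snd p) \<noteq> 0} \<in> sets (P \<Otimes>\<^sub>M Q)" by measurable
    show "AE x in P. AE y in Q. norm (fst (x, y) - snd (x, y)) \<noteq> 0" using Qae by simp
  qed
  then have "AE p in P \<Otimes>\<^sub>M Q. a < 0 \<or> fst p \<noteq> snd p" by eventually_elim auto
  then show "kk_admissible a P Q" using int by (simp only: kk_admissible_def)
  show "integrable P (kk_pot a Q)" unfolding kk_pot_def[abs_def] by (rule PQ.integrable_fst'[OF int])
  show "kk_energy a P Q = (\<integral> x. kk_pot a Q x \<partial>P)"
    unfolding kk_energy_def kk_pot_def by (rule PQ.integral_fst'[OF int, symmetric])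
qed

lemma kk_energy_commute:
  fixes P Q :: "'a::euclidean_space measure"
  assumes P: "P \<in> borel_probs" and Q: "Q \<in> borel_probs"
  shows "kk_energy a Q P = kk_energy a P Q"
proof -
  interpret P: prob_space P using borel_probsD[OF P] by simp
  interpret Q: prob_space Q using borel_probsD[OF Q] by simp
  interpret PQ: pair_sigma_finite P Q ..
  have s: "sets P = sets borel" "sets Q = sets borel" using borel_probsD P Q by auto
  have e: "(\<lambda>(x, y). kk_pair a (y, x)) = (kk_pair a :: 'a \<times> 'a \<Rightarrow> real)"
    by (auto simp: kk_pair_def norm_minus_commute)
  show ?thesis unfolding kk_energy_def using PQ.integral_product_swap[OF kk_pair_measurable[OF s], of a] unfolding e .
qed

lemma AE_sphere_not_point:
  fixes x :: "'a::euclidean_space"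
  assumes d: "DIM('a) \<ge> 2"
  shows "AE y in uniform_sphere 1. x \<noteq> y"
proof (cases "norm x = 1")
  case True
  then have "AE y in uniform_sphere 1. \<bar>x \<bullet> y\<bar> < 1" using d by (intro AE_sphere_inner_lt) auto
  then show ?thesis by eventually_elim (use True in \<open>auto simp: dot_square_norm\<close>)
next
  case False
  then show ?thesis using AE_sphere_norm[where 'a='a] by (auto elim: eventually_mono)
qed

lemma AE_uniform_sphere_not_point:
  fixes x :: "'a::euclidean_space"
  assumes d: "DIM('a) \<ge> 2" and R: "R > 0"
  shows "AE y in uniform_sphere R. x \<noteq> y"
proof -
  have "AE y in uniform_sphere 1. (1 / R) *\<^sub>R x \<noteq> y" by (rule AE_sphere_not_point[OF d])
  then have "AE y in uniform_sphere 1. x \<noteq> R *\<^sub>R y" by eventually_elim (use R in auto)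
  moreover have m: "(\<lambda>y. R *\<^sub>R y) \<in> measurable (uniform_sphere 1 :: 'a measure) borel" by measurable
  moreover have "{y. x \<noteq> y} = - {x}" by auto
  then have s: "{y \<in> space borel. x \<noteq> y} \<in> sets borel" by simp
  ultimately show ?thesis unfolding uniform_sphere_scale[of R] by (simp only: AE_distr_iff[OF m s])
qed

definition sph_pot :: "real \<Rightarrow> real \<Rightarrow> real \<Rightarrow> real \<Rightarrow> real" where
  "sph_pot a c R r = kk a (R\<^sup>2) + (R\<^sup>2) powr (- a) * u0 a c (r\<^sup>2 / R\<^sup>2)"

lemma uniform_sphere_potential:
  fixes x :: "'a::euclidean_space"
  assumes d: "DIM('a) \<ge> 2" and rs: "riesz_sphere a (DIM('a) / 2)" and R: "R > 0"
  shows "integrable (uniform_sphere R) (\<lambda>y. kk_pair a (x, y))"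
    "kk_pot a (uniform_sphere R) x = sph_pot a (DIM('a) / 2) R (norm x)"
proof -
  let ?M = "uniform_sphere 1 :: 'a measure"
  interpret prob_space ?M by (rule uniform_sphere_prob)
  define z where "z = (1 / R) *\<^sub>R x"
  let ?g = "\<lambda>y. kk a (R\<^sup>2) + (R\<^sup>2) powr (- a) * kk a ((norm (z - y))\<^sup>2)"
  have [measurable]: "(\<lambda>y. kk_pair a (x, y)) \<in> borel_measurable borel" unfolding kk_pair_def fst_conv snd_conv by measurable
  have ae: "AE y in ?M. ?g y = kk_pair a (x, R *\<^sub>R y)"
    using AE_sphere_not_point[OF d, of z]
  proof eventually_elim
    case (elim y)
    have "x - R *\<^sub>R y = R *\<^sub>R (z - y)" using R by (simp add: z_def algebra_simps)
    then have "(norm (x - R *\<^sub>R y))\<^sup>2 = R\<^sup>2 * (norm (z - y))\<^sup>2" by (simp add: power_mult_distrib)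
    moreover have "(norm (z - y))\<^sup>2 > 0" using elim by simp
    ultimately show ?case using kk_mult[of "R\<^sup>2" "(norm (z - y))\<^sup>2" a] R by (simp add: kk_pair_def)
  qed
  note sp = sphere_potential[OF d rs, of z]
  have ig: "integrable ?M ?g" using sp(1) by auto
  show "integrable (uniform_sphere R) (\<lambda>y. kk_pair a (x, y))"
    unfolding uniform_sphere_scale[of R]
    by (subst integrable_distr_eq) (auto intro!: integrable_cong_AE_imp[OF ig _ ae])
  have "kk_pot a (uniform_sphere R) x = (\<integral> y. kk_pair a (x, R *\<^sub>R y) \<partial>?M)"
    unfolding kk_pot_def uniform_sphere_scale[of R] by (subst integral_distr) auto
  also have "\<dots> = (\<integral> y. ?g y \<partial>?M)"
    by (rule integral_cong_AE) (use ae in \<open>auto elim: eventually_mono\<close>)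
  also have "\<dots> = kk a (R\<^sup>2) + (R\<^sup>2) powr (- a) * u0 a (DIM('a) / 2) ((norm z)\<^sup>2)"
    using sp prob_space by simp
  also have "(norm z)\<^sup>2 = (norm x)\<^sup>2 / R\<^sup>2" using R by (simp add: z_def power_divide)
  finally show "kk_pot a (uniform_sphere R) x = sph_pot a (DIM('a) / 2) R (norm x)" by (simp add: sph_pot_def)
qed

lemma integrable_norm_uniform_sphere:
  assumes "R > 0" and h: "h \<in> borel_measurable borel"
  shows "integrable (uniform_sphere R) (\<lambda>y::'a::euclidean_space. h (norm y) :: real)"
    "(\<integral> y. h (norm y) \<partial>(uniform_sphere R :: 'a measure)) = h R"
proof -
  let ?M = "uniform_sphere R :: 'a measure"
  interpret prob_space ?M by (rule uniform_sphere_prob)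
  have [measurable]: "h \<in> borel_measurable borel" by (rule h)
  have ae: "AE y in ?M. h R = h (norm y)" using AE_uniform_sphere[OF assms(1), where 'a='a] by eventually_elim auto
  show "integrable ?M (\<lambda>y. h (norm y))" by (rule integrable_cong_AE_imp[OF _ _ ae]) auto
  have "(\<integral> y. h (norm y) \<partial>?M) = (\<integral> y. h R \<partial>?M)"
    by (rule integral_cong_AE) (use ae in \<open>auto elim: eventually_mono\<close>)
  moreover have "prob UNIV = 1" using prob_space by simp
  ultimately show "(\<integral> y. h (norm y) \<partial>?M) = h R" by simp
qed

text \<open>Compactness covers \<open>\<rho> \<le> 4\<close>. Beyond that, every point of the unit
  sphere is at distance at least 1, where the kernel is nonpositive.\<close>

lemma u0_bounded_above:
  assumes d: "DIM('a::euclidean_space) \<ge> 2" and rs: "riesz_sphere a (DIM('a) / 2)"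
  obtains B where "\<And>\<rho>. \<rho> \<ge> 0 \<Longrightarrow> u0 a (DIM('a) / 2) \<rho> \<le> B"
proof -
  let ?u = "u0 a (DIM('a) / 2)"
  interpret riesz_sphere a "DIM('a) / 2" by (rule rs)
  interpret M: prob_space "uniform_sphere 1 :: 'a measure" by (rule uniform_sphere_prob)
  have "continuous_on {0..4} ?u" by (rule continuous_on_subset[OF u0_continuous]) auto
  then have "compact (?u ` {0..4})" by (intro compact_continuous_image) auto
  then have "bdd_above (?u ` {0..4})" by (intro bounded_imp_bdd_above compact_imp_bounded)
  then have "\<exists>B. \<forall>y\<in>?u ` {0..4}. y \<le> B" by (simp only: bdd_above_def)
  then obtain B where B: "\<And>\<rho>. \<rho> \<in> {0..4} \<Longrightarrow> ?u \<rho> \<le> B" by (metis imageI)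
  have far: "?u \<rho> \<le> 0" if r: "\<rho> \<ge> 4" for \<rho>
  proof -
    obtain x :: 'a where x: "norm x = sqrt \<rho>" using vector_choose_size[of "sqrt \<rho>"] r by auto
    have x2: "norm x \<ge> 2" using r real_sqrt_le_mono[of 4 \<rho>] by (simp add: x)
    have "?u \<rho> = (\<integral> y. kk a ((norm (x - y))\<^sup>2) \<partial>(uniform_sphere 1 :: 'a measure))"
      using sphere_potential(2)[OF d rs, of x] r by (simp add: x)
    also have "\<dots> \<le> (\<integral> y. 0 \<partial>(uniform_sphere 1 :: 'a measure))"
    proof (rule integral_mono_AE[OF sphere_potential(1)[OF d rs]])
      show "AE y in uniform_sphere 1. kk a ((norm (x - y))\<^sup>2) \<le> 0"
        using AE_sphere_norm
      proof eventually_elim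
        case (elim y)
        have "norm (x - y) \<ge> 1" using norm_triangle_ineq2[of x y] elim x2 by linarith
        then have "1 \<le> (norm (x - y))\<^sup>2" by (simp add: one_le_power)
        then show ?case using kk_antimono[of 1 "(norm (x - y))\<^sup>2" a] by simp
      qed
    qed simp
    finally show ?thesis by simp
  qed
  show ?thesis
  proof (rule that[of "max B 0"])
    fix \<rho> :: real assume "\<rho> \<ge> 0"
    then show "?u \<rho> \<le> max B 0" using B[of \<rho>] far[of \<rho>] by (cases "\<rho> \<le> 4") auto
  qed
qed

lemma bounded_potential_uniform_sphere:
  assumes d: "DIM('a::euclidean_space) \<ge> 2" and rs: "riesz_sphere a (DIM('a) / 2)" and R: "R > 0"
  shows "bounded_potential a \<alpha> (uniform_sphere R :: 'a measure)"
proof -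
  obtain B where B: "\<And>\<rho>. \<rho> \<ge> 0 \<Longrightarrow> u0 a (DIM('a) / 2) \<rho> \<le> B" using u0_bounded_above[OF d rs] by blast
  have "sph_pot a (DIM('a) / 2) R r \<le> kk a (R\<^sup>2) + (R\<^sup>2) powr (- a) * B" for r
    unfolding sph_pot_def by (intro add_left_mono mult_left_mono B) auto
  then have "\<exists>B. \<forall>x::'a. kk_pot a (uniform_sphere R) x \<le> B"
    unfolding uniform_sphere_potential(2)[OF d rs R] by blast
  then show ?thesis
    unfolding bounded_potential_def using AE_uniform_sphere_not_point[OF d R] uniform_sphere_potential(1)[OF d rs R]
    using integrable_norm_uniform_sphere(1)[OF R, of "\<lambda>r. r powr \<alpha>", where 'a='a]
    by (simp add: uniform_sphere_borel_probs)
qed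

section \<open>Energies with values in the extended reals\<close>

lemma ereal_integral_eq_integral:
  fixes f :: "'b \<Rightarrow> ereal" and g :: "'b \<Rightarrow> real"
  assumes g: "integrable M g" and ae: "AE z in M. f z = ereal (g z)"
  shows "ereal_integral M f = ereal (\<integral> z. g z \<partial>M)"
proof -
  have p: "(\<integral>\<^sup>+ z. e2ennreal (f z) \<partial>M) = (\<integral>\<^sup>+ z. ennreal (g z) \<partial>M)"
    and n: "(\<integral>\<^sup>+ z. e2ennreal (- f z) \<partial>M) = (\<integral>\<^sup>+ z. ennreal (- g z) \<partial>M)"
    by (intro nn_integral_cong_AE; use ae in \<open>eventually_elim, simp\<close>)+
  have "(\<integral>\<^sup>+ z. ennreal (g z) \<partial>M) < \<infinity>" "(\<integral>\<^sup>+ z. ennreal (- g z) \<partial>M) < \<infinity>"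
    using g unfolding real_integrable_def by (auto simp: less_top)
  then obtain u v where uv: "(\<integral>\<^sup>+ z. ennreal (g z) \<partial>M) = ennreal u" "(\<integral>\<^sup>+ z. ennreal (- g z) \<partial>M) = ennreal v" "u \<ge> 0" "v \<ge> 0"
    by (metis ennreal_cases less_irrefl infinity_ennreal_def)
  show ?thesis
    unfolding ereal_integral_def p n real_lebesgue_integral_def[OF g] uv using uv(3,4) by simp
qed

lemma ereal_integral_finite_imp:
  fixes f :: "'b \<Rightarrow> ereal"
  assumes M: "prob_space M" and [measurable]: "f \<in> borel_measurable M" and lb: "\<And>z. ereal (- C) \<le> f z"
    and fin: "ereal_integral M f \<noteq> \<infinity>"
  shows "AE z in M. f z \<noteq> \<infinity>" "integrable M (\<lambda>z. real_of_ereal (f z))"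
proof -
  interpret prob_space M by (rule M)
  let ?p = "\<integral>\<^sup>+ z. e2ennreal (f z) \<partial>M" and ?n = "\<integral>\<^sup>+ z. e2ennreal (- f z) \<partial>M"
  have "?n \<le> (\<integral>\<^sup>+ z. ennreal C \<partial>M)"
  proof (intro nn_integral_mono)
    fix z
    have "- f z \<le> ereal C" using lb[of z] by (simp add: ereal_uminus_le_reorder)
    then show "e2ennreal (- f z) \<le> ennreal C" using e2ennreal_mono by fastforce
  qed
  also have "\<dots> < top" by (simp add: emeasure_space_1 less_top)
  finally have n: "?n < top" .
  have p: "?p < top"
  proof (rule ccontr)
    assume "\<not> ?p < top"
    then have "?p = top" by (metis top.not_eq_extremum)
    moreover obtain v where "?n = ennreal v" "v \<ge> 0" using n by (cases ?n) auto
    ultimately show False using fin by (simp add: ereal_integral_def)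
  qed
  have "AE z in M. e2ennreal (f z) \<noteq> \<infinity>" by (rule nn_integral_PInf_AE) (use p in auto)
  then show "AE z in M. f z \<noteq> \<infinity>" by eventually_elim auto
  show "integrable M (\<lambda>z. real_of_ereal (f z))"
  proof (rule integrableI_bounded)
    have "(\<integral>\<^sup>+ z. ennreal (norm (real_of_ereal (f z))) \<partial>M) \<le> (\<integral>\<^sup>+ z. e2ennreal (f z) + e2ennreal (- f z) \<partial>M)"
    proof (intro nn_integral_mono)
      fix z
      show "ennreal (norm (real_of_ereal (f z))) \<le> e2ennreal (f z) + e2ennreal (- f z)"
        by (cases "f z") (auto simp: abs_if ennreal_neg)
    qed
    also have "\<dots> = ?p + ?n" by (rule nn_integral_add) auto
    also have "\<dots> < \<infinity>" using p n by simp
    finally show "(\<integral>\<^sup>+ z. ennreal (norm (real_of_ereal (f z))) \<partial>M) < \<infinity>" .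
  qed measurable
qed

lemma pair_integral_marginals:
  fixes f :: "'a::euclidean_space \<Rightarrow> real"
  assumes P: "P \<in> borel_probs" and f: "integrable P f"
  shows "integrable (P \<Otimes>\<^sub>M P) (\<lambda>p. f (fst p))" "integrable (P \<Otimes>\<^sub>M P) (\<lambda>p. f (snd p))"
    "(\<integral> p. f (fst p) \<partial>(P \<Otimes>\<^sub>M P)) = (\<integral> x. f x \<partial>P)" "(\<integral> p. f (snd p) \<partial>(P \<Otimes>\<^sub>M P)) = (\<integral> x. f x \<partial>P)"
proof -
  interpret P: prob_space P using borel_probsD[OF P] by simp
  interpret PP: pair_sigma_finite P P ..
  have [measurable]: "f \<in> borel_measurable P" using f by simp
  have u: "measure P (space P) = 1" by (rule P.prob_space)
  show 1: "integrable (P \<Otimes>\<^sub>M P) (\<lambda>p. f (fst p))"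
    by (rule PP.Fubini_integrable) (use f u in simp_all)
  show 2: "integrable (P \<Otimes>\<^sub>M P) (\<lambda>p. f (snd p))"
    by (rule PP.Fubini_integrable) (use f u in simp_all)
  show "(\<integral> p. f (fst p) \<partial>(P \<Otimes>\<^sub>M P)) = (\<integral> x. f x \<partial>P)"
    unfolding PP.integral_fst'[OF 1, symmetric] by (simp add: u)
  show "(\<integral> p. f (snd p) \<partial>(P \<Otimes>\<^sub>M P)) = (\<integral> x. f x \<partial>P)"
    unfolding PP.integral_fst'[OF 2, symmetric] by (simp add: u)
qed

locale riesz_field =
  fixes s \<gamma> \<alpha> :: real and V :: "'a::euclidean_space \<Rightarrow> ereal"
  assumes dim: "DIM('a) \<ge> 2" and s: "- 2 < s" "s < real DIM('a) - 3"
    and V: "V = (\<lambda>x. ereal (\<gamma> / \<alpha> * norm x powr \<alpha>))" and \<gamma>: "\<gamma> > 0" and \<alpha>: "\<alpha> > max (- s) 0"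
begin

definition vr :: "'a \<Rightarrow> real" where "vr x = \<gamma> / \<alpha> * norm x powr \<alpha>"

text \<open>The additive constant that separates \<open>riesz_kernel s\<close> from
  \<open>kk (s / 2)\<close>; it is integrated against a probability measure and so reappears
  unchanged in the energy.\<close>

definition kshift :: real where "kshift = (if s = 0 then 0 else 1 / s)"

definition tot :: "'a \<times> 'a \<Rightarrow> real" where
  "tot p = kk_pair (s / 2) p + kshift + vr (fst p) + vr (snd p)"

lemma rs: "riesz_sphere (s / 2) (real DIM('a) / 2)"
  using s by unfold_locales auto

sublocale riesz_sphere "s / 2" "real DIM('a) / 2" by (rule rs)

lemma \<alpha>': "\<alpha> > 0" "\<alpha> > - 2 * (s / 2)"
  using \<alpha> by auto

lemma vr_measurable [measurable]: "vr \<in> borel_measurable borel"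
  unfolding vr_def[abs_def] by measurable

text \<open>On the diagonal with \<open>s < 0\<close> the two kernels agree because
  \<open>kk (s / 2) 0 = - 1 / s\<close> cancels \<open>kshift\<close>. For \<open>s \<ge> 0\<close>
  the infinite value must be kept; the diagonal is written through the norm to suit measurability
  proofs.\<close>

lemma integrand_eq:
  "(case p of (x, y) \<Rightarrow> riesz_kernel s (x - y) + V x + V y) =
    (if s \<ge> 0 \<and> norm (fst p - snd p) = 0 then \<infinity> else ereal (tot p))"
proof -
  obtain x y where p: "p = (x, y)" by (cases p)
  have "riesz_kernel s (x - y) = (if s \<ge> 0 \<and> x = y then \<infinity> else ereal (kk_pair (s / 2) (x, y) + kshift))"
  proof (cases "x = y")
    case True
    then show ?thesis by (auto simp: riesz_kernel_def kk_pair_def kk_def kshift_def)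
  next
    case False
    then have n: "norm (x - y) > 0" by simp
    then have l: "ln ((norm (x - y))\<^sup>2) = 2 * ln (norm (x - y))" by (simp add: ln_realpow)
    have q: "((norm (x - y))\<^sup>2) powr (- (s / 2)) = norm (x - y) powr (- s)"
      using power2_powr_half[of "norm (x - y)" "- s"] by simp
    have q2: "((norm (x - y))\<^sup>2) powr (s / 2) = norm (x - y) powr s"
      using power2_powr_half[of "norm (x - y)" s] by simp
    show ?thesis
      using False by (auto simp: riesz_kernel_def kk_pair_def kk_def kshift_def l q q2 powr_minus field_simps)
  qed
  then show ?thesis by (auto simp: p V tot_def vr_def)
qed

lemma riesz_energy_alt:
  "riesz_energy s V P = ereal_integral (P \<Otimes>\<^sub>M P)
    (\<lambda>p. if s \<ge> 0 \<and> norm (fst p - snd p) = 0 then \<infinity> else ereal (tot p))"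
  unfolding riesz_energy_def integrand_eq[abs_def, symmetric] ..

lemma integrable_vr: "integrable P (\<lambda>x. norm x powr \<alpha>) \<Longrightarrow> integrable P vr"
  unfolding vr_def[abs_def] by simp

lemma riesz_energy_eq:
  assumes P: "P \<in> borel_probs" and i: "integrable P (\<lambda>x. norm x powr \<alpha>)" and adm: "kk_admissible (s / 2) P P"
  shows "riesz_energy s V P = ereal (kk_energy (s / 2) P P + kshift + 2 * (\<integral> x. vr x \<partial>P))"
proof -
  interpret PP: prob_space "P \<Otimes>\<^sub>M P" by (rule prob_space_pair[OF P P])
  note v = pair_integral_marginals[OF P integrable_vr[OF i]]
  have k: "integrable (P \<Otimes>\<^sub>M P) (kk_pair (s / 2))" and "AE p in P \<Otimes>\<^sub>M P. s / 2 < 0 \<or> fst p \<noteq> snd p"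
    using adm by (simp_all only: kk_admissible_def)
  from this(2) have ae: "AE p in P \<Otimes>\<^sub>M P. (if s \<ge> 0 \<and> norm (fst p - snd p) = 0 then \<infinity> else ereal (tot p)) = ereal (tot p)"
    by eventually_elim auto
  have t: "integrable (P \<Otimes>\<^sub>M P) tot"
    unfolding tot_def[abs_def] using k v by auto
  have "(\<integral> p. tot p \<partial>(P \<Otimes>\<^sub>M P)) = kk_energy (s / 2) P P + kshift + 2 * (\<integral> x. vr x \<partial>P)"
    unfolding tot_def[abs_def] using k v PP.prob_space by (simp add: kk_energy_def)
  then show ?thesis unfolding riesz_energy_alt ereal_integral_eq_integral[OF t ae] by simp
qed

lemma riesz_energy_finite_imp:
  assumes P: "P \<in> borel_probs" and fin: "riesz_energy s V P \<noteq> \<infinity>"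
  shows "integrable P (\<lambda>x. norm x powr \<alpha>)" "kk_admissible (s / 2) P P"
proof -
  interpret P: prob_space P using borel_probsD[OF P] by simp
  interpret PX: pair_sigma_finite P P ..
  interpret PP: prob_space "P \<Otimes>\<^sub>M P" by (rule prob_space_pair[OF P P])
  have [measurable_cong]: "sets P = sets borel" using borel_probsD[OF P] by auto
  let ?F = "\<lambda>p. if s \<ge> 0 \<and> norm (fst p - snd p) = 0 then \<infinity> else ereal (tot p)"
  \<comment> \<open>Half of the field compensates the negative part of the kernel; the other half
    remains and bounds the moment of order \<alpha>.\<close>
  define w where "w = \<gamma> / (2 * \<alpha>)"
  have w: "w > 0" using \<gamma> \<alpha>' by (simp add: w_def)
  have vrw: "vr x = 2 * (w * norm x powr \<alpha>)" for x using \<alpha>' by (simp add: vr_def w_def)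
  obtain C where C: "C \<ge> 0"
    "\<And>p :: 'a \<times> 'a. kk_pair (s / 2) p \<ge> - C - w * norm (fst p) powr \<alpha> - w * norm (snd p) powr \<alpha>"
    using kk_pair_lower_bound[OF w \<alpha>'] by blast
  define D where "D = C + \<bar>kshift\<bar>"
  have lb: "tot p \<ge> - D + w * norm (fst p) powr \<alpha> + w * norm (snd p) powr \<alpha>" for p
    using C(2)[of p] unfolding tot_def vrw D_def by linarith
  have wn: "0 \<le> w * norm (x::'a) powr \<alpha>" for x using w by simp
  have [measurable]: "tot \<in> borel_measurable (P \<Otimes>\<^sub>M P)" unfolding tot_def[abs_def] by measurable
  have Fm: "?F \<in> borel_measurable (P \<Otimes>\<^sub>M P)" by measurable
  have Flb: "ereal (- D) \<le> ?F p" for p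
  proof -
    have "- D \<le> tot p" using lb[of p] wn[of "fst p"] wn[of "snd p"] by linarith
    then show ?thesis by simp
  qed
  note fi = ereal_integral_finite_imp[OF PP.prob_space_axioms Fm Flb fin[unfolded riesz_energy_alt]]
  have ae: "AE p in P \<Otimes>\<^sub>M P. real_of_ereal (?F p) = tot p" using fi(1) by eventually_elim auto
  have t: "integrable (P \<Otimes>\<^sub>M P) tot" by (rule integrable_cong_AE_imp[OF fi(2) _ ae]) measurable
  have "integrable (P \<Otimes>\<^sub>M P) (\<lambda>p. norm (fst p) powr \<alpha>)"
  proof (rule Bochner_Integration.integrable_bound[where f = "\<lambda>p. (tot p + D) / w"])
    show "AE p in P \<Otimes>\<^sub>M P. norm (norm (fst p) powr \<alpha>) \<le> norm ((tot p + D) / w)"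
    proof (intro always_eventually allI)
      fix p :: "'a \<times> 'a"
      have "w * norm (fst p) powr \<alpha> \<le> tot p + D" using lb[of p] wn[of "snd p"] by linarith
      then have "norm (fst p) powr \<alpha> \<le> (tot p + D) / w" using w by (simp add: pos_le_divide_eq mult.commute)
      then have "norm (fst p) powr \<alpha> \<le> \<bar>(tot p + D) / w\<bar>" by linarith
      then show "norm (norm (fst p) powr \<alpha>) \<le> norm ((tot p + D) / w)"
        by (simp only: real_norm_def abs_of_nonneg[OF powr_ge_zero])
    qed
  qed (use t in auto)
  from PX.integrable_fst'[OF this] show i: "integrable P (\<lambda>x. norm x powr \<alpha>)" by (simp add: P.prob_space)
  note v = pair_integral_marginals[OF P integrable_vr[OF i]]
  have "integrable (P \<Otimes>\<^sub>M P) (\<lambda>p. tot p - kshift - vr (fst p) - vr (snd p))" using t v by auto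
  then have k: "integrable (P \<Otimes>\<^sub>M P) (kk_pair (s / 2))" by (simp add: tot_def)
  have "AE p in P \<Otimes>\<^sub>M P. s / 2 < 0 \<or> fst p \<noteq> snd p" using fi(1) by eventually_elim auto
  then show "kk_admissible (s / 2) P P" using k by (simp only: kk_admissible_def)
qed

definition wpot :: "real \<Rightarrow> real \<Rightarrow> real" where
  "wpot R r = sph_pot (s / 2) (real DIM('a) / 2) R r + \<gamma> / \<alpha> * r powr \<alpha>"

lemma wpot_eq:
  assumes R: "R > 0" and r: "r \<ge> 0"
  shows "wpot R r = kk (s / 2) (R\<^sup>2) +
    R powr (- s) * eff_pot (s / 2) (real DIM('a) / 2) (\<gamma> * R powr (\<alpha> + s)) \<alpha> (r\<^sup>2 / R\<^sup>2)"
proof -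
  have 1: "(R\<^sup>2) powr (- (s / 2)) = R powr (- s)" using power2_powr_half[of R "- s"] R by simp
  have 2: "(r\<^sup>2 / R\<^sup>2) powr (\<alpha> / 2) = r powr \<alpha> / R powr \<alpha>"
    using power2_powr_half[of "r / R" \<alpha>] R r by (simp add: power_divide powr_divide)
  have 3: "R powr (- s) * R powr (\<alpha> + s) = R powr \<alpha>" using R by (simp add: powr_add[symmetric])
  have "R powr (- s) * (\<gamma> * R powr (\<alpha> + s) / \<alpha> * (r powr \<alpha> / R powr \<alpha>)) = (R powr (- s) * R powr (\<alpha> + s)) * (\<gamma> / \<alpha> * (r powr \<alpha> / R powr \<alpha>))"
    by simp
  also have "\<dots> = \<gamma> / \<alpha> * r powr \<alpha>" unfolding 3 using R by simp
  finally show ?thesis by (simp add: wpot_def sph_pot_def eff_pot_def 1 2 distrib_left)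
qed

lemma sphere_facts:
  fixes x :: 'a
  assumes R: "R > 0"
  shows "bounded_potential (s / 2) \<alpha> (uniform_sphere R :: 'a measure)"
    "integrable (uniform_sphere R :: 'a measure) (\<lambda>x. norm x powr \<alpha>)"
    "(\<integral> x. vr x \<partial>uniform_sphere R) = \<gamma> / \<alpha> * R powr \<alpha>"
    "kk_pot (s / 2) (uniform_sphere R) x = sph_pot (s / 2) (real DIM('a) / 2) R (norm x)"
  using bounded_potential_uniform_sphere[OF dim rs R, of \<alpha>] uniform_sphere_potential(2)[OF dim rs R, of x]
    integrable_norm_uniform_sphere[OF R, of "\<lambda>r. r powr \<alpha>", where 'a='a]
    integrable_norm_uniform_sphere(2)[OF R, of "\<lambda>r. \<gamma> / \<alpha> * r powr \<alpha>", where 'a='a]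
  by (simp_all add: vr_def[abs_def])

lemma kk_energy_spheres:
  assumes R: "R > 0" and r: "r > 0"
  shows "kk_energy (s / 2) (uniform_sphere r :: 'a measure) (uniform_sphere R) = sph_pot (s / 2) (real DIM('a) / 2) R r"
proof -
  interpret prob_space "uniform_sphere r :: 'a measure" by (rule uniform_sphere_prob)
  have "AE x in uniform_sphere r. kk_pot (s / 2) (uniform_sphere R) (x::'a) = sph_pot (s / 2) (real DIM('a) / 2) R r"
    using AE_uniform_sphere[OF r, where 'a='a] by eventually_elim (simp add: sphere_facts(4)[OF R])
  moreover note adm = kk_admissible_bounded_potential[OF \<alpha>' uniform_sphere_borel_probs sphere_facts(2)[OF r] sphere_facts(1)[OF R]]
  ultimately have "(\<integral> x. kk_pot (s / 2) (uniform_sphere R) x \<partial>(uniform_sphere r :: 'a measure)) =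
    (\<integral> x. sph_pot (s / 2) (real DIM('a) / 2) R r \<partial>(uniform_sphere r :: 'a measure))"
    by (intro integral_cong_AE) (use adm(2) in auto)
  then show ?thesis using adm(3) prob_space by simp
qed

lemma riesz_energy_sphere:
  assumes R: "R > 0"
  shows "riesz_energy s V (uniform_sphere R) = ereal (wpot R R + kshift + \<gamma> / \<alpha> * R powr \<alpha>)"
  using riesz_energy_eq[OF uniform_sphere_borel_probs sphere_facts(2)[OF R]
    kk_admissible_bounded_potential(1)[OF \<alpha>' uniform_sphere_borel_probs sphere_facts(2)[OF R] sphere_facts(1)[OF R]]]
  by (simp add: kk_energy_spheres[OF R R] sphere_facts(3)[OF R] wpot_def)

text \<open>For P of finite energy, the excess of its energy over that of the sphere is the form of
  \<open>kk_energy_posdef\<close> for P and the sphere, plus twice the integral over P of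
  \<open>wpot R\<close> minus its value on the sphere. Both are nonnegative, and the first vanishes
  only if the measures coincide.\<close>

theorem equilibrium_sphere:
  assumes R: "R > 0" and min: "\<And>r. r \<ge> 0 \<Longrightarrow> wpot R R \<le> wpot R r"
  shows "equilibrium_measure s V (uniform_sphere R)"
proof -
  let ?S = "uniform_sphere R :: 'a measure"
  let ?E = "kk_energy (s / 2)"
  have S: "?S \<in> borel_probs" by (rule uniform_sphere_borel_probs)
  have key: "riesz_energy s V ?S \<le> riesz_energy s V P \<and> (riesz_energy s V P \<le> riesz_energy s V ?S \<longrightarrow> P = ?S)"
    if P: "P \<in> borel_probs" for P
  proof (cases "riesz_energy s V P = \<infinity>")
    case True
    then show ?thesis by (simp add: riesz_energy_sphere[OF R])
  next
    case False
    interpret P: prob_space P using borel_probsD[OF P] by simp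
    note f = riesz_energy_finite_imp[OF P False]
    note c1 = kk_admissible_bounded_potential[OF \<alpha>' P f(1) sphere_facts(1)[OF R]]
    note c2 = kk_admissible_bounded_potential(1)[OF \<alpha>' S sphere_facts(2)[OF R] sphere_facts(1)[OF R]]
    have "- 1 < s / 2" using s by simp
    note pd = kk_energy_posdef[OF this P S f(2) c1(1) c2]
    have iv: "integrable P vr" by (rule integrable_vr[OF f(1)])
    have "wpot R R = (\<integral> x. wpot R R \<partial>P)" by (simp add: P.prob_space)
    also have "\<dots> \<le> (\<integral> x. kk_pot (s / 2) ?S x + vr x \<partial>P)"
    proof (rule integral_mono)
      show "integrable P (\<lambda>x. kk_pot (s / 2) ?S x + vr x)" using c1(2) iv by auto
      show "wpot R R \<le> kk_pot (s / 2) ?S x + vr x" for x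
        using min[of "norm x"] by (simp add: sphere_facts(4)[OF R] wpot_def vr_def)
    qed simp
    also have "\<dots> = ?E P ?S + (\<integral> x. vr x \<partial>P)" using c1 iv by simp
    finally have w: "wpot R R \<le> ?E P ?S + (\<integral> x. vr x \<partial>P)" .
    have e1: "riesz_energy s V P = ereal (?E P P + kshift + 2 * (\<integral> x. vr x \<partial>P))"
      by (rule riesz_energy_eq[OF P f])
    have e2: "?E ?S ?S + \<gamma> / \<alpha> * R powr \<alpha> = wpot R R" by (simp add: kk_energy_spheres[OF R R] wpot_def)
    show ?thesis unfolding e1 riesz_energy_sphere[OF R]
    proof (intro conjI impI)
      show "ereal (wpot R R + kshift + \<gamma> / \<alpha> * R powr \<alpha>) \<le> ereal (?E P P + kshift + 2 * (\<integral> x. vr x \<partial>P))"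
        using pd(1) w e2 by simp
      assume "ereal (?E P P + kshift + 2 * (\<integral> x. vr x \<partial>P)) \<le> ereal (wpot R R + kshift + \<gamma> / \<alpha> * R powr \<alpha>)"
      then have "?E P P - 2 * ?E P ?S + ?E ?S ?S = 0" using pd(1) w e2 by simp
      then show "P = ?S" by (rule pd(2))
    qed
  qed
  then show ?thesis using S by (auto simp: equilibrium_measure_def energy_minimizer_def)
qed

end

section \<open>Perturbation by mixtures\<close>

text \<open>The convex combination with weight e on Q, realized by a biased coin so that monadic
  integration rules apply.\<close>

definition mixture :: "real \<Rightarrow> 'a::euclidean_space measure \<Rightarrow> 'a measure \<Rightarrow> 'a measure" where
  "mixture e P Q = measure_pmf (bernoulli_pmf e) \<bind> (\<lambda>b. if b then Q else P)"

context
  fixes P Q :: "'a::euclidean_space measure" and e :: real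
  assumes P: "P \<in> borel_probs" and Q: "Q \<in> borel_probs" and e: "0 \<le> e" "e \<le> 1"
begin

lemma mixture_kernel: "(\<lambda>b. if b then Q else P) \<in> measurable (measure_pmf (bernoulli_pmf e)) (subprob_algebra borel)"
proof -
  have "P \<in> space (subprob_algebra borel)" "Q \<in> space (subprob_algebra borel)"
    using P Q by (simp_all add: borel_probs_def space_subprob_algebra prob_space_imp_subprob_space)
  then have "(if b then Q else P) \<in> space (subprob_algebra borel)" for b by (cases b) simp_all
  then show ?thesis by (simp only: measurable_pmf_measure1 Pi_iff) blast
qed

lemma mixture_borel_probs: "mixture e P Q \<in> borel_probs"
proof -
  have "prob_space (mixture e P Q)" unfolding mixture_def
    by (rule measure_pmf.prob_space_bind[OF _ mixture_kernel]) (use borel_probsD[OF P] borel_probsD[OF Q] in auto)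
  moreover have "sets (mixture e P Q) = sets borel" unfolding mixture_def
    by (rule sets_bind) (use borel_probsD[OF P] borel_probsD[OF Q] in auto)
  ultimately show ?thesis by (simp add: borel_probs_def)
qed

lemma nn_integral_mixture:
  assumes "f \<in> borel_measurable borel"
  shows "(\<integral>\<^sup>+ x. f x \<partial>mixture e P Q) = ennreal (1 - e) * (\<integral>\<^sup>+ x. f x \<partial>P) + ennreal e * (\<integral>\<^sup>+ x. f x \<partial>Q)"
  unfolding mixture_def nn_integral_bind[OF assms mixture_kernel]
  by (subst nn_integral_bernoulli_pmf) (use e in \<open>auto simp: mult.commute add.commute\<close>)

lemma has_bochner_integral_mixture_nonneg:
  fixes f :: "'a \<Rightarrow> real"
  assumes [measurable]: "f \<in> borel_measurable borel" and nn: "\<And>x. f x \<ge> 0" and i: "integrable P f" "integrable Q f"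
  shows "has_bochner_integral (mixture e P Q) f ((1 - e) * (\<integral> x. f x \<partial>P) + e * (\<integral> x. f x \<partial>Q))"
proof (rule has_bochner_integral_nn_integral)
  have [measurable_cong]: "sets (mixture e P Q) = sets borel" using borel_probsD[OF mixture_borel_probs] by simp
  show "f \<in> borel_measurable (mixture e P Q)" by measurable
  have p: "(\<integral> x. f x \<partial>P) \<ge> 0" "(\<integral> x. f x \<partial>Q) \<ge> 0" using nn by (auto intro!: integral_nonneg_AE)
  then show "0 \<le> (1 - e) * (\<integral> x. f x \<partial>P) + e * (\<integral> x. f x \<partial>Q)" using e by simp
  show "(\<integral>\<^sup>+ x. ennreal (f x) \<partial>mixture e P Q) = ennreal ((1 - e) * (\<integral> x. f x \<partial>P) + e * (\<integral> x. f x \<partial>Q))"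
    using i nn e p by (simp add: nn_integral_mixture nn_integral_eq_integral ennreal_mult ennreal_plus)
qed (use nn in auto)

lemma integral_mixture:
  fixes f :: "'a \<Rightarrow> real"
  assumes [measurable]: "f \<in> borel_measurable borel" and i: "integrable P f" "integrable Q f"
  shows "integrable (mixture e P Q) f"
    "(\<integral> x. f x \<partial>mixture e P Q) = (1 - e) * (\<integral> x. f x \<partial>P) + e * (\<integral> x. f x \<partial>Q)"
proof -
  let ?p = "\<lambda>x. max 0 (f x)" and ?n = "\<lambda>x. max 0 (- f x)"
  have d: "f = (\<lambda>x. ?p x - ?n x)" by (auto simp: max_def)
  have pi: "integrable P ?p" "integrable P ?n" "integrable Q ?p" "integrable Q ?n" using i by auto
  have "(\<integral> x. ?p x - ?n x \<partial>P) = (\<integral> x. ?p x \<partial>P) - (\<integral> x. ?n x \<partial>P)"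
    using pi by (auto intro!: Bochner_Integration.integral_diff)
  then have fP: "(\<integral> x. f x \<partial>P) = (\<integral> x. ?p x \<partial>P) - (\<integral> x. ?n x \<partial>P)" unfolding d[symmetric] .
  have "(\<integral> x. ?p x - ?n x \<partial>Q) = (\<integral> x. ?p x \<partial>Q) - (\<integral> x. ?n x \<partial>Q)"
    using pi by (auto intro!: Bochner_Integration.integral_diff)
  then have fQ: "(\<integral> x. f x \<partial>Q) = (\<integral> x. ?p x \<partial>Q) - (\<integral> x. ?n x \<partial>Q)" unfolding d[symmetric] .
  have e: "(1 - e) * (\<integral> x. f x \<partial>P) + e * (\<integral> x. f x \<partial>Q) =
      ((1 - e) * (\<integral> x. ?p x \<partial>P) + e * (\<integral> x. ?p x \<partial>Q)) - ((1 - e) * (\<integral> x. ?n x \<partial>P) + e * (\<integral> x. ?n x \<partial>Q))"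
    unfolding fP fQ by (simp add: algebra_simps)
  have "has_bochner_integral (mixture e P Q) (\<lambda>x. ?p x - ?n x)
      (((1 - e) * (\<integral> x. ?p x \<partial>P) + e * (\<integral> x. ?p x \<partial>Q)) - ((1 - e) * (\<integral> x. ?n x \<partial>P) + e * (\<integral> x. ?n x \<partial>Q)))"
    by (intro has_bochner_integral_diff has_bochner_integral_mixture_nonneg) (use pi in auto)
  then have h: "has_bochner_integral (mixture e P Q) f ((1 - e) * (\<integral> x. f x \<partial>P) + e * (\<integral> x. f x \<partial>Q))"
    unfolding d[symmetric] e .
  show "integrable (mixture e P Q) f" using h by (rule integrable.intros)
  show "(\<integral> x. f x \<partial>mixture e P Q) = (1 - e) * (\<integral> x. f x \<partial>P) + e * (\<integral> x. f x \<partial>Q)"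
    using h by (rule has_bochner_integral_integral_eq)
qed

lemma bounded_potential_mixture:
  assumes bP: "bounded_potential a \<alpha> P" and bQ: "bounded_potential a \<alpha> Q"
  shows "bounded_potential a \<alpha> (mixture e P Q)"
    "kk_pot a (mixture e P Q) x = (1 - e) * kk_pot a P x + e * kk_pot a Q x"
proof -
  interpret P: prob_space P using borel_probsD[OF P] by simp
  interpret Q: prob_space Q using borel_probsD[OF Q] by simp
  have iP: "integrable P (\<lambda>y. norm y powr \<alpha>)" "\<And>x. integrable P (\<lambda>y. kk_pair a (x, y))"
    and iQ: "integrable Q (\<lambda>y. norm y powr \<alpha>)" "\<And>x. integrable Q (\<lambda>y. kk_pair a (x, y))"
    and aP: "\<And>x. AE y in P. x \<noteq> y" and aQ: "\<And>x. AE y in Q. x \<noteq> y"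
    using bP bQ by (auto simp: bounded_potential_def)
  obtain B1 B2 where B: "\<And>x. kk_pot a P x \<le> B1" "\<And>x. kk_pot a Q x \<le> B2"
    using bP bQ by (auto simp: bounded_potential_def)
  have km [measurable]: "(\<lambda>y. kk_pair a (x, y)) \<in> borel_measurable borel" for x :: 'a
    unfolding kk_pair_def fst_conv snd_conv by measurable
  have nm: "(\<lambda>y::'a. norm y powr \<alpha>) \<in> borel_measurable borel" by measurable
  have pot: "kk_pot a (mixture e P Q) x = (1 - e) * kk_pot a P x + e * kk_pot a Q x" for x
    unfolding kk_pot_def by (rule integral_mixture(2)[OF km iP(2) iQ(2)])
  then show "kk_pot a (mixture e P Q) x = (1 - e) * kk_pot a P x + e * kk_pot a Q x" .
  have ae: "AE y in mixture e P Q. x \<noteq> y" for x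
  proof -
    have "(\<integral>\<^sup>+ y. indicator {x} y \<partial>P) = 0" "(\<integral>\<^sup>+ y. indicator {x} y \<partial>Q) = 0"
      using aP[of x] aQ[of x] borel_probsD[OF P] borel_probsD[OF Q]
        AE_iff_measurable[of "{x}" P "\<lambda>y. x \<noteq> y"] AE_iff_measurable[of "{x}" Q "\<lambda>y. x \<noteq> y"] by auto
    then have "(\<integral>\<^sup>+ y. indicator {x} y \<partial>mixture e P Q) = 0"
      using nn_integral_mixture[of "indicator {x}"] by simp
    then have "emeasure (mixture e P Q) {x} = 0" using borel_probsD[OF mixture_borel_probs] by simp
    then have "{x} \<in> null_sets (mixture e P Q)" using borel_probsD[OF mixture_borel_probs] by (auto simp: null_sets_def)
    from AE_not_in[OF this] show ?thesis by eventually_elim auto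
  qed
  have "kk_pot a (mixture e P Q) x \<le> (1 - e) * B1 + e * B2" for x
    unfolding pot using B e by (intro add_mono mult_left_mono) auto
  then show "bounded_potential a \<alpha> (mixture e P Q)"
    unfolding bounded_potential_def
    using mixture_borel_probs ae integral_mixture(1)[OF km iP(2) iQ(2)] integral_mixture(1)[OF nm iP(1) iQ(1)] by blast
qed

end

lemma nonneg_of_perturbation:
  assumes "\<And>e. 0 < e \<Longrightarrow> e < 1 \<Longrightarrow> 0 \<le> 2 * x + e * (y::real)"
  shows "x \<ge> 0"
proof (rule ccontr)
  assume "\<not> x \<ge> 0"
  then have x: "x < 0" by simp
  \<comment> \<open>Chosen so that \<open>e * y \<le> - x\<close>, which leaves
    \<open>2 * x + e * y \<le> x < 0\<close>.\<close>
  define e where "e = min (1 / 2) (- x / (\<bar>y\<bar> + 1))"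
  have "0 < - x / (\<bar>y\<bar> + 1)" using x by (intro divide_pos_pos) auto
  then have e: "0 < e" "e < 1" by (auto simp: e_def)
  have "e * y \<le> e * (\<bar>y\<bar> + 1)" using e by (intro mult_left_mono) auto
  also have "\<dots> \<le> - x / (\<bar>y\<bar> + 1) * (\<bar>y\<bar> + 1)" by (intro mult_right_mono) (auto simp: e_def)
  also have "\<dots> = - x" using abs_ge_zero[of y] by (simp add: field_simps)
  finally show False using assms[OF e] x by linarith
qed

context riesz_field
begin

text \<open>Along the mixtures the energy is a quadratic polynomial in e, and its linear coefficient
  \<open>2 * (B - A)\<close> must be nonnegative. Competing spheres have finite energy, in contrast
  to point masses when \<open>s \<ge> 0\<close>.\<close>

theorem minimizer_sphere_imp:
  assumes R: "R > 0" and min: "energy_minimizer s V (uniform_sphere R)" and r: "r > 0"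
  shows "wpot R R \<le> wpot R r"
proof -
  let ?P = "uniform_sphere R :: 'a measure" and ?Q = "uniform_sphere r :: 'a measure"
  let ?S = "sph_pot (s / 2) (real DIM('a) / 2)"
  let ?v = "\<lambda>r. \<gamma> / \<alpha> * r powr \<alpha>"
  have P: "?P \<in> borel_probs" and Q: "?Q \<in> borel_probs" by (rule uniform_sphere_borel_probs)+
  note fP = sphere_facts[OF R] and fQ = sphere_facts[OF r]
  define A B D where "A = ?S R R + 2 * ?v R" and "B = ?S R r + ?v R + ?v r" and "D = ?S r r + 2 * ?v r"
  have sym: "?S r R = ?S R r"
    using kk_energy_commute[OF P Q, of "s / 2"] kk_energy_spheres[OF R r] kk_energy_spheres[OF r R] by simp
  have "0 \<le> 2 * (B - A) + e * (A - 2 * B + D)" if e: "0 < e" "e < 1" for e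
  proof -
    let ?N = "mixture e ?P ?Q"
    have e': "0 \<le> e" "e \<le> 1" using e by auto
    have N: "?N \<in> borel_probs" by (rule mixture_borel_probs[OF P Q e'])
    note bN = bounded_potential_mixture[OF P Q e' fP(1) fQ(1)]
    have iN: "integrable ?N (\<lambda>x. norm x powr \<alpha>)" using bN(1) by (simp add: bounded_potential_def)
    note c = kk_admissible_bounded_potential[OF \<alpha>' N iN bN(1)]
    note cP = kk_admissible_bounded_potential[OF \<alpha>' P fP(2) bN(1)]
    note cQ = kk_admissible_bounded_potential[OF \<alpha>' Q fQ(2) bN(1)]
    note cPP = kk_admissible_bounded_potential[OF \<alpha>' P fP(2) fP(1)]
    note cPQ = kk_admissible_bounded_potential[OF \<alpha>' P fP(2) fQ(1)]
    note cQP = kk_admissible_bounded_potential[OF \<alpha>' Q fQ(2) fP(1)]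
    note cQQ = kk_admissible_bounded_potential[OF \<alpha>' Q fQ(2) fQ(1)]
    have km: "kk_pot (s / 2) ?N \<in> borel_measurable borel"
    proof -
      interpret prob_space ?N using borel_probsD[OF N] by simp
      have [measurable_cong]: "sets ?N = sets borel" using borel_probsD[OF N] by simp
      have "(\<lambda>x. \<integral> y. kk ((s / 2)) ((norm (x - y))\<^sup>2) \<partial>?N) \<in> borel_measurable borel" by measurable
      then show ?thesis unfolding kk_pot_def[abs_def] kk_pair_def fst_conv snd_conv .
    qed
    have "kk_energy (s / 2) ?N ?N = (1 - e) * (\<integral> x. kk_pot (s / 2) ?N x \<partial>?P) + e * (\<integral> x. kk_pot (s / 2) ?N x \<partial>?Q)"
      unfolding c(3) by (rule integral_mixture(2)[OF P Q e' km cP(2) cQ(2)])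
    also have "(\<integral> x. kk_pot (s / 2) ?N x \<partial>?P) = (1 - e) * ?S R R + e * ?S R r"
      unfolding bN(2) using cPP cPQ sym by (simp add: kk_energy_spheres[OF R R] kk_energy_spheres[OF r R])
    also have "(\<integral> x. kk_pot (s / 2) ?N x \<partial>?Q) = (1 - e) * ?S R r + e * ?S r r"
      unfolding bN(2) using cQP cQQ by (simp add: kk_energy_spheres[OF R r] kk_energy_spheres[OF r r])
    finally have E: "kk_energy (s / 2) ?N ?N = (1 - e) * ((1 - e) * ?S R R + e * ?S R r) + e * ((1 - e) * ?S R r + e * ?S r r)" .
    have vN: "(\<integral> x. vr x \<partial>?N) = (1 - e) * ?v R + e * ?v r"
      using integral_mixture(2)[OF P Q e' vr_measurable integrable_vr[OF fP(2)] integrable_vr[OF fQ(2)]] fP(3) fQ(3) by simp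
    have "riesz_energy s V ?P \<le> riesz_energy s V ?N" using min N by (auto simp: energy_minimizer_def)
    then have "A \<le> kk_energy (s / 2) ?N ?N + 2 * (\<integral> x. vr x \<partial>?N)"
      unfolding riesz_energy_sphere[OF R] riesz_energy_eq[OF N iN c(1)] A_def wpot_def by simp
    also have "\<dots> = A + e * (2 * (B - A) + e * (A - 2 * B + D))"
      unfolding E vN A_def B_def D_def by (simp only: algebra_simps) (simp add: algebra_simps)
    finally have "0 \<le> e * (2 * (B - A) + e * (A - 2 * B + D))" by simp
    then show ?thesis using e by (simp add: zero_le_mult_iff)
  qed
  then have "B - A \<ge> 0" by (rule nonneg_of_perturbation)
  then show ?thesis by (simp add: A_def B_def wpot_def)
qed

lemma wpot_minimal_iff:
  assumes R: "R > 0" and r: "r \<ge> 0"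
  shows "wpot R R \<le> wpot R r \<longleftrightarrow>
    eff_pot (s / 2) (real DIM('a) / 2) (\<gamma> * R powr (\<alpha> + s)) \<alpha> 1 \<le>
    eff_pot (s / 2) (real DIM('a) / 2) (\<gamma> * R powr (\<alpha> + s)) \<alpha> (r\<^sup>2 / R\<^sup>2)"
  using R wpot_eq[OF R, of R] wpot_eq[OF R r] by simp

theorem equilibrium_sphere_threshold:
  assumes t: "\<alpha> \<ge> - cst / (2 * u0 (s / 2) (real DIM('a) / 2) 1)" "\<alpha> \<ge> 2 + 2 * ell"
    and R: "R > 0" "\<gamma> * R powr (\<alpha> + s) = cst / 2"
  shows "equilibrium_measure s V (uniform_sphere R)"
proof (rule equilibrium_sphere[OF R(1)])
  fix r :: real assume r: "r \<ge> 0"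
  show "wpot R R \<le> wpot R r"
    unfolding wpot_minimal_iff[OF R(1) r] R(2) using \<alpha>' t by (intro eff_pot_minimal) auto
qed

theorem minimizer_sphere_threshold:
  assumes R: "R > 0" and min: "energy_minimizer s V (uniform_sphere R)"
  shows "\<alpha> \<ge> - cst / (2 * u0 (s / 2) (real DIM('a) / 2) 1)" "\<alpha> \<ge> 2 + 2 * ell"
proof -
  have "eff_pot (s / 2) (real DIM('a) / 2) (\<gamma> * R powr (\<alpha> + s)) \<alpha> 1 \<le>
      eff_pot (s / 2) (real DIM('a) / 2) (\<gamma> * R powr (\<alpha> + s)) \<alpha> \<rho>" if "\<rho> > 0" for \<rho>
  proof -
    have "sqrt \<rho> * R > 0" using that R by simp
    from minimizer_sphere_imp[OF R min this] this
    show ?thesis using wpot_minimal_iff[OF R, of "sqrt \<rho> * R"] R that by (simp add: power_mult_distrib)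
  qed
  from eff_pot_minimal_imp[OF \<alpha>'(1) this]
  show "\<alpha> \<ge> - cst / (2 * u0 (s / 2) (real DIM('a) / 2) 1)" "\<alpha> \<ge> 2 + 2 * ell" by auto
qed

end

section \<open>The constants\<close>

text \<open>For fixed x, both sides as functions of y satisfy the same difference equation, with
  increment \<open>1 / (y - x) - 1 / y\<close>. The series tends to 0 along \<open>y + k\<close>, so
  telescoping identifies it with the difference of two series for \<open>Digamma\<close>.\<close>

lemma Digamma_diff_sums:
  fixes x y :: real
  assumes x: "x > 0" and xy: "y > x"
  shows "(\<lambda>n. pochhammer x (Suc n) / (real (Suc n) * pochhammer y (Suc n))) sums (Digamma y - Digamma (y - x))"
proof -
  define r where "r y n = pochhammer x (Suc n) / pochhammer y (Suc n)" for y :: real and n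
  define t where "t y n = r y n / real (Suc n)" for y :: real and n
  have pp: "pochhammer y n > 0" if "y > 0" for y :: real and n using that by (rule pochhammer_pos)
  have rpos: "r y n \<ge> 0" if "y > x" for y n
    using pp[of x "Suc n"] pp[of y "Suc n"] that x by (simp add: r_def)
  have r_Suc: "r y n - r y (Suc n) = r y n * (y - x) / (y + real (Suc n))" if "y > x" for y n
  proof -
    have "r y (Suc n) = r y n * ((x + real (Suc n)) / (y + real (Suc n)))"
      unfolding r_def pochhammer_Suc[of _ "Suc n"] by simp
    moreover have "y + real (Suc n) > 0" using that x by simp
    ultimately show ?thesis by (simp add: field_simps)
  qed
  have r_lim: "r y \<longlonglongrightarrow> 0" if "y > x" for y
  proof -
    have "hyp_coeff x 1 y \<longlonglongrightarrow> 0" using hyp_coeff_tendsto_0[of y x 1 0] that x by simp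
    then have "(\<lambda>n. hyp_coeff x 1 y (Suc n)) \<longlonglongrightarrow> 0" by (rule LIMSEQ_Suc)
    moreover have "hyp_coeff x 1 y (Suc n) = r y n" for n
      using pp[of 1 "Suc n"] by (simp add: hyp_coeff_def r_def pochhammer_fact del: fact_Suc)
    ultimately show ?thesis by simp
  qed
  have tel: "(\<lambda>n. r y n - r y (Suc n)) sums (x / y)" if "y > x" for y
    using telescope_sums'[OF r_lim[OF that]] by (simp add: r_def)
  have t_diff: "t y n - t (y + 1) n = (r y n - r y (Suc n)) / (y - x)" if y: "y > x" for y n
  proof -
    have h: "y * pochhammer (y + 1) (Suc n) = pochhammer y (Suc n) * (y + real (Suc n))"
      using pochhammer_rec[of y "Suc n"] pochhammer_Suc[of y "Suc n"] by simp
    have "y \<noteq> 0" using y x by simp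
    then have A: "pochhammer (y + 1) (Suc n) = pochhammer y (Suc n) * (y + real (Suc n)) / y"
      using h by (metis nonzero_eq_divide_eq mult.commute)
    have r: "r (y + 1) n = r y n * (y / (y + real (Suc n)))"
      unfolding r_def A by simp
    have g: "u / m - u * (y / (y + m)) / m = u * q / (y + m) / q" if "m > 0" "y + m > 0" "q > 0" for u m q :: real
    proof -
      have "y / (y + m) = 1 - m / (y + m)" using that(2) by (simp add: field_simps)
      then have "u * (y / (y + m)) / m = u / m - u / (y + m)"
        using that(1) by (simp add: right_diff_distrib diff_divide_distrib)
      then show ?thesis using that(3) by simp
    qed
    show ?thesis unfolding r_Suc[OF y] t_def r by (rule g) (use y x in auto)
  qed
  have t_summable: "summable (t y)" if y: "y > x" for y
  proof (rule summable_comparison_test)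
    show "summable (\<lambda>n. (y + 1) / (y - x) * (r y n - r y (Suc n)))"
      using tel[OF y] by (intro summable_mult sums_summable)
    show "\<exists>N. \<forall>n\<ge>N. norm (t y n) \<le> (y + 1) / (y - x) * (r y n - r y (Suc n))"
    proof (intro exI[of _ 0] allI impI)
      fix n
      have p: "y + real (Suc n) > 0" "y - x > 0" using y x by auto
      have "y + real (Suc n) \<le> (y + 1) * real (Suc n)" using y x by (simp add: algebra_simps)
      then have "1 / real (Suc n) \<le> (y + 1) / (y + real (Suc n))" using p by (simp add: field_simps)
      then have "r y n * (1 / real (Suc n)) \<le> r y n * ((y + 1) / (y + real (Suc n)))"
        by (intro mult_left_mono rpos y)
      also have "\<dots> = (y + 1) / (y - x) * (r y n - r y (Suc n))"
        unfolding r_Suc[OF y] using p(2) by simp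
      finally show "norm (t y n) \<le> (y + 1) / (y - x) * (r y n - r y (Suc n))" using rpos[OF y, of n] by (simp add: t_def)
    qed
  qed
  define T where "T y = suminf (t y)" for y
  have T_diff: "T y - T (y + 1) = inverse (y - x) - inverse y" if y: "y > x" for y
  proof -
    have "(\<lambda>n. t y n - t (y + 1) n) sums (T y - T (y + 1))"
      unfolding T_def using y by (intro sums_diff summable_sums t_summable) auto
    moreover have "(\<lambda>n. t y n - t (y + 1) n) sums (x / y / (y - x))"
      unfolding t_diff[OF y] by (rule sums_divide[OF tel[OF y]])
    ultimately have "T y - T (y + 1) = x / y / (y - x)" by (rule sums_unique2)
    then show ?thesis using y x by (simp add: field_simps)
  qed
  \<comment> \<open>As in Gauss's theorem, the first factor of the Pochhammer symbol in the
    denominator gives the decay and the others only help.\<close>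
  have T_le: "T (y + real k) \<le> y / (y + real k) * T y" for k
  proof -
    have "t (y + real k) n \<le> y / (y + real k) * t y n" for n
    proof -
      have "pochhammer (y + 1) n \<le> pochhammer (y + real k + 1) n"
        unfolding pochhammer_prod using x xy by (intro prod_mono) auto
      then have "y * pochhammer (y + 1) n * (y + real k) \<le> y * pochhammer (y + real k + 1) n * (y + real k)"
        using x xy by (intro mult_right_mono mult_left_mono) auto
      then have "pochhammer y (Suc n) * (y + real k) \<le> y * pochhammer (y + real k) (Suc n)"
        unfolding pochhammer_rec by (simp add: algebra_simps)
      then have "1 / pochhammer (y + real k) (Suc n) \<le> y / (y + real k) * (1 / pochhammer y (Suc n))"
      proof -
        have g: "1 / q \<le> y / z * (1 / p)" if "p * z \<le> y * q" "p > 0" "q > 0" "z > 0" for p q z :: real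
        proof -
          have "p * z / (p * z * q) \<le> y * q / (p * z * q)" using that by (intro divide_right_mono) auto
          then show ?thesis using that by (simp add: mult.commute)
        qed
        show ?thesis
          by (rule g) (use \<open>pochhammer y (Suc n) * (y + real k) \<le> y * pochhammer (y + real k) (Suc n)\<close>
            pp[of y "Suc n"] pp[of "y + real k" "Suc n"] x xy in auto)
      qed
      then have "pochhammer x (Suc n) / real (Suc n) * (1 / pochhammer (y + real k) (Suc n)) \<le>
          pochhammer x (Suc n) / real (Suc n) * (y / (y + real k) * (1 / pochhammer y (Suc n)))"
        using pp[OF x, of "Suc n"] by (intro mult_left_mono) auto
      then show ?thesis by (simp add: t_def r_def mult_ac)
    qed
    then show ?thesis unfolding T_def using xy x t_summable[of y] t_summable[of "y + real k"]
      by (subst suminf_mult[symmetric]) (auto intro!: suminf_le summable_mult)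
  qed
  have T_nonneg: "T y \<ge> 0" if "y > x" for y
    unfolding T_def using rpos[OF that] by (intro suminf_nonneg t_summable that) (simp add: t_def)
  have T_lim: "(\<lambda>k. T (y + real k)) \<longlonglongrightarrow> 0"
  proof (rule real_tendsto_sandwich[OF _ _ tendsto_const])
    show "(\<lambda>k. y / (y + real k) * T y) \<longlonglongrightarrow> 0" using x xy by real_asymp
    show "eventually (\<lambda>k. 0 \<le> T (y + real k)) sequentially" using xy by (intro always_eventually allI T_nonneg) auto
  qed (use T_le in auto)
  have "(\<lambda>k. T (y + real k) - T (y + real (Suc k))) sums T y"
    using telescope_sums'[OF T_lim] by simp
  moreover have "T (y + real k) - T (y + real (Suc k)) = inverse (y - x + real k) - inverse (y + real k)" for k
    using T_diff[of "y + real k"] xy by (simp add: algebra_simps)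
  ultimately have s1: "(\<lambda>k. inverse (y - x + real k) - inverse (y + real k)) sums T y" by simp
  have "(\<lambda>k. (inverse (real (Suc k)) - inverse (y + real k)) - (inverse (real (Suc k)) - inverse (y - x + real k)))
      sums ((Digamma y + euler_mascheroni) - (Digamma (y - x) + euler_mascheroni))"
  proof (rule sums_diff)
    show "(\<lambda>k. inverse (real (Suc k)) - inverse (y + real k)) sums (Digamma y + euler_mascheroni)"
      using summable_sums[OF summable_Digamma[of y]] x xy by (simp add: Digamma_def)
    show "(\<lambda>k. inverse (real (Suc k)) - inverse (y - x + real k)) sums (Digamma (y - x) + euler_mascheroni)"
      using summable_sums[OF summable_Digamma[of "y - x"]] x xy by (simp add: Digamma_def)
  qed
  then have "(\<lambda>k. inverse (y - x + real k) - inverse (y + real k)) sums (Digamma y - Digamma (y - x))" by simp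
  with s1 have "T y = Digamma y - Digamma (y - x)" by (rule sums_unique2)
  then have "t y sums (Digamma y - Digamma (y - x))"
    using summable_sums[OF t_summable[OF xy]] by (simp add: T_def)
  then show ?thesis by (simp add: t_def[abs_def] r_def mult.commute)
qed

text \<open>The partial sum with \<open>2 * m\<close> terms splits into even and odd indices, which
  are half the partial sums at z and at \<open>z + 1 / 2\<close>. The constant \<open>ln 2\<close>
  comes from the logarithm of \<open>2 * m\<close>.\<close>

lemma Digamma_duplication:
  fixes z :: real
  assumes z: "z > 0"
  shows "Digamma (2 * z) = Digamma z / 2 + Digamma (z + 1 / 2) / 2 + ln 2"
proof -
  have sum: "(\<Sum>n<2 * m. inverse (2 * z + real n)) =
      (\<Sum>n<m. inverse (z + real n)) / 2 + (\<Sum>n<m. inverse (z + 1 / 2 + real n)) / 2" for m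
  proof (induction m)
    case (Suc m)
    have "inverse (2 * z + real (2 * m)) = inverse (z + real m) / 2"
      "inverse (2 * z + real (Suc (2 * m))) = inverse (z + 1 / 2 + real m) / 2"
      using z by (simp_all add: field_simps)
    then show ?case using Suc by (simp add: add_divide_distrib)
  qed simp
  let ?D = "\<lambda>z m. ln (real m) - (\<Sum>n<m. inverse (z + real n))"
  have D: "?D z \<longlonglongrightarrow> Digamma z" if "z > 0" for z :: real
    using Digamma_LIMSEQ[of z] that by simp
  have "(\<lambda>m. ?D (2 * z) (2 * m)) \<longlonglongrightarrow> Digamma (2 * z)"
    by (rule filterlim_compose[OF D]) (use z in \<open>auto intro!: filterlim_subseq strict_monoI\<close>)
  moreover have "(\<lambda>m. ?D (2 * z) (2 * m)) \<longlonglongrightarrow> Digamma z / 2 + Digamma (z + 1 / 2) / 2 + ln 2"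
  proof (rule Lim_transform_eventually)
    show "(\<lambda>m. ?D z m / 2 + ?D (z + 1 / 2) m / 2 + ln 2) \<longlonglongrightarrow> Digamma z / 2 + Digamma (z + 1 / 2) / 2 + ln 2"
      using z by (intro tendsto_intros D) auto
    show "eventually (\<lambda>m. ?D z m / 2 + ?D (z + 1 / 2) m / 2 + ln 2 = ?D (2 * z) (2 * m)) sequentially"
      using eventually_gt_at_top[of 0]
    proof eventually_elim
      case (elim m)
      then have "ln (real (2 * m)) = ln 2 + ln (real m)" by (simp add: ln_mult)
      then show ?case unfolding sum by (simp add: field_simps)
    qed
  qed
  ultimately show ?thesis by (rule LIMSEQ_unique)
qed

text \<open>With \<open>x = (d - 1) / 2\<close> the n-th term of the 3F2 series is twice the n-th
  term of \<open>Digamma_diff_sums\<close> at \<open>y = 2 * x\<close>: the parameters 1, 1 and 2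
  leave \<open>1 / (n + 1)\<close>, and the others are the shifted x and
  \<open>2 * x\<close>.\<close>

lemma b_const_eq:
  assumes d: "d \<ge> 2"
  shows "b_const d = - ln 2 + 1 / 2 * (Digamma (real d - 1) - Digamma ((real d - 1) / 2))"
proof -
  define x where "x = (real d - 1) / 2"
  have x: "x > 0" "2 * x = real d - 1" using d by (auto simp: x_def)
  have x2: "2 * x - x = x" by simp
  have "fps_nth (fps_hypergeo [1, 1, (real d + 1) / 2] [2, real d] 1) n =
      2 * (pochhammer x (Suc n) / (real (Suc n) * pochhammer (2 * x) (Suc n)))" for n
  proof -
    have e: "(real d + 1) / 2 = x + 1" "real d = 2 * x + 1" using x(2) by (simp_all add: x_def field_simps)
    have 2: "pochhammer 2 n = (fact (Suc n) :: real)" using pochhammer_rec[of "1::real" n] by (simp add: pochhammer_fact del: fact_Suc)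
    have q: "pochhammer (2 * x + 1) n > 0" using x by (intro pochhammer_pos) auto
    have "fps_nth (fps_hypergeo [1, 1, (real d + 1) / 2] [2, real d] 1) n =
        pochhammer (x + 1) n / (real (Suc n) * pochhammer (2 * x + 1) n)"
      unfolding e(1) unfolding e(2) by (simp add: 2 pochhammer_fact[symmetric])
    also have "\<dots> = 2 * (pochhammer x (Suc n) / (real (Suc n) * pochhammer (2 * x) (Suc n)))"
      unfolding pochhammer_rec[of x] pochhammer_rec[of "2 * x"] using x(1) q by simp
    finally show ?thesis .
  qed
  then have "hypergeometric [1, 1, (real d + 1) / 2] [2, real d] 1 =
      (\<Sum>n. 2 * (pochhammer x (Suc n) / (real (Suc n) * pochhammer (2 * x) (Suc n))))"
    by (simp add: hypergeometric_def eval_fps_def)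
  also have "\<dots> = 2 * (Digamma (2 * x) - Digamma (2 * x - x))"
    using sums_mult[OF Digamma_diff_sums[of x "2 * x"], of 2] x(1) by (intro sums_unique[symmetric]) auto
  finally show ?thesis unfolding b_const_def x2 by (simp add: x(2)) (simp add: x_def)
qed

lemma c_const_eq: "c_const s d = F2 (s / 2) (s / 2 + 1 - real d / 2) (real d / 2) 1"
proof -
  have e: "(2 + s - real d) / 2 = s / 2 + 1 - real d / 2" by (simp add: field_simps)
  show ?thesis unfolding c_const_def e by (simp add: hypergeometric_def eval_fps_def F2_def hyp_coeff_def mult_ac)
qed

lemma u0_log_at_1:
  assumes "riesz_sphere 0 c"
  shows "u0 0 c 1 = - ln 2 / 2 + (Digamma c - Digamma (c - 1 / 2)) / 4"
proof -
  interpret riesz_sphere 0 c by (rule assms)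
  have c: "c > 3 / 2" using a_lt by simp
  have "phi0 0 c (Suc i) = 1 / 4 * (pochhammer (1 / 2) (Suc i) / (real (Suc i) * pochhammer c (Suc i)))" for i
  proof -
    have "pochhammer (c + 1) i > 0" using c by (intro pochhammer_pos) auto
    then show ?thesis using c unfolding pochhammer_rec[of "1/2"] pochhammer_rec[of c]
      by (simp add: phi0_def hyp_coeff_def pochhammer_fact[symmetric] field_simps)
  qed
  then have "(\<lambda>i. phi0 0 c (Suc i)) sums (1 / 4 * (Digamma c - Digamma (c - 1 / 2)))"
    using sums_mult[OF Digamma_diff_sums[of "1 / 2" c], of "1 / 4"] c by simp
  then have "phi0 0 c sums (1 / 4 * (Digamma c - Digamma (c - 1 / 2)))" by (simp add: sums_Suc_iff)
  then have "Phi0 0 c 1 = 1 / 4 * (Digamma c - Digamma (c - 1 / 2))"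
    unfolding Phi0_def using sums_unique by fastforce
  then show ?thesis by (simp add: u0_def kk_def)
qed

text \<open>The moment series gives \<open>Digamma\<close> at \<open>d / 2\<close> and
  \<open>(d - 1) / 2\<close>, while \<open>b_const\<close> involves \<open>d - 1\<close> and
  \<open>(d - 1) / 2\<close>; the duplication formula reconciles them.\<close>

lemma u0_log_eq_b_const:
  assumes "riesz_sphere 0 (real d / 2)"
  shows "u0 0 (real d / 2) 1 = b_const d"
proof -
  have d: "d \<ge> 2" using assms by (simp add: riesz_sphere_def)
  have "Digamma (real d - 1) = Digamma ((real d - 1) / 2) / 2 + Digamma (real d / 2) / 2 + ln 2"
  proof -
    have e: "2 * ((real d - 1) / 2) = real d - 1" "(real d - 1) / 2 + 1 / 2 = real d / 2" by (simp_all add: field_simps)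
    have "(real d - 1) / 2 > 0" using d by simp
    from Digamma_duplication[OF this] show ?thesis unfolding e .
  qed
  then show ?thesis
    unfolding u0_log_at_1[OF assms] b_const_eq[OF d] by (simp add: field_simps)
qed

context riesz_field
begin

lemma cst_c_const: "cst = c_const s DIM('a)"
  by (simp add: cst_def c_const_eq)

lemma cst_Gamma:
  "cst = Gamma (real DIM('a) / 2) * Gamma (real DIM('a) - s - 1) /
    (Gamma ((real DIM('a) - s) / 2) * Gamma (real DIM('a) - s / 2 - 1))"
proof -
  have "real DIM('a) / 2 - s / 2 = (real DIM('a) - s) / 2" "2 * (real DIM('a) / 2) - s / 2 - 1 = real DIM('a) - s / 2 - 1"
    "2 * (real DIM('a) / 2) - 2 * (s / 2) - 1 = real DIM('a) - s - 1" by (simp_all add: field_simps)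
  then show ?thesis unfolding cst_eq by (simp add: rGamma_inverse_Gamma field_simps)
qed

lemma cst_log:
  assumes "s = 0"
  shows "cst = 1"
proof -
  have "Gamma (real DIM('a) / 2) \<noteq> 0" "Gamma (real DIM('a) - 1) \<noteq> 0"
    by (rule less_imp_neq[OF Gamma_real_pos, symmetric], use dim in simp)+
  then show ?thesis using assms unfolding cst_Gamma by simp
qed

text \<open>For \<open>s = 0\<close> one has \<open>cst = 1\<close> and \<open>u0\<close> at 1 is
  \<open>b_const\<close>; otherwise \<open>u0\<close> at 1 is \<open>(cst - 1) / s\<close>. Hence
  both branches of the first entry come from one comparison with the origin.\<close>

lemma alpha_threshold_eq:
  "alpha_threshold s DIM('a) = max (- cst / (2 * u0 (s / 2) (real DIM('a) / 2) 1)) (2 + 2 * ell)"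
proof (cases "s = 0")
  case True
  note cst_log[OF True]
  moreover have "u0 0 (real DIM('a) / 2) 1 = b_const DIM('a)"
    using rs True by (intro u0_log_eq_b_const) simp
  moreover have "2 + 2 * ell = 2 - (real DIM('a) - 4) / (real DIM('a) - 3)"
    unfolding ell_def using s True by (simp add: field_simps)
  ultimately show ?thesis using True by (simp add: alpha_threshold_def)
next
  case False
  have u: "u0 (s / 2) (real DIM('a) / 2) 1 = (cst - 1) / s" using u0_1 False by simp
  have m: "2 - 2 * cst = - (2 * (cst - 1))" by simp
  have 1: "- cst / (2 * u0 (s / 2) (real DIM('a) / 2) 1) = s * cst / (2 - 2 * cst)"
    unfolding u m divide_minus_right using False by (simp add: mult.commute del: right_diff_distrib_numeral)
  have 2: "2 + 2 * ell = 2 - (s + 2) * (real DIM('a) - s - 4) / (2 * (real DIM('a) - s - 3))"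
    unfolding ell_def using s by (simp add: field_simps)
  show ?thesis unfolding 1 2 using False by (simp add: alpha_threshold_def cst_c_const)
qed

lemma riesz_energy_equilibrium:
  assumes R: "R = (cst / (2 * \<gamma>)) powr (1 / (\<alpha> + s))"
  shows "R > 0" "\<gamma> * R powr (\<alpha> + s) = cst / 2"
    "riesz_energy s V (uniform_sphere R) = ereal (if s \<noteq> 0
        then (\<alpha> + s) * (2 * \<gamma>) powr (s / (\<alpha> + s)) / (\<alpha> * s) * cst powr (\<alpha> / (\<alpha> + s))
        else (1 + ln (2 * \<gamma>)) / \<alpha> - ln 2 + 1 / 2 * (Digamma (real DIM('a) - 1) - Digamma ((real DIM('a) - 1) / 2)))"
proof -
  have q: "cst / (2 * \<gamma>) > 0" using cst_pos \<gamma> by simp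
  have as: "\<alpha> + s > 0" using \<alpha> by auto
  show Rpos: "R > 0" unfolding R using cst_pos \<gamma> by simp
  have Rp: "R powr (\<alpha> + s) = cst / (2 * \<gamma>)" using cst_pos \<gamma> as by (simp add: R powr_powr)
  then show "\<gamma> * R powr (\<alpha> + s) = cst / 2" using \<gamma> by simp
  have R\<alpha>: "R powr \<alpha> = R powr (- s) * (cst / (2 * \<gamma>))"
    unfolding Rp[symmetric] by (simp add: powr_add[symmetric])
  have 1: "(R\<^sup>2) powr (- (s / 2)) = R powr (- s)" using power2_powr_half[of R "- s"] Rpos by simp
  have w: "wpot R R = kk (s / 2) (R\<^sup>2) + R powr (- s) * u0 (s / 2) (real DIM('a) / 2) 1 + \<gamma> / \<alpha> * R powr \<alpha>"
    using Rpos by (simp add: wpot_def sph_pot_def 1)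
  show "riesz_energy s V (uniform_sphere R) = ereal (if s \<noteq> 0
        then (\<alpha> + s) * (2 * \<gamma>) powr (s / (\<alpha> + s)) / (\<alpha> * s) * cst powr (\<alpha> / (\<alpha> + s))
        else (1 + ln (2 * \<gamma>)) / \<alpha> - ln 2 + 1 / 2 * (Digamma (real DIM('a) - 1) - Digamma ((real DIM('a) - 1) / 2)))"
  proof (cases "s = 0")
    case False
    have k: "kk (s / 2) (R\<^sup>2) = (R powr (- s) - 1) / s" using False by (simp add: kk_def 1)
    have u: "u0 (s / 2) (real DIM('a) / 2) 1 = (cst - 1) / s" using u0_1 False by simp
    \<comment> \<open>The shift cancels the constant in \<open>kk\<close>, and the equation for R
      turns the field term into a multiple of \<open>R powr (- s)\<close>, so a single power of R
      remains.\<close>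
    have "wpot R R + kshift + \<gamma> / \<alpha> * R powr \<alpha> = R powr (- s) * (cst / s) + R powr (- s) * (cst / \<alpha>)"
      unfolding w k u R\<alpha> using False \<gamma> \<alpha>' by (simp add: kshift_def field_simps)
    also have "\<dots> = (R powr (- s) * cst) * ((\<alpha> + s) / (\<alpha> * s))" using False \<alpha>' by (simp add: field_simps)
    also have "R powr (- s) * cst = (2 * \<gamma>) powr (s / (\<alpha> + s)) * cst powr (\<alpha> / (\<alpha> + s))"
    proof -
      have "R powr (- s) = (cst / (2 * \<gamma>)) powr (- (s / (\<alpha> + s)))" by (simp add: R powr_powr)
      also have "\<dots> = cst powr (- (s / (\<alpha> + s))) * (2 * \<gamma>) powr (s / (\<alpha> + s))"
        using cst_pos \<gamma> by (simp add: powr_divide powr_minus field_simps)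
      finally have "R powr (- s) * cst = (2 * \<gamma>) powr (s / (\<alpha> + s)) * (cst powr (- (s / (\<alpha> + s))) * cst powr 1)"
        using cst_pos by simp
      also have "cst powr (- (s / (\<alpha> + s))) * cst powr 1 = cst powr (\<alpha> / (\<alpha> + s))"
      proof -
        have "- (s / (\<alpha> + s)) + 1 = \<alpha> / (\<alpha> + s)" using as by (simp add: field_simps)
        then show ?thesis by (simp only: powr_add[symmetric])
      qed
      finally show ?thesis .
    qed
    finally show ?thesis unfolding riesz_energy_sphere[OF Rpos] using False by (simp add: mult_ac)
  next
    case True
    note c = cst_log[OF True]
    have u: "u0 (s / 2) (real DIM('a) / 2) 1 = b_const DIM('a)"
      using rs True u0_log_eq_b_const[of "DIM('a)"] by simp
    have l: "ln R = - ln (2 * \<gamma>) / \<alpha>" unfolding R using \<gamma> True c by (simp add: ln_div ln_powr)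
    have "kk (s / 2) (R\<^sup>2) = - ln R" using Rpos True by (simp add: kk_def ln_realpow)
    then have "wpot R R + kshift + \<gamma> / \<alpha> * R powr \<alpha> = ln (2 * \<gamma>) / \<alpha> + b_const DIM('a) + 1 / \<alpha>"
      unfolding w u R\<alpha> l kshift_def using True Rpos \<gamma> c by simp
    then show ?thesis unfolding riesz_energy_sphere[OF Rpos] b_const_eq[OF dim] using True
      by (simp add: add_divide_distrib)
  qed
qed

end

theorem theorem1p2:
  fixes d :: nat and s \<gamma> \<alpha> :: real and V :: "real^'n \<Rightarrow> ereal"
  assumes dim: "d = CARD('n)" "d \<ge> 2"
    and s: "- 2 < s" "s < real d - 3"
    and V: "V = (\<lambda>x. ereal (\<gamma> / \<alpha> * norm x powr \<alpha>))"
    and \<gamma>: "\<gamma> > 0"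
    and \<alpha>: "\<alpha> > max (- s) 0"
  shows "(\<alpha> \<ge> alpha_threshold s d \<longrightarrow>
      (let R = (c_const s d / (2 * \<gamma>)) powr (1 / (\<alpha> + s)) in
        equilibrium_measure s V (uniform_sphere R)
        \<and> R = (Gamma (real d / 2) * Gamma (real d - s - 1)
                / (2 * \<gamma> * Gamma ((real d - s) / 2) * Gamma (real d - s / 2 - 1)))
              powr (1 / (\<alpha> + s))
        \<and> riesz_energy s V (uniform_sphere R) =
            ereal (if s \<noteq> 0
              then (\<alpha> + s) * (2 * \<gamma>) powr (s / (\<alpha> + s)) / (\<alpha> * s)
                * (Gamma (real d / 2) * Gamma (real d - s - 1)
                    / (Gamma ((real d - s) / 2) * Gamma (real d - s / 2 - 1)))
                  powr (\<alpha> / (\<alpha> + s))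
              else (1 + ln (2 * \<gamma>)) / \<alpha> - ln 2
                + 1 / 2 * (Digamma (real d - 1) - Digamma ((real d - 1) / 2)))))
    \<and> (\<alpha> < alpha_threshold s d \<longrightarrow>
      (\<forall>R>0. \<not> energy_minimizer s V (uniform_sphere R)))"
proof -
  interpret riesz_field s \<gamma> \<alpha> V
    by unfold_locales (use assms in auto)
  have D: "DIM(real^'n) = d" using assms(1) by simp
  note thr = alpha_threshold_eq[unfolded D]
  have G: "riesz_sphere.cst (s / 2) (real d / 2) = Gamma (real d / 2) * Gamma (real d - s - 1) / (Gamma ((real d - s) / 2) * Gamma (real d - s / 2 - 1))"
    using cst_Gamma unfolding D .
  show ?thesis
  proof (intro conjI impI allI)
    assume t: "\<alpha> \<ge> alpha_threshold s d"
    define R where "R = (c_const s d / (2 * \<gamma>)) powr (1 / (\<alpha> + s))"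
    have R: "R = (cst / (2 * \<gamma>)) powr (1 / (\<alpha> + s))" using cst_c_const unfolding D R_def by simp
    note E = riesz_energy_equilibrium[OF R]
    have eq: "equilibrium_measure s V (uniform_sphere R)"
      using equilibrium_sphere_threshold[OF _ _ E(1,2)] t unfolding thr D by simp
    have Req: "R = (Gamma (real d / 2) * Gamma (real d - s - 1)
                / (2 * \<gamma> * Gamma ((real d - s) / 2) * Gamma (real d - s / 2 - 1))) powr (1 / (\<alpha> + s))"
      unfolding R D G by (simp add: mult_ac)
    show "let R = (c_const s d / (2 * \<gamma>)) powr (1 / (\<alpha> + s)) in
        equilibrium_measure s V (uniform_sphere R)
        \<and> R = (Gamma (real d / 2) * Gamma (real d - s - 1)
                / (2 * \<gamma> * Gamma ((real d - s) / 2) * Gamma (real d - s / 2 - 1)))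
              powr (1 / (\<alpha> + s))
        \<and> riesz_energy s V (uniform_sphere R) =
            ereal (if s \<noteq> 0
              then (\<alpha> + s) * (2 * \<gamma>) powr (s / (\<alpha> + s)) / (\<alpha> * s)
                * (Gamma (real d / 2) * Gamma (real d - s - 1)
                    / (Gamma ((real d - s) / 2) * Gamma (real d - s / 2 - 1)))
                  powr (\<alpha> / (\<alpha> + s))
              else (1 + ln (2 * \<gamma>)) / \<alpha> - ln 2
                + 1 / 2 * (Digamma (real d - 1) - Digamma ((real d - 1) / 2)))"
      unfolding Let_def R_def[symmetric] using eq Req E(3)[unfolded D G] by (intro conjI)
  next
    fix R :: real assume "\<alpha> < alpha_threshold s d" "R > 0"
    then show "\<not> energy_minimizer s V (uniform_sphere R)"
      using minimizer_sphere_threshold[of R] unfolding thr D by auto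
  qed
qed

end
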